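(* Let $p$ be a prime, let $R$ be a Noetherian ring containing $\mathbb{F}_p$, and let $X=\operatorname{Spec}R$. (1) For an ideal $I$ of $R$, the following are equivalent: (a) for every $f\in R$, $(I_f)^*=(I^* )_f$; (b) the sheaf $(\tilde I)^*$ of $\mathcal{O}_X$-ideals is coherent. Thus, tight closure of ideals in $R$ commutes with localization at single elements if and only if the tight closure of any coherent sheaf of $\mathcal{O}_X$-ideals is coherent. (2) For an $R$-module $M$ and a submodule $L$ of $M$, the following are equivalent: (a) for every $f\in R$, $(L_f)^*_{M_f}=(L^*_M)_f$; (b) the sheaf $\tilde L^*_{\tilde M}$ of $\mathcal{O}_X$-submodules of $\tilde M$ is quasi-coherent. Thus, tight closure of submodules of $R$-modules (resp. finite $R$-modules) commutes with localization at single elements if and only if the tight closure of any quasi-coherent sheaf of submodules of a quasi-coherent (resp. coherent) sheaf of $\mathcal{O}_X$-modules is always quasi-coherent.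
   Context: Rings are commutative with $1$. For a ring $S$, $S^\circ$ is the complement of the union of the minimal primes of $S$. For a Noetherian ring $S$ of characteristic $p$, $S$-modules $L\subseteq M$, $z\in M$ and $q=p^e$: $F^e(M)$ is the base change of $M$ along the $e$-th iterated Frobenius $S\to S$, $z^q_M=1\otimes z\in F^e(M)$, and $L^{[q]}_M$ is the image of $F^e(L)\to F^e(M)$. The tight closure $L^*_M$ is the set of $z\in M$ for which there are $c\in S^\circ$ and a power $q_0$ of $p$ with $c\,z^q_M\in L^{[q]}_M$ for all powers $q\ge q_0$ of $p$. For an ideal $I$ of $S$, $I^*:=I^*_S$ (i.e. $z\in I^*$ iff for some such $c,q_0$, $cz^q\in I^{[q]}$ for all $q\geq q_0$, where $I^{[q]}$ is generated by $q$-th powers of elements of $I$). $\tilde M$ is the quasi-coherent sheaf on $\operatorname{Spec}R$ associated to $M$. For a quasi-coherent $\mathcal{O}_X$-module $\mathcal{M}$ and a sheaf of submodules $\mathcal{L}\subseteq\mathcal{M}$, the tight closure $\mathcal{L}^*_{\mathcal{M}}$ is the sheaf of submodules of $\mathcal{M}$ whose sections over an open $U$ are those $s\in\mathcal{M}(U)$ for which $U$ has an affine open cover $\{U_\alpha\}$ with $s|_{U_\alpha}\in\mathcal{L}(U_\alpha)^*_{\mathcal{M}(U_\alpha)}$ (as $\mathcal{O}_X(U_\alpha)$-modules) for all $\alpha$. For a sheaf of ideals $\mathcal{I}$, $\mathcal{I}^*:=\mathcal{I}^*_{\mathcal{O}_X}$. *)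

theory Defs
  imports "HOL-Algebra.Module" "HOL-Algebra.IntRing" "HOL-Algebra.Ring_Divisibility" "HOL-Analysis.Abstract_Topology"
begin

section \<open>Rings, modules and base change\<close>

text \<open>
  Modules are records of type \<open>('a, 'b) module\<close>; this type extends that of rings, so every module
  carries two fields \<open>mult\<close> and \<open>one\<close> that the locale \<open>module\<close> ignores. They are left undefined
  below.
\<close>

definition ring_module :: "('a, 'm) ring_scheme \<Rightarrow> ('a, 'a) module" where
  "ring_module S = \<lparr>carrier = carrier S, monoid.mult = monoid.mult S, one = one S, ring.zero = ring.zero S, ring.add = ring.add S,
     smult = monoid.mult S\<rparr>"

definition gen_submodule :: "('a, 'm) ring_scheme \<Rightarrow> ('a, 'b, 'k) module_scheme \<Rightarrow> 'b set \<Rightarrow> 'b set" where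
  "gen_submodule S M A = (\<lambda>N. submodule N S M) hull A"

definition finite_module :: "('a, 'm) ring_scheme \<Rightarrow> ('a, 'b, 'k) module_scheme \<Rightarrow> bool" where
  "finite_module S M \<longleftrightarrow> module S M \<and>
     (\<exists>A \<subseteq> carrier M. finite A \<and> gen_submodule S M A = carrier M)"

definition quot_module :: "('a, 'b, 'k) module_scheme \<Rightarrow> 'b set \<Rightarrow> ('a, 'b set) module" where
  "quot_module M N = \<lparr>carrier = a_rcosets\<^bsub>M\<^esub> N, monoid.mult = undefined, one = undefined, ring.zero = N,
     ring.add = set_add M, smult = (\<lambda>a X. set_add M N ((\<lambda>x. a \<odot>\<^bsub>M\<^esub> x) ` X))\<rparr>"

text \<open>The free module on the set \<open>B\<close>: finitely supported functions.\<close>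

definition free_module :: "('a, 'm) ring_scheme \<Rightarrow> 'b set \<Rightarrow> ('a, 'b \<Rightarrow> 'a) module" where
  "free_module T B = \<lparr>
     carrier = {g. (\<forall>x \<in> B. g x \<in> carrier T) \<and> (\<forall>x. x \<notin> B \<longrightarrow> g x = \<zero>\<^bsub>T\<^esub>) \<and> finite {x. g x \<noteq> \<zero>\<^bsub>T\<^esub>}},
     monoid.mult = undefined, one = undefined, ring.zero = (\<lambda>_. \<zero>\<^bsub>T\<^esub>), ring.add = (\<lambda>g h x. g x \<oplus>\<^bsub>T\<^esub> h x),
     smult = (\<lambda>a g x. a \<otimes>\<^bsub>T\<^esub> g x)\<rparr>"

definition basis_elem :: "('a, 'm) ring_scheme \<Rightarrow> 'b \<Rightarrow> 'b \<Rightarrow> 'a" where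
  "basis_elem T x = (\<lambda>y. if y = x then \<one>\<^bsub>T\<^esub> else \<zero>\<^bsub>T\<^esub>)"

text \<open>
  Base change of an \<open>S\<close>-module \<open>M\<close> along a ring homomorphism \<open>\<phi>\<close> from \<open>S\<close> to \<open>T\<close>: the \<open>T\<close>-module
  with generators \<open>1 \<otimes> x\<close>, \<open>x \<in> M\<close>, and relations \<open>1 \<otimes> (x + y) = 1 \<otimes> x + 1 \<otimes> y\<close> and
  \<open>1 \<otimes> a x = \<phi>(a) (1 \<otimes> x)\<close>. Thus \<open>T\<close>-linear maps out of it are the same as \<open>\<phi>\<close>-semilinear maps
  out of \<open>M\<close>.
\<close>

definition base_change_rels ::
  "('a \<Rightarrow> 'c) \<Rightarrow> ('a, 'm) ring_scheme \<Rightarrow> ('c, 'n) ring_scheme \<Rightarrow> ('a, 'b, 'k) module_scheme \<Rightarrow> ('b \<Rightarrow> 'c) set" where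
  "base_change_rels \<phi> S T M = gen_submodule T (free_module T (carrier M))
     ({basis_elem T (x \<oplus>\<^bsub>M\<^esub> y) \<ominus>\<^bsub>free_module T (carrier M)\<^esub>
         (basis_elem T x \<oplus>\<^bsub>free_module T (carrier M)\<^esub> basis_elem T y) | x y. x \<in> carrier M \<and> y \<in> carrier M}
      \<union> {basis_elem T (a \<odot>\<^bsub>M\<^esub> x) \<ominus>\<^bsub>free_module T (carrier M)\<^esub>
         (\<phi> a \<odot>\<^bsub>free_module T (carrier M)\<^esub> basis_elem T x) | a x. a \<in> carrier S \<and> x \<in> carrier M})"

definition base_change ::
  "('a \<Rightarrow> 'c) \<Rightarrow> ('a, 'm) ring_scheme \<Rightarrow> ('c, 'n) ring_scheme \<Rightarrow> ('a, 'b, 'k) module_scheme \<Rightarrow> ('c, ('b \<Rightarrow> 'c) set) module" where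
  "base_change \<phi> S T M = quot_module (free_module T (carrier M)) (base_change_rels \<phi> S T M)"

definition one_tensor ::
  "('a \<Rightarrow> 'c) \<Rightarrow> ('a, 'm) ring_scheme \<Rightarrow> ('c, 'n) ring_scheme \<Rightarrow> ('a, 'b, 'k) module_scheme \<Rightarrow> 'b \<Rightarrow> ('b \<Rightarrow> 'c) set" where
  "one_tensor \<phi> S T M x = base_change_rels \<phi> S T M +>\<^bsub>free_module T (carrier M)\<^esub> basis_elem T x"

text \<open>
  For a submodule \<open>L\<close> of \<open>M\<close>, the free module on \<open>L\<close> consists of elements of the free module on \<open>M\<close>,
  and the map induced by the inclusion sends the class of \<open>g\<close> modulo the relations of \<open>L\<close> to the
  class of \<open>g\<close> modulo the relations of \<open>M\<close>.
\<close>

definition base_change_incl ::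
  "('a \<Rightarrow> 'c) \<Rightarrow> ('a, 'm) ring_scheme \<Rightarrow> ('c, 'n) ring_scheme \<Rightarrow> ('a, 'b, 'k) module_scheme \<Rightarrow>
   ('b \<Rightarrow> 'c) set \<Rightarrow> ('b \<Rightarrow> 'c) set" where
  "base_change_incl \<phi> S T M X = set_add (free_module T (carrier M)) (base_change_rels \<phi> S T M) X"


section \<open>Tight closure\<close>

definition minimal_prime :: "('a, 'm) ring_scheme \<Rightarrow> 'a set \<Rightarrow> bool" where
  "minimal_prime S P \<longleftrightarrow> primeideal P S \<and> (\<forall>Q. primeideal Q S \<and> Q \<subseteq> P \<longrightarrow> Q = P)"

definition ring_circ :: "('a, 'm) ring_scheme \<Rightarrow> 'a set" where
  "ring_circ S = carrier S - \<Union>{P. minimal_prime S P}"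

definition frob :: "nat \<Rightarrow> nat \<Rightarrow> ('a, 'm) ring_scheme \<Rightarrow> 'a \<Rightarrow> 'a" where
  "frob p e S a = a [^]\<^bsub>S\<^esub> (p ^ e)"

definition frob_module ::
  "nat \<Rightarrow> nat \<Rightarrow> ('a, 'm) ring_scheme \<Rightarrow> ('a, 'b, 'k) module_scheme \<Rightarrow> ('a, ('b \<Rightarrow> 'a) set) module" where
  "frob_module p e S M = base_change (frob p e S) S S M"

definition frob_elem ::
  "nat \<Rightarrow> nat \<Rightarrow> ('a, 'm) ring_scheme \<Rightarrow> ('a, 'b, 'k) module_scheme \<Rightarrow> 'b \<Rightarrow> ('b \<Rightarrow> 'a) set" where
  "frob_elem p e S M z = one_tensor (frob p e S) S S M z"

definition frob_submodule ::
  "nat \<Rightarrow> nat \<Rightarrow> ('a, 'm) ring_scheme \<Rightarrow> ('a, 'b, 'k) module_scheme \<Rightarrow> 'b set \<Rightarrow> ('b \<Rightarrow> 'a) set set" where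
  "frob_submodule p e S M L =
     base_change_incl (frob p e S) S S M ` carrier (frob_module p e S (M\<lparr>carrier := L\<rparr>))"

definition tight_closure ::
  "nat \<Rightarrow> ('a, 'm) ring_scheme \<Rightarrow> ('a, 'b, 'k) module_scheme \<Rightarrow> 'b set \<Rightarrow> 'b set" where
  "tight_closure p S M L = {z \<in> carrier M. \<exists>c \<in> ring_circ S. \<exists>e0. \<forall>e \<ge> e0.
     c \<odot>\<^bsub>frob_module p e S M\<^esub> frob_elem p e S M z \<in> frob_submodule p e S M L}"

definition ideal_tight_closure :: "nat \<Rightarrow> ('a, 'm) ring_scheme \<Rightarrow> 'a set \<Rightarrow> 'a set" where
  "ideal_tight_closure p S I = tight_closure p S (ring_module S) I"


section \<open>Localization\<close>

text \<open>
  \<open>frac S M W x s\<close> is the fraction \<open>x/s\<close> in \<open>W\<inverse>M\<close>, an equivalence class of pairs. For \<open>M = S\<close>, take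
  \<open>ring_module S\<close>. The unions below are unions of copies of one and the same class.
\<close>

definition frac ::
  "('a, 'm) ring_scheme \<Rightarrow> ('a, 'b, 'k) module_scheme \<Rightarrow> 'a set \<Rightarrow> 'b \<Rightarrow> 'a \<Rightarrow> ('b \<times> 'a) set" where
  "frac S M W x s = {(y, t). y \<in> carrier M \<and> t \<in> W \<and>
     (\<exists>u \<in> W. u \<odot>\<^bsub>M\<^esub> (t \<odot>\<^bsub>M\<^esub> x) = u \<odot>\<^bsub>M\<^esub> (s \<odot>\<^bsub>M\<^esub> y))}"

definition loc_sub ::
  "('a, 'm) ring_scheme \<Rightarrow> ('a, 'b, 'k) module_scheme \<Rightarrow> 'a set \<Rightarrow> 'b set \<Rightarrow> ('b \<times> 'a) set set" where
  "loc_sub S M W L = {frac S M W x s | x s. x \<in> L \<and> s \<in> W}"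

definition loc_ring :: "('a, 'm) ring_scheme \<Rightarrow> 'a set \<Rightarrow> ('a \<times> 'a) set ring" where
  "loc_ring S W = \<lparr>carrier = loc_sub S (ring_module S) W (carrier S),
     monoid.mult = (\<lambda>X Y. \<Union>(a, s) \<in> X. \<Union>(b, t) \<in> Y. frac S (ring_module S) W (a \<otimes>\<^bsub>S\<^esub> b) (s \<otimes>\<^bsub>S\<^esub> t)),
     one = frac S (ring_module S) W \<one>\<^bsub>S\<^esub> \<one>\<^bsub>S\<^esub>,
     ring.zero = frac S (ring_module S) W \<zero>\<^bsub>S\<^esub> \<one>\<^bsub>S\<^esub>,
     ring.add = (\<lambda>X Y. \<Union>(a, s) \<in> X. \<Union>(b, t) \<in> Y.
       frac S (ring_module S) W (t \<otimes>\<^bsub>S\<^esub> a \<oplus>\<^bsub>S\<^esub> s \<otimes>\<^bsub>S\<^esub> b) (s \<otimes>\<^bsub>S\<^esub> t))\<rparr>"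

definition loc_module ::
  "('a, 'm) ring_scheme \<Rightarrow> 'a set \<Rightarrow> ('a, 'b, 'k) module_scheme \<Rightarrow> (('a \<times> 'a) set, ('b \<times> 'a) set) module" where
  "loc_module S W M = \<lparr>carrier = loc_sub S M W (carrier M), monoid.mult = undefined, one = undefined,
     ring.zero = frac S M W \<zero>\<^bsub>M\<^esub> \<one>\<^bsub>S\<^esub>,
     ring.add = (\<lambda>X Y. \<Union>(x, s) \<in> X. \<Union>(y, t) \<in> Y.
       frac S M W (t \<odot>\<^bsub>M\<^esub> x \<oplus>\<^bsub>M\<^esub> s \<odot>\<^bsub>M\<^esub> y) (s \<otimes>\<^bsub>S\<^esub> t)),
     smult = (\<lambda>X Y. \<Union>(a, s) \<in> X. \<Union>(y, t) \<in> Y. frac S M W (a \<odot>\<^bsub>M\<^esub> y) (s \<otimes>\<^bsub>S\<^esub> t))\<rparr>"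

definition powers :: "('a, 'm) ring_scheme \<Rightarrow> 'a \<Rightarrow> 'a set" where
  "powers S f = {f [^]\<^bsub>S\<^esub> n | n::nat. True}"


section \<open>Ringed spaces and sheaves of modules\<close>

text \<open>Sections and restriction maps are only meaningful on open sets.\<close>

record ('x, 's) ringed_space =
  top_of :: "'x topology"
  Osec :: "'x set \<Rightarrow> 's ring"
  Ores :: "'x set \<Rightarrow> 'x set \<Rightarrow> 's \<Rightarrow> 's"

record ('x, 's, 'b) mod_sheaf =
  sec :: "'x set \<Rightarrow> ('s, 'b) module"
  res :: "'x set \<Rightarrow> 'x set \<Rightarrow> 'b \<Rightarrow> 'b"

definition open_subspace :: "('x, 's) ringed_space \<Rightarrow> 'x set \<Rightarrow> ('x, 's) ringed_space" where
  "open_subspace X U = X\<lparr>top_of := subtopology (top_of X) U\<rparr>"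

definition open_cover :: "('x, 's) ringed_space \<Rightarrow> 'x set \<Rightarrow> 'x set set \<Rightarrow> bool" where
  "open_cover X U C \<longleftrightarrow> (\<forall>V \<in> C. openin (top_of X) V) \<and> \<Union>C = U"

definition sheaf_of_modules :: "('x, 's) ringed_space \<Rightarrow> ('x, 's, 'b) mod_sheaf \<Rightarrow> bool" where
  "sheaf_of_modules X F \<longleftrightarrow>
     (\<forall>U. openin (top_of X) U \<longrightarrow> module (Osec X U) (sec F U)) \<and>
     (\<forall>U V. openin (top_of X) U \<and> openin (top_of X) V \<and> V \<subseteq> U \<longrightarrow>
        res F U V \<in> carrier (sec F U) \<rightarrow> carrier (sec F V) \<and>
        (\<forall>s \<in> carrier (sec F U). \<forall>t \<in> carrier (sec F U).
           res F U V (s \<oplus>\<^bsub>sec F U\<^esub> t) = res F U V s \<oplus>\<^bsub>sec F V\<^esub> res F U V t) \<and>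
        (\<forall>a \<in> carrier (Osec X U). \<forall>s \<in> carrier (sec F U).
           res F U V (a \<odot>\<^bsub>sec F U\<^esub> s) = Ores X U V a \<odot>\<^bsub>sec F V\<^esub> res F U V s)) \<and>
     (\<forall>U. openin (top_of X) U \<longrightarrow> (\<forall>s \<in> carrier (sec F U). res F U U s = s)) \<and>
     (\<forall>U V W. openin (top_of X) U \<and> openin (top_of X) V \<and> openin (top_of X) W \<and> W \<subseteq> V \<and> V \<subseteq> U \<longrightarrow>
        (\<forall>s \<in> carrier (sec F U). res F V W (res F U V s) = res F U W s)) \<and>
     (\<forall>U C. openin (top_of X) U \<and> open_cover X U C \<longrightarrow>
        (\<forall>s \<in> carrier (sec F U). \<forall>t \<in> carrier (sec F U).
           (\<forall>V \<in> C. res F U V s = res F U V t) \<longrightarrow> s = t) \<and>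
        (\<forall>\<sigma>. (\<forall>V \<in> C. \<sigma> V \<in> carrier (sec F V)) \<and>
             (\<forall>V \<in> C. \<forall>W \<in> C. res F V (V \<inter> W) (\<sigma> V) = res F W (V \<inter> W) (\<sigma> W)) \<longrightarrow>
             (\<exists>s \<in> carrier (sec F U). \<forall>V \<in> C. res F U V s = \<sigma> V)))"

text \<open>A sheaf of submodules of \<open>F\<close>, given by its sets of sections.\<close>

definition subsheaf_of_modules ::
  "('x, 's) ringed_space \<Rightarrow> ('x, 's, 'b) mod_sheaf \<Rightarrow> ('x set \<Rightarrow> 'b set) \<Rightarrow> bool" where
  "subsheaf_of_modules X F L \<longleftrightarrow>
     (\<forall>U. openin (top_of X) U \<longrightarrow> submodule (L U) (Osec X U) (sec F U)) \<and>
     (\<forall>U V. openin (top_of X) U \<and> openin (top_of X) V \<and> V \<subseteq> U \<longrightarrow> res F U V ` L U \<subseteq> L V) \<and>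
     (\<forall>U C. openin (top_of X) U \<and> open_cover X U C \<longrightarrow>
        (\<forall>s \<in> carrier (sec F U). (\<forall>V \<in> C. res F U V s \<in> L V) \<longrightarrow> s \<in> L U))"

definition sub_sheaf :: "('x, 's, 'b) mod_sheaf \<Rightarrow> ('x set \<Rightarrow> 'b set) \<Rightarrow> ('x, 's, 'b) mod_sheaf" where
  "sub_sheaf F L = F\<lparr>sec := (\<lambda>U. (sec F U)\<lparr>carrier := L U\<rparr>)\<rparr>"

definition structure_module :: "('x, 's) ringed_space \<Rightarrow> ('x, 's, 's) mod_sheaf" where
  "structure_module X = \<lparr>sec = (\<lambda>U. ring_module (Osec X U)), res = Ores X\<rparr>"

text \<open>
  An isomorphism of ringed spaces \<open>(\<psi>, \<theta>)\<close>: a homeomorphism \<open>\<psi>\<close> from \<open>X\<close> to \<open>Y\<close> with ring isomorphisms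
  \<open>\<theta> V\<close> from \<open>\<O>\<^sub>Y(V)\<close> to \<open>\<O>\<^sub>X(\<psi>\<inverse>V)\<close>. For locally ringed spaces it is automatically local.
\<close>

definition preim :: "('x, 's) ringed_space \<Rightarrow> ('x \<Rightarrow> 'y) \<Rightarrow> 'y set \<Rightarrow> 'x set" where
  "preim X \<psi> V = {x \<in> topspace (top_of X). \<psi> x \<in> V}"

definition ringed_space_iso ::
  "('x, 's) ringed_space \<Rightarrow> ('y, 't) ringed_space \<Rightarrow> ('x \<Rightarrow> 'y) \<Rightarrow> ('y set \<Rightarrow> 't \<Rightarrow> 's) \<Rightarrow> bool" where
  "ringed_space_iso X Y \<psi> \<theta> \<longleftrightarrow>
     homeomorphic_map (top_of X) (top_of Y) \<psi> \<and>
     (\<forall>V. openin (top_of Y) V \<longrightarrow> \<theta> V \<in> ring_iso (Osec Y V) (Osec X (preim X \<psi> V))) \<and>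
     (\<forall>V W. openin (top_of Y) V \<and> openin (top_of Y) W \<and> W \<subseteq> V \<longrightarrow>
        (\<forall>s \<in> carrier (Osec Y V).
           \<theta> W (Ores Y V W s) = Ores X (preim X \<psi> V) (preim X \<psi> W) (\<theta> V s)))"

definition mod_sheaf_iso ::
  "('x, 's) ringed_space \<Rightarrow> ('x, 's, 'b) mod_sheaf \<Rightarrow> ('y, 't) ringed_space \<Rightarrow> ('y, 't, 'c) mod_sheaf \<Rightarrow>
   ('x \<Rightarrow> 'y) \<Rightarrow> ('y set \<Rightarrow> 't \<Rightarrow> 's) \<Rightarrow> ('y set \<Rightarrow> 'c \<Rightarrow> 'b) \<Rightarrow> bool" where
  "mod_sheaf_iso X F Y G \<psi> \<theta> \<eta> \<longleftrightarrow>
     (\<forall>V. openin (top_of Y) V \<longrightarrow>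
        bij_betw (\<eta> V) (carrier (sec G V)) (carrier (sec F (preim X \<psi> V))) \<and>
        (\<forall>s \<in> carrier (sec G V). \<forall>t \<in> carrier (sec G V).
           \<eta> V (s \<oplus>\<^bsub>sec G V\<^esub> t) = \<eta> V s \<oplus>\<^bsub>sec F (preim X \<psi> V)\<^esub> \<eta> V t) \<and>
        (\<forall>a \<in> carrier (Osec Y V). \<forall>s \<in> carrier (sec G V).
           \<eta> V (a \<odot>\<^bsub>sec G V\<^esub> s) = \<theta> V a \<odot>\<^bsub>sec F (preim X \<psi> V)\<^esub> \<eta> V s)) \<and>
     (\<forall>V W. openin (top_of Y) V \<and> openin (top_of Y) W \<and> W \<subseteq> V \<longrightarrow>
        (\<forall>s \<in> carrier (sec G V). \<eta> W (res G V W s) = res F (preim X \<psi> V) (preim X \<psi> W) (\<eta> V s)))"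


section \<open>Affine schemes\<close>

definition Spec :: "('a, 'm) ring_scheme \<Rightarrow> 'a set set" where
  "Spec R = {P. primeideal P R}"

definition zariski :: "('a, 'm) ring_scheme \<Rightarrow> 'a set topology" where
  "zariski R = topology (\<lambda>U. \<exists>A \<subseteq> carrier R. U = {P \<in> Spec R. \<not> A \<subseteq> P})"

lemma openin_zariski: "openin (zariski R) U \<longleftrightarrow> (\<exists>A \<subseteq> carrier R. U = {P \<in> Spec R. \<not> A \<subseteq> P})"
proof -
  let ?op = "\<lambda>U. \<exists>A \<subseteq> carrier R. U = {P \<in> Spec R. \<not> A \<subseteq> P}"
  have "istopology ?op"
    unfolding istopology_def
  proof safe
    fix A B assume A: "A \<subseteq> carrier R" and B: "B \<subseteq> carrier R"
    let ?C = "{a \<otimes>\<^bsub>R\<^esub> b | a b. a \<in> A \<and> b \<in> B} \<inter> carrier R"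
    have "\<not> ?C \<subseteq> P \<longleftrightarrow> \<not> A \<subseteq> P \<and> \<not> B \<subseteq> P" if "P \<in> Spec R" for P
    proof -
      interpret primeideal P R using that by (simp add: Spec_def)
      show ?thesis
      proof
        assume "\<not> ?C \<subseteq> P"
        then obtain a b where ab: "a \<in> A" "b \<in> B" "a \<otimes>\<^bsub>R\<^esub> b \<notin> P" by blast
        then have "a \<in> carrier R" "b \<in> carrier R" using A B by auto
        then have "a \<notin> P" "b \<notin> P" using ab(3) I_l_closed I_r_closed by blast+
        with ab show "\<not> A \<subseteq> P \<and> \<not> B \<subseteq> P" by blast
      next
        assume "\<not> A \<subseteq> P \<and> \<not> B \<subseteq> P"
        then obtain a b where ab: "a \<in> A" "b \<in> B" "a \<notin> P" "b \<notin> P" by blast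
        then have "a \<in> carrier R" "b \<in> carrier R" using A B by auto
        with ab I_prime have "a \<otimes>\<^bsub>R\<^esub> b \<notin> P" "a \<otimes>\<^bsub>R\<^esub> b \<in> carrier R" by auto
        with ab show "\<not> ?C \<subseteq> P" by blast
      qed
    qed
    then have "{P \<in> Spec R. \<not> A \<subseteq> P} \<inter> {P \<in> Spec R. \<not> B \<subseteq> P} = {P \<in> Spec R. \<not> ?C \<subseteq> P}"
      by blast
    then show "?op ({P \<in> Spec R. \<not> A \<subseteq> P} \<inter> {P \<in> Spec R. \<not> B \<subseteq> P})"
      by (intro exI[of _ ?C]) auto
  next
    fix K assume "\<forall>U \<in> K. ?op U"
    then obtain A where A: "\<And>U. U \<in> K \<Longrightarrow> A U \<subseteq> carrier R \<and> U = {P \<in> Spec R. \<not> A U \<subseteq> P}"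
      by metis
    have "x \<in> \<Union>K \<longleftrightarrow> x \<in> {P \<in> Spec R. \<not> \<Union>(A ` K) \<subseteq> P}" for x
      using A by blast
    then have "\<Union>K = {P \<in> Spec R. \<not> \<Union>(A ` K) \<subseteq> P}" by blast
    moreover have "\<Union>(A ` K) \<subseteq> carrier R" using A by blast
    ultimately show "?op (\<Union>K)" by blast
  qed
  then show ?thesis by (simp add: zariski_def topology_inverse')
qed

text \<open>
  Sections over \<open>U\<close> of the sheaf associated with \<open>M\<close>: families of elements of the stalks \<open>M\<^sub>P\<close> that
  are locally of the form \<open>x/f\<close>. With a submodule \<open>L\<close> in place of \<open>carrier M\<close> the numerators are
  taken in \<open>L\<close>; this gives the image of the injective map from the sheaf associated with \<open>L\<close>.
\<close>

definition tilde_sub ::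
  "('a, 'm) ring_scheme \<Rightarrow> ('a, 'b, 'k) module_scheme \<Rightarrow> 'b set \<Rightarrow> 'a set set \<Rightarrow> ('a set \<Rightarrow> ('b \<times> 'a) set) set" where
  "tilde_sub R M L U = {s \<in> extensional U. \<forall>P \<in> U. \<exists>V. openin (zariski R) V \<and> P \<in> V \<and> V \<subseteq> U \<and>
     (\<exists>x \<in> L. \<exists>f \<in> carrier R. \<forall>Q \<in> V. f \<notin> Q \<and> s Q = frac R M (carrier R - Q) x f)}"

definition spec :: "('a, 'm) ring_scheme \<Rightarrow> ('a set, 'a set \<Rightarrow> ('a \<times> 'a) set) ringed_space" where
  "spec R = \<lparr>top_of = zariski R,
     Osec = (\<lambda>U. \<lparr>carrier = tilde_sub R (ring_module R) (carrier R) U,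
       monoid.mult = (\<lambda>s t. \<lambda>P \<in> U. s P \<otimes>\<^bsub>loc_ring R (carrier R - P)\<^esub> t P),
       one = (\<lambda>P \<in> U. \<one>\<^bsub>loc_ring R (carrier R - P)\<^esub>),
       ring.zero = (\<lambda>P \<in> U. \<zero>\<^bsub>loc_ring R (carrier R - P)\<^esub>),
       ring.add = (\<lambda>s t. \<lambda>P \<in> U. s P \<oplus>\<^bsub>loc_ring R (carrier R - P)\<^esub> t P)\<rparr>),
     Ores = (\<lambda>U V s. restrict s V)\<rparr>"

definition tilde ::
  "('a, 'm) ring_scheme \<Rightarrow> ('a, 'b, 'k) module_scheme \<Rightarrow>
   ('a set, 'a set \<Rightarrow> ('a \<times> 'a) set, 'a set \<Rightarrow> ('b \<times> 'a) set) mod_sheaf" where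
  "tilde R M = \<lparr>
     sec = (\<lambda>U. \<lparr>carrier = tilde_sub R M (carrier M) U, monoid.mult = undefined, one = undefined,
       ring.zero = (\<lambda>P \<in> U. \<zero>\<^bsub>loc_module R (carrier R - P) M\<^esub>),
       ring.add = (\<lambda>s t. \<lambda>P \<in> U. s P \<oplus>\<^bsub>loc_module R (carrier R - P) M\<^esub> t P),
       smult = (\<lambda>a s. \<lambda>P \<in> U. a P \<odot>\<^bsub>loc_module R (carrier R - P) M\<^esub> s P)\<rparr>),
     res = (\<lambda>U V s. restrict s V)\<rparr>"

text \<open>
  Since a ring \<open>A\<close> with \<open>U\<close> isomorphic to \<open>Spec A\<close> is isomorphic to \<open>\<O>\<^sub>X(U)\<close>, it is no restriction
  that the elements of \<open>A\<close> have the type of the sections of \<open>\<O>\<^sub>X\<close>. Likewise, a module whose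
  associated sheaf is isomorphic to the restriction of \<open>F\<close> to \<open>U\<close> is isomorphic to \<open>F(U)\<close>.
\<close>

definition affine_open :: "('x, 's) ringed_space \<Rightarrow> 'x set \<Rightarrow> bool" where
  "affine_open X U \<longleftrightarrow> openin (top_of X) U \<and>
     (\<exists>(A :: 's ring) \<psi> \<theta>. cring A \<and> ringed_space_iso (open_subspace X U) (spec A) \<psi> \<theta>)"

definition affine_chart ::
  "('x, 's) ringed_space \<Rightarrow> ('x, 's, 'b) mod_sheaf \<Rightarrow> 'x set \<Rightarrow> 's ring \<Rightarrow> ('s, 'b) module \<Rightarrow> bool" where
  "affine_chart X F U A N \<longleftrightarrow> openin (top_of X) U \<and> cring A \<and> module A N \<and>
     (\<exists>\<psi> \<theta> \<eta>. ringed_space_iso (open_subspace X U) (spec A) \<psi> \<theta> \<and>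
        mod_sheaf_iso (open_subspace X U) F (spec A) (tilde A N) \<psi> \<theta> \<eta>)"

definition quasi_coherent :: "('x, 's) ringed_space \<Rightarrow> ('x, 's, 'b) mod_sheaf \<Rightarrow> bool" where
  "quasi_coherent X F \<longleftrightarrow> sheaf_of_modules X F \<and>
     (\<forall>x \<in> topspace (top_of X). \<exists>U A N. x \<in> U \<and> affine_chart X F U A N)"

text \<open>
  Coherence in the sense used on Noetherian schemes, where it agrees with the general notion for
  sheaves of modules on ringed spaces.
\<close>

definition coherent :: "('x, 's) ringed_space \<Rightarrow> ('x, 's, 'b) mod_sheaf \<Rightarrow> bool" where
  "coherent X F \<longleftrightarrow> sheaf_of_modules X F \<and>
     (\<forall>x \<in> topspace (top_of X). \<exists>U A N. x \<in> U \<and> affine_chart X F U A N \<and> finite_module A N)"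


section \<open>Tight closure of sheaves\<close>

definition tight_closure_sheaf ::
  "nat \<Rightarrow> ('x, 's) ringed_space \<Rightarrow> ('x, 's, 'b) mod_sheaf \<Rightarrow> ('x set \<Rightarrow> 'b set) \<Rightarrow> 'x set \<Rightarrow> 'b set" where
  "tight_closure_sheaf p X M L U = {s \<in> carrier (sec M U).
     \<exists>C. open_cover X U C \<and> (\<forall>V \<in> C. affine_open X V \<and>
       res M U V s \<in> tight_closure p (Osec X V) (sec M V) (L V))}"

definition ideal_tight_closure_sheaf ::
  "nat \<Rightarrow> ('x, 's) ringed_space \<Rightarrow> ('x set \<Rightarrow> 's set) \<Rightarrow> 'x set \<Rightarrow> 's set" where
  "ideal_tight_closure_sheaf p X I = tight_closure_sheaf p X (structure_module X) I"

end

theory Submission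
  imports Defs
begin

text \<open>
  Everything is reduced to a condition over \<open>R\<close>: \<open>z/1\<close> is in the tight closure of \<open>L\<^sub>g\<close> iff there is \<open>d\<close>, outside
  the minimal primes that do not contain \<open>g\<close>, such that for all large \<open>q\<close> some \<open>g\<^sup>n d\<close> multiplies \<open>z\<^sup>q\<close> into
  the Frobenius power of \<open>L\<close>. Since minimal primes of \<open>R\<^sub>g\<close> contract to minimal primes of \<open>R\<close>, tight closure
  persists under localization; since \<open>R\<close> has only finitely many of them, the condition glues: if it holds for
  elements \<open>g\<close> generating the unit ideal, then \<open>z\<close> is in the tight closure \<open>L*\<close>. Hence \<open>L*\<close> is the module of
  global sections of the tight closure sheaf. A sheaf \<open>F\<close> on \<open>X = Spec R\<close> is quasi-coherent iff \<open>F(X) \<rightarrow> F(D(f))\<close>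
  is localization at \<open>f\<close> for every \<open>f\<close>, so (a) and (b) both say that \<open>z/1\<close> is in the tight closure of \<open>L\<^sub>f\<close>
  only if \<open>f\<^sup>n z\<close> is in \<open>L*\<close> for some \<open>n\<close>.
\<close>

\<comment> \<open>Membership of \<open>c z^q\<close> in a Frobenius power is not computed with
  tensors: for each \<open>e\<close> there is a Frobenius-semilinear map \<open>h\<close> on
  \<open>M\<close>, killing \<open>L\<close>, such that the membership reads
  \<open>c h(z) = 0\<close> (\<open>frob_univ\<close>). In \<open>loc_tight\<close> the exponent of
  \<open>g\<close> is chosen after \<open>e\<close>, because denominators are cleared separately for
  each \<open>q\<close>; only \<open>d\<close> and the bound on \<open>e\<close> are uniform. Hence
  gluing argues with ideals anew for each \<open>e\<close>, and first needs a multiplier outside all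
  minimal primes, found by prime avoidance. Covers in the definition of the tight closure sheaf
  consist of arbitrary affine open sets, so restriction from such a set to a basic open set inside
  it must be recognized as a localization. This rests on the fact that D(r) is the largest open set
  on which \<open>r\<close> is a unit, a notion that isomorphisms respect. Finally, the elements of
  all modules, and the sections of all sheaves, considered in one statement have one fixed type,
  while the sheaf associated with a module has sections of another type. Both are therefore compared
  through \<open>global_model\<close>: a sheaf together with a module identified with its global
  sections.\<close>
text \<open>Structure arguments are also written as in \<open>x \<otimes>\<^sub>R y\<close>.\<close>

syntax "_index" :: "logic \<Rightarrow> index" ("\<^sub>_" [1000])
notation (input) iff (infixr "<->" 25)
type_synonym ('a, 'b) spec_mod = "('a set, 'a set \<Rightarrow> ('a \<times> 'a) set, 'b) mod_sheaf"
abbreviation (input) "zopen R \<equiv> openin (zariski R)"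
abbreviation (input) "\<O> R \<equiv> Osec (spec R)"
abbreviation (input) "germ R M P \<equiv> frac R M (carrier R - P)"
abbreviation (input) "lmod R P M \<equiv> loc_module R (carrier R - P) M"
abbreviation (input) "lring R P \<equiv> loc_ring R (carrier R - P)"
abbreviation (input) "Sec F U \<equiv> carrier (sec F U)"

section \<open>Semilinear maps and quotients\<close>

text \<open>\<open>phi\<close> is \<open>id\<close> for linear maps, \<open>frob p e S\<close> for
  Frobenius-semilinear ones, and a restriction or localization map where the ring changes together
  with the module.\<close>

definition semilinear ::
 "('a, 'm) ring_scheme => ('a => 'c) => ('a, 'b, 'k) module_scheme => ('c, 'd, 'l) module_scheme => ('b => 'd) => bool" where
 "semilinear A phi M N h <-> h : carrier M \<rightarrow> carrier N &
   (ALL x:carrier M. ALL y:carrier M. h (x \<oplus>\<^sub>M y) = h x \<oplus>\<^sub>N h y) &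
   (ALL a:carrier A. ALL x:carrier M. h (a \<odot>\<^sub>M x) = phi a \<odot>\<^sub>N h x)"

lemma semilinearI:
 assumes "\<And>x. x : carrier M ==> h x : carrier N"
  and "\<And>x y. x : carrier M ==> y : carrier M ==> h (x \<oplus>\<^sub>M y) = h x \<oplus>\<^sub>N h y"
  and "\<And>a x. a : carrier A ==> x : carrier M ==> h (a \<odot>\<^sub>M x) = phi a \<odot>\<^sub>N h x"
 shows "semilinear A phi M N h"
 using assms unfolding semilinear_def by auto

lemma semilinearD:
 assumes "semilinear A phi M N h"
 shows "x : carrier M ==> h x : carrier N"
  and "x : carrier M ==> y : carrier M ==> h (x \<oplus>\<^sub>M y) = h x \<oplus>\<^sub>N h y"
  and "a : carrier A ==> x : carrier M ==> h (a \<odot>\<^sub>M x) = phi a \<odot>\<^sub>N h x"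
 using assms unfolding semilinear_def by auto

lemma semilinear_zero:
 assumes h: "semilinear A phi M N h" and "abelian_group M" "abelian_group N"
 shows "h \<zero>\<^sub>M = \<zero>\<^sub>N"
proof -
 interpret M: abelian_group M by fact
 interpret N: abelian_group N by fact
 have "h \<zero>\<^sub>M \<oplus>\<^sub>N h \<zero>\<^sub>M = h \<zero>\<^sub>M"
  using semilinearD(2)[OF h, of "\<zero>\<^sub>M" "\<zero>\<^sub>M"] by simp
 moreover have "h \<zero>\<^sub>M : carrier N" using semilinearD(1)[OF h] by simp
 ultimately show ?thesis by (metis N.add.r_cancel_one')
qed

lemma semilinear_neg:
 assumes h: "semilinear A phi M N h" and "abelian_group M" "abelian_group N" and x: "x : carrier M"
 shows "h (\<ominus>\<^sub>M x) = \<ominus>\<^sub>N h x"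
proof -
 interpret M: abelian_group M by fact
 interpret N: abelian_group N by fact
 have "h (\<ominus>\<^sub>M x) \<oplus>\<^sub>N h x = h \<zero>\<^sub>M"
  using semilinearD(2)[OF h, of "\<ominus>\<^sub>M x" x] x by (simp add: M.l_neg)
 then have "h (\<ominus>\<^sub>M x) \<oplus>\<^sub>N h x = \<zero>\<^sub>N" using semilinear_zero[OF h] assms by simp
 then show ?thesis using semilinearD(1)[OF h] x N.minus_equality by (metis M.a_inv_closed)
qed

lemma semilinear_minus:
 assumes h: "semilinear A phi M N h" and "abelian_group M" "abelian_group N"
  and x: "x : carrier M" "y : carrier M"
 shows "h (x \<ominus>\<^sub>M y) = h x \<ominus>\<^sub>N h y"
proof -
 interpret M: abelian_group M by fact
 show ?thesis unfolding a_minus_def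
  using semilinearD(2)[OF h, of x "\<ominus>\<^sub>M y"] semilinear_neg[OF h assms(2,3)] x by simp
qed

lemma semilinear_comp:
 assumes "semilinear A phi M N h" "semilinear B \<chi> N K k" "phi : carrier A \<rightarrow> carrier B"
 shows "semilinear A (\<chi> \<circ> phi) M K (k \<circ> h)"
 using assms unfolding semilinear_def by (auto simp: Pi_iff)

lemma module_abelian: "module S M ==> abelian_group M"
 by (simp add: module_def)

lemma module_cring: "module S M ==> cring S"
 by (simp add: module_def)

lemma submoduleD:
 assumes "submodule L S M" "module S M"
 shows "L <= carrier M" "\<zero>\<^sub>M : L" "x : L ==> y : L ==> x \<oplus>\<^sub>M y : L"
  "x : L ==> \<ominus>\<^sub>M x : L" "a : carrier S ==> x : L ==> a \<odot>\<^sub>M x : L"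
  "x : L ==> y : L ==> x \<ominus>\<^sub>M y : L" "x : L ==> x : carrier M"
proof -
 interpret L: submodule L S M by fact
 interpret M: module S M by fact
 show s: "L <= carrier M" using M.submoduleE(1)[OF assms(1)] .
 show "\<zero>\<^sub>M : L" using L.one_closed by simp
 show "x : L ==> y : L ==> x \<oplus>\<^sub>M y : L" for x y using L.m_closed by simp
 show n: "x : L ==> \<ominus>\<^sub>M x : L" for x using M.submoduleE(3)[OF assms(1)] .
 show "a : carrier S ==> x : L ==> a \<odot>\<^sub>M x : L" for a x using L.smult_closed .
 show "x : L ==> y : L ==> x \<ominus>\<^sub>M y : L"
  unfolding a_minus_def using M.submoduleE(5)[OF assms(1)] n by simp
 show "x : L ==> x : carrier M" using s by blast
qed

text \<open>Negatives are multiples by \<open>\<ominus> \<one>\<close>, so closure under scalars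
  already gives closure under negation.\<close>

lemma submoduleI2:
 fixes S (structure)
 assumes "module S M" "H <= carrier M" "\<zero>\<^sub>M : H"
  and "\<And>x y. x : H ==> y : H ==> x \<oplus>\<^sub>M y : H"
  and s: "\<And>a x. a : carrier S ==> x : H ==> a \<odot>\<^sub>M x : H"
 shows "submodule H S M"
proof -
 interpret M: module S M by fact
 show ?thesis
 proof (rule M.submoduleI)
  fix x assume x: "x : H"
  then have "\<ominus>\<^sub>M x = (\<ominus> \<one>) \<odot>\<^sub>M x" using assms(2) M.smult_l_minus[of "\<one>" x] by auto
  then show "\<ominus>\<^sub>M x : H" using s[of "\<ominus> \<one>" x] x by simp
 qed (use assms in auto)
qed

lemma gen_submodule_least: "A <= N ==> submodule N S M ==> gen_submodule S M A <= N"
 unfolding gen_submodule_def by (simp add: hull_minimal)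

lemma gen_submodule_incl: "A <= gen_submodule S M A"
 unfolding gen_submodule_def by (simp add: hull_subset)

lemma gen_submodule_submodule:
 assumes "module S M" "A <= carrier M"
 shows "submodule (gen_submodule S M A) S M"
proof -
 interpret M: module S M by fact
 have *: "gen_submodule S M A = \<Inter>{N. submodule N S M & A <= N}"
  unfolding gen_submodule_def hull_def by blast
 have c: "carrier M : {N. submodule N S M & A <= N}"
  using M.carrier_is_submodule assms by simp
 show ?thesis unfolding *
 proof (rule submoduleI2[OF assms(1)])
  show "\<Inter>{N. submodule N S M & A <= N} <= carrier M" using c by blast
 next
  show "\<zero>\<^sub>M : \<Inter>{N. submodule N S M & A <= N}"
   using submoduleD(2)[OF _ assms(1)] by simp
 next
  fix x y assume "x : \<Inter>{N. submodule N S M & A <= N}" "y : \<Inter>{N. submodule N S M & A <= N}"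
  then show "x \<oplus>\<^sub>M y : \<Inter>{N. submodule N S M & A <= N}"
   using submoduleD(3)[OF _ assms(1)] by simp
 next
  fix a x assume "a : carrier S" "x : \<Inter>{N. submodule N S M & A <= N}"
  then show "a \<odot>\<^sub>M x : \<Inter>{N. submodule N S M & A <= N}"
   using submoduleD(5)[OF _ assms(1)] by simp
 qed
qed

lemma submodule_module:
 assumes "submodule L S M" "module S M"
 shows "module S (M\<lparr>carrier := L\<rparr>)"
 using submodule.submodule_is_module assms by blast

lemma abelian_subgroup_of_submodule:
 assumes "module S M" "submodule N S M"
 shows "abelian_subgroup N M"
proof -
 interpret M: module S M by fact
 interpret N: submodule N S M by fact
 show ?thesis
  by (rule abelian_subgroupI3) (auto intro: additive_subgroupI N.subgroup_axioms M.abelian_group_axioms)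
qed

lemma coset_iff: "v : N +>\<^bsub>M\<^esub> x <-> (EX n:N. v = n \<oplus>\<^sub>M x)"
 by (auto simp: a_r_coset_def')

lemma set_add_iff: "v : set_add M A B <-> (EX a:A. EX b:B. v = a \<oplus>\<^sub>M b)"
 by (auto simp: set_add_def')

context
 fixes S :: "('a, 'm) ring_scheme" (structure) and M :: "('a, 'b, 'k) module_scheme" and N
 assumes M: "module S M" and N: "submodule N S M"
begin

interpretation M: module S M by (rule M)

interpretation N: abelian_subgroup N M by (rule abelian_subgroup_of_submodule[OF M N])

text \<open>Scalar multiplication on the quotient adds \<open>N\<close> to the pointwise multiples
  of a coset; the additional terms \<open>a n'\<close> lie in \<open>N\<close> and are
  absorbed.\<close>

lemma coset_smult:
 assumes a: "a : carrier S" and x: "x : carrier M"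
 shows "a \<odot>\<^sub>(quot_module M N) (N +>\<^bsub>M\<^esub> x) = N +>\<^bsub>M\<^esub> (a \<odot>\<^sub>M x)"
proof (rule Set.set_eqI)
 fix v
 have "v : a \<odot>\<^sub>(quot_module M N) (N +>\<^bsub>M\<^esub> x) <-> (EX n:N. EX n':N. v = n \<oplus>\<^sub>M (a \<odot>\<^sub>M (n' \<oplus>\<^sub>M x)))"
  unfolding quot_module_def set_add_def' a_r_coset_def' by auto
 also have "\<dots> <-> (EX n:N. v = n \<oplus>\<^sub>M (a \<odot>\<^sub>M x))"
 proof
  assume "EX n:N. EX n':N. v = n \<oplus>\<^sub>M (a \<odot>\<^sub>M (n' \<oplus>\<^sub>M x))"
  then obtain n n' where n: "n : N" "n' : N" "v = n \<oplus>\<^sub>M (a \<odot>\<^sub>M (n' \<oplus>\<^sub>M x))" by blast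
  note c = submoduleD[OF N M]
  have "v = (n \<oplus>\<^sub>M a \<odot>\<^sub>M n') \<oplus>\<^sub>M (a \<odot>\<^sub>M x)"
   using n a x c(7) by (simp add: M.smult_r_distr M.a_assoc)
  moreover have "n \<oplus>\<^sub>M a \<odot>\<^sub>M n' : N" using n a c by simp
  ultimately show "EX n:N. v = n \<oplus>\<^sub>M (a \<odot>\<^sub>M x)" by blast
 next
  assume "EX n:N. v = n \<oplus>\<^sub>M (a \<odot>\<^sub>M x)"
  then obtain n where "n : N" "v = n \<oplus>\<^sub>M (a \<odot>\<^sub>M x)" by blast
  then have "v = n \<oplus>\<^sub>M (a \<odot>\<^sub>M (\<zero>\<^sub>M \<oplus>\<^sub>M x))" using x by simp
  then show "EX n:N. EX n':N. v = n \<oplus>\<^sub>M (a \<odot>\<^sub>M (n' \<oplus>\<^sub>M x))"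
   using \<open>n : N\<close> submoduleD(2)[OF N M] by blast
 qed
 finally show "v : a \<odot>\<^sub>(quot_module M N) (N +>\<^bsub>M\<^esub> x) <-> v : N +>\<^bsub>M\<^esub> (a \<odot>\<^sub>M x)"
  by (simp add: coset_iff)
qed

lemma coset_add:
 assumes "x : carrier M" "y : carrier M"
 shows "(N +>\<^bsub>M\<^esub> x) \<oplus>\<^sub>(quot_module M N) (N +>\<^bsub>M\<^esub> y) = N +>\<^bsub>M\<^esub> (x \<oplus>\<^sub>M y)"
 using N.a_rcos_sum[OF assms] by (simp add: quot_module_def)

lemma quot_carrier: "carrier (quot_module M N) = (%x. N +>\<^bsub>M\<^esub> x) ` carrier M"
 unfolding quot_module_def A_RCOSETS_def' by auto

lemma coset_eq_iff:
 assumes x: "x : carrier M" and y: "y : carrier M"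
 shows "N +>\<^bsub>M\<^esub> x = N +>\<^bsub>M\<^esub> y <-> x \<ominus>\<^sub>M y : N"
proof
 note c = submoduleD[OF N M]
 assume "N +>\<^bsub>M\<^esub> x = N +>\<^bsub>M\<^esub> y"
 moreover have "x : N +>\<^bsub>M\<^esub> x" using x c(2) unfolding coset_iff by (intro bexI[of _ "\<zero>\<^sub>M"]) auto
 ultimately have "x : N +>\<^bsub>M\<^esub> y" by simp
 then obtain n where n: "n : N" "x = n \<oplus>\<^sub>M y" unfolding coset_iff by blast
 then have "x \<ominus>\<^sub>M y = n" using x y c(7) unfolding a_minus_def by (simp add: M.a_assoc M.r_neg)
 then show "x \<ominus>\<^sub>M y : N" using n by simp
next
 note c = submoduleD[OF N M]
 have *: "N +>\<^bsub>M\<^esub> x <= N +>\<^bsub>M\<^esub> y" if "x \<ominus>\<^sub>M y : N" "x : carrier M" "y : carrier M" for x y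
 proof
  fix v assume "v : N +>\<^bsub>M\<^esub> x"
  then obtain n where n: "n : N" "v = n \<oplus>\<^sub>M x" unfolding coset_iff by blast
  have "v = (n \<oplus>\<^sub>M (x \<ominus>\<^sub>M y)) \<oplus>\<^sub>M y"
   using n that c(7) unfolding a_minus_def by (simp add: M.a_assoc M.l_neg)
  then show "v : N +>\<^bsub>M\<^esub> y" unfolding coset_iff using n that c(3) by blast
 qed
 assume d: "x \<ominus>\<^sub>M y : N"
 then have "\<ominus>\<^sub>M (x \<ominus>\<^sub>M y) : N" using c(4) by blast
 moreover have "\<ominus>\<^sub>M (x \<ominus>\<^sub>M y) = y \<ominus>\<^sub>M x"
  using x y unfolding a_minus_def by (simp add: M.minus_add M.a_comm)
 ultimately have "y \<ominus>\<^sub>M x : N" by simp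
 then show "N +>\<^bsub>M\<^esub> x = N +>\<^bsub>M\<^esub> y" using * d x y by blast
qed

lemma coset_zero: "N +>\<^bsub>M\<^esub> \<zero>\<^sub>M = \<zero>\<^sub>(quot_module M N)"
proof -
 note c = submoduleD[OF N M]
 have "v : N +>\<^bsub>M\<^esub> \<zero>\<^sub>M <-> v : N" for v using c(7) unfolding coset_iff by (auto intro!: bexI[of _ v])
 then show ?thesis by (auto simp: quot_module_def)
qed

lemma coset_eq_zero_iff:
 assumes x: "x : carrier M"
 shows "N +>\<^bsub>M\<^esub> x = \<zero>\<^sub>(quot_module M N) <-> x : N"
proof -
 have "x \<ominus>\<^sub>M \<zero>\<^sub>M = x" using x by (simp add: a_minus_def)
 then show ?thesis using coset_eq_iff[OF x, of "\<zero>\<^sub>M"] coset_zero by simp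
qed

lemma quot_module_module: "module S (quot_module M N)"
proof (rule moduleI)
 note [simp] = coset_add coset_smult
 show "abelian_group (quot_module M N)"
 proof (rule abelian_groupI)
  fix X assume "X : carrier (quot_module M N)"
  then obtain x where x: "x : carrier M" "X = N +>\<^bsub>M\<^esub> x" by (auto simp: quot_carrier)
  show "EX Y:carrier (quot_module M N). Y \<oplus>\<^sub>(quot_module M N) X = \<zero>\<^sub>(quot_module M N)"
   using x by (intro bexI[of _ "N +>\<^bsub>M\<^esub> (\<ominus>\<^sub>M x)"]) (auto simp: quot_carrier M.l_neg coset_zero)
 qed (auto simp: quot_carrier M.a_ac coset_zero[symmetric])
qed (auto simp: quot_carrier coset_add coset_smult M.smult_l_distr M.smult_r_distr M.smult_assoc1 M.is_cring)


end

section \<open>Free modules\<close>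

lemma free_carrier:
 "g : carrier (free_module T B) <-> (ALL x:B. g x : carrier T) & (ALL x. x ~: B --> g x = \<zero>\<^sub>T) & finite {x. g x ~= \<zero>\<^sub>T}"
 by (simp add: free_module_def)

lemma free_ops [simp]:
 "g \<oplus>\<^sub>(free_module T B) h = (%x. g x \<oplus>\<^sub>T h x)"
 "a \<odot>\<^sub>(free_module T B) g = (%x. a \<otimes>\<^sub>T g x)"
 "\<zero>\<^sub>(free_module T B) = (%_. \<zero>\<^sub>T)"
 by (simp_all add: free_module_def)

context
 fixes T :: "('a, 'm) ring_scheme" (structure)
 assumes T: "cring T"
begin

interpretation T: cring T by (rule T)

lemma free_in: "g : carrier (free_module T B) ==> g x : carrier T"
 by (cases "x : B") (auto simp: free_carrier)

lemma free_module_module: "module T (free_module T B)"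
proof (rule moduleI)
 show "abelian_group (free_module T B)"
 proof (rule abelian_groupI)
  fix g h k assume g: "g : carrier (free_module T B)" and h: "h : carrier (free_module T B)"
   and k: "k : carrier (free_module T B)"
  have "{x. g x \<oplus> h x ~= \<zero>} <= {x. g x ~= \<zero>} Un {x. h x ~= \<zero>}" by auto
  then have "finite {x. g x \<oplus> h x ~= \<zero>}" using g h finite_subset unfolding free_carrier by blast
  then show "g \<oplus>\<^sub>(free_module T B) h : carrier (free_module T B)"
   using g h by (simp add: free_carrier)
  note gh = free_in[OF g] free_in[OF h] free_in[OF k]
  show "g \<oplus>\<^sub>(free_module T B) h = h \<oplus>\<^sub>(free_module T B) g"
   using gh by (auto simp: T.a_comm)
  show "(g \<oplus>\<^sub>(free_module T B) h) \<oplus>\<^sub>(free_module T B) k = g \<oplus>\<^sub>(free_module T B) (h \<oplus>\<^sub>(free_module T B) k)"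
   using gh by (auto simp: T.a_assoc)
  show "\<zero>\<^sub>(free_module T B) \<oplus>\<^sub>(free_module T B) g = g" using gh by simp
  have "{x. \<ominus> g x ~= \<zero>} <= {x. g x ~= \<zero>}" by auto
  then have "finite {x. \<ominus> g x ~= \<zero>}" using g finite_subset unfolding free_carrier by blast
  then have "(%x. \<ominus> g x) : carrier (free_module T B)" using g by (simp add: free_carrier)
  then show "EX y:carrier (free_module T B). y \<oplus>\<^sub>(free_module T B) g = \<zero>\<^sub>(free_module T B)"
   using gh by (intro bexI[of _ "%x. \<ominus> g x"]) (auto simp: T.l_neg)
 qed (auto simp: free_carrier)
 fix a g assume a: "a : carrier T" and g: "g : carrier (free_module T B)"
 have "{x. a \<otimes> g x ~= \<zero>} <= {x. g x ~= \<zero>}" using a by auto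
 then have "finite {x. a \<otimes> g x ~= \<zero>}" using g finite_subset unfolding free_carrier by blast
 then show "a \<odot>\<^sub>(free_module T B) g : carrier (free_module T B)" using g a by (simp add: free_carrier)
qed (auto simp: T.cring_axioms free_in T.l_distr T.r_distr T.m_assoc T.is_cring)

lemma free_minus:
 assumes g: "g : carrier (free_module T B)" and h: "h : carrier (free_module T B)"
 shows "g \<ominus>\<^sub>(free_module T B) h = (%x. g x \<ominus> h x)"
proof -
 interpret F: module T "free_module T B" by (rule free_module_module)
 let ?n = "%x. \<ominus> h x"
 have "{x. \<ominus> h x ~= \<zero>} <= {x. h x ~= \<zero>}" by auto
 then have "finite {x. \<ominus> h x ~= \<zero>}" using h finite_subset unfolding free_carrier by blast
 then have n: "?n : carrier (free_module T B)" using h by (simp add: free_carrier)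
 have "?n \<oplus>\<^sub>(free_module T B) h = \<zero>\<^sub>(free_module T B)" using free_in[OF h] by (auto simp: T.l_neg)
 then have "\<ominus>\<^sub>(free_module T B) h = ?n" using F.minus_equality n h by blast
 then show ?thesis by (auto simp: a_minus_def)
qed

lemma basis_elem_in: "x : B ==> basis_elem T x : carrier (free_module T B)"
 by (auto simp: free_carrier basis_elem_def)

text \<open>Functions vanish outside their index set, so the free module on a subset is literally
  contained in the larger one. This lets F^e(L) and F^e(M) be compared inside one free
  module.\<close>

lemma free_submodule: "C <= B ==> submodule (carrier (free_module T C)) T (free_module T B)"
proof (rule submoduleI2[OF free_module_module])
 interpret F: module T "free_module T C" by (rule free_module_module)
 show "x : carrier (free_module T C) ==> y : carrier (free_module T C) ==>
   x \<oplus>\<^sub>(free_module T B) y : carrier (free_module T C)" for x y using F.a_closed[of x y] by simp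
 show "a : carrier T ==> x : carrier (free_module T C) ==> a \<odot>\<^sub>(free_module T B) x : carrier (free_module T C)" for a x
  using F.smult_closed[of a x] by simp
 assume "C <= B" then show "carrier (free_module T C) <= carrier (free_module T B)" by (fastforce simp: free_carrier)
qed (auto simp: free_carrier)

end

text \<open>The linear extension of \<open>h\<close> from the basis to the free module.\<close>

definition free_lift :: "('a, 'm) ring_scheme => ('a, 'q, 'k) module_scheme => ('b => 'q) => ('b => 'a) => 'q" where
 "free_lift T Q h g = finsum Q (%x. g x \<odot>\<^sub>Q h x) {x. g x ~= \<zero>\<^sub>T}"

context
 fixes T :: "('a, 'm) ring_scheme" (structure) and Q :: "('a, 'q, 'k) module_scheme" and h :: "'b => 'q" and B
 assumes Q: "module T Q" and h: "h : B \<rightarrow> carrier Q"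
begin

interpretation Q: module T Q by (rule Q)

text \<open>Terms outside the support vanish, so the sum may be taken over any larger finite set;
  two functions can then be summed over the union of their supports.\<close>

lemma free_lift_eq:
 assumes g: "g : carrier (free_module T B)" and A: "finite A" "{x. g x ~= \<zero>} <= A" "A <= B"
 shows "free_lift T Q h g = finsum Q (%x. g x \<odot>\<^sub>Q h x) A"
proof -
 have cl: "g x \<odot>\<^sub>Q h x : carrier Q" if "x : A" for x
  using that h A(3) free_in[OF Q.is_cring g] by blast
 have z: "g x \<odot>\<^sub>Q h x = \<zero>\<^sub>Q" if "x : A - {x. g x ~= \<zero>}" for x
 proof -
  have "h x : carrier Q" using that A(3) h by blast
  then show ?thesis using that by simp
 qed
 show ?thesis unfolding free_lift_def
  by (rule Q.M.add.finprod_mono_neutral_cong_left[OF A(1,2)]) (use z cl in auto)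
qed

lemma semilinear_free_lift: "semilinear T id (free_module T B) Q (free_lift T Q h)"
proof (rule semilinearI)
 interpret F: module T "free_module T B" by (rule free_module_module[OF Q.is_cring])
 fix g assume g: "g : carrier (free_module T B)"
 have supp: "{x. k x ~= \<zero>} <= B & finite {x. k x ~= \<zero>}" if "k : carrier (free_module T B)" for k
  using that by (auto simp: free_carrier)
 have cl: "k x \<odot>\<^sub>Q h x : carrier Q" if "k : carrier (free_module T B)" "x : B" for k x
  using that h free_in[OF Q.is_cring that(1)] by (auto simp: Pi_iff)
 show "free_lift T Q h g : carrier Q" unfolding free_lift_def
  by (rule Q.M.finsum_closed) (use cl[OF g] supp[OF g] in auto)
 {
  fix k assume k: "k : carrier (free_module T B)"
  let ?A = "{x. g x ~= \<zero>} Un {x. k x ~= \<zero>}"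
  have gk: "(%x. g x \<oplus> k x) : carrier (free_module T B)" using F.a_closed[OF g k] by simp
  have A: "finite ?A" "?A <= B" using supp[OF g] supp[OF k] by auto
  have "free_lift T Q h (%x. g x \<oplus> k x) = finsum Q (%x. (g x \<oplus> k x) \<odot>\<^sub>Q h x) ?A"
   by (rule free_lift_eq[OF gk A(1) _ A(2)]) auto
  also have "\<dots> = finsum Q (%x. g x \<odot>\<^sub>Q h x \<oplus>\<^sub>Q k x \<odot>\<^sub>Q h x) ?A"
   by (rule Q.M.finsum_cong') (use A h cl[OF g] cl[OF k] free_in[OF Q.is_cring g] free_in[OF Q.is_cring k] Q.smult_l_distr in \<open>auto simp: Pi_iff subset_iff\<close>)
  also have "\<dots> = finsum Q (%x. g x \<odot>\<^sub>Q h x) ?A \<oplus>\<^sub>Q finsum Q (%x. k x \<odot>\<^sub>Q h x) ?A"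
   by (rule Q.M.finsum_addf) (use A cl[OF g] cl[OF k] in auto)
  also have "finsum Q (%x. g x \<odot>\<^sub>Q h x) ?A = free_lift T Q h g"
   by (rule free_lift_eq[OF g A(1) _ A(2), symmetric]) auto
  also have "finsum Q (%x. k x \<odot>\<^sub>Q h x) ?A = free_lift T Q h k"
   by (rule free_lift_eq[OF k A(1) _ A(2), symmetric]) auto
  finally show "free_lift T Q h (g \<oplus>\<^sub>(free_module T B) k) = free_lift T Q h g \<oplus>\<^sub>Q free_lift T Q h k" by simp
 }
 fix a assume a: "a : carrier T"
 let ?A = "{x. g x ~= \<zero>}"
 have A: "finite ?A" "?A <= B" using supp[OF g] by auto
 have ag: "(%x. a \<otimes> g x) : carrier (free_module T B)" using F.smult_closed[OF a g] by simp
 have "free_lift T Q h (%x. a \<otimes> g x) = finsum Q (%x. (a \<otimes> g x) \<odot>\<^sub>Q h x) ?A"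
  by (rule free_lift_eq[OF ag A(1) _ A(2)]) (use a in auto)
 also have "\<dots> = finsum Q (%x. a \<odot>\<^sub>Q (g x \<odot>\<^sub>Q h x)) ?A"
  by (rule Q.M.finsum_cong') (use A h a cl[OF g] free_in[OF Q.is_cring g] Q.smult_assoc1 in \<open>auto simp: Pi_iff subset_iff\<close>)
 also have "\<dots> = a \<odot>\<^sub>Q finsum Q (%x. g x \<odot>\<^sub>Q h x) ?A"
  by (rule Q.finsum_smult_ldistr[symmetric]) (use A a cl[OF g] in auto)
 finally show "free_lift T Q h (a \<odot>\<^sub>(free_module T B) g) = id a \<odot>\<^sub>Q free_lift T Q h g"
  by (simp add: free_lift_def)
qed

lemma free_lift_basis:
 assumes "x : B" shows "free_lift T Q h (basis_elem T x) = h x"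
proof -
 have "free_lift T Q h (basis_elem T x) = finsum Q (%y. basis_elem T x y \<odot>\<^sub>Q h y) {x}"
  by (rule free_lift_eq[OF basis_elem_in[OF Q.is_cring assms]]) (use assms in \<open>auto simp: basis_elem_def\<close>)
 also have "\<dots> = h x" using assms h by (auto simp: basis_elem_def Pi_iff)
 finally show ?thesis .
qed

end

section \<open>Frobenius powers\<close>

text \<open>Stands for \<open>c z^q\<close> in \<open>L^[q]\<close> with \<open>q = p^e\<close>;
  tight closure is a statement about these relations for fixed \<open>c\<close> and all large
  \<open>e\<close>.\<close>

definition fmem ::
 "nat => nat => ('a, 'm) ring_scheme => ('a, 'b, 'k) module_scheme => 'b set => 'a => 'b => bool" where
 "fmem p e S M L c z <-> c \<odot>\<^sub>(frob_module p e S M) frob_elem p e S M z : frob_submodule p e S M L"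

lemma tight_closure_fmem:
 "tight_closure p S M L = {z : carrier M. EX c:ring_circ S. EX e0. ALL e >= e0. fmem p e S M L c z}"
 by (simp add: tight_closure_def fmem_def)

text \<open>The inverse image of \<open>L^[q]\<close> in the free module on \<open>M\<close>, when
  \<open>phi\<close> is the \<open>e\<close>-th Frobenius. The quotient by it is F^e(M/L).\<close>

definition frob_gen :: "('a => 'a) => ('a, 'm) ring_scheme => ('a, 'b, 'k) module_scheme => 'b set => ('b => 'a) set" where
 "frob_gen phi S M L = {v : carrier (free_module S (carrier M)).
   EX g:carrier (free_module S L). v \<ominus>\<^sub>(free_module S (carrier M)) g : base_change_rels phi S S M}"

lemma frob_closed: "cring S ==> frob p e S : carrier S \<rightarrow> carrier S"
proof -
 assume "cring S" then interpret S: cring S .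
 show ?thesis by (auto simp: frob_def)
qed

context
 fixes S :: "('a, 'm) ring_scheme" (structure) and M :: "('a, 'b, 'k) module_scheme" and L and phi :: "'a => 'a"
 assumes M: "module S M" and L: "submodule L S M" and phi: "phi : carrier S \<rightarrow> carrier S"
begin

interpretation M: module S M by (rule M)

abbreviation (input) "FM \<equiv> free_module S (carrier M)"

abbreviation (input) "rel_gens A \<equiv>
   ({basis_elem S (x \<oplus>\<^sub>M y) \<ominus>\<^sub>FM (basis_elem S x \<oplus>\<^sub>FM basis_elem S y) | x y. x : A & y : A}
   Un {basis_elem S (a \<odot>\<^sub>M x) \<ominus>\<^sub>FM (phi a \<odot>\<^sub>FM basis_elem S x) | a x. a : carrier S & x : A})"

interpretation F: module S FM by (rule free_module_module[OF M.is_cring])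

lemma bas_in: "x : carrier M ==> basis_elem S x : carrier FM"
 by (rule basis_elem_in[OF M.is_cring])

lemma rel_gens_in: "rel_gens (carrier M) <= carrier FM"
proof -
 have "phi a : carrier S" if "a : carrier S" for a using that phi by blast
 then have 1: "phi a \<odot>\<^sub>FM basis_elem S x : carrier FM" if "a : carrier S" "x : carrier M" for a x
  using that F.smult_closed bas_in by blast
 have 2: "basis_elem S x \<oplus>\<^sub>FM basis_elem S y : carrier FM" if "x : carrier M" "y : carrier M" for x y
  using that F.a_closed bas_in by blast
 have "basis_elem S (x \<oplus>\<^sub>M y) \<ominus>\<^sub>FM (basis_elem S x \<oplus>\<^sub>FM basis_elem S y) : carrier FM"
  if "x : carrier M" "y : carrier M" for x y
  by (rule F.minus_closed[OF bas_in[OF M.M.a_closed[OF that]] 2[OF that]])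
 moreover have "basis_elem S (a \<odot>\<^sub>M x) \<ominus>\<^sub>FM (phi a \<odot>\<^sub>FM basis_elem S x) : carrier FM"
  if "a : carrier S" "x : carrier M" for a x
  by (rule F.minus_closed[OF bas_in[OF M.smult_closed[OF that]] 1[OF that]])
 ultimately show ?thesis by blast
qed

lemma rels_eq: "base_change_rels phi S S M = gen_submodule S FM (rel_gens (carrier M))"
 by (simp only: base_change_rels_def)

lemma rels_submodule: "submodule (base_change_rels phi S S M) S FM"
 unfolding rels_eq by (rule gen_submodule_submodule[OF F.module_axioms rel_gens_in])

lemma LM: "L <= carrier M" using submoduleD(1)[OF L M] .

lemma FL_sub: "submodule (carrier (free_module S L)) S FM"
 by (rule free_submodule[OF M.is_cring LM])

text \<open>Both kinds of relations defining F^e(L) are relations of F^e(M) between elements of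
  \<open>L\<close>. This makes the map from F^e(L) to F^e(M) well defined on cosets.\<close>

lemma rels_mono: "base_change_rels phi S S (M\<lparr>carrier := L\<rparr>) <= base_change_rels phi S S M"
proof -
 interpret L: module S "M\<lparr>carrier := L\<rparr>" by (rule submodule_module[OF L M])
 interpret FL: module S "free_module S L" by (rule free_module_module[OF M.is_cring])
 have sub: "carrier (free_module S L) <= carrier FM" using submoduleD(1)[OF FL_sub F.module_axioms] .
 have min_eq: "g \<ominus>\<^sub>(free_module S L) h = g \<ominus>\<^sub>FM h"
  if "g : carrier (free_module S L)" "h : carrier (free_module S L)" for g h
 proof -
  have "g : carrier FM" "h : carrier FM" using that sub by auto
  then show ?thesis by (simp only: free_minus[OF M.is_cring] that)
 qed
 have basL: "basis_elem S x : carrier (free_module S L)" if "x : L" for x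
  using basis_elem_in[OF M.is_cring that] .
 let ?R = "{basis_elem S (x \<oplus>\<^sub>M y) \<ominus>\<^sub>(free_module S L) (basis_elem S x \<oplus>\<^sub>(free_module S L) basis_elem S y) | x y. x : L & y : L}
   Un {basis_elem S (a \<odot>\<^sub>M x) \<ominus>\<^sub>(free_module S L) (phi a \<odot>\<^sub>(free_module S L) basis_elem S x) | a x. a : carrier S & x : L}"
 note c = submoduleD[OF L M]
 have e1: "basis_elem S (x \<oplus>\<^sub>M y) \<ominus>\<^sub>(free_module S L) (basis_elem S x \<oplus>\<^sub>(free_module S L) basis_elem S y)
   = basis_elem S (x \<oplus>\<^sub>M y) \<ominus>\<^sub>FM (basis_elem S x \<oplus>\<^sub>FM basis_elem S y)"
  if "x : L" "y : L" for x y
  using min_eq[OF basL[OF c(3)[OF that]] FL.a_closed[OF basL basL]] that by simp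
 have e2: "basis_elem S (a \<odot>\<^sub>M x) \<ominus>\<^sub>(free_module S L) (phi a \<odot>\<^sub>(free_module S L) basis_elem S x)
   = basis_elem S (a \<odot>\<^sub>M x) \<ominus>\<^sub>FM (phi a \<odot>\<^sub>FM basis_elem S x)"
  if "x : L" "a : carrier S" for x a
  using min_eq[OF basL[OF c(5)[OF that(2,1)]] FL.smult_closed[OF _ basL[OF that(1)], of "phi a"]] that phi by auto
 have RR: "?R <= rel_gens (carrier M)"
 proof
  fix v assume "v : ?R"
  then consider x y where "x : L" "y : L" "v = basis_elem S (x \<oplus>\<^sub>M y) \<ominus>\<^sub>(free_module S L) (basis_elem S x \<oplus>\<^sub>(free_module S L) basis_elem S y)"
   | a x where "a : carrier S" "x : L" "v = basis_elem S (a \<odot>\<^sub>M x) \<ominus>\<^sub>(free_module S L) (phi a \<odot>\<^sub>(free_module S L) basis_elem S x)"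
   by blast
  then show "v : rel_gens (carrier M)"
  proof cases
   case 1 then show ?thesis unfolding 1(3) e1[OF 1(1,2)] using c(7) by blast
  next
   case 2 then show ?thesis unfolding 2(3) e2[OF 2(2,1)] using c(7) by blast
  qed
 qed
 note RM = submoduleD[OF rels_submodule F.module_axioms]
 \<comment> \<open>The relations for \<open>L\<close> are generated inside the free module on
   \<open>L\<close>, so the relations for \<open>M\<close> are intersected with it before minimality
   is applied.\<close>
 let ?I = "base_change_rels phi S S M Int carrier (free_module S L)"
 note FLc = submoduleD[OF FL_sub F.module_axioms]
 have subI: "submodule ?I S (free_module S L)"
 proof (rule submoduleI2[OF FL.module_axioms])
  fix x y assume "x : ?I" "y : ?I"
  then show "x \<oplus>\<^sub>(free_module S L) y : ?I"
   using RM(3)[of x y] FLc(3)[of x y] by simp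
 next
  fix a x assume "a : carrier S" "x : ?I"
  then show "a \<odot>\<^sub>(free_module S L) x : ?I"
   using RM(5)[of a x] FLc(5)[of a x] by simp
 qed (use RM(2) FLc(2) in auto)
 have "?R <= base_change_rels phi S S M"
  unfolding rels_eq by (rule subset_trans[OF RR gen_submodule_incl])
 moreover have "?R <= carrier (free_module S L)"
 proof -
  have pc: "phi a : carrier S" if "a : carrier S" for a using that phi by blast
  have "basis_elem S (a \<odot>\<^sub>M x) \<ominus>\<^sub>(free_module S L) (phi a \<odot>\<^sub>(free_module S L) basis_elem S x) : carrier (free_module S L)"
   if "a : carrier S" "x : L" for a x
   by (intro FL.minus_closed basL FL.smult_closed c(5) pc that)
  moreover have "basis_elem S (x \<oplus>\<^sub>M y) \<ominus>\<^sub>(free_module S L) (basis_elem S x \<oplus>\<^sub>(free_module S L) basis_elem S y) : carrier (free_module S L)"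
   if "x : L" "y : L" for x y
   by (intro FL.minus_closed basL FL.a_closed c(3) that)
  ultimately show ?thesis by blast
 qed
 ultimately have "?R <= ?I" by blast
 then have "gen_submodule S (free_module S L) ?R <= ?I" using subI by (rule gen_submodule_least)
 then show ?thesis unfolding base_change_rels_def by simp
qed

lemma frob_gen_submodule: "submodule (frob_gen phi S M L) S FM"
proof (rule submoduleI2[OF F.module_axioms])
 note RM = submoduleD[OF rels_submodule F.module_axioms]
 note FLc = submoduleD[OF FL_sub F.module_axioms]
 show "frob_gen phi S M L <= carrier FM" unfolding frob_gen_def by blast
 have "\<zero>\<^sub>FM \<ominus>\<^sub>FM \<zero>\<^sub>FM = \<zero>\<^sub>FM" unfolding a_minus_def by (simp del: free_ops)
 then show "\<zero>\<^sub>FM : frob_gen phi S M L"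
  unfolding frob_gen_def using FLc(2) RM(2) F.M.zero_closed by (metis (mono_tags, lifting) mem_Collect_eq)
next
 note RM = submoduleD[OF rels_submodule F.module_axioms]
 note FLc = submoduleD[OF FL_sub F.module_axioms]
 fix x y assume "x : frob_gen phi S M L" "y : frob_gen phi S M L"
 then obtain g h where g: "x : carrier FM" "y : carrier FM" "g : carrier (free_module S L)" "h : carrier (free_module S L)"
  "x \<ominus>\<^sub>FM g : base_change_rels phi S S M" "y \<ominus>\<^sub>FM h : base_change_rels phi S S M"
  unfolding frob_gen_def by blast
 have "(x \<ominus>\<^sub>FM g) \<oplus>\<^sub>FM (y \<ominus>\<^sub>FM h) = (x \<oplus>\<^sub>FM y) \<ominus>\<^sub>FM (g \<oplus>\<^sub>FM h)"
  using g(1,2) FLc(7)[OF g(3)] FLc(7)[OF g(4)] unfolding a_minus_def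
  by (simp add: F.minus_add F.M.a_ac del: free_ops)
 then show "x \<oplus>\<^sub>FM y : frob_gen phi S M L"
  unfolding frob_gen_def using g FLc(3)[OF g(3,4)] RM(3)[OF g(5,6)] F.M.a_closed
  by (metis (mono_tags, lifting) mem_Collect_eq)
next
 note RM = submoduleD[OF rels_submodule F.module_axioms]
 note FLc = submoduleD[OF FL_sub F.module_axioms]
 fix a x assume a: "a : carrier S" "x : frob_gen phi S M L"
 then obtain g where g: "x : carrier FM" "g : carrier (free_module S L)"
  "x \<ominus>\<^sub>FM g : base_change_rels phi S S M"
  unfolding frob_gen_def by blast
 have "a \<odot>\<^sub>FM (x \<ominus>\<^sub>FM g) = (a \<odot>\<^sub>FM x) \<ominus>\<^sub>FM (a \<odot>\<^sub>FM g)"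
  using g(1) FLc(7)[OF g(2)] a unfolding a_minus_def
  by (simp add: F.smult_r_distr F.smult_r_minus del: free_ops)
 then show "a \<odot>\<^sub>FM x : frob_gen phi S M L"
  unfolding frob_gen_def using g FLc(5)[OF a(1) g(2)] RM(5)[OF a(1) g(3)] F.smult_closed[OF a(1) g(1)]
  by (metis (mono_tags, lifting) mem_Collect_eq)
qed

lemma rels_frob_gen: "base_change_rels phi S S M <= frob_gen phi S M L"
proof
 fix v assume v: "v : base_change_rels phi S S M"
 have vc: "v : carrier FM" using submoduleD(7)[OF rels_submodule F.module_axioms v] .
 then have "v \<ominus>\<^sub>FM \<zero>\<^sub>FM = v" unfolding a_minus_def by (simp del: free_ops)
 then show "v : frob_gen phi S M L" unfolding frob_gen_def
  using v vc submoduleD(2)[OF FL_sub F.module_axioms] by (metis (mono_tags, lifting) mem_Collect_eq)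
qed

lemma basL_frob_gen: "x : L ==> basis_elem S x : frob_gen phi S M L"
proof -
 assume x: "x : L"
 have b: "basis_elem S x : carrier FM" "basis_elem S x : carrier (free_module S L)"
  using x bas_in LM basis_elem_in[OF M.is_cring x] by auto
 then have "basis_elem S x \<ominus>\<^sub>FM basis_elem S x : base_change_rels phi S S M"
  using submoduleD(2)[OF rels_submodule F.module_axioms] unfolding a_minus_def
  by (simp add: F.M.r_neg del: free_ops)
 then show ?thesis using b unfolding frob_gen_def by blast
qed

text \<open>Inclusion of the relations makes the image of the class of \<open>g\<close> in F^e(L)
  the class of the same \<open>g\<close> in F^e(M). Membership in the image becomes congruence to
  some \<open>g\<close> supported on \<open>L\<close>.\<close>

lemma image_base_change_iff:
 assumes c: "c : carrier S" and z: "z : carrier M"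
 shows "c \<odot>\<^sub>(base_change phi S S M) one_tensor phi S S M z
   : base_change_incl phi S S M ` carrier (base_change phi S S (M\<lparr>carrier := L\<rparr>))
  <-> c \<odot>\<^sub>FM basis_elem S z : frob_gen phi S M L"
proof -
 let ?N = "base_change_rels phi S S M" and ?NL = "base_change_rels phi S S (M\<lparr>carrier := L\<rparr>)"
 note RM = submoduleD[OF rels_submodule F.module_axioms]
 note FLc = submoduleD[OF FL_sub F.module_axioms]
 have zc: "c \<odot>\<^sub>FM basis_elem S z : carrier FM" using F.smult_closed[OF c bas_in[OF z]] .
 interpret L: module S "M\<lparr>carrier := L\<rparr>" by (rule submodule_module[OF L M])
 have 1: "c \<odot>\<^sub>(base_change phi S S M) one_tensor phi S S M z = ?N +>\<^bsub>FM\<^esub> (c \<odot>\<^sub>FM basis_elem S z)"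
  unfolding base_change_def one_tensor_def
  by (rule coset_smult[OF F.module_axioms rels_submodule c bas_in[OF z]])
 have z0: "\<zero>\<^sub>FM : ?NL"
 proof -
  have *: "module S (free_module S L)" by (rule free_module_module[OF M.is_cring])
  have "\<zero>\<^sub>(free_module S L) : ?NL"
   unfolding base_change_rels_def gen_submodule_def hull_def using submoduleD(2)[OF _ *] by auto
  then show ?thesis by simp
 qed
 have 2: "base_change_incl phi S S M ` carrier (base_change phi S S (M\<lparr>carrier := L\<rparr>))
   = {?N +>\<^bsub>FM\<^esub> g | g. g : carrier (free_module S L)}"
 proof -
  have "base_change_incl phi S S M (?NL +>\<^bsub>free_module S L\<^esub> g) = ?N +>\<^bsub>FM\<^esub> g" (is "?l = ?r")
   if g: "g : carrier (free_module S L)" for g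
  proof (rule Set.set_eqI)
   fix v
   have gc: "g : carrier FM" using FLc(7)[OF g] .
   have "v : ?l <-> (EX n:?N. EX n':?NL. v = n \<oplus>\<^sub>FM (n' \<oplus>\<^sub>FM g))"
    unfolding base_change_incl_def set_add_iff Bex_def coset_iff by auto
   also have "\<dots> <-> (EX n:?N. v = n \<oplus>\<^sub>FM g)"
   proof
    assume "EX n:?N. EX n':?NL. v = n \<oplus>\<^sub>FM (n' \<oplus>\<^sub>FM g)"
    then obtain n n' where n: "n : ?N" "n' : ?N" "v = n \<oplus>\<^sub>FM (n' \<oplus>\<^sub>FM g)"
     using rels_mono by blast
    then have "v = (n \<oplus>\<^sub>FM n') \<oplus>\<^sub>FM g" using gc RM(7) F.M.a_assoc by metis
    then show "EX n:?N. v = n \<oplus>\<^sub>FM g" using RM(3)[OF n(1,2)] by blast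
   next
    assume "EX n:?N. v = n \<oplus>\<^sub>FM g"
    then obtain n where "n : ?N" "v = n \<oplus>\<^sub>FM g" by blast
    moreover have "\<zero>\<^sub>FM \<oplus>\<^sub>FM g = g" using gc F.M.l_zero by blast
    ultimately show "EX n:?N. EX n':?NL. v = n \<oplus>\<^sub>FM (n' \<oplus>\<^sub>FM g)" using z0 by metis
   qed
   finally show "v : ?l <-> v : ?r" unfolding coset_iff .
  qed
  then show ?thesis unfolding base_change_def quot_module_def A_RCOSETS_def' by auto
 qed
 have "c \<odot>\<^sub>(base_change phi S S M) one_tensor phi S S M z
   : base_change_incl phi S S M ` carrier (base_change phi S S (M\<lparr>carrier := L\<rparr>))
  <-> (EX g:carrier (free_module S L). ?N +>\<^bsub>FM\<^esub> (c \<odot>\<^sub>FM basis_elem S z) = ?N +>\<^bsub>FM\<^esub> g)"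
  unfolding 1 2 by auto
 also have "\<dots> <-> (EX g:carrier (free_module S L). (c \<odot>\<^sub>FM basis_elem S z) \<ominus>\<^sub>FM g : ?N)"
  using coset_eq_iff[OF F.module_axioms rels_submodule zc] FLc(7) by blast
 finally show ?thesis unfolding frob_gen_def using zc by blast
qed

text \<open>The kernel of the linear extension of \<open>h\<close> is a submodule; semilinearity
  puts the defining relations into it, and vanishing on \<open>L\<close> the functions supported on
  \<open>L\<close>.\<close>

lemma frob_gen_kills:
 fixes Q :: "('a, 'q, 'l) module_scheme"
 assumes Q: "module S Q" and h: "semilinear S phi M Q h" and hL: "\<And>x. x : L ==> h x = \<zero>\<^sub>Q"
  and v: "v : frob_gen phi S M L"
 shows "free_lift S Q h v = \<zero>\<^sub>Q"
proof -
 interpret Q: module S Q by (rule Q)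
 have hc: "h : carrier M \<rightarrow> carrier Q" using h unfolding semilinear_def by blast
 note lin = semilinear_free_lift[OF Q hc]
 note linD = semilinearD[OF lin, unfolded id_apply]
 note lm = semilinear_minus[OF lin F.M.abelian_group_axioms Q.M.abelian_group_axioms]
 note lb = free_lift_basis[OF Q hc]
 let ?K = "{v : carrier FM. free_lift S Q h v = \<zero>\<^sub>Q}"
 have K: "submodule ?K S FM"
 proof (rule submoduleI2[OF F.module_axioms])
  show "\<zero>\<^sub>FM : ?K"
   using semilinear_zero[OF lin F.M.abelian_group_axioms Q.M.abelian_group_axioms] F.M.zero_closed by blast
  show "\<And>x y. x : ?K ==> y : ?K ==> x \<oplus>\<^sub>FM y : ?K"
   using linD(2) F.M.a_closed by (simp del: free_ops)
  show "\<And>a x. a : carrier S ==> x : ?K ==> a \<odot>\<^sub>FM x : ?K"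
   using linD(3) F.smult_closed by (simp del: free_ops)
 qed auto
 have phic: "phi a : carrier S" if "a : carrier S" for a using that phi by blast
 have "rel_gens (carrier M) <= ?K"
 proof
  fix w assume w: "w : rel_gens (carrier M)"
  then have wc: "w : carrier FM" using rel_gens_in by blast
  from w consider x y where "x : carrier M" "y : carrier M" "w = basis_elem S (x \<oplus>\<^sub>M y) \<ominus>\<^sub>FM (basis_elem S x \<oplus>\<^sub>FM basis_elem S y)"
   | a x where "a : carrier S" "x : carrier M" "w = basis_elem S (a \<odot>\<^sub>M x) \<ominus>\<^sub>FM (phi a \<odot>\<^sub>FM basis_elem S x)"
   by blast
  then have "free_lift S Q h w = \<zero>\<^sub>Q"
  proof cases
   case (1 x y)
   have "free_lift S Q h w = h (x \<oplus>\<^sub>M y) \<ominus>\<^sub>Q (h x \<oplus>\<^sub>Q h y)"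
    unfolding 1(3)
    using lm[OF bas_in[OF M.M.a_closed[OF 1(1,2)]] F.M.a_closed[OF bas_in[OF 1(1)] bas_in[OF 1(2)]]]
     linD(2)[OF bas_in[OF 1(1)] bas_in[OF 1(2)]] lb 1 by (simp del: free_ops)
   then show ?thesis using semilinearD[OF h] 1 by (simp add: Q.M.r_neg a_minus_def)
  next
   case (2 a x)
   have "free_lift S Q h w = h (a \<odot>\<^sub>M x) \<ominus>\<^sub>Q (phi a \<odot>\<^sub>Q h x)"
    unfolding 2(3)
    using lm[OF bas_in[OF M.smult_closed[OF 2(1,2)]] F.smult_closed[OF phic[OF 2(1)] bas_in[OF 2(2)]]]
     linD(3)[OF phic[OF 2(1)] bas_in[OF 2(2)]] lb 2 by (simp del: free_ops)
   then show ?thesis using semilinearD[OF h] 2 phic by (simp add: Q.M.r_neg a_minus_def)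
  qed
  then show "w : ?K" using wc by blast
 qed
 then have N: "base_change_rels phi S S M <= ?K" unfolding rels_eq using K by (rule gen_submodule_least)
 from v obtain g where g: "v : carrier FM" "g : carrier (free_module S L)" "v \<ominus>\<^sub>FM g : base_change_rels phi S S M"
  unfolding frob_gen_def by blast
 have gc: "g : carrier FM" using submoduleD(7)[OF FL_sub F.module_axioms g(2)] .
 have "g x \<odot>\<^sub>Q h x = \<zero>\<^sub>Q" if "x : {x. g x ~= \<zero>}" for x
 proof -
  have "x : L" using that g(2) by (auto simp: free_carrier)
  then show ?thesis using hL free_in[OF M.is_cring gc] by simp
 qed
 then have "free_lift S Q h g = finsum Q (%x. \<zero>\<^sub>Q) {x. g x ~= \<zero>}"
  unfolding free_lift_def by (intro Q.M.finsum_cong') auto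
 then have gz: "free_lift S Q h g = \<zero>\<^sub>Q" by simp
 have "free_lift S Q h v \<ominus>\<^sub>Q free_lift S Q h g = \<zero>\<^sub>Q" using N g(3) lm[OF g(1) gc] by auto
 moreover have "\<ominus>\<^sub>Q \<zero>\<^sub>Q = \<zero>\<^sub>Q" by (rule Q.M.minus_equality) simp_all
 ultimately show ?thesis using gz linD(1)[OF g(1)] by (simp add: a_minus_def)
qed

end

section \<open>Testing membership in Frobenius powers by semilinear maps\<close>

lemma fmem_iff_frob_gen:
 assumes "module S M" "submodule L S M" "c : carrier S" "z : carrier M"
 shows "fmem p e S M L c z <-> c \<odot>\<^sub>(free_module S (carrier M)) basis_elem S z : frob_gen (frob p e S) S M L"
 using image_base_change_iff[OF assms(1,2) frob_closed[OF module_cring[OF assms(1)], of p e] assms(3,4)]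
 unfolding fmem_def frob_module_def frob_elem_def frob_submodule_def .

text \<open>Any Frobenius-semilinear map that kills \<open>L\<close> factors through F^e(M)/L^[q].
  The target may have any type, which is used for localized modules and for modules with restricted
  scalars.\<close>

theorem fmem_kills:
 fixes Q :: "('a, 'q, 'l) module_scheme"
 assumes M: "module S M" and L: "submodule L S M" and c: "c : carrier S" and z: "z : carrier M"
  and Q: "module S Q" and h: "semilinear S (frob p e S) M Q h" and hL: "\<And>x. x : L ==> h x = \<zero>\<^sub>Q"
  and f: "fmem p e S M L c z"
 shows "c \<odot>\<^sub>Q h z = \<zero>\<^sub>Q"
proof -
 interpret M: module S M by (rule M)
 have hc: "h : carrier M \<rightarrow> carrier Q" using h unfolding semilinear_def by blast
 have "c \<odot>\<^sub>(free_module S (carrier M)) basis_elem S z : frob_gen (frob p e S) S M L"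
  using f fmem_iff_frob_gen[OF M L c z] by blast
 then have "free_lift S Q h (c \<odot>\<^sub>(free_module S (carrier M)) basis_elem S z) = \<zero>\<^sub>Q"
  using frob_gen_kills[OF M L frob_closed[OF M.is_cring] Q h] hL by blast
 then show ?thesis
  using semilinearD(3)[OF semilinear_free_lift[OF Q hc] c basis_elem_in[OF M.is_cring z]]
   free_lift_basis[OF Q hc z] by simp
qed

text \<open>Once such a pair is available, calculations with Frobenius powers take place in the
  ordinary module \<open>Q\<close>, without returning to generators and relations.\<close>

definition frob_univ ::
 "nat => nat => ('a, 'm) ring_scheme => ('a, 'b, 'k) module_scheme => 'b set => ('a, 'q) module => ('b => 'q) => bool" where
 "frob_univ p e S M L Q h <-> module S Q & semilinear S (frob p e S) M Q h & (ALL x:L. h x = \<zero>\<^sub>Q) &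
   (ALL c:carrier S. ALL z:carrier M. fmem p e S M L c z <-> c \<odot>\<^sub>Q h z = \<zero>\<^sub>Q)"

lemma frob_univD:
 assumes "frob_univ p e S M L Q h"
 shows "module S Q" "semilinear S (frob p e S) M Q h" "x : L ==> h x = \<zero>\<^sub>Q"
  "c : carrier S ==> z : carrier M ==> fmem p e S M L c z <-> c \<odot>\<^sub>Q h z = \<zero>\<^sub>Q"
 using assms unfolding frob_univ_def by blast+

text \<open>The universal module is the base change of \<open>M/L\<close> along the \<open>e\<close>-th Frobenius.\<close>

theorem fmem_universal:
 fixes M :: "('a, 'b, 'k) module_scheme"
 assumes M: "module S M" and L: "submodule L S M"
 shows "EX (Q :: ('a, ('b => 'a) set) module) h. frob_univ p e S M L Q h"
proof -
 interpret M: module S M by (rule M)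
 let ?phi = "frob p e S"
 let ?F = "free_module S (carrier M)"
 let ?G = "frob_gen ?phi S M L"
 let ?Q = "quot_module ?F ?G"
 let ?h = "%x. ?G +>\<^bsub>?F\<^esub> basis_elem S x"
 have F: "module S ?F" by (rule free_module_module[OF M.is_cring])
 interpret F: module S ?F by (rule F)
 have phi: "?phi : carrier S \<rightarrow> carrier S" by (rule frob_closed[OF M.is_cring])
 have G: "submodule ?G S ?F" by (rule frob_gen_submodule[OF M L phi])
 have Q: "module S ?Q" by (rule quot_module_module[OF F G])
 have b: "basis_elem S x : carrier ?F" if "x : carrier M" for x
  using basis_elem_in[OF M.is_cring that] .
 note rg = subset_trans[OF gen_submodule_incl rels_frob_gen[OF M L phi, unfolded base_change_rels_def]]
 have "frob_univ p e S M L ?Q ?h"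
  unfolding frob_univ_def
 proof (intro conjI ballI Q)
  show "semilinear S ?phi M ?Q ?h"
  proof (rule semilinearI)
   show "?h x : carrier ?Q" if "x : carrier M" for x
    using b[OF that] quot_carrier[OF F G] by blast
   show "?h (x \<oplus>\<^sub>M y) = ?h x \<oplus>\<^sub>?Q ?h y" if "x : carrier M" "y : carrier M" for x y
   proof -
    have "basis_elem S (x \<oplus>\<^sub>M y) \<ominus>\<^sub>?F (basis_elem S x \<oplus>\<^sub>?F basis_elem S y) : ?G"
     using rg that by blast
    then show ?thesis
     using coset_eq_iff[OF F G b[OF M.M.a_closed[OF that]] F.M.a_closed[OF b[OF that(1)] b[OF that(2)]]]
      coset_add[OF F G b[OF that(1)] b[OF that(2)]] by metis
   qed
   show "?h (a \<odot>\<^sub>M x) = ?phi a \<odot>\<^sub>?Q ?h x" if "a : carrier S" "x : carrier M" for a x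
   proof -
    have "basis_elem S (a \<odot>\<^sub>M x) \<ominus>\<^sub>?F (?phi a \<odot>\<^sub>?F basis_elem S x) : ?G"
     using rg that by blast
    moreover have "?phi a : carrier S" using phi that by blast
    ultimately show ?thesis
     using coset_eq_iff[OF F G b[OF M.smult_closed[OF that]] F.smult_closed[OF _ b[OF that(2)], of "?phi a"]]
      coset_smult[OF F G _ b[OF that(2)], of "?phi a"] by metis
   qed
  qed
  show "?h x = \<zero>\<^sub>?Q" if "x : L" for x
   using coset_eq_zero_iff[OF F G b] basL_frob_gen[OF M L phi that] submoduleD(7)[OF L M that] by blast
  show "fmem p e S M L c z <-> c \<odot>\<^sub>?Q ?h z = \<zero>\<^sub>?Q" if "c : carrier S" "z : carrier M" for c z
   using fmem_iff_frob_gen[OF M L that] coset_smult[OF F G that(1) b[OF that(2)]]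
    coset_eq_zero_iff[OF F G F.smult_closed[OF that(1) b[OF that(2)]]] by metis
 qed
 then show ?thesis by blast
qed

text \<open>In a detecting module the claim reads: \<open>c h(z) = 0\<close> implies
  \<open>(a c) h(z) = 0\<close>. The next lemmas are read off in the same way.\<close>

lemma fmem_smult:
 fixes M :: "('a, 'b, 'k) module_scheme"
 assumes M: "module S M" and L: "submodule L S M" and c: "a : carrier S" "c : carrier S" "z : carrier M"
  and f: "fmem p e S M L c z"
 shows "fmem p e S M L (a \<otimes>\<^sub>S c) z"
proof -
 interpret M: module S M by (rule M)
 obtain Q :: "('a, ('b => 'a) set) module" and h where univ: "frob_univ p e S M L Q h"
  using fmem_universal[OF M L, of p e] by (elim exE)
 note Q = frob_univD[OF univ]
 interpret Q: module S Q by (rule Q(1))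
 show ?thesis using f Q(4) c semilinearD(1)[OF Q(2)] by (simp add: Q.smult_assoc1)
qed

lemma fmem_add_coeff:
 fixes M :: "('a, 'b, 'k) module_scheme"
 assumes M: "module S M" and L: "submodule L S M" and c: "c : carrier S" "d : carrier S" "z : carrier M"
  and f: "fmem p e S M L c z" "fmem p e S M L d z"
 shows "fmem p e S M L (c \<oplus>\<^sub>S d) z"
proof -
 interpret M: module S M by (rule M)
 obtain Q :: "('a, ('b => 'a) set) module" and h where univ: "frob_univ p e S M L Q h"
  using fmem_universal[OF M L, of p e] by (elim exE)
 note Q = frob_univD[OF univ]
 interpret Q: module S Q by (rule Q(1))
 show ?thesis using f Q(4) c semilinearD(1)[OF Q(2)] by (simp add: Q.smult_l_distr)
qed

lemma fmem_zero_coeff: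
 fixes M :: "('a, 'b, 'k) module_scheme"
 assumes M: "module S M" and L: "submodule L S M" and z: "z : carrier M"
 shows "fmem p e S M L \<zero>\<^sub>S z"
proof -
 interpret M: module S M by (rule M)
 obtain Q :: "('a, ('b => 'a) set) module" and h where univ: "frob_univ p e S M L Q h"
  using fmem_universal[OF M L, of p e] by (elim exE)
 note Q = frob_univD[OF univ]
 interpret Q: module S Q by (rule Q(1))
 show ?thesis using Q(4) z semilinearD(1)[OF Q(2)] by simp
qed

lemma fmem_add:
 fixes M :: "('a, 'b, 'k) module_scheme"
 assumes M: "module S M" and L: "submodule L S M" and c: "c : carrier S" "x : carrier M" "y : carrier M"
  and f: "fmem p e S M L c x" "fmem p e S M L c y"
 shows "fmem p e S M L c (x \<oplus>\<^sub>M y)"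
proof -
 interpret M: module S M by (rule M)
 obtain Q :: "('a, ('b => 'a) set) module" and h where univ: "frob_univ p e S M L Q h"
  using fmem_universal[OF M L, of p e] by (elim exE)
 note Q = frob_univD[OF univ]
 interpret Q: module S Q by (rule Q(1))
 show ?thesis using f Q(4) c semilinearD[OF Q(2)] by (simp add: Q.smult_r_distr)
qed

text \<open>The map sends \<open>a x\<close> to \<open>a^q h(x)\<close>, and the scalar
  \<open>a^q\<close> commutes with \<open>c\<close>.\<close>

lemma fmem_smult_elem:
 fixes M :: "('a, 'b, 'k) module_scheme"
 assumes M: "module S M" and L: "submodule L S M" and c: "c : carrier S" "a : carrier S" "x : carrier M"
  and f: "fmem p e S M L c x"
 shows "fmem p e S M L c (a \<odot>\<^sub>M x)"
proof -
 interpret M: module S M by (rule M)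
 obtain Q :: "('a, ('b => 'a) set) module" and h where univ: "frob_univ p e S M L Q h"
  using fmem_universal[OF M L, of p e] by (elim exE)
 note Q = frob_univD[OF univ]
 interpret Q: module S Q by (rule Q(1))
 have a: "frob p e S a : carrier S" using frob_closed[OF M.is_cring] c by blast
 have hx: "h x : carrier Q" using semilinearD(1)[OF Q(2)] c by blast
 have "c \<odot>\<^sub>Q (frob p e S a \<odot>\<^sub>Q h x) = frob p e S a \<odot>\<^sub>Q (c \<odot>\<^sub>Q h x)"
  using a hx c by (metis Q.smult_assoc1 M.R.m_comm)
 then show ?thesis using f Q(4) c semilinearD[OF Q(2)] a by simp
qed

lemma fmem_submodule:
 fixes M :: "('a, 'b, 'k) module_scheme"
 assumes M: "module S M" and L: "submodule L S M" and c: "c : carrier S" "x : L"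
 shows "fmem p e S M L c x"
proof -
 interpret M: module S M by (rule M)
 obtain Q :: "('a, ('b => 'a) set) module" and h where univ: "frob_univ p e S M L Q h"
  using fmem_universal[OF M L, of p e] by (elim exE)
 note Q = frob_univD[OF univ]
 interpret Q: module S Q by (rule Q(1))
 show ?thesis using Q(3,4) c submoduleD(7)[OF L M] by simp
qed

definition restrict_scalars :: "('a => 'c) => ('c, 'b, 'k) module_scheme => ('a, 'b) module" where
 "restrict_scalars rho N = \<lparr>carrier = carrier N, monoid.mult = undefined, one = undefined,
   ring.zero = \<zero>\<^sub>N, ring.add = (%x y. x \<oplus>\<^sub>N y), smult = (%a x. rho a \<odot>\<^sub>N x)\<rparr>"

lemma restrict_scalars_simps [simp]:
 "carrier (restrict_scalars rho N) = carrier N" "\<zero>\<^sub>(restrict_scalars rho N) = \<zero>\<^sub>N"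
 "x \<oplus>\<^sub>(restrict_scalars rho N) y = x \<oplus>\<^sub>N y" "a \<odot>\<^sub>(restrict_scalars rho N) x = rho a \<odot>\<^sub>N x"
 by (simp_all add: restrict_scalars_def)

lemma restrict_scalars_module:
 assumes "module B N" "cring A" "rho : ring_hom A B"
 shows "module A (restrict_scalars rho N)"
proof -
 interpret N: module B N by fact
 interpret A: cring A by fact
 have [simp]: "\<And>a. a : carrier A ==> rho a : carrier B" using ring_hom_closed[OF assms(3)] .
 show ?thesis
 proof (rule moduleI[OF assms(2)])
  show "abelian_group (restrict_scalars rho N)"
  proof (rule abelian_groupI)
   fix x assume "x : carrier (restrict_scalars rho N)"
   then show "EX y:carrier (restrict_scalars rho N). y \<oplus>\<^sub>(restrict_scalars rho N) x = \<zero>\<^sub>(restrict_scalars rho N)"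
    by (intro bexI[of _ "\<ominus>\<^sub>N x"]) (auto simp: N.M.l_neg)
  qed (auto simp: N.M.a_ac)
 qed (use assms(3) in \<open>auto simp: N.smult_l_distr N.smult_r_distr N.smult_assoc1 ring_hom_add ring_hom_mult ring_hom_one\<close>)
qed

lemma frob_hom:
 assumes "cring A" "cring B" "rho : ring_hom A B" "a : carrier A"
 shows "rho (frob p e A a) = frob p e B (rho a)"
proof -
 interpret ring_hom_cring A B rho
  by (intro ring_hom_cringI ring_hom_ringI2) (use assms cring.axioms(1) in auto)
 show ?thesis unfolding frob_def using assms(4) by (simp add: hom_nat_pow)
qed

text \<open>Compose \<open>h\<close> with a detecting map for \<open>K\<close> and restrict the
  scalars of its target to \<open>A\<close>. Since \<open>rho\<close> commutes with Frobenius, the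
  composite is Frobenius-semilinear over \<open>A\<close>, and it kills \<open>L\<close> because
  \<open>h\<close> maps \<open>L\<close> into \<open>K\<close>.\<close>

theorem fmem_semilinear:
 fixes N :: "('c, 'd, 'l) module_scheme"
 assumes M: "module A M" and N: "module B N" and rho: "rho : ring_hom A B" and h: "semilinear A rho M N h"
  and L: "submodule L A M" and K: "submodule K B N" and hLK: "h ` L <= K"
  and c: "c : carrier A" and z: "z : carrier M" and f: "fmem p e A M L c z"
 shows "fmem p e B N K (rho c) (h z)"
proof -
 interpret M: module A M by (rule M)
 interpret N: module B N by (rule N)
 obtain Q :: "('c, ('d => 'c) set) module" and k where univ: "frob_univ p e B N K Q k"
  using fmem_universal[OF N K, of p e] by (elim exE)
 note Q = frob_univD[OF univ]
 let ?Q = "restrict_scalars rho Q"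
 have mQ: "module A ?Q" by (rule restrict_scalars_module[OF Q(1) M.is_cring rho])
 have "semilinear A (frob p e A) M ?Q (k \<circ> h)"
  by (rule semilinearI) (use semilinearD[OF Q(2)] semilinearD[OF h] ring_hom_closed[OF rho]
    frob_hom[OF M.is_cring N.is_cring rho] in auto)
 then have "c \<odot>\<^sub>?Q (k \<circ> h) z = \<zero>\<^sub>?Q"
  by (rule fmem_kills[OF M L c z mQ]) (use Q(3) hLK f in auto)
 then show ?thesis using Q(4)[OF ring_hom_closed[OF rho c] semilinearD(1)[OF h z]] by simp
qed

section \<open>Localization\<close>

definition mult_set :: "('a, 'm) ring_scheme => 'a set => bool" where
 "mult_set S W <-> W <= carrier S & \<one>\<^sub>S : W & (ALL s:W. ALL t:W. s \<otimes>\<^sub>S t : W)"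

lemma mult_setD:
 assumes "mult_set S W"
 shows "s : W ==> s : carrier S" "\<one>\<^sub>S : W" "s : W ==> t : W ==> s \<otimes>\<^sub>S t : W"
 using assms unfolding mult_set_def by auto

lemma mult_set_pow:
 assumes "mult_set S W" "s : W"
 shows "s [^]\<^sub>S (n::nat) : W"
 by (induction n) (use mult_setD[OF assms(1)] assms(2) in auto)

lemma (in cring) mult_set_powers:
 assumes "g : carrier R" shows "mult_set R (powers R g)"
proof -
 have "g [^] (m + n) : powers R g" for m n :: nat unfolding powers_def by blast
 moreover have "\<one> : powers R g" unfolding powers_def using nat_pow_0[of g] by (metis (mono_tags, lifting) mem_Collect_eq)
 ultimately show ?thesis using assms unfolding mult_set_def by (auto simp: powers_def nat_pow_mult)
qed

lemma (in primeideal) mult_set_prime: "mult_set R (carrier R - I)"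
 unfolding mult_set_def using I_prime I_notcarr one_imp_carrier by auto

lemma ring_module_simps [simp]:
 "carrier (ring_module S) = carrier S" "\<zero>\<^sub>(ring_module S) = \<zero>\<^sub>S" "\<one>\<^sub>(ring_module S) = \<one>\<^sub>S"
 "x \<oplus>\<^sub>(ring_module S) y = x \<oplus>\<^sub>S y" "x \<otimes>\<^sub>(ring_module S) y = x \<otimes>\<^sub>S y" "a \<odot>\<^sub>(ring_module S) x = a \<otimes>\<^sub>S x"
 by (simp_all add: ring_module_def)

lemma ring_module_module:
 assumes "cring S" shows "module S (ring_module S)"
proof -
 interpret S: cring S by fact
 show ?thesis
 proof (rule moduleI[OF assms])
  show "abelian_group (ring_module S)"
  proof (rule abelian_groupI)
   fix x assume "x : carrier (ring_module S)"
   then show "EX y:carrier (ring_module S). y \<oplus>\<^sub>(ring_module S) x = \<zero>\<^sub>(ring_module S)"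
    by (intro bexI[of _ "\<ominus>\<^sub>S x"]) (auto simp: S.l_neg)
  qed (auto simp: S.a_ac)
 qed (auto simp: S.l_distr S.r_distr S.m_assoc)
qed

lemma ideal_iff_submodule:
 fixes S (structure)
 assumes "cring S" shows "ideal I S <-> submodule I S (ring_module S)"
proof
 interpret S: cring S by fact
 assume "ideal I S"
 then interpret I: ideal I S .
 show "submodule I S (ring_module S)"
  by (rule submoduleI2[OF ring_module_module[OF assms]])
    (use I.a_subset I.zero_closed I.a_closed I.I_l_closed in auto)
next
 interpret S: cring S by fact
 assume I: "submodule I S (ring_module S)"
 note c = submoduleD[OF I ring_module_module[OF assms], simplified]
 interpret rm3: module S "ring_module S" by (rule ring_module_module[OF assms])
 have inv: "\<ominus> x : I" if "x : I" for x
 proof -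
  have "\<ominus> x = (\<ominus> \<one>) \<otimes> x" using c(7)[OF that] by (simp add: S.l_minus)
  then show ?thesis using c(5)[OF _ that] by simp
 qed
 show "ideal I S"
 proof (rule idealI[OF S.ring_axioms])
  show "subgroup I (add_monoid S)"
   by (rule S.add.subgroupI) (use c inv in \<open>auto simp: a_inv_def\<close>)
  show "x \<otimes> a : I" if "a : I" "x : carrier S" for a x using c(5) that by blast
  then show "a \<otimes> x : I" if "a : I" "x : carrier S" for a x using that c(7) S.m_comm by metis
 qed
qed

text \<open>Operations on fractions are defined as unions over all representatives; once the value
  does not depend on them, the union is that single value.\<close>

lemma UN_pair_const:
 assumes "X ~= {}" "Y ~= {}" "\<And>a s b t. (a, s) : X ==> (b, t) : Y ==> f a s b t = C"
 shows "(\<Union>(a, s) \<in> X. \<Union>(b, t) \<in> Y. f a s b t) = C"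
proof -
 have "(\<Union>(b, t) \<in> Y. f a s b t) = C" if "(a, s) : X" for a s
 proof -
  have "(case y of (b, t) => f a s b t) = C" if "y : Y" for y
   using that assms(3)[OF \<open>(a, s) : X\<close>] by (cases y) auto
  then have "(\<Union>(b, t) \<in> Y. f a s b t) = (\<Union>y \<in> Y. C)" by (rule SUP_cong[OF refl])
  then show ?thesis using assms(2) by simp
 qed
 then have "(case x of (a, s) => \<Union>(b, t) \<in> Y. f a s b t) = C" if "x : X" for x
  using that by (cases x) auto
 then have "(\<Union>(a, s) \<in> X. \<Union>(b, t) \<in> Y. f a s b t) = (\<Union>x \<in> X. C)" by (rule SUP_cong[OF refl])
 then show ?thesis using assms(1) by simp
qed

context
 fixes S :: "('a, 'm) ring_scheme" (structure) and M :: "('a, 'b, 'k) module_scheme" and W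
 assumes M: "module S M" and W: "mult_set S W"
begin

interpretation M: module S M by (rule M)

private lemmas Wc = mult_setD[OF W]

lemma frac_iff: "(y, t) : frac S M W x s <-> y : carrier M & t : W &
   (EX u:W. (u \<otimes> t) \<odot>\<^sub>M x = (u \<otimes> s) \<odot>\<^sub>M y)"
 if "x : carrier M" "s : W"
 using that Wc(1) by (auto simp: frac_def M.smult_assoc1)

lemma frac_self: "x : carrier M ==> s : W ==> (x, s) : frac S M W x s"
 using Wc(2) by (auto simp: frac_iff)

text \<open>Transitivity of equality of fractions: the witnesses \<open>u\<close> and
  \<open>v\<close> and the middle denominator \<open>t\<close> combine to the witness
  \<open>u v t\<close>.\<close>

lemma frac_subset:
 assumes x: "x : carrier M" "s : W" and y: "y : carrier M" "t : W"
  and u: "u : W" "(u \<otimes> t) \<odot>\<^sub>M x = (u \<otimes> s) \<odot>\<^sub>M y"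
 shows "frac S M W y t <= frac S M W x s"
proof
 fix zr assume "zr : frac S M W y t"
 then obtain z r v where zr: "zr = (z, r)" "z : carrier M" "r : W" "v : W"
  "(v \<otimes> r) \<odot>\<^sub>M y = (v \<otimes> t) \<odot>\<^sub>M z"
  using y by (cases zr) (auto simp: frac_iff)
 note [simp] = Wc(1)
 have "((u \<otimes> v \<otimes> t) \<otimes> r) \<odot>\<^sub>M x = (v \<otimes> r) \<odot>\<^sub>M ((u \<otimes> t) \<odot>\<^sub>M x)"
  using assms(1-5) zr(1-4) by (simp add: M.smult_assoc1[symmetric] M.R.m_ac)
 also have "\<dots> = (u \<otimes> s) \<odot>\<^sub>M ((v \<otimes> r) \<odot>\<^sub>M y)"
  unfolding u(2) using assms(1-5) zr(1-4) by (simp add: M.smult_assoc1[symmetric] M.R.m_ac)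
 also have "\<dots> = ((u \<otimes> v \<otimes> t) \<otimes> s) \<odot>\<^sub>M z"
  unfolding zr(5) using assms(1-5) zr(1-4) by (simp add: M.smult_assoc1[symmetric] M.R.m_ac)
 finally show "zr : frac S M W x s"
  unfolding zr(1) frac_iff[OF x] using zr(2,3) Wc(3)[OF Wc(3)[OF u(1) zr(4)] y(2)] by blast
qed

lemma frac_eq_iff:
 assumes x: "x : carrier M" "s : W" and y: "y : carrier M" "t : W"
 shows "frac S M W x s = frac S M W y t <-> (EX u:W. (u \<otimes> t) \<odot>\<^sub>M x = (u \<otimes> s) \<odot>\<^sub>M y)"
proof
 assume "frac S M W x s = frac S M W y t"
 then have "(y, t) : frac S M W x s" using frac_self[OF y] by simp
 then show "EX u:W. (u \<otimes> t) \<odot>\<^sub>M x = (u \<otimes> s) \<odot>\<^sub>M y" using x by (simp add: frac_iff)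
next
 assume "EX u:W. (u \<otimes> t) \<odot>\<^sub>M x = (u \<otimes> s) \<odot>\<^sub>M y"
 then obtain u where "u : W" "(u \<otimes> t) \<odot>\<^sub>M x = (u \<otimes> s) \<odot>\<^sub>M y" by blast
 then show "frac S M W x s = frac S M W y t"
  using frac_subset[OF x y] frac_subset[OF y x] by (metis subset_antisym)
qed

lemma frac_eqI:
 assumes "x : carrier M" "s : W" "y : carrier M" "t : W" "t \<odot>\<^sub>M x = s \<odot>\<^sub>M y"
 shows "frac S M W x s = frac S M W y t"
 using assms Wc(1,2) by (auto simp: frac_eq_iff intro!: bexI[of _ "\<one>"])


lemma frac_cancel:
 assumes "x : carrier M" "s : W" "t : W"
 shows "frac S M W (t \<odot>\<^sub>M x) (t \<otimes> s) = frac S M W x s"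
 using assms Wc(1,3) by (intro frac_eqI) (auto simp: M.smult_assoc1[symmetric] M.R.m_ac)

text \<open>If \<open>u\<close> and \<open>v\<close> witness two changes of representative,
  \<open>u v\<close> witnesses the change for the sum, so the defining union collapses to one
  class.\<close>

lemma loc_add:
 assumes x: "x : carrier M" "s : W" and y: "y : carrier M" "t : W"
 shows "frac S M W x s \<oplus>\<^sub>(loc_module S W M) frac S M W y t = frac S M W (t \<odot>\<^sub>M x \<oplus>\<^sub>M s \<odot>\<^sub>M y) (s \<otimes> t)"
proof -
 have "(\<Union>(x, s) \<in> frac S M W x s. \<Union>(y, t) \<in> frac S M W y t. frac S M W (t \<odot>\<^sub>M x \<oplus>\<^sub>M s \<odot>\<^sub>M y) (s \<otimes> t))
   = frac S M W (t \<odot>\<^sub>M x \<oplus>\<^sub>M s \<odot>\<^sub>M y) (s \<otimes> t)"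
 proof (rule UN_pair_const)
  show "frac S M W x s ~= {}" "frac S M W y t ~= {}" using frac_self x y by blast+
  fix x' s' y' t' assume "(x', s') : frac S M W x s" "(y', t') : frac S M W y t"
  then obtain u v where u: "x' : carrier M" "s' : W" "u : W" "(u \<otimes> s') \<odot>\<^sub>M x = (u \<otimes> s) \<odot>\<^sub>M x'"
   and v: "y' : carrier M" "t' : W" "v : W" "(v \<otimes> t') \<odot>\<^sub>M y = (v \<otimes> t) \<odot>\<^sub>M y'"
   using x y by (auto simp: frac_iff)
  note [simp] = Wc(1)
  have 1: "((u \<otimes> v) \<otimes> (s' \<otimes> t')) \<odot>\<^sub>M (t \<odot>\<^sub>M x) = ((u \<otimes> v) \<otimes> (s \<otimes> t)) \<odot>\<^sub>M (t' \<odot>\<^sub>M x')"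
  proof -
   have "((u \<otimes> v) \<otimes> (s' \<otimes> t')) \<odot>\<^sub>M (t \<odot>\<^sub>M x) = (v \<otimes> t' \<otimes> t) \<odot>\<^sub>M ((u \<otimes> s') \<odot>\<^sub>M x)"
    using x y u(1-3) v(1-3) by (simp add: M.smult_assoc1[symmetric] M.R.m_ac)
   also have "\<dots> = ((u \<otimes> v) \<otimes> (s \<otimes> t)) \<odot>\<^sub>M (t' \<odot>\<^sub>M x')"
    unfolding u(4) using x y u(1-3) v(1-3) by (simp add: M.smult_assoc1[symmetric] M.R.m_ac)
   finally show ?thesis .
  qed
  have 2: "((u \<otimes> v) \<otimes> (s' \<otimes> t')) \<odot>\<^sub>M (s \<odot>\<^sub>M y) = ((u \<otimes> v) \<otimes> (s \<otimes> t)) \<odot>\<^sub>M (s' \<odot>\<^sub>M y')"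
  proof -
   have "((u \<otimes> v) \<otimes> (s' \<otimes> t')) \<odot>\<^sub>M (s \<odot>\<^sub>M y) = (u \<otimes> s' \<otimes> s) \<odot>\<^sub>M ((v \<otimes> t') \<odot>\<^sub>M y)"
    using x y u(1-3) v(1-3) by (simp add: M.smult_assoc1[symmetric] M.R.m_ac)
   also have "\<dots> = ((u \<otimes> v) \<otimes> (s \<otimes> t)) \<odot>\<^sub>M (s' \<odot>\<^sub>M y')"
    unfolding v(4) using x y u(1-3) v(1-3) by (simp add: M.smult_assoc1[symmetric] M.R.m_ac)
   finally show ?thesis .
  qed
  have "((u \<otimes> v) \<otimes> (s' \<otimes> t')) \<odot>\<^sub>M (t \<odot>\<^sub>M x \<oplus>\<^sub>M s \<odot>\<^sub>M y)
   = ((u \<otimes> v) \<otimes> (s \<otimes> t)) \<odot>\<^sub>M (t' \<odot>\<^sub>M x' \<oplus>\<^sub>M s' \<odot>\<^sub>M y')"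
   using 1 2 x y u(1-3) v(1-3) by (simp add: M.smult_r_distr)
  then show "frac S M W (t' \<odot>\<^sub>M x' \<oplus>\<^sub>M s' \<odot>\<^sub>M y') (s' \<otimes> t') = frac S M W (t \<odot>\<^sub>M x \<oplus>\<^sub>M s \<odot>\<^sub>M y) (s \<otimes> t)"
   using x y u(1-3) v(1-3) Wc(3) by (subst frac_eq_iff) (auto intro!: bexI[of _ "u \<otimes> v"])
 qed
 then show ?thesis by (simp add: loc_module_def)
qed

lemma loc_add_same:
 assumes x: "x : carrier M" "y : carrier M" "s : W"
 shows "frac S M W x s \<oplus>\<^sub>(loc_module S W M) frac S M W y s = frac S M W (x \<oplus>\<^sub>M y) s"
proof -
 have "s \<odot>\<^sub>M x \<oplus>\<^sub>M s \<odot>\<^sub>M y = s \<odot>\<^sub>M (x \<oplus>\<^sub>M y)" using x Wc(1) by (simp add: M.smult_r_distr)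
 then show ?thesis using x frac_cancel[of "x \<oplus>\<^sub>M y" s s] by (simp add: loc_add)
qed

lemma loc_carrier: "carrier (loc_module S W M) = {frac S M W x s | x s. x : carrier M & s : W}"
 by (simp add: loc_module_def loc_sub_def)

lemma loc_zero: "\<zero>\<^sub>(loc_module S W M) = frac S M W \<zero>\<^sub>M \<one>"
 by (simp add: loc_module_def)

lemma frac_zero: "s : W ==> frac S M W \<zero>\<^sub>M s = \<zero>\<^sub>(loc_module S W M)"
 unfolding loc_zero using Wc by (intro frac_eqI) auto

lemma frac_eq_zero_iff:
 assumes "x : carrier M" "s : W"
 shows "frac S M W x s = \<zero>\<^sub>(loc_module S W M) <-> (EX u:W. u \<odot>\<^sub>M x = \<zero>\<^sub>M)"
 unfolding loc_zero using assms Wc by (auto simp: frac_eq_iff)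


lemma abelian_group_loc: "abelian_group (loc_module S W M)"
proof (rule abelian_groupI)
 note [simp] = Wc(1)
 fix X Y Z assume XYZ: "X : carrier (loc_module S W M)" "Y : carrier (loc_module S W M)" "Z : carrier (loc_module S W M)"
 then obtain x s y t z r where x: "X = frac S M W x s" "x : carrier M" "s : W"
  and y: "Y = frac S M W y t" "y : carrier M" "t : W"
  and z: "Z = frac S M W z r" "z : carrier M" "r : W" by (auto simp: loc_carrier)
 show "X \<oplus>\<^sub>(loc_module S W M) Y : carrier (loc_module S W M)"
 proof -
  have "t \<odot>\<^sub>M x \<oplus>\<^sub>M s \<odot>\<^sub>M y : carrier M" using x y by simp
  then show ?thesis unfolding x(1) y(1) loc_add[OF x(2,3) y(2,3)] loc_carrier using Wc(3)[OF x(3) y(3)] by blast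
 qed
 show "X \<oplus>\<^sub>(loc_module S W M) Y = Y \<oplus>\<^sub>(loc_module S W M) X"
  using x y by (simp add: loc_add M.R.m_comm M.M.a_comm)
 show "X \<oplus>\<^sub>(loc_module S W M) Y \<oplus>\<^sub>(loc_module S W M) Z = X \<oplus>\<^sub>(loc_module S W M) (Y \<oplus>\<^sub>(loc_module S W M) Z)"
  using x y z by (simp add: loc_add Wc(3) M.smult_r_distr M.smult_assoc1[symmetric] M.R.m_ac M.M.a_ac)
 show "\<zero>\<^sub>(loc_module S W M) \<oplus>\<^sub>(loc_module S W M) X = X"
  unfolding loc_zero using x by (simp add: loc_add Wc)
 show "EX Y:carrier (loc_module S W M). Y \<oplus>\<^sub>(loc_module S W M) X = \<zero>\<^sub>(loc_module S W M)"
  using x by (intro bexI[of _ "frac S M W (\<ominus>\<^sub>M x) s"]) (auto simp: loc_add_same M.M.l_neg frac_zero loc_carrier)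
next
 show "\<zero>\<^sub>(loc_module S W M) : carrier (loc_module S W M)" unfolding loc_zero loc_carrier using Wc(2) by blast
qed

end

context
 fixes S :: "('a, 'm) ring_scheme" (structure) and W
 assumes S: "cring S" and W: "mult_set S W"
begin

interpretation S: cring S by (rule S)

private lemmas Wd = mult_setD[OF W]

lemma loc_smult:
 fixes M :: "('a, 'b, 'k) module_scheme"
 assumes M: "module S M" and x: "a : carrier S" "s : W" and y: "y : carrier M" "t : W"
 shows "frac S (ring_module S) W a s \<odot>\<^sub>(loc_module S W M) frac S M W y t = frac S M W (a \<odot>\<^sub>M y) (s \<otimes> t)"
proof -
 interpret M: module S M by (rule M)
 note rm3 = ring_module_module[OF S]
 have "(\<Union>(a, s) \<in> frac S (ring_module S) W a s. \<Union>(y, t) \<in> frac S M W y t. frac S M W (a \<odot>\<^sub>M y) (s \<otimes> t))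
   = frac S M W (a \<odot>\<^sub>M y) (s \<otimes> t)"
 proof (rule UN_pair_const)
  show "frac S (ring_module S) W a s ~= {}" "frac S M W y t ~= {}"
   using frac_self[OF rm3 W, of a s] frac_self[OF M W] x y by auto
  fix a' s' y' t' assume *: "(a', s') : frac S (ring_module S) W a s" "(y', t') : frac S M W y t"
  obtain u where u: "a' : carrier S" "s' : W" "u : W" "(u \<otimes> s') \<otimes> a = (u \<otimes> s) \<otimes> a'"
   using *(1) frac_iff[OF rm3 W, of a s a' s'] x by auto
  obtain v where v: "y' : carrier M" "t' : W" "v : W" "(v \<otimes> t') \<odot>\<^sub>M y = (v \<otimes> t) \<odot>\<^sub>M y'"
   using *(2) frac_iff[OF M W, of y t y' t'] y by auto
  note [simp] = Wd(1)
  have "((u \<otimes> v) \<otimes> (s' \<otimes> t')) \<odot>\<^sub>M (a \<odot>\<^sub>M y) = ((u \<otimes> s') \<otimes> a) \<odot>\<^sub>M ((v \<otimes> t') \<odot>\<^sub>M y)"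
   using x y u(1-3) v(1-3) by (simp add: M.smult_assoc1[symmetric] S.m_ac)
  also have "\<dots> = ((u \<otimes> v) \<otimes> (s \<otimes> t)) \<odot>\<^sub>M (a' \<odot>\<^sub>M y')"
   unfolding u(4) v(4) using x y u(1-3) v(1-3) by (simp add: M.smult_assoc1[symmetric] S.m_ac)
  finally show "frac S M W (a' \<odot>\<^sub>M y') (s' \<otimes> t') = frac S M W (a \<odot>\<^sub>M y) (s \<otimes> t)"
   using x y u(1-3) v(1-3) Wd(3) by (subst frac_eq_iff[OF M W]) (auto intro!: bexI[of _ "u \<otimes> v"])
 qed
 then show ?thesis by (simp add: loc_module_def)
qed

text \<open>The localized ring is the localization of \<open>ring_module S\<close> read again, with
  scalar multiplication as product, so additive facts are inherited from modules.\<close>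

lemma loc_ring_eqs:
 "carrier (loc_ring S W) = carrier (loc_module S W (ring_module S))"
 "\<zero>\<^sub>(loc_ring S W) = \<zero>\<^sub>(loc_module S W (ring_module S))"
 "\<one>\<^sub>(loc_ring S W) = frac S (ring_module S) W \<one> \<one>"
 "X \<oplus>\<^sub>(loc_ring S W) Y = X \<oplus>\<^sub>(loc_module S W (ring_module S)) Y"
 "X \<otimes>\<^sub>(loc_ring S W) Y = X \<odot>\<^sub>(loc_module S W (ring_module S)) Y"
 by (simp_all add: loc_ring_def loc_module_def)

lemma loc_ring_carrier: "carrier (loc_ring S W) = {frac S (ring_module S) W x s | x s. x : carrier S & s : W}"
 by (simp add: loc_ring_def loc_sub_def)

private lemmas rm3 = ring_module_module[OF S]

lemmas loc_ring_ops = loc_add[OF rm3 W, simplified] loc_smult[OF rm3, simplified] frac_zero[OF rm3 W, simplified]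

lemma loc_ring_mult:
 assumes "a : carrier S" "s : W" "b : carrier S" "t : W"
 shows "frac S (ring_module S) W a s \<otimes>\<^sub>(loc_ring S W) frac S (ring_module S) W b t
  = frac S (ring_module S) W (a \<otimes> b) (s \<otimes> t)"
 using loc_smult[OF rm3, of a s b t] assms by (simp add: loc_ring_eqs)

lemma cring_loc_ring: "cring (loc_ring S W)"
proof (rule cringI)
 interpret L: abelian_group "loc_module S W (ring_module S)" by (rule abelian_group_loc[OF rm3 W])
 show "abelian_group (loc_ring S W)"
 proof (rule abelian_groupI)
  fix x assume "x : carrier (loc_ring S W)"
  then show "EX y:carrier (loc_ring S W). y \<oplus>\<^sub>(loc_ring S W) x = \<zero>\<^sub>(loc_ring S W)"
   by (intro bexI[of _ "\<ominus>\<^sub>(loc_module S W (ring_module S)) x"]) (auto simp: loc_ring_eqs L.l_neg)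
 qed (auto simp: loc_ring_eqs L.a_ac)
 note [simp] = Wd(1)
 show "Group.comm_monoid (loc_ring S W)"
 proof (rule comm_monoidI)
  fix X Y Z assume "X : carrier (loc_ring S W)" "Y : carrier (loc_ring S W)" "Z : carrier (loc_ring S W)"
  then obtain x s y t z r where x: "X = frac S (ring_module S) W x s" "x : carrier S" "s : W"
   and y: "Y = frac S (ring_module S) W y t" "y : carrier S" "t : W"
   and z: "Z = frac S (ring_module S) W z r" "z : carrier S" "r : W" by (auto simp: loc_ring_carrier)
  show "X \<otimes>\<^sub>(loc_ring S W) Y : carrier (loc_ring S W)"
   unfolding x(1) y(1) loc_ring_mult[OF x(2,3) y(2,3)] loc_ring_carrier
   using Wd(3)[OF x(3) y(3)] S.m_closed[OF x(2) y(2)] by blast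
  show "X \<otimes>\<^sub>(loc_ring S W) Y \<otimes>\<^sub>(loc_ring S W) Z = X \<otimes>\<^sub>(loc_ring S W) (Y \<otimes>\<^sub>(loc_ring S W) Z)"
   using x y z by (simp add: loc_ring_mult Wd(3) S.m_assoc)
  show "X \<otimes>\<^sub>(loc_ring S W) Y = Y \<otimes>\<^sub>(loc_ring S W) X"
   using x y by (simp add: loc_ring_mult S.m_comm)
  show "\<one>\<^sub>(loc_ring S W) \<otimes>\<^sub>(loc_ring S W) X = X" unfolding loc_ring_eqs(3) using x by (simp add: loc_ring_mult Wd)
 next
  show "\<one>\<^sub>(loc_ring S W) : carrier (loc_ring S W)" unfolding loc_ring_carrier loc_ring_eqs(3) using Wd(2) by blast
 qed
 fix X Y Z assume "X : carrier (loc_ring S W)" "Y : carrier (loc_ring S W)" "Z : carrier (loc_ring S W)"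
 then obtain x s y t z r where x: "X = frac S (ring_module S) W x s" "x : carrier S" "s : W"
  and y: "Y = frac S (ring_module S) W y t" "y : carrier S" "t : W"
  and z: "Z = frac S (ring_module S) W z r" "z : carrier S" "r : W" by (auto simp: loc_ring_carrier)
 show "(X \<oplus>\<^sub>(loc_ring S W) Y) \<otimes>\<^sub>(loc_ring S W) Z = X \<otimes>\<^sub>(loc_ring S W) Z \<oplus>\<^sub>(loc_ring S W) Y \<otimes>\<^sub>(loc_ring S W) Z"
  using x y z
  by (simp add: loc_ring_mult Wd(3) loc_ring_eqs(4) loc_add[OF rm3 W])
    (rule frac_eqI[OF rm3 W], auto simp: Wd(3) S.l_distr S.r_distr S.m_ac)
qed

lemma module_loc:
 fixes M :: "('a, 'b, 'k) module_scheme"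
 assumes M: "module S M"
 shows "module (loc_ring S W) (loc_module S W M)"
proof (rule moduleI[OF cring_loc_ring abelian_group_loc[OF M W]])
 interpret M: module S M by (rule M)
 note [simp] = Wd(1)
 note lc = loc_carrier[OF M W]
 note ops = loc_smult[OF M] loc_add[OF M W] loc_ring_eqs(4) loc_add[OF rm3 W] loc_ring_mult Wd(3)
 fix X assume "X : carrier (loc_module S W M)"
 then obtain x r where x: "X = frac S M W x r" "x : carrier M" "r : W" by (auto simp: lc)
 show "\<one>\<^sub>(loc_ring S W) \<odot>\<^sub>(loc_module S W M) X = X"
  unfolding loc_ring_eqs(3) using x Wd(2) by (simp add: ops)
 fix A assume "A : carrier (loc_ring S W)"
 then obtain a s where a: "A = frac S (ring_module S) W a s" "a : carrier S" "s : W" by (auto simp: loc_ring_carrier)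
 show "A \<odot>\<^sub>(loc_module S W M) X : carrier (loc_module S W M)"
  unfolding a(1) x(1) loc_smult[OF M a(2,3) x(2,3)] lc
  using Wd(3)[OF a(3) x(3)] M.smult_closed[OF a(2) x(2)] by blast
 {
  fix B assume "B : carrier (loc_ring S W)"
  then obtain b t where b: "B = frac S (ring_module S) W b t" "b : carrier S" "t : W" by (auto simp: loc_ring_carrier)
  show "(A \<oplus>\<^sub>(loc_ring S W) B) \<odot>\<^sub>(loc_module S W M) X = A \<odot>\<^sub>(loc_module S W M) X \<oplus>\<^sub>(loc_module S W M) B \<odot>\<^sub>(loc_module S W M) X"
   using x a b
   by (simp add: ops)
     (rule frac_eqI[OF M W], auto simp: Wd(3) M.smult_l_distr M.smult_r_distr M.smult_assoc1[symmetric] S.m_ac S.l_distr S.r_distr)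
  show "(A \<otimes>\<^sub>(loc_ring S W) B) \<odot>\<^sub>(loc_module S W M) X = A \<odot>\<^sub>(loc_module S W M) (B \<odot>\<^sub>(loc_module S W M) X)"
   using x a b by (simp add: ops M.smult_assoc1 S.m_assoc)
 }
 fix Y assume "Y : carrier (loc_module S W M)"
 then obtain y t where y: "Y = frac S M W y t" "y : carrier M" "t : W" by (auto simp: lc)
 show "A \<odot>\<^sub>(loc_module S W M) (X \<oplus>\<^sub>(loc_module S W M) Y) = A \<odot>\<^sub>(loc_module S W M) X \<oplus>\<^sub>(loc_module S W M) A \<odot>\<^sub>(loc_module S W M) Y"
  using x a y
  by (simp add: ops)
    (rule frac_eqI[OF M W], auto simp: Wd(3) M.smult_l_distr M.smult_r_distr M.smult_assoc1[symmetric] S.m_ac S.l_distr S.r_distr)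
qed

lemma loc_ring_hom: "(%a. frac S (ring_module S) W a \<one>) : ring_hom S (loc_ring S W)"
proof (rule ring_hom_memI)
 fix a b assume "a : carrier S" "b : carrier S"
 then show "frac S (ring_module S) W (a \<otimes> b) \<one> = frac S (ring_module S) W a \<one> \<otimes>\<^sub>(loc_ring S W) frac S (ring_module S) W b \<one>"
  "frac S (ring_module S) W (a \<oplus> b) \<one> = frac S (ring_module S) W a \<one> \<oplus>\<^sub>(loc_ring S W) frac S (ring_module S) W b \<one>"
  using Wd(2) by (simp_all add: loc_ring_mult loc_ring_eqs(4) loc_add_same[OF rm3 W])
qed (use Wd(2) in \<open>auto simp: loc_ring_carrier loc_ring_eqs(3)\<close>)

lemma loc_semilinear:
 assumes M: "module S M"
 shows "semilinear S (%a. frac S (ring_module S) W a \<one>) M (loc_module S W M) (%x. frac S M W x \<one>)"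
proof -
 interpret M: module S M by (rule M)
 show ?thesis
  by (rule semilinearI) (use Wd(2) in \<open>auto simp: loc_carrier[OF M W] loc_add_same[OF M W] loc_smult[OF M]\<close>)
qed

lemma loc_ring_inverse:
 assumes "s : W" "t : W"
 shows "frac S (ring_module S) W s t \<otimes>\<^sub>(loc_ring S W) frac S (ring_module S) W t s = \<one>\<^sub>(loc_ring S W)"
 using assms Wd by (simp add: loc_ring_mult loc_ring_eqs(3)) (rule frac_eqI[OF rm3 W], auto simp: S.m_comm)

lemma loc_ring_Units:
 assumes "s : W" "t : W" shows "frac S (ring_module S) W s t : Units (loc_ring S W)"
proof -
 interpret L: cring "loc_ring S W" by (rule cring_loc_ring)
 have c: "frac S (ring_module S) W s t : carrier (loc_ring S W)" "frac S (ring_module S) W t s : carrier (loc_ring S W)"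
  using assms Wd(1) by (auto simp: loc_ring_carrier)
 then show ?thesis using loc_ring_inverse[OF assms] loc_ring_inverse[OF assms(2,1)] unfolding Units_def by blast
qed

lemma frac_pow:
 assumes "a : carrier S" "s : W"
 shows "frac S (ring_module S) W a s [^]\<^sub>(loc_ring S W) (n::nat) = frac S (ring_module S) W (a [^] n) (s [^] n)"
proof (induction n)
 case 0
 interpret L: cring "loc_ring S W" by (rule cring_loc_ring)
 show ?case by (simp add: loc_ring_eqs(3))
next
 case (Suc n)
 interpret L: cring "loc_ring S W" by (rule cring_loc_ring)
 show ?case using Suc assms mult_set_pow[OF W] by (simp add: loc_ring_mult)
qed

lemma loc_sub_submodule:
 fixes M :: "('a, 'b, 'k) module_scheme"
 assumes M: "module S M" and L: "submodule L S M"
 shows "submodule (loc_sub S M W L) (loc_ring S W) (loc_module S W M)"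
proof (rule submoduleI2[OF module_loc[OF M]])
 interpret M: module S M by (rule M)
 note c = submoduleD[OF L M]
 note [simp] = Wd(1) c(7)
 show "loc_sub S M W L <= carrier (loc_module S W M)"
  unfolding loc_carrier[OF M W] loc_sub_def using c(7) by blast
 show "\<zero>\<^sub>(loc_module S W M) : loc_sub S M W L"
  unfolding loc_zero[OF M W] loc_sub_def using c(2) Wd(2) by blast
 fix X assume "X : loc_sub S M W L"
 then obtain x s where x: "X = frac S M W x s" "x : L" "s : W" unfolding loc_sub_def by blast
 {
  fix Y assume "Y : loc_sub S M W L"
  then obtain y t where y: "Y = frac S M W y t" "y : L" "t : W" unfolding loc_sub_def by blast
  have "t \<odot>\<^sub>M x \<oplus>\<^sub>M s \<odot>\<^sub>M y : L" using x y c(3,5) by simp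
  moreover have "s \<otimes> t : W" using x y Wd(3) by blast
  moreover have "X \<oplus>\<^sub>(loc_module S W M) Y = frac S M W (t \<odot>\<^sub>M x \<oplus>\<^sub>M s \<odot>\<^sub>M y) (s \<otimes> t)"
   using x y by (simp add: loc_add[OF M W])
  ultimately show "X \<oplus>\<^sub>(loc_module S W M) Y : loc_sub S M W L" unfolding loc_sub_def by blast
 }
 fix A assume "A : carrier (loc_ring S W)"
 then obtain a t where a: "A = frac S (ring_module S) W a t" "a : carrier S" "t : W" by (auto simp: loc_ring_carrier)
 have "A \<odot>\<^sub>(loc_module S W M) X = frac S M W (a \<odot>\<^sub>M x) (t \<otimes> s)"
  using x a by (simp add: loc_smult[OF M])
 then show "A \<odot>\<^sub>(loc_module S W M) X : loc_sub S M W L"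
  unfolding loc_sub_def using a x c(5) Wd(3) by blast
qed

text \<open>If \<open>Q\<close> represents the Frobenius power, the Frobenius-semilinear map from \<open>M\<close> to \<open>Q\<close> extends to the
 localizations by \<open>x/t \<mapsto> x/t\<^sup>q\<close>.\<close>

lemma fmem_localization:
 fixes M :: "('a, 'b, 'k) module_scheme"
 assumes M: "module S M" and L: "submodule L S M" and c: "c : carrier S" and z: "z : carrier M"
  and f: "fmem p e (loc_ring S W) (loc_module S W M) (loc_sub S M W L)
   (frac S (ring_module S) W c \<one>) (frac S M W z \<one>)"
 shows "EX w:W. fmem p e S M L (w \<otimes> c) z"
proof -
 interpret M: module S M by (rule M)
 note [simp] = Wd(1)
 obtain Q :: "('a, ('b => 'a) set) module" and h where univ: "frob_univ p e S M L Q h"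
  using fmem_universal[OF M L, of p e] by (elim exE)
 note Q = frob_univD[OF univ]
 interpret Q: module S Q by (rule Q(1))
 let ?q = "p ^ e"
 let ?k = "%X. \<Union>(x, t) \<in> X. frac S Q W (h x) (t [^] ?q)"
 have hx: "h (a \<odot>\<^sub>M x) = (a [^] ?q) \<odot>\<^sub>Q h x" if "a : carrier S" "x : carrier M" for a x
  using semilinearD(3)[OF Q(2) that] by (simp add: frob_def)
 note hc [simp] = semilinearD(1)[OF Q(2)]
 note pW [simp] = mult_set_pow[OF W]
 \<comment> \<open>Applying \<open>h\<close> to the equation between two representatives raises its
   scalars to the power \<open>q\<close>, so \<open>u^q\<close> witnesses that the value is
   independent of the representative.\<close>
 have k: "?k (frac S M W x t) = frac S Q W (h x) (t [^] ?q)" if x: "x : carrier M" "t : W" for x t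
 proof -
  have "frac S Q W (h x') (t' [^] ?q) = frac S Q W (h x) (t [^] ?q)" if "(x', t') : frac S M W x t" for x' t'
  proof -
   obtain u where u: "x' : carrier M" "t' : W" "u : W" "(u \<otimes> t') \<odot>\<^sub>M x = (u \<otimes> t) \<odot>\<^sub>M x'"
    using \<open>(x', t') : frac S M W x t\<close> frac_iff[OF M W x] by blast
   have "h ((u \<otimes> t') \<odot>\<^sub>M x) = h ((u \<otimes> t) \<odot>\<^sub>M x')" using u(4) by simp
   then have "(u [^] ?q \<otimes> t' [^] ?q) \<odot>\<^sub>Q h x = (u [^] ?q \<otimes> t [^] ?q) \<odot>\<^sub>Q h x'"
    using u(1-3) x by (simp add: hx S.nat_pow_distrib)
   then show ?thesis
    using u x by (subst frac_eq_iff[OF Q(1) W]) (auto intro!: bexI[of _ "u [^] ?q"])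
  qed
  then have "(case y of (x, t) => frac S Q W (h x) (t [^] ?q)) = frac S Q W (h x) (t [^] ?q)"
   if "y : frac S M W x t" for y using that by (cases y) auto
  then have "?k (frac S M W x t) = (\<Union>y \<in> frac S M W x t. frac S Q W (h x) (t [^] ?q))"
   by (rule SUP_cong[OF refl])
  then show ?thesis using frac_self[OF M W x] by (metis SUP_const empty_iff)
 qed
 have mQ: "module (loc_ring S W) (loc_module S W Q)" by (rule module_loc[OF Q(1)])
 have sl: "semilinear (loc_ring S W) (frob p e (loc_ring S W)) (loc_module S W M) (loc_module S W Q) ?k"
 proof (rule semilinearI)
  fix X assume "X : carrier (loc_module S W M)"
  then obtain x s where x: "X = frac S M W x s" "x : carrier M" "s : W" by (auto simp: loc_carrier[OF M W])
  have "frac S Q W (h x) (s [^] ?q) : carrier (loc_module S W Q)"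
   unfolding loc_carrier[OF Q(1) W] using x hc pW by blast
  then show "?k X : carrier (loc_module S W Q)"
   unfolding x(1) k[OF x(2,3)] .
  {
   fix Y assume "Y : carrier (loc_module S W M)"
   then obtain y t where y: "Y = frac S M W y t" "y : carrier M" "t : W" by (auto simp: loc_carrier[OF M W])
   have XY: "X \<oplus>\<^sub>(loc_module S W M) Y = frac S M W (t \<odot>\<^sub>M x \<oplus>\<^sub>M s \<odot>\<^sub>M y) (s \<otimes> t)"
    using x y by (simp add: loc_add[OF M W])
   have "?k (X \<oplus>\<^sub>(loc_module S W M) Y) = frac S Q W (h (t \<odot>\<^sub>M x \<oplus>\<^sub>M s \<odot>\<^sub>M y)) ((s \<otimes> t) [^] ?q)"
    unfolding XY using x y Wd(3) by (subst k) simp_all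
   also have "\<dots> = frac S Q W (h x) (s [^] ?q) \<oplus>\<^sub>(loc_module S W Q) frac S Q W (h y) (t [^] ?q)"
    using x y semilinearD(2)[OF Q(2), of "t \<odot>\<^sub>M x" "s \<odot>\<^sub>M y"]
    by (simp add: hx S.nat_pow_distrib loc_add[OF Q(1) W])
   also have "\<dots> = ?k X \<oplus>\<^sub>(loc_module S W Q) ?k Y"
    unfolding x(1) y(1) k[OF x(2,3)] k[OF y(2,3)] ..
   finally show "?k (X \<oplus>\<^sub>(loc_module S W M) Y) = ?k X \<oplus>\<^sub>(loc_module S W Q) ?k Y" .
  }
  fix A assume "A : carrier (loc_ring S W)"
  then obtain a t where a: "A = frac S (ring_module S) W a t" "a : carrier S" "t : W" by (auto simp: loc_ring_carrier)
  have AX: "A \<odot>\<^sub>(loc_module S W M) X = frac S M W (a \<odot>\<^sub>M x) (t \<otimes> s)"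
   using a x by (simp add: loc_smult[OF M])
  have "?k (A \<odot>\<^sub>(loc_module S W M) X) = frac S Q W (h (a \<odot>\<^sub>M x)) ((t \<otimes> s) [^] ?q)"
   unfolding AX using a x Wd(3) by (subst k) simp_all
  also have "\<dots> = frob p e (loc_ring S W) A \<odot>\<^sub>(loc_module S W Q) frac S Q W (h x) (s [^] ?q)"
   using a x by (simp add: hx S.nat_pow_distrib frob_def frac_pow loc_smult[OF Q(1)])
  finally show "?k (A \<odot>\<^sub>(loc_module S W M) X) = frob p e (loc_ring S W) A \<odot>\<^sub>(loc_module S W Q) ?k X"
   unfolding x(1) k[OF x(2,3)] .
 qed
 have kL: "?k X = \<zero>\<^sub>(loc_module S W Q)" if X: "X : loc_sub S M W L" for X
 proof -
  obtain x s where x: "X = frac S M W x s" "x : L" "s : W" using X unfolding loc_sub_def by blast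
  show ?thesis unfolding x(1) k[OF submoduleD(7)[OF L M x(2)] x(3)] Q(3)[OF x(2)]
   using frac_zero[OF Q(1) W] pW x(3) by blast
 qed
 have cW: "frac S (ring_module S) W c \<one> : carrier (loc_ring S W)" using c Wd(2) by (auto simp: loc_ring_carrier)
 have zW: "frac S M W z \<one> : carrier (loc_module S W M)" using z Wd(2) by (auto simp: loc_carrier[OF M W])
 have "frac S (ring_module S) W c \<one> \<odot>\<^sub>(loc_module S W Q) ?k (frac S M W z \<one>) = \<zero>\<^sub>(loc_module S W Q)"
  by (rule fmem_kills[OF module_loc[OF M] loc_sub_submodule[OF M L] cW zW mQ sl _ f]) (rule kL)
 then have "frac S Q W (c \<odot>\<^sub>Q h z) \<one> = \<zero>\<^sub>(loc_module S W Q)"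
  unfolding k[OF z Wd(2)] using c z Wd(2) by (simp add: loc_smult[OF Q(1)])
 \<comment> \<open>A fraction over \<open>W\<close> vanishes as soon as some element of
   \<open>W\<close> kills its numerator; this element is the factor \<open>w\<close> of the
   conclusion.\<close>
 then obtain w where w: "w : W" "w \<odot>\<^sub>Q (c \<odot>\<^sub>Q h z) = \<zero>\<^sub>Q"
  using frac_eq_zero_iff[OF Q(1) W, of "c \<odot>\<^sub>Q h z" "\<one>"] c z Wd(2) by auto
 then have "(w \<otimes> c) \<odot>\<^sub>Q h z = \<zero>\<^sub>Q" using c z by (simp add: Q.smult_assoc1)
 then have "fmem p e S M L (w \<otimes> c) z" using Q(4)[of "w \<otimes> c" z] w c z by simp
 then show ?thesis using w(1) by blast
qed

end

section \<open>Prime ideals\<close>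

lemma idealI2:
 assumes "cring A" "J <= carrier A" "\<zero>\<^sub>A : J"
  and "\<And>x y. x : J ==> y : J ==> x \<oplus>\<^sub>A y : J"
  and "\<And>a x. a : carrier A ==> x : J ==> a \<otimes>\<^sub>A x : J"
 shows "ideal J A"
 unfolding ideal_iff_submodule[OF assms(1)]
 by (rule submoduleI2[OF ring_module_module[OF assms(1)]]) (use assms in auto)

lemma idealD:
 fixes A (structure)
 assumes "ideal J A"
 shows "x : J ==> x : carrier A" "\<zero> : J" "x : J ==> y : J ==> x \<oplus> y : J"
  "a : carrier A ==> x : J ==> a \<otimes> x : J" "x : J ==> y : J ==> x \<ominus> y : J"
  "a : carrier A ==> x : J ==> x \<otimes> a : J"
proof -
 interpret ideal J A by fact
 show "x : J ==> x : carrier A" by (rule Icarr)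
 show "\<zero> : J" by simp
 show "x : J ==> y : J ==> x \<oplus> y : J" by simp
 show "a : carrier A ==> x : J ==> a \<otimes> x : J" by (rule I_l_closed)
 show "a : carrier A ==> x : J ==> x \<otimes> a : J" by (rule I_r_closed)
 show "x : J ==> y : J ==> x \<ominus> y : J" by (simp add: a_minus_def)
qed

lemma primeD:
 fixes A (structure)
 assumes "primeideal P A"
 shows "ideal P A" "cring A" "\<one> ~: P"
  "a : carrier A ==> b : carrier A ==> a \<otimes> b : P <-> a : P \<or> b : P"
  "mult_set A (carrier A - P)"
proof -
 interpret primeideal P A by fact
 show "ideal P A" by (rule ideal_axioms)
 show "cring A" by (rule is_cring)
 show "\<one> ~: P" using I_notcarr one_imp_carrier by auto
 show "a : carrier A ==> b : carrier A ==> a \<otimes> b : P <-> a : P \<or> b : P"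
  using I_prime I_l_closed I_r_closed by blast
 show "mult_set A (carrier A - P)" by (rule mult_set_prime)
qed

lemma prime_pow:
 assumes "primeideal P A" "a : carrier A" "a ~: P"
 shows "a [^]\<^sub>A (n::nat) ~: P"
proof -
 interpret cring A using primeD(2)[OF assms(1)] .
 show ?thesis by (induction n) (use primeD(3,4)[OF assms(1)] assms(2,3) in auto)
qed

lemma primeidealI3:
 assumes "ideal P A" "cring A" "\<one>\<^sub>A ~: P"
  and "\<And>a b. a : carrier A ==> b : carrier A ==> a \<otimes>\<^sub>A b : P ==> a : P \<or> b : P"
 shows "primeideal P A"
proof -
 interpret cring A by fact
 show ?thesis by (rule primeidealI) (use assms in auto)
qed

text \<open>An ideal maximal among those containing \<open>I\<close> and missing \<open>W\<close> is
  prime: enlarging it by \<open>a\<close> or by \<open>b\<close> makes it meet \<open>W\<close>, and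
  if \<open>a b\<close> were in it, so would be the product of the two elements of
  \<open>W\<close>.\<close>

theorem krull_prime:
 fixes A (structure)
 assumes A: "cring A" and I: "ideal I A" and W: "mult_set A W" and IW: "I Int W = {}"
 shows "EX P. primeideal P A & I <= P & P Int W = {}"
proof -
 interpret A: cring A by (rule A)
 let ?X = "{J. ideal J A & I <= J & J Int W = {}}"
 have "EX P:?X. ALL J:?X. P <= J --> J = P"
 proof (rule subset_Zorn_nonempty)
  show "?X ~= {}" using I IW by blast
  fix C assume C: "C ~= {}" "subset.chain ?X C"
  then have "subset.chain {J. ideal J A} C" unfolding pred_on.chain_def by auto
  from A.chain_Union_is_ideal[OF this] C(1) have "ideal (\<Union>C) A" by simp
  moreover have CX: "C <= ?X" using C(2) unfolding pred_on.chain_def by blast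
  then have "\<Union>C Int W = {}" by blast
  moreover obtain c where "c : C" using C(1) by blast
  then have "I <= \<Union>C" using CX by blast
  ultimately show "\<Union>C \<in> ?X" by simp
 qed
 then obtain P where PX: "P : ?X" and mx0: "ALL J:?X. P <= J --> J = P" by (elim bexE)
 from PX have P: "ideal P A" "I <= P" "P Int W = {}" by simp_all
 from mx0 have mx: "J = P" if "ideal J A" "I <= J" "J Int W = {}" "P <= J" for J
  using that by simp
 have one: "\<one> : W" using mult_setD(2)[OF W] .
 \<comment> \<open>By maximality the ideal \<open>P + A a\<close> meets \<open>W\<close>;
   \<open>?J\<close> below is this ideal.\<close>
 have ext: "EX w:W. EX m:P. EX r:carrier A. w = m \<oplus> r \<otimes> a" if a: "a : carrier A" "a ~: P" for a
 proof (rule ccontr)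
  assume no: "~ ?thesis"
  let ?J = "{m \<oplus> r \<otimes> a | m r. m : P & r : carrier A}"
  have J: "ideal ?J A"
  proof (rule idealI2[OF A])
   show "?J <= carrier A" using a idealD(1)[OF P(1)] by auto
   have "\<zero> = \<zero> \<oplus> \<zero> \<otimes> a" using a by simp
   then show "\<zero> : ?J" using idealD(2)[OF P(1)] A.zero_closed by blast
   fix x assume "x : ?J"
   then obtain m r where x: "x = m \<oplus> r \<otimes> a" "m : P" "r : carrier A" by blast
   note mc = idealD(1)[OF P(1) x(2)]
   {
    fix y assume "y : ?J"
    then obtain m' r' where y: "y = m' \<oplus> r' \<otimes> a" "m' : P" "r' : carrier A" by blast
    have "x \<oplus> y = (m \<oplus> m') \<oplus> (r \<oplus> r') \<otimes> a"
     unfolding x(1) y(1) using x(3) y(3) mc idealD(1)[OF P(1) y(2)] a by (simp add: A.l_distr A.a_ac)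
    then show "x \<oplus> y : ?J" using idealD(3)[OF P(1) x(2) y(2)] A.a_closed[OF x(3) y(3)] by blast
   }
   fix b assume b: "b : carrier A"
   have "b \<otimes> x = b \<otimes> m \<oplus> (b \<otimes> r) \<otimes> a"
    unfolding x(1) using x(3) mc a b by (simp add: A.r_distr A.m_assoc)
   then show "b \<otimes> x : ?J" using idealD(4)[OF P(1) b x(2)] A.m_closed[OF b x(3)] by blast
  qed
  have PJ: "P <= ?J"
  proof
   fix m assume m: "m : P"
   then have "m = m \<oplus> \<zero> \<otimes> a" using a idealD(1)[OF P(1)] by simp
   then show "m : ?J" using m A.zero_closed by blast
  qed
  have "a = \<zero> \<oplus> \<one> \<otimes> a" using a by simp
  then have "a : ?J" using idealD(2)[OF P(1)] A.one_closed by blast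
  then have "?J ~= P" using a by blast
  then have "?J Int W ~= {}" using mx[OF J _ _ PJ] P(2) PJ by blast
  then show False using no by blast
 qed
 have "primeideal P A"
 proof (rule primeidealI3[OF P(1) A])
  show "\<one> ~: P" using one P(3) by blast
  fix a b assume ab: "a : carrier A" "b : carrier A" "a \<otimes> b : P"
  show "a : P \<or> b : P"
  proof (rule ccontr)
   assume "~ ?thesis"
   then obtain w m r w' m' r' where w: "w : W" "m : P" "r : carrier A" "w = m \<oplus> r \<otimes> a"
    and w': "w' : W" "m' : P" "r' : carrier A" "w' = m' \<oplus> r' \<otimes> b"
    using ext[OF ab(1)] ext[OF ab(2)] by blast
   note mc = idealD(1)[OF P(1) w(2)] idealD(1)[OF P(1) w'(2)]
   have "w \<otimes> w' = w' \<otimes> m \<oplus> ((r \<otimes> a) \<otimes> m' \<oplus> (r \<otimes> r') \<otimes> (a \<otimes> b))"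
    unfolding w(4) w'(4) using w(3) w'(3) mc ab(1,2) by (simp add: A.l_distr A.r_distr A.m_ac A.a_ac)
   also have "\<dots> : P"
   proof -
    have "w' \<otimes> m : P" using idealD(4)[OF P(1) _ w(2)] mult_setD(1)[OF W w'(1)] by blast
    moreover have "(r \<otimes> a) \<otimes> m' : P" using idealD(4)[OF P(1) _ w'(2)] w(3) ab(1) by simp
    moreover have "(r \<otimes> r') \<otimes> (a \<otimes> b) : P" using idealD(4)[OF P(1) _ ab(3)] w(3) w'(3) by simp
    ultimately show ?thesis using idealD(3)[OF P(1)] by blast
   qed
   finally have "w \<otimes> w' : P" .
   then show False using mult_setD(3)[OF W w(1) w'(1)] P(3) by blast
  qed
 qed
 then show ?thesis using P(2,3) by blast
qed

text \<open>This replaces quasi-compactness arguments.\<close>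

corollary ideal_local:
 assumes A: "cring A" and J: "ideal J A" and f: "f : carrier A"
  and loc: "\<And>Q. primeideal Q A ==> f ~: Q ==> EX j:J. j ~: Q"
 shows "EX n::nat. f [^]\<^sub>A n : J"
proof (rule ccontr)
 interpret A: cring A by (rule A)
 assume "~ ?thesis"
 then have "J Int powers A f = {}" unfolding powers_def by blast
 then obtain P where P: "primeideal P A" "J <= P" "P Int powers A f = {}"
  using krull_prime[OF A J A.mult_set_powers[OF f]] by blast
 have "f [^]\<^sub>A (1::nat) : powers A f" unfolding powers_def by blast
 then have "f ~: P" using P(3) f by auto
 then show False using loc[OF P(1)] P(2) by blast
qed

corollary ideal_local_one:
 assumes A: "cring A" and J: "ideal J A"
  and loc: "\<And>Q. primeideal Q A ==> EX j:J. j ~: Q"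
 shows "\<one>\<^sub>A : J"
proof -
 interpret A: cring A by (rule A)
 show ?thesis using ideal_local[OF A J A.one_closed loc] by simp
qed

section \<open>Minimal primes: nilpotence, finiteness and prime avoidance\<close>

lemma minimal_primeD:
 assumes "minimal_prime A P"
 shows "primeideal P A" "primeideal Q A ==> Q <= P ==> Q = P"
 using assms unfolding minimal_prime_def by auto

lemma ring_circ_iff: "c : ring_circ A <-> c : carrier A & (ALL P. minimal_prime A P --> c ~: P)"
 unfolding ring_circ_def by blast

lemma ring_circ_mult:
 assumes "c : ring_circ A" "d : ring_circ A" "cring A"
 shows "c \<otimes>\<^sub>A d : ring_circ A"
proof -
 interpret A: cring A by fact
 show ?thesis using assms primeD(4)[OF minimal_primeD(1)] unfolding ring_circ_iff by (metis A.m_closed)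
qed

lemma ring_circ_one: "cring A ==> \<one>\<^sub>A : ring_circ A"
proof -
 assume "cring A"
 then interpret A: cring A .
 show ?thesis unfolding ring_circ_iff using A.one_closed primeD(3)[OF minimal_primeD(1)] by blast
qed

text \<open>In the local ring at a minimal prime, every element of the prime is nilpotent. Directly:
  if no \<open>g^n u\<close> were zero, some prime would miss all of them; it would lie in
  \<open>P\<close>, hence equal \<open>P\<close>, and yet miss \<open>g\<close>.\<close>

lemma minimal_prime_annihilator:
 fixes A (structure)
 assumes P: "minimal_prime A P" and g: "g : P"
 shows "EX u:carrier A - P. EX n::nat. g [^] n \<otimes> u = \<zero>"
proof (rule ccontr)
 assume no: "~ ?thesis"
 note pP = minimal_primeD(1)[OF P]
 interpret A: cring A using primeD(2)[OF pP] .
 have gc: "g : carrier A" using idealD(1)[OF primeD(1)[OF pP] g] .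
 note PW = mult_setD[OF primeD(5)[OF pP]]
 let ?W = "{g [^] n \<otimes> u | (n::nat) u. u : carrier A - P}"
 have W: "mult_set A ?W"
 proof -
  have "?W <= carrier A" using gc by auto
  moreover have "\<one> : ?W" using PW(2) by (auto intro!: exI[of _ "0::nat"] exI[of _ "\<one>"])
  moreover have "s \<otimes> t : ?W" if "s : ?W" "t : ?W" for s t
  proof -
   from that obtain n :: nat and u and m :: nat and v where *: "s = g [^] n \<otimes> u" "t = g [^] m \<otimes> v"
    "u : carrier A - P" "v : carrier A - P" by blast
   have "s \<otimes> t = g [^] (n + m) \<otimes> (u \<otimes> v)"
    unfolding * using * gc by (simp add: A.nat_pow_mult[symmetric] A.m_ac)
   then show ?thesis using PW(3)[OF *(3,4)] by blast
  qed
  ultimately show ?thesis unfolding mult_set_def by blast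
 qed
 have "{\<zero>} Int ?W = {}" using no by fastforce
 then obtain Q where Q: "primeideal Q A" "Q Int ?W = {}"
  using krull_prime[OF A.is_cring A.zeroideal W] by blast
 have "u : ?W" if "u : carrier A - P" for u using that by (auto intro!: exI[of _ "0::nat"] exI[of _ u])
 then have "Q <= P" using Q(2) idealD(1)[OF primeD(1)[OF Q(1)]] by blast
 then have "Q = P" using minimal_primeD(2)[OF P Q(1)] by blast
 moreover have "g : ?W" using gc PW(2) by (auto intro!: exI[of _ "1::nat"] exI[of _ "\<one>"])
 ultimately show False using Q(2) g by blast
qed

text \<open>In a Noetherian ring the union of a nonempty chain of ideals is already a member of the
  chain, so Zorn's lemma applies to any nonempty set of ideals.\<close>

lemma noetherian_maximal:
 assumes "noetherian_ring A" "X ~= {}" "\<And>I. I : X ==> ideal I A"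
 shows "EX I:X. ALL J:X. I <= J --> J = I"
proof (rule subset_Zorn_nonempty[OF assms(2)])
 interpret noetherian_ring A by fact
 fix C assume C: "C ~= {}" "subset.chain X C"
 then have "subset.chain {I. ideal I A} C" using assms(3) unfolding pred_on.chain_def by auto
 then show "\<Union>C \<in> X" using ideal_chain_is_trivial[OF C(1)] C(2) unfolding pred_on.chain_def by blast
qed

text \<open>Noetherian induction: an ideal \<open>J\<close> maximal among the bad ones is proper and
  not prime, so \<open>a b\<close> is in \<open>J\<close> for some \<open>a\<close> and
  \<open>b\<close> outside it. A prime over \<open>J\<close> contains \<open>a\<close> or
  \<open>b\<close>, and the finite sets for the two larger ideals combine.\<close>

lemma finite_minimal_primes:
 fixes A (structure)
 assumes A: "cring A" and N: "noetherian_ring A"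
 shows "finite {P. minimal_prime A P}"
proof -
 interpret A: cring A by (rule A)
 \<comment> \<open>It is only asked that some member of \<open>F\<close> lies below each prime over
   \<open>I\<close>, a condition that survives enlarging \<open>F\<close>.\<close>
 define good where "good I <-> (EX F. finite F & (ALL P:F. primeideal P A) &
  (ALL Q. primeideal Q A & I <= Q --> (EX P:F. P <= Q)))" for I
 have "good I" if I: "ideal I A" for I
 proof (rule ccontr)
  assume "~ good I"
  then have "{J. ideal J A & ~ good J} ~= {}" using I by blast
  from noetherian_maximal[OF N this] obtain J where J: "ideal J A" "~ good J"
   and mx: "\<And>K. ideal K A ==> J <= K ==> K ~= J ==> good K" by blast
  have "~ primeideal J A" using J(2) unfolding good_def by (metis finite.emptyI finite_insert singletonD singletonI)
  moreover have "\<one> ~: J"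
  proof
   assume "\<one> : J"
   then have "~ (primeideal Q A & J <= Q)" for Q using primeD(3) by blast
   then have "good J" unfolding good_def by (intro exI[of _ "{}"]) auto
   then show False using J(2) by blast
  qed
  ultimately obtain a b where ab: "a : carrier A" "b : carrier A" "a \<otimes> b : J" "a ~: J" "b ~: J"
   using primeidealI3[OF J(1) A] by blast
  have gen: "good (Idl\<^bsub>A\<^esub> (insert c J))" if "c : carrier A" "c ~: J" for c
  proof -
   have c: "insert c J <= carrier A" using that idealD(1)[OF J(1)] by blast
   then have "insert c J <= Idl\<^bsub>A\<^esub> (insert c J)" by (rule A.genideal_self)
   then show ?thesis using mx[OF A.genideal_ideal[OF c]] that by blast
  qed
  obtain F G where F: "finite F" "\<And>P. P : F ==> primeideal P A"
    "\<And>Q. primeideal Q A ==> Idl\<^bsub>A\<^esub> (insert a J) <= Q ==> EX P:F. P <= Q"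
   and G: "finite G" "\<And>P. P : G ==> primeideal P A"
    "\<And>Q. primeideal Q A ==> Idl\<^bsub>A\<^esub> (insert b J) <= Q ==> EX P:G. P <= Q"
   using gen[OF ab(1,4)] gen[OF ab(2,5)] unfolding good_def by metis
  have "EX P:F Un G. P <= Q" if Q: "primeideal Q A" "J <= Q" for Q
  proof -
   have "a : Q \<or> b : Q" using primeD(4)[OF Q(1) ab(1,2)] ab(3) Q(2) by blast
   then show ?thesis
   proof
    assume "a : Q"
    then have "Idl\<^bsub>A\<^esub> (insert a J) <= Q" using Q by (intro A.genideal_minimal primeD(1)) auto
    then show ?thesis using F(3)[OF Q(1)] by blast
   next
    assume "b : Q"
    then have "Idl\<^bsub>A\<^esub> (insert b J) <= Q" using Q by (intro A.genideal_minimal primeD(1)) auto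
    then show ?thesis using G(3)[OF Q(1)] by blast
   qed
  qed
  then have "good J" unfolding good_def using F(1,2) G(1,2) by (intro exI[of _ "F Un G"]) auto
  then show False using J(2) by blast
 qed
 then obtain F where F: "finite F" "\<And>P. P : F ==> primeideal P A"
   "\<And>Q. primeideal Q A ==> {\<zero>} <= Q ==> EX P:F. P <= Q"
  using A.zeroideal unfolding good_def by metis
 have "Q : F" if Q: "minimal_prime A Q" for Q
 proof -
  have pQ: "primeideal Q A" using minimal_primeD(1)[OF Q] .
  then obtain P where "P : F" "P <= Q" using F(3)[OF pQ] idealD(2)[OF primeD(1)[OF pQ]] by blast
  then show ?thesis using minimal_primeD(2)[OF Q F(2)] by metis
 qed
 then have "{P. minimal_prime A P} <= F" by blast
 then show ?thesis using F(1) finite_subset by blast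
qed

text \<open>The induction rests on distinct minimal primes being incomparable: if the element found
  so far lies in the new prime \<open>P\<close>, an element of \<open>J\<close> is added that lies
  in all the old primes but not in \<open>P\<close>.\<close>

lemma prime_avoidance:
 fixes A (structure)
 assumes A: "cring A" and J: "ideal J A" and F: "finite F"
  and mp: "\<And>P. P : F ==> minimal_prime A P" and ne: "\<And>P. P : F ==> ~ J <= P"
 shows "EX a:J. ALL P:F. a ~: P"
 using F mp ne
proof (induction F)
 case empty
 then show ?case using idealD(2)[OF J] by blast
next
 case (insert P F)
 interpret A: cring A by (rule A)
 obtain a where a: "a : J" "\<And>Q. Q : F ==> a ~: Q" using insert by blast
 have P: "minimal_prime A P" "~ J <= P" using insert by auto
 note pP = minimal_primeD(1)[OF P(1)]
 show ?case
 proof (cases "a : P")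
  case False
  then show ?thesis using a by blast
 next
  case True
  \<comment> \<open>Built as a product with one factor from each \<open>Q\<close> outside
    \<open>P\<close>, starting from an element of \<open>J\<close> outside \<open>P\<close>.\<close>
  have "EX b:J. b ~: P & (ALL Q:G. b : Q)" if "G <= F" for G
   using finite_subset[OF that insert.hyps(1)] that
  proof (induction G)
   case empty then show ?case using P(2) by blast
  next
   case (insert Q G)
   then obtain b where b: "b : J" "b ~: P" "\<And>Q. Q : G ==> b : Q" by blast
   have Q: "minimal_prime A Q" "Q ~= P" using insert \<open>P ~: F\<close> \<open>\<And>Q. Q : insert P F ==> minimal_prime A Q\<close> by auto
   note pQ = minimal_primeD(1)[OF Q(1)]
   have "~ Q <= P" using minimal_primeD(2)[OF P(1) pQ] Q(2) by blast
   then obtain c where c: "c : Q" "c ~: P" by blast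
   have cc: "c : carrier A" "b : carrier A" using idealD(1)[OF primeD(1)[OF pQ] c(1)] idealD(1)[OF J b(1)] by auto
   have "c \<otimes> b : J" using idealD(4)[OF J cc(1) b(1)] .
   moreover have "c \<otimes> b ~: P" using primeD(4)[OF pP cc] b c by blast
   moreover have "c \<otimes> b : Q" using primeD(4)[OF pQ cc] c by blast
   moreover have "c \<otimes> b : Q'" if "Q' : G" for Q'
   proof -
    have "minimal_prime A Q'" using that insert(4) \<open>\<And>Q. Q : insert P F ==> minimal_prime A Q\<close> by auto
    then show ?thesis using idealD(4)[OF primeD(1)[OF minimal_primeD(1)] cc(1) b(3)[OF that]] by blast
   qed
   ultimately show ?case by blast
  qed
  then obtain b where b: "b : J" "b ~: P" "\<And>Q. Q : F ==> b : Q" by blast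
  have cc: "a : carrier A" "b : carrier A" using idealD(1)[OF J] a(1) b(1) by auto
  have eq: "(a \<oplus> b) \<ominus> a = b" "(a \<oplus> b) \<ominus> b = a"
  proof -
   show "(a \<oplus> b) \<ominus> b = a" using cc by (simp add: a_minus_def A.a_assoc A.r_neg)
   have "(a \<oplus> b) \<ominus> a = (b \<oplus> a) \<ominus> a" using cc by (simp add: A.a_comm)
   also have "\<dots> = b" using cc by (simp add: a_minus_def A.a_assoc A.r_neg)
   finally show "(a \<oplus> b) \<ominus> a = b" .
  qed
  have "a \<oplus> b : J" using idealD(3)[OF J a(1) b(1)] .
  moreover have "a \<oplus> b ~: P" using idealD(5)[OF primeD(1)[OF pP] _ True, of "a \<oplus> b"] eq(1) b(2) by auto
  moreover have "a \<oplus> b ~: Q" if "Q : F" for Q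
  proof -
   have "minimal_prime A Q" using that insert(4) by blast
   then have "ideal Q A" using primeD(1)[OF minimal_primeD(1)] by blast
   then show ?thesis using idealD(5)[of Q A "a \<oplus> b" b] eq(2) b(3)[OF that] a(2)[OF that] by auto
  qed
  ultimately show ?thesis by blast
 qed
qed

text \<open>The elements \<open>c\<close> with \<open>g^n c\<close> in \<open>A d\<close> for some
  \<open>n\<close> form an ideal. It contains \<open>d\<close>, which avoids the minimal primes
  without \<open>g\<close>; for a minimal prime containing \<open>g\<close> it contains an element
  outside that prime which a power of \<open>g\<close> annihilates. Prime avoidance then gives one
  \<open>c\<close> for all of them.\<close>

lemma spread_ring_circ:
 fixes A (structure)
 assumes A: "cring A" and N: "noetherian_ring A" and g: "g : carrier A" and d: "d : carrier A"
  and mp: "\<And>P. minimal_prime A P ==> g ~: P ==> d ~: P"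
 shows "EX c:ring_circ A. EX n::nat. EX b:carrier A. g [^] n \<otimes> c = b \<otimes> d"
proof -
 interpret A: cring A by (rule A)
 let ?J = "{c : carrier A. EX n::nat. EX b:carrier A. g [^] n \<otimes> c = b \<otimes> d}"
 have J: "ideal ?J A"
 proof (rule idealI2[OF A])
  show "\<zero> : ?J" using g d by (auto intro!: exI[of _ 0] bexI[of _ "\<zero>"])
  fix x assume x: "x : ?J"
  then obtain n :: nat and b where xb: "b : carrier A" "g [^] n \<otimes> x = b \<otimes> d" by blast
  {
   fix y assume y: "y : ?J"
   then obtain m :: nat and c where yc: "c : carrier A" "g [^] m \<otimes> y = c \<otimes> d" by blast
   have "g [^] (n + m) \<otimes> (x \<oplus> y) = g [^] m \<otimes> (g [^] n \<otimes> x) \<oplus> g [^] n \<otimes> (g [^] m \<otimes> y)"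
    using x y g by (simp add: A.nat_pow_mult[symmetric] A.r_distr A.m_ac)
   also have "\<dots> = (g [^] m \<otimes> b \<oplus> g [^] n \<otimes> c) \<otimes> d"
    unfolding xb yc using xb(1) yc(1) g d by (simp add: A.l_distr A.r_distr A.m_ac)
   finally show "x \<oplus> y : ?J" using x y g xb(1) yc(1)
    by (intro CollectI conjI exI[of _ "n + m"] bexI[of _ "g [^] m \<otimes> b \<oplus> g [^] n \<otimes> c"]) auto
  }
  fix a assume a: "a : carrier A"
  have "g [^] n \<otimes> (a \<otimes> x) = a \<otimes> (g [^] n \<otimes> x)" using x g a by (simp add: A.m_ac)
  also have "\<dots> = (a \<otimes> b) \<otimes> d" unfolding xb(2) using xb(1) a d by (simp add: A.m_ac)
  finally show "a \<otimes> x : ?J" using x a xb(1)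
   by (intro CollectI conjI exI[of _ n] bexI[of _ "a \<otimes> b"]) auto
 qed auto
 have "EX a:?J. ALL P:{P. minimal_prime A P}. a ~: P"
 proof (rule prime_avoidance[OF A J finite_minimal_primes[OF A N]])
  fix P assume "P : {P. minimal_prime A P}"
  then have P: "minimal_prime A P" by simp
  show "~ ?J <= P"
  proof (cases "g : P")
   case False
   have "d : ?J" using g d by (intro CollectI conjI exI[of _ 0] bexI[of _ "\<one>"]) auto
   then show ?thesis using mp[OF P False] by blast
  next
   case True
   then obtain u and n :: nat where "u : carrier A - P" "g [^] n \<otimes> u = \<zero>"
    using minimal_prime_annihilator[OF P] by blast
   then have "u : ?J" "u ~: P" using d by (auto intro!: exI[of _ n] bexI[of _ "\<zero>"])
   then show ?thesis by blast
  qed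
 qed blast
 then obtain c where c: "c : ?J" "ALL P:{P. minimal_prime A P}. c ~: P" by (elim bexE)
 then have "c : ring_circ A" unfolding ring_circ_iff by simp
 then show ?thesis using c(1) by blast
qed

section \<open>Localization at one element\<close>

text \<open>The two conditions by which \<open>h\<close> identifies \<open>N\<close> with the
  localization of \<open>M\<close> at \<open>g\<close> once \<open>g\<close> acts invertibly on
  \<open>N\<close>. That invertibility is part of \<open>ring_loc_at\<close>, and it holds for
  sections over open subsets of D(g).\<close>

definition loc_at ::
 "('a, 'm) ring_scheme => 'a => ('a => 'c) => ('a, 'b, 'k) module_scheme => ('c, 'd, 'l) module_scheme => ('b => 'd) => bool" where
 "loc_at A g rho M N h <-> semilinear A rho M N h &
   (ALL x:carrier M. h x = \<zero>\<^sub>N --> (EX n::nat. (g [^]\<^sub>A n) \<odot>\<^sub>M x = \<zero>\<^sub>M)) &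
   (ALL y:carrier N. EX n::nat. EX x:carrier M. rho (g [^]\<^sub>A n) \<odot>\<^sub>N y = h x)"

definition ring_loc_at ::
 "('a, 'm) ring_scheme => 'a => ('c, 'n) ring_scheme => ('a => 'c) => bool" where
 "ring_loc_at A g B rho <-> rho : ring_hom A B & rho g : Units B & loc_at A g rho (ring_module A) (ring_module B) rho"

lemma loc_atD:
 assumes "loc_at A g rho M N h"
 shows "semilinear A rho M N h"
  "x : carrier M ==> h x = \<zero>\<^sub>N ==> EX n::nat. (g [^]\<^sub>A n) \<odot>\<^sub>M x = \<zero>\<^sub>M"
  "y : carrier N ==> EX n::nat. EX x:carrier M. rho (g [^]\<^sub>A n) \<odot>\<^sub>N y = h x"
 using assms unfolding loc_at_def by auto

lemma ring_loc_atD: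
 fixes A (structure)
 assumes "ring_loc_at A g B rho"
 shows "rho : ring_hom A B" "rho g : Units B" "loc_at A g rho (ring_module A) (ring_module B) rho"
  "a : carrier A ==> rho a = \<zero>\<^sub>B ==> EX n::nat. g [^] n \<otimes> a = \<zero>"
  "b : carrier B ==> EX n::nat. EX a:carrier A. rho (g [^] n) \<otimes>\<^sub>B b = rho a"
proof -
 show 1: "rho : ring_hom A B" "rho g : Units B" and l: "loc_at A g rho (ring_module A) (ring_module B) rho"
  using assms unfolding ring_loc_at_def by auto
 show "a : carrier A ==> rho a = \<zero>\<^sub>B ==> EX n::nat. g [^] n \<otimes> a = \<zero>"
  using loc_atD(2)[OF l, of a] by simp
 show "b : carrier B ==> EX n::nat. EX a:carrier A. rho (g [^] n) \<otimes>\<^sub>B b = rho a"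
  using loc_atD(3)[OF l, of b] by simp
qed

lemma ring_hom_cring_I: "cring A ==> cring B ==> rho : ring_hom A B ==> ring_hom_cring A B rho"
 by (intro ring_hom_cringI ring_hom_ringI2) (auto dest: cring.axioms(1))

lemma ring_loc_atI:
 fixes A (structure)
 assumes "cring A" "cring B" "rho : ring_hom A B" "rho g : Units B"
  and "\<And>a. a : carrier A ==> rho a = \<zero>\<^sub>B ==> EX n::nat. g [^] n \<otimes> a = \<zero>"
  and "\<And>b. b : carrier B ==> EX n::nat. EX a:carrier A. rho (g [^] n) \<otimes>\<^sub>B b = rho a"
 shows "ring_loc_at A g B rho"
proof -
 have "semilinear A rho (ring_module A) (ring_module B) rho"
  by (rule semilinearI) (use ring_hom_closed[OF assms(3)] ring_hom_add[OF assms(3)] ring_hom_mult[OF assms(3)] in auto)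
 then show ?thesis using assms unfolding ring_loc_at_def loc_at_def by auto
qed

lemma unit_smult_cancel:
 assumes N: "module B N" and u: "u : Units B" and xy: "x : carrier N" "y : carrier N" and eq: "u \<odot>\<^sub>N x = u \<odot>\<^sub>N y"
 shows "x = y"
proof -
 interpret N: module B N by (rule N)
 have i: "inv\<^bsub>B\<^esub> u : carrier B" "u : carrier B" "inv\<^bsub>B\<^esub> u \<otimes>\<^sub>B u = \<one>\<^sub>B" using u by auto
 have "inv\<^bsub>B\<^esub> u \<odot>\<^sub>N (u \<odot>\<^sub>N x) = inv\<^bsub>B\<^esub> u \<odot>\<^sub>N (u \<odot>\<^sub>N y)" using eq by simp
 then show ?thesis using i xy by (simp add: N.smult_assoc1[symmetric])
qed

lemma Units_pow:
 assumes "cring B" "u : Units B" shows "u [^]\<^sub>B (n::nat) : Units B"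
proof -
 interpret B: cring B by fact
 show ?thesis using assms(2) by (rule B.Units_pow_closed)
qed

lemma fraction_power:
 assumes "cring A" "g : carrier A" "t : powers A g"
 shows "EX n::nat. t = g [^]\<^sub>A n"
 using assms unfolding powers_def by auto

lemma unit_powers:
 assumes "cring A" "cring B" "rho : ring_hom A B" "g : carrier A" "rho g : Units B" "t : powers A g"
 shows "rho t : Units B"
proof -
 interpret ring_hom_cring A B rho by (rule ring_hom_cring_I[OF assms(1-3)])
 obtain n :: nat where "t = g [^]\<^sub>A n" using fraction_power[OF assms(1,4,6)] by blast
 then show ?thesis using Units_pow[OF assms(2,5), of n] assms(4) by (simp add: hom_nat_pow)
qed

section \<open>Comparison with fractions and the correspondence of primes\<close>

definition contraction :: "('a, 'm) ring_scheme => ('a => 'c) => 'c set => 'a set" where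
 "contraction A rho Q = {a : carrier A. rho a : Q}"

definition extension :: "('a, 'm) ring_scheme => 'a => ('c, 'n) ring_scheme => ('a => 'c) => 'a set => 'c set" where
 "extension A g B rho P = {b : carrier B. EX n::nat. EX a:P. rho (g [^]\<^sub>A n) \<otimes>\<^sub>B b = rho a}"

text \<open>The inverse of the identification of fractions with elements of \<open>N\<close>. A
  fraction is the set of all its representations, so the pairs \<open>(x, t)\<close> with
  \<open>t y = h x\<close> are the fraction itself and nothing has to be chosen.\<close>

definition lam ::
 "('a, 'm) ring_scheme => 'a => ('a => 'c) => ('a, 'b, 'k) module_scheme => ('c, 'd, 'l) module_scheme => ('b => 'd) => 'd => ('b \<times> 'a) set" where
 "lam A g rho M N h y = {(x, t). x : carrier M & t : powers A g & rho t \<odot>\<^sub>N y = h x}"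

text \<open>Two representations of \<open>y\<close> have cross products that agree after
  \<open>h\<close>, hence up to a power of \<open>g\<close>; conversely the unit
  \<open>rho (u t)\<close> can be cancelled in \<open>N\<close>.\<close>

lemma lam_eq:
 fixes A (structure)
 assumes A: "cring A" and M: "module A M" and N: "module B N" and g: "g : carrier A"
  and rho: "rho : ring_hom A B" "rho g : Units B" and h: "loc_at A g rho M N h"
  and x: "x : carrier M" "t : powers A g" and y: "y : carrier N" "rho t \<odot>\<^sub>N y = h x"
 shows "lam A g rho M N h y = frac A M (powers A g) x t"
proof -
 interpret M: module A M by (rule M)
 interpret N: module B N by (rule N)
 interpret rho: ring_hom_cring A B rho by (rule ring_hom_cring_I[OF A N.is_cring rho(1)])
 note W = M.R.mult_set_powers[OF g]
 note Wc = mult_setD[OF W]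
 note hD = semilinearD[OF loc_atD(1)[OF h]]
 have tc: "t : carrier A" using Wc(1)[OF x(2)] .
 show ?thesis
 proof (rule Set.set_eqI, clarify)
  fix x' t'
  show "(x', t') : lam A g rho M N h y <-> (x', t') : frac A M (powers A g) x t"
  proof
   assume "(x', t') : lam A g rho M N h y"
   then have x': "x' : carrier M" "t' : powers A g" "rho t' \<odot>\<^sub>N y = h x'" unfolding lam_def by auto
   have tc': "t' : carrier A" using Wc(1)[OF x'(2)] .
   have "h (t' \<odot>\<^sub>M x \<ominus>\<^sub>M t \<odot>\<^sub>M x') = rho t' \<odot>\<^sub>N h x \<ominus>\<^sub>N rho t \<odot>\<^sub>N h x'"
    using semilinear_minus[OF loc_atD(1)[OF h] M.M.abelian_group_axioms N.M.abelian_group_axioms] x(1) x'(1) tc tc' hD(3) by simp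
   also have "rho t' \<odot>\<^sub>N h x = rho t \<odot>\<^sub>N h x'"
    unfolding y(2)[symmetric] x'(3)[symmetric] using tc tc' y(1)
    by (simp add: N.smult_assoc1[symmetric] N.R.m_comm)
   finally have "h (t' \<odot>\<^sub>M x \<ominus>\<^sub>M t \<odot>\<^sub>M x') = \<zero>\<^sub>N"
    using hD(1)[OF x'(1)] tc by (simp add: a_minus_def N.M.r_neg)
   then obtain n :: nat where "(g [^] n) \<odot>\<^sub>M (t' \<odot>\<^sub>M x \<ominus>\<^sub>M t \<odot>\<^sub>M x') = \<zero>\<^sub>M"
    using loc_atD(2)[OF h] x(1) x'(1) tc tc' by (metis M.M.minus_closed M.smult_closed)
   then have "(g [^] n) \<odot>\<^sub>M (t' \<odot>\<^sub>M x) \<ominus>\<^sub>M (g [^] n) \<odot>\<^sub>M (t \<odot>\<^sub>M x') = \<zero>\<^sub>M"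
    using x(1) x'(1) tc tc' g by (simp add: a_minus_def M.smult_r_distr M.smult_r_minus)
   then have "(g [^] n) \<odot>\<^sub>M (t' \<odot>\<^sub>M x) = (g [^] n) \<odot>\<^sub>M (t \<odot>\<^sub>M x')"
    using x(1) x'(1) tc tc' g unfolding a_minus_def
    by (metis M.M.minus_equality M.M.minus_minus M.M.a_inv_closed M.R.nat_pow_closed M.smult_closed)
   then show "(x', t') : frac A M (powers A g) x t"
    unfolding frac_iff[OF M W x] using x(1) x' tc tc' g
    by (auto simp: M.smult_assoc1 powers_def intro!: bexI[of _ "g [^] n"])
  next
   assume "(x', t') : frac A M (powers A g) x t"
   then obtain u where u: "x' : carrier M" "t' : powers A g" "u : powers A g"
    "(u \<otimes> t') \<odot>\<^sub>M x = (u \<otimes> t) \<odot>\<^sub>M x'"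
    unfolding frac_iff[OF M W x] by blast
   note uc = Wc(1)[OF u(2)] Wc(1)[OF u(3)]
   have "rho (u \<otimes> t) \<odot>\<^sub>N (rho t' \<odot>\<^sub>N y) = rho (u \<otimes> t') \<odot>\<^sub>N h x"
    unfolding y(2)[symmetric] using uc tc y(1) by (simp add: N.smult_assoc1[symmetric] N.R.m_ac)
   also have "\<dots> = h ((u \<otimes> t') \<odot>\<^sub>M x)" using hD(3) uc x(1) by simp
   also have "\<dots> = rho (u \<otimes> t) \<odot>\<^sub>N h x'" unfolding u(4) using hD(3) uc u(1) tc by simp
   finally have "rho t' \<odot>\<^sub>N y = h x'"
    using unit_smult_cancel[OF N unit_powers[OF A N.is_cring rho(1) g rho(2) Wc(3)[OF u(3) x(2)]]] uc y(1) hD(1)[OF u(1)]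
    by simp
   then show "(x', t') : lam A g rho M N h y" unfolding lam_def using u(1,2) by simp
  qed
 qed
qed

context
 fixes A :: "('a, 'm) ring_scheme" (structure) and g and B :: "('c, 'n) ring_scheme" and rho
 assumes A: "cring A" and B: "cring B" and g: "g : carrier A" and rho: "ring_loc_at A g B rho"
begin

interpretation A: cring A by (rule A)
interpretation B: cring B by (rule B)
interpretation rho: ring_hom_cring A B rho by (rule ring_hom_cring_I[OF A B ring_loc_atD(1)[OF rho]])

private lemmas rhoD = ring_loc_atD[OF rho]
private lemmas W = A.mult_set_powers[OF g]

lemma pow_powers: "g [^] (n::nat) : powers A g"
 unfolding powers_def by blast

lemma loc_rep:
 assumes N: "module B N" and h: "loc_at A g rho M N h" and y: "y : carrier N"
 obtains x t where "x : carrier M" "t : powers A g" "rho t \<odot>\<^sub>N y = h x"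
proof -
 obtain n :: nat and x where "x : carrier M" "rho (g [^] n) \<odot>\<^sub>N y = h x"
  using loc_atD(3)[OF h y] by blast
 then show thesis using that pow_powers by blast
qed

abbreviation (input) "lamR \<equiv> lam A g rho (ring_module A) (ring_module B) rho"

text \<open>Representations are added and multiplied like fractions: \<open>t y = h x\<close> and
  \<open>t' y' = h x'\<close> give \<open>t t' (y + y') = h (t' x + t x')\<close>.\<close>

lemma lam_semilinear:
 assumes M: "module A M" and N: "module B N" and h: "loc_at A g rho M N h"
 shows "semilinear B lamR N (loc_module A (powers A g) M) (lam A g rho M N h)"
proof (rule semilinearI)
 interpret M: module A M by (rule M)
 interpret N: module B N by (rule N)
 note hD = semilinearD[OF loc_atD(1)[OF h]]
 note eq = lam_eq[OF A M N g rhoD(1,2) h]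
 note eqR = lam_eq[OF A ring_module_module[OF A] ring_module_module[OF B] g rhoD(1,2,3), simplified]
 note Wc = mult_setD[OF W]
 fix y assume y: "y : carrier N"
 obtain x t where x: "x : carrier M" "t : powers A g" "rho t \<odot>\<^sub>N y = h x" using loc_rep[OF N h y] .
 show "lam A g rho M N h y : carrier (loc_module A (powers A g) M)"
  unfolding eq[OF x(1,2) y x(3)] loc_carrier[OF M W] using x by blast
 {
  fix y' assume y': "y' : carrier N"
  obtain x' t' where x': "x' : carrier M" "t' : powers A g" "rho t' \<odot>\<^sub>N y' = h x'" using loc_rep[OF N h y'] .
  note tc = Wc(1)[OF x(2)] Wc(1)[OF x'(2)]
  have "rho (t \<otimes> t') \<odot>\<^sub>N (y \<oplus>\<^sub>N y') = rho t' \<odot>\<^sub>N (rho t \<odot>\<^sub>N y) \<oplus>\<^sub>N rho t \<odot>\<^sub>N (rho t' \<odot>\<^sub>N y')"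
   using tc y y' by (simp add: N.smult_r_distr N.smult_assoc1[symmetric] B.m_comm)
  also have "\<dots> = h (t' \<odot>\<^sub>M x \<oplus>\<^sub>M t \<odot>\<^sub>M x')" using x x' tc hD by simp
  finally have *: "rho (t \<otimes> t') \<odot>\<^sub>N (y \<oplus>\<^sub>N y') = h (t' \<odot>\<^sub>M x \<oplus>\<^sub>M t \<odot>\<^sub>M x')" .
  show "lam A g rho M N h (y \<oplus>\<^sub>N y') = lam A g rho M N h y \<oplus>\<^sub>(loc_module A (powers A g) M) lam A g rho M N h y'"
   unfolding eq[OF x(1,2) y x(3)] eq[OF x'(1,2) y' x'(3)] loc_add[OF M W x(1,2) x'(1,2)]
   using x x' tc y y' * Wc(3) by (intro eq) auto
 }
 fix b assume b: "b : carrier B"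
 obtain a s where a: "a : carrier A" "s : powers A g" "rho s \<otimes>\<^sub>B b = rho a"
  using loc_rep[OF ring_module_module[OF B] rhoD(3), of b] b by auto
 note tc = Wc(1)[OF x(2)] Wc(1)[OF a(2)]
 have "rho (s \<otimes> t) \<odot>\<^sub>N (b \<odot>\<^sub>N y) = (rho s \<otimes>\<^sub>B b) \<odot>\<^sub>N (rho t \<odot>\<^sub>N y)"
  using tc b y by (simp add: N.smult_assoc1[symmetric] B.m_ac)
 also have "\<dots> = h (a \<odot>\<^sub>M x)" unfolding a(3) x(3) using hD a x by simp
 finally have *: "rho (s \<otimes> t) \<odot>\<^sub>N (b \<odot>\<^sub>N y) = h (a \<odot>\<^sub>M x)" .
 show "lam A g rho M N h (b \<odot>\<^sub>N y) = lamR b \<odot>\<^sub>(loc_module A (powers A g) M) lam A g rho M N h y"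
  unfolding eq[OF x(1,2) y x(3)] eqR[OF a(1,2) b a(3)] loc_smult[OF A W M a(1,2) x(1,2)]
  using x a tc b y * Wc(3) by (intro eq) auto
qed

lemma lam_apply:
 assumes M: "module A M" and N: "module B N" and h: "loc_at A g rho M N h" and x: "x : carrier M"
 shows "lam A g rho M N h (h x) = frac A M (powers A g) x \<one>"
proof -
 interpret N: module B N by (rule N)
 show ?thesis
  by (rule lam_eq[OF A M N g rhoD(1,2) h x mult_setD(2)[OF W]])
    (use semilinearD(1)[OF loc_atD(1)[OF h] x] in auto)
qed

lemma lam_ring_hom: "lamR : ring_hom B (loc_ring A (powers A g))"
proof (rule ring_hom_memI)
 note sl = semilinearD[OF lam_semilinear[OF ring_module_module[OF A] ring_module_module[OF B] rhoD(3)], simplified]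
 show "b : carrier B ==> lamR b : carrier (loc_ring A (powers A g))" for b
  using sl(1) by (simp add: loc_ring_eqs[OF A W])
 show "b : carrier B ==> c : carrier B ==> lamR (b \<otimes>\<^sub>B c) = lamR b \<otimes>\<^sub>(loc_ring A (powers A g)) lamR c" for b c
  using sl(3) by (simp add: loc_ring_eqs[OF A W])
 show "b : carrier B ==> c : carrier B ==> lamR (b \<oplus>\<^sub>B c) = lamR b \<oplus>\<^sub>(loc_ring A (powers A g)) lamR c" for b c
  using sl(2) by (simp add: loc_ring_eqs[OF A W])
 have "lamR (rho \<one>) = \<one>\<^sub>(loc_ring A (powers A g))"
  using lam_apply[OF ring_module_module[OF A] ring_module_module[OF B] rhoD(3), of "\<one>"]
  by (simp add: loc_ring_eqs[OF A W])
 then show "lamR \<one>\<^sub>B = \<one>\<^sub>(loc_ring A (powers A g))" by simp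
qed

text \<open>Transport along \<open>lam\<close> to the concrete localization, where the Frobenius map
  extends to fractions; the factor from \<open>powers A g\<close> found there is the
  \<open>g^n\<close> of the conclusion.\<close>

lemma fmem_loc_at:
 assumes M: "module A M" and N: "module B N" and h: "loc_at A g rho M N h"
  and L: "submodule L A M" and K: "submodule K B N"
  and KL: "\<And>y. y : K ==> EX n::nat. EX x:L. rho (g [^] n) \<odot>\<^sub>N y = h x"
  and c: "c : carrier A" and z: "z : carrier M" and f: "fmem p e B N K (rho c) (h z)"
 shows "EX n::nat. fmem p e A M L (g [^] n \<otimes> c) z"
proof -
 let ?W = "powers A g"
 have "lam A g rho M N h ` K <= loc_sub A M ?W L"
 proof
  fix Y assume "Y : lam A g rho M N h ` K"
  then obtain y where y: "y : K" "Y = lam A g rho M N h y" by blast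
  obtain n :: nat and x where x: "x : L" "rho (g [^] n) \<odot>\<^sub>N y = h x" using KL[OF y(1)] by blast
  have "Y = frac A M ?W x (g [^] n)" unfolding y(2)
   by (rule lam_eq[OF A M N g rhoD(1,2) h submoduleD(7)[OF L M x(1)] pow_powers submoduleD(7)[OF K N y(1)] x(2)])
  then show "Y : loc_sub A M ?W L" unfolding loc_sub_def using x(1) pow_powers by blast
 qed
 from fmem_semilinear[OF N module_loc[OF A W M] lam_ring_hom lam_semilinear[OF M N h] K
   loc_sub_submodule[OF A W M L] this _ _ f]
 have "fmem p e (loc_ring A ?W) (loc_module A ?W M) (loc_sub A M ?W L) (lamR (rho c)) (lam A g rho M N h (h z))"
  using c semilinearD(1)[OF loc_atD(1)[OF h] z] by simp
 then have "fmem p e (loc_ring A ?W) (loc_module A ?W M) (loc_sub A M ?W L)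
   (frac A (ring_module A) ?W c \<one>) (frac A M ?W z \<one>)"
  using lam_apply[OF M N h z] lam_apply[OF ring_module_module[OF A] ring_module_module[OF B] rhoD(3), of c] c by simp
 from fmem_localization[OF A W M L c z this] show ?thesis unfolding powers_def by blast
qed

abbreviation (input) "contr \<equiv> contraction A rho"

abbreviation (input) "extn \<equiv> extension A g B rho"

lemma unit_not_prime:
 assumes "primeideal Q B" "u : Units B" shows "u ~: Q"
proof
 assume "u : Q"
 then have "inv\<^bsub>B\<^esub> u \<otimes>\<^sub>B u : Q"
  using idealD(4)[OF primeD(1)[OF assms(1)] B.Units_inv_closed[OF assms(2)]] by blast
 then show False using primeD(3)[OF assms(1)] B.Units_l_inv[OF assms(2)] by simp
qed

lemma contr_prime:
 assumes "primeideal Q B" shows "primeideal (contr Q) A" "g ~: contr Q"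
proof -
 note Q = idealD[OF primeD(1)[OF assms]]
 have "ideal (contr Q) A" by (rule idealI2[OF A]) (use Q in \<open>auto simp: contraction_def\<close>)
 then show "primeideal (contr Q) A"
  by (rule primeidealI3[OF _ A]) (use primeD(3,4)[OF assms] in \<open>auto simp: contraction_def\<close>)
 show "g ~: contr Q" using unit_not_prime[OF assms rhoD(2)] by (auto simp: contraction_def)
qed

text \<open>Any other numerator of \<open>b\<close> agrees with \<open>a\<close> up to powers of
  \<open>g\<close>, and these cancel modulo \<open>P\<close> because \<open>g\<close> is not in
  \<open>P\<close>.\<close>

lemma extn_iff:
 assumes P: "primeideal P A" "g ~: P" and b: "b : carrier B" and a: "a : carrier A"
  and eq: "rho (g [^] (n::nat)) \<otimes>\<^sub>B b = rho a"
 shows "b : extn P <-> a : P"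
proof
 assume "a : P" then show "b : extn P" unfolding extension_def using b eq by blast
next
 assume "b : extn P"
 then obtain m :: nat and a' where a': "a' : P" "rho (g [^] m) \<otimes>\<^sub>B b = rho a'" unfolding extension_def by blast
 have ac: "a' : carrier A" using idealD(1)[OF primeD(1)[OF P(1)] a'(1)] .
 have gm: "g [^] k : carrier A" for k :: nat using g by simp
 have "rho (g [^] m \<otimes> a) = rho (g [^] m) \<otimes>\<^sub>B (rho (g [^] n) \<otimes>\<^sub>B b)" using gm a eq by simp
 also have "\<dots> = rho (g [^] n) \<otimes>\<^sub>B (rho (g [^] m) \<otimes>\<^sub>B b)"
  by (rule B.m_lcomm) (use gm b rho.hom_closed in blast)+
 also have "\<dots> = rho (g [^] n \<otimes> a')" unfolding a'(2) by (rule rho.hom_mult[symmetric]) (use gm ac in auto)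
 finally have "rho (g [^] m \<otimes> a) \<ominus>\<^sub>B rho (g [^] n \<otimes> a') = \<zero>\<^sub>B" using gm ac by (simp add: a_minus_def B.r_neg)
 then have "rho (g [^] m \<otimes> a \<ominus> g [^] n \<otimes> a') = \<zero>\<^sub>B"
  unfolding a_minus_def using gm a ac by (simp add: rho.hom_a_inv)
 then obtain k :: nat where k: "g [^] k \<otimes> (g [^] m \<otimes> a \<ominus> g [^] n \<otimes> a') = \<zero>"
  using rhoD(4)[of "g [^] m \<otimes> a \<ominus> g [^] n \<otimes> a'"] gm a ac by auto
 note Pi = idealD[OF primeD(1)[OF P(1)]]
 have "g [^] k \<otimes> (g [^] m \<otimes> a \<ominus> g [^] n \<otimes> a') : P" unfolding k by (rule Pi(2))
 then have "g [^] m \<otimes> a \<ominus> g [^] n \<otimes> a' : P"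
  using primeD(4)[OF P(1) gm] prime_pow[OF P(1) g P(2)] gm a ac by auto
 moreover have "g [^] n \<otimes> a' : P" using Pi(4)[OF gm a'(1)] .
 ultimately have "(g [^] m \<otimes> a \<ominus> g [^] n \<otimes> a') \<oplus> g [^] n \<otimes> a' : P" by (rule Pi(3))
 then have "g [^] m \<otimes> a : P" using gm a ac by (simp add: a_minus_def A.a_assoc A.l_neg)
 then show "a : P" using primeD(4)[OF P(1) gm a] prime_pow[OF P(1) g P(2)] by blast
qed

lemma extn_hom_iff:
 assumes "primeideal P A" "g ~: P" "a : carrier A"
 shows "rho a : extn P <-> a : P"
 by (rule extn_iff[OF assms(1,2) _ assms(3), of _ 0]) (use assms(3) in auto)

lemma extn_prime:
 assumes P: "primeideal P A" "g ~: P" shows "primeideal (extn P) B"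
proof -
 note Pi = idealD[OF primeD(1)[OF P(1)]]
 have gm: "g [^] k : carrier A" for k :: nat using g by simp
 have "ideal (extn P) B"
 proof (rule idealI2[OF B])
  show "extn P <= carrier B" unfolding extension_def by blast
  show "\<zero>\<^sub>B : extn P" using extn_hom_iff[OF P A.zero_closed] Pi(2) by simp
  fix x assume x: "x : extn P"
  then have xc: "x : carrier B" unfolding extension_def by blast
  from x obtain n :: nat and a where a: "a : P" "rho (g [^] n) \<otimes>\<^sub>B x = rho a" unfolding extension_def by blast
  note ac = Pi(1)[OF a(1)]
  {
   fix y assume y: "y : extn P"
   then have yc: "y : carrier B" unfolding extension_def by blast
   from y obtain m :: nat and b where b: "b : P" "rho (g [^] m) \<otimes>\<^sub>B y = rho b" unfolding extension_def by blast
   note bc = Pi(1)[OF b(1)]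
   have "rho (g [^] (n + m)) \<otimes>\<^sub>B (x \<oplus>\<^sub>B y) = rho (g [^] n \<otimes> g [^] m) \<otimes>\<^sub>B (x \<oplus>\<^sub>B y)"
    using g by (simp add: A.nat_pow_mult)
   also have "\<dots> = rho (g [^] m) \<otimes>\<^sub>B (rho (g [^] n) \<otimes>\<^sub>B x) \<oplus>\<^sub>B rho (g [^] n) \<otimes>\<^sub>B (rho (g [^] m) \<otimes>\<^sub>B y)"
    using rho.hom_mult[OF gm gm] rho.hom_closed[OF gm] xc yc by (simp add: B.r_distr B.l_distr B.m_ac)
   also have "\<dots> = rho (g [^] m \<otimes> a \<oplus> g [^] n \<otimes> b)"
    unfolding a(2) b(2) using gm ac bc by simp
   finally have "rho (g [^] (n + m)) \<otimes>\<^sub>B (x \<oplus>\<^sub>B y) = rho (g [^] m \<otimes> a \<oplus> g [^] n \<otimes> b)" .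
   moreover have "g [^] m \<otimes> a \<oplus> g [^] n \<otimes> b : P" using Pi(3,4) gm a b by simp
   ultimately show "x \<oplus>\<^sub>B y : extn P" using extn_iff[OF P B.a_closed[OF xc yc] Pi(1)] by blast
  }
  fix c assume c: "c : carrier B"
  obtain m :: nat and b where b: "b : carrier A" "rho (g [^] m) \<otimes>\<^sub>B c = rho b" using rhoD(5)[OF c] by blast
  have "rho (g [^] (n + m)) \<otimes>\<^sub>B (c \<otimes>\<^sub>B x) = rho (g [^] n \<otimes> g [^] m) \<otimes>\<^sub>B (c \<otimes>\<^sub>B x)"
   using g by (simp add: A.nat_pow_mult)
  also have "\<dots> = (rho (g [^] m) \<otimes>\<^sub>B c) \<otimes>\<^sub>B (rho (g [^] n) \<otimes>\<^sub>B x)"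
   using rho.hom_mult[OF gm gm] rho.hom_closed[OF gm] xc c by (simp add: B.m_ac)
  also have "\<dots> = rho (b \<otimes> a)" unfolding a(2) b(2) using b ac by simp
  finally show "c \<otimes>\<^sub>B x : extn P"
   using extn_iff[OF P B.m_closed[OF c xc] A.m_closed[OF b(1) ac]] Pi(4)[OF b(1) a(1)] by blast
 qed
 then show ?thesis
 proof (rule primeidealI3[OF _ B])
  show "\<one>\<^sub>B ~: extn P" using extn_hom_iff[OF P A.one_closed] primeD(3)[OF P(1)] by simp
  fix x y assume xy: "x : carrier B" "y : carrier B" "x \<otimes>\<^sub>B y : extn P"
  obtain n :: nat and a where a: "a : carrier A" "rho (g [^] n) \<otimes>\<^sub>B x = rho a" using rhoD(5)[OF xy(1)] by blast
  obtain m :: nat and b where b: "b : carrier A" "rho (g [^] m) \<otimes>\<^sub>B y = rho b" using rhoD(5)[OF xy(2)] by blast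
  have "rho (g [^] (n + m)) \<otimes>\<^sub>B (x \<otimes>\<^sub>B y) = rho (g [^] n \<otimes> g [^] m) \<otimes>\<^sub>B (x \<otimes>\<^sub>B y)"
   using g by (simp add: A.nat_pow_mult)
  also have "\<dots> = (rho (g [^] n) \<otimes>\<^sub>B x) \<otimes>\<^sub>B (rho (g [^] m) \<otimes>\<^sub>B y)"
   using rho.hom_mult[OF gm gm] rho.hom_closed[OF gm] xy by (simp add: B.m_ac)
  also have "\<dots> = rho (a \<otimes> b)" unfolding a(2) b(2) using a b by simp
  finally have "a \<otimes> b : P"
   using extn_iff[OF P B.m_closed[OF xy(1,2)] A.m_closed[OF a(1) b(1)]] xy(3) by blast
  then have "a : P \<or> b : P" using primeD(4)[OF P(1) a(1) b(1)] by blast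
  then show "x : extn P \<or> y : extn P"
   using extn_iff[OF P xy(1) a] extn_iff[OF P xy(2) b] by blast
 qed
qed

lemma contr_extn:
 assumes P: "primeideal P A" "g ~: P" shows "contr (extn P) = P"
proof (rule Set.set_eqI)
 fix a
 show "a : contr (extn P) <-> a : P"
  using extn_hom_iff[OF P, of a] idealD(1)[OF primeD(1)[OF P(1)], of a] by (auto simp: contraction_def)
qed

lemma extn_contr:
 assumes Q: "primeideal Q B" shows "extn (contr Q) = Q"
proof -
 have "b : extn (contr Q) <-> b : Q" if b: "b : carrier B" for b
 proof -
  obtain n :: nat and a where a: "a : carrier A" "rho (g [^] n) \<otimes>\<^sub>B b = rho a" using rhoD(5)[OF b] by blast
  have u: "rho (g [^] n) ~: Q" "rho (g [^] n) : carrier B"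
   using unit_not_prime[OF Q Units_pow[OF B rhoD(2), of n]] g by (auto simp: rho.ring.hom_nat_pow)
  have "b : extn (contr Q) <-> a : contr Q" by (rule extn_iff[OF contr_prime[OF Q] b a])
  also have "\<dots> <-> rho (g [^] n) \<otimes>\<^sub>B b : Q" using a by (simp add: contraction_def)
  also have "\<dots> <-> b : Q" using primeD(4)[OF Q u(2) b] u(1) by blast
  finally show ?thesis .
 qed
 moreover have "extn (contr Q) <= carrier B" unfolding extension_def by blast
 moreover have "Q <= carrier B" using idealD(1)[OF primeD(1)[OF Q]] by blast
 ultimately show ?thesis by blast
qed

lemma extn_mono: "P <= P' ==> extn P <= extn P'"
 unfolding extension_def by blast

lemma contr_mono: "Q <= Q' ==> contr Q <= contr Q'"
 unfolding contraction_def by blast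

text \<open>Extension and contraction are inverse, inclusion-preserving bijections between the
  primes of \<open>A\<close> without \<open>g\<close> and the primes of \<open>B\<close>. A prime
  below one without \<open>g\<close> is again without \<open>g\<close>, so minimality means the same
  on both sides.\<close>

lemma ring_circ_loc:
 assumes d: "d : carrier A"
 shows "rho d : ring_circ B <-> (ALL P. minimal_prime A P --> g ~: P --> d ~: P)"
proof
 assume c: "rho d : ring_circ B"
 show "ALL P. minimal_prime A P --> g ~: P --> d ~: P"
 proof (intro allI impI)
  fix P assume P: "minimal_prime A P" "g ~: P"
  note pP = minimal_primeD(1)[OF P(1)]
  have "minimal_prime B (extn P)" unfolding minimal_prime_def
  proof (intro conjI allI impI)
   show "primeideal (extn P) B" by (rule extn_prime[OF pP P(2)])
   fix Q assume Q: "primeideal Q B & Q <= extn P"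
   then have "contr Q <= P" using contr_mono contr_extn[OF pP P(2)] by metis
   then have "contr Q = P" using minimal_primeD(2)[OF P(1) contr_prime(1)] Q by blast
   then show "Q = extn P" using extn_contr Q by metis
  qed
  then have "rho d ~: extn P" using c unfolding ring_circ_iff by blast
  then show "d ~: P" using extn_hom_iff[OF pP P(2) d] by blast
 qed
next
 assume c: "ALL P. minimal_prime A P --> g ~: P --> d ~: P"
 have "rho d ~: Q" if Q: "minimal_prime B Q" for Q
 proof -
  note pQ = minimal_primeD(1)[OF Q]
  have "minimal_prime A (contr Q)" unfolding minimal_prime_def
  proof (intro conjI allI impI)
   show "primeideal (contr Q) A" by (rule contr_prime(1)[OF pQ])
   fix P assume P: "primeideal P A & P <= contr Q"
   then have gP: "g ~: P" using contr_prime(2)[OF pQ] by blast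
   have "extn P <= Q" using extn_mono P extn_contr[OF pQ] by metis
   then have "extn P = Q" using minimal_primeD(2)[OF Q extn_prime] P gP by blast
   then show "P = contr Q" using contr_extn P gP by metis
  qed
  then have "d ~: contr Q" using c contr_prime(2)[OF pQ] by blast
  then show ?thesis using d unfolding contraction_def by blast
 qed
 then show "rho d : ring_circ B" unfolding ring_circ_iff using d by auto
qed

text \<open>An element of \<open>ring_circ A\<close> stays in \<open>ring_circ B\<close>, so the
  same multiplier and the same bound on \<open>e\<close> serve. The module map is later a
  restriction of sections from an affine open set.\<close>

lemma tight_closure_push:
 assumes M: "module A M" and N: "module B N" and h: "semilinear A rho M N h"
  and L: "submodule L A M" and K: "submodule K B N" and hLK: "h ` L <= K"
  and z: "z : tight_closure p A M L"
 shows "h z : tight_closure p B N K"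
proof -
 obtain c e0 where c: "z : carrier M" "c : ring_circ A" "\<And>e. e >= e0 ==> fmem p e A M L c z"
  using z unfolding tight_closure_fmem by blast
 have cc: "c : carrier A" using c(2) by (simp add: ring_circ_iff)
 have "rho c : ring_circ B" using ring_circ_loc[OF cc] c(2) unfolding ring_circ_iff by blast
 moreover have "fmem p e B N K (rho c) (h z)" if "e >= e0" for e
  by (rule fmem_semilinear[OF M N rhoD(1) h L K hLK cc c(1) c(3)[OF that]])
 ultimately show ?thesis unfolding tight_closure_fmem using semilinearD(1)[OF h c(1)] by blast
qed

end

text \<open>Membership of \<open>z/1\<close> in the tight closure of \<open>L\<^sub>g\<close> in \<open>M\<^sub>g\<close>, expressed over the original ring.\<close>

definition loc_tight ::
 "nat => 'a => ('a, 'm) ring_scheme => ('a, 'b, 'k) module_scheme => 'b set => 'b => bool" where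
 "loc_tight p g A M L z <-> z : carrier M &
   (EX d:carrier A. (ALL P. minimal_prime A P --> g ~: P --> d ~: P) &
    (EX e0. ALL e >= e0. EX n::nat. fmem p e A M L (g [^]\<^sub>A n \<otimes>\<^sub>A d) z))"

text \<open>A multiplier over \<open>B\<close> becomes some \<open>rho d\<close> after
  multiplication by a power of the unit \<open>rho g\<close>, which lies in no prime; back in
  \<open>A\<close> each \<open>e\<close> costs its own power of \<open>g\<close>. Conversely these
  powers are inverted in \<open>B\<close>, so the single multiplier \<open>rho d\<close>
  remains.\<close>

theorem tight_closure_loc_at:
 fixes A (structure)
 assumes A: "cring A" and B: "cring B" and g: "g : carrier A" and rho: "ring_loc_at A g B rho"
  and M: "module A M" and N: "module B N" and h: "loc_at A g rho M N h"
  and L: "submodule L A M" and K: "submodule K B N" and hLK: "h ` L <= K"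
  and KL: "\<And>y. y : K ==> EX n::nat. EX x:L. rho (g [^] n) \<odot>\<^sub>N y = h x"
  and z: "z : carrier M"
 shows "h z : tight_closure p B N K <-> loc_tight p g A M L z"
proof
 interpret A: cring A by (rule A)
 interpret B: cring B by (rule B)
 note rhoD = ring_loc_atD[OF rho]
 interpret rho: ring_hom_cring A B rho by (rule ring_hom_cring_I[OF A B rhoD(1)])
 have gm: "g [^] k : carrier A" for k :: nat using g by simp
 have um: "rho (g [^] k) : Units B" for k :: nat using Units_pow[OF B rhoD(2)] g by (simp add: rho.ring.hom_nat_pow)
 {
  assume "h z : tight_closure p B N K"
  then obtain c e0 where c: "c : ring_circ B" "\<And>e. e >= e0 ==> fmem p e B N K c (h z)"
   unfolding tight_closure_fmem by blast
  have cc: "c : carrier B" using c(1) by (simp add: ring_circ_iff)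
  obtain n :: nat and d where d: "d : carrier A" "rho (g [^] n) \<otimes>\<^sub>B c = rho d" using rhoD(5)[OF cc] by blast
  have "rho d : ring_circ B" unfolding d(2)[symmetric]
  proof (rule ring_circ_mult[OF _ c(1) B])
   show "rho (g [^] n) : ring_circ B" unfolding ring_circ_iff
    using um unit_not_prime[OF A B g rho minimal_primeD(1)] by blast
  qed
  then have mp: "ALL P. minimal_prime A P --> g ~: P --> d ~: P" using ring_circ_loc[OF A B g rho d(1)] by blast
  have "EX n::nat. fmem p e A M L (g [^] n \<otimes> d) z" if "e >= e0" for e
  proof -
   have "fmem p e B N K (rho d) (h z)" unfolding d(2)[symmetric]
    by (rule fmem_smult[OF N K _ cc _ c(2)[OF that]])
      (use um semilinearD(1)[OF loc_atD(1)[OF h] z] in auto)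
   from fmem_loc_at[OF A B g rho M N h L K _ d(1) z this] KL show ?thesis by blast
  qed
  then show "loc_tight p g A M L z" unfolding loc_tight_def using z d(1) mp by blast
 next
  assume "loc_tight p g A M L z"
  then obtain d e0 where d: "d : carrier A" "ALL P. minimal_prime A P --> g ~: P --> d ~: P"
   "\<And>e. e >= e0 ==> EX n::nat. fmem p e A M L (g [^] n \<otimes> d) z"
   unfolding loc_tight_def by blast
  have hz: "h z : carrier N" using semilinearD(1)[OF loc_atD(1)[OF h] z] .
  have "rho d : ring_circ B" using ring_circ_loc[OF A B g rho d(1)] d(2) by blast
  moreover have "fmem p e B N K (rho d) (h z)" if e: "e >= e0" for e
  proof -
   obtain n :: nat where "fmem p e A M L (g [^] n \<otimes> d) z" using d(3)[OF e] by blast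
   then have *: "fmem p e B N K (rho (g [^] n \<otimes> d)) (h z)"
    by (rule fmem_semilinear[OF M N rhoD(1) loc_atD(1)[OF h] L K hLK A.m_closed[OF gm d(1)] z])
   let ?u = "rho (g [^] n)"
   have uc: "?u : carrier B" "inv\<^bsub>B\<^esub> ?u : carrier B" "inv\<^bsub>B\<^esub> ?u \<otimes>\<^sub>B ?u = \<one>\<^sub>B" using um by auto
   have "fmem p e B N K (inv\<^bsub>B\<^esub> ?u \<otimes>\<^sub>B rho (g [^] n \<otimes> d)) (h z)"
    by (rule fmem_smult[OF N K uc(2) _ hz *]) (use gm d(1) in auto)
   moreover have "inv\<^bsub>B\<^esub> ?u \<otimes>\<^sub>B rho (g [^] n \<otimes> d) = (inv\<^bsub>B\<^esub> ?u \<otimes>\<^sub>B ?u) \<otimes>\<^sub>B rho d"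
    unfolding rho.hom_mult[OF gm d(1)] by (rule B.m_assoc[symmetric]) (use uc d(1) in auto)
   ultimately show ?thesis using uc(3) d(1) by simp
  qed
  ultimately show "h z : tight_closure p B N K" unfolding tight_closure_fmem using hz by blast
 }
qed

lemma loc_at_loc_ring:
 fixes A (structure)
 assumes A: "cring A" and g: "g : carrier A" and M: "module A M"
 shows "loc_at A g (%a. frac A (ring_module A) (powers A g) a \<one>) M (loc_module A (powers A g) M) (%x. frac A M (powers A g) x \<one>)"
proof -
 interpret A: cring A by (rule A)
 interpret M: module A M by (rule M)
 note W = A.mult_set_powers[OF g]
 show ?thesis unfolding loc_at_def
 proof (intro conjI ballI impI)
  show "semilinear A (%a. frac A (ring_module A) (powers A g) a \<one>) M (loc_module A (powers A g) M) (%x. frac A M (powers A g) x \<one>)"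
   by (rule loc_semilinear[OF A W M])
  show "EX n::nat. (g [^] n) \<odot>\<^sub>M x = \<zero>\<^sub>M"
   if x1: "x : carrier M" and x2: "frac A M (powers A g) x \<one> = \<zero>\<^sub>(loc_module A (powers A g) M)" for x
  proof -
   obtain u where "u : powers A g" "u \<odot>\<^sub>M x = \<zero>\<^sub>M"
    using x2 frac_eq_zero_iff[OF M W x1 mult_setD(2)[OF W]] by blast
   then show ?thesis unfolding powers_def by blast
  qed
  fix y assume "y : carrier (loc_module A (powers A g) M)"
  then obtain x t where xt: "x : carrier M" "t : powers A g" "y = frac A M (powers A g) x t"
   unfolding loc_carrier[OF M W] by blast
  obtain n :: nat where n: "t = g [^] n" using fraction_power[OF A g xt(2)] by blast
  have x: "x : carrier M" "y = frac A M (powers A g) x (g [^] n)" using xt n by auto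
  have gW: "g [^] n : powers A g" unfolding powers_def by blast
  note Wc = mult_setD[OF W]
  have "frac A (ring_module A) (powers A g) (g [^] n) \<one> \<odot>\<^sub>(loc_module A (powers A g) M) y = frac A M (powers A g) x \<one>"
   unfolding x(2) using x(1) gW Wc(1)[OF gW] Wc(2)
   by (simp add: loc_smult[OF A W M]) (rule frac_eqI[OF M W], auto)
  then show "EX n::nat. EX x:carrier M. frac A (ring_module A) (powers A g) (g [^] n) \<one> \<odot>\<^sub>(loc_module A (powers A g) M) y = frac A M (powers A g) x \<one>"
   using x(1) by blast
 qed
qed

lemma ring_loc_at_loc_ring:
 fixes A (structure)
 assumes A: "cring A" and g: "g : carrier A"
 shows "ring_loc_at A g (loc_ring A (powers A g)) (%a. frac A (ring_module A) (powers A g) a \<one>)"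
proof -
 interpret A: cring A by (rule A)
 note W = A.mult_set_powers[OF g]
 note l = loc_at_loc_ring[OF A g ring_module_module[OF A]]
 have gW: "g : powers A g" unfolding powers_def using g A.nat_pow_eone[of g] by (metis (mono_tags, lifting) mem_Collect_eq)
 show ?thesis
 proof (rule ring_loc_atI[OF A cring_loc_ring[OF A W] loc_ring_hom[OF A W] loc_ring_Units[OF A W gW mult_setD(2)[OF W]]])
  show "EX n::nat. g [^] n \<otimes> a = \<zero>"
   if "a : carrier A" "frac A (ring_module A) (powers A g) a \<one> = \<zero>\<^sub>(loc_ring A (powers A g))" for a
   using loc_atD(2)[OF l, of a] that by (simp add: loc_ring_eqs[OF A W])
  show "EX n::nat. EX a:carrier A. frac A (ring_module A) (powers A g) (g [^] n) \<one> \<otimes>\<^sub>(loc_ring A (powers A g)) b = frac A (ring_module A) (powers A g) a \<one>"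
   if "b : carrier (loc_ring A (powers A g))" for b
   using loc_atD(3)[OF l, of b] that by (simp add: loc_ring_eqs[OF A W])
 qed
qed

lemma tight_closure_subset: "tight_closure p S M L <= carrier M"
 unfolding tight_closure_fmem by blast

text \<open>For a sum the multiplier is \<open>c d\<close> and the bound on \<open>e\<close> the
  larger of the two; \<open>c d\<close> avoids each minimal prime because both factors do.\<close>

theorem tight_closure_submodule:
 assumes M: "module S M" and L: "submodule L S M"
 shows "submodule (tight_closure p S M L) S M"
proof (rule submoduleI2[OF M tight_closure_subset])
 interpret M: module S M by (rule M)
 show "\<zero>\<^sub>M : tight_closure p S M L"
  unfolding tight_closure_fmem
  using fmem_submodule[OF M L M.R.one_closed submoduleD(2)[OF L M]] ring_circ_one[OF M.is_cring] by blast
 fix x assume "x : tight_closure p S M L"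
 then obtain c e0 where x: "x : carrier M" "c : ring_circ S" "\<And>e. e >= e0 ==> fmem p e S M L c x"
  unfolding tight_closure_fmem by blast
 have cc: "c : carrier S" using x(2) by (simp add: ring_circ_iff)
 {
  fix y assume "y : tight_closure p S M L"
  then obtain d e1 where y: "y : carrier M" "d : ring_circ S" "\<And>e. e >= e1 ==> fmem p e S M L d y"
   unfolding tight_closure_fmem by blast
  have dc: "d : carrier S" using y(2) by (simp add: ring_circ_iff)
  have "fmem p e S M L (c \<otimes>\<^sub>S d) (x \<oplus>\<^sub>M y)" if "e >= max e0 e1" for e
  proof (rule fmem_add[OF M L M.R.m_closed[OF cc dc] x(1) y(1)])
   show "fmem p e S M L (c \<otimes>\<^sub>S d) x"
    using fmem_smult[OF M L dc cc x(1) x(3)] that by (simp add: M.R.m_comm[OF cc dc])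
   show "fmem p e S M L (c \<otimes>\<^sub>S d) y"
    using fmem_smult[OF M L cc dc y(1) y(3)] that by simp
  qed
  then show "x \<oplus>\<^sub>M y : tight_closure p S M L"
   unfolding tight_closure_fmem using ring_circ_mult[OF x(2) y(2) M.is_cring] M.M.a_closed[OF x(1) y(1)] by blast
 }
 fix a assume a: "a : carrier S"
 show "a \<odot>\<^sub>M x : tight_closure p S M L"
  unfolding tight_closure_fmem using fmem_smult_elem[OF M L cc a x(1) x(3)] x(2) M.smult_closed[OF a x(1)] by blast
qed


lemma loc_tight_of_tight:
 fixes A (structure)
 assumes M: "module A M" and L: "submodule L A M" and g: "g : carrier A" and z: "z : tight_closure p A M L"
 shows "loc_tight p g A M L z"
proof -
 interpret M: module A M by (rule M)
 obtain c e0 where c: "z : carrier M" "c : ring_circ A" "\<And>e. e >= e0 ==> fmem p e A M L c z"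
  using z unfolding tight_closure_fmem by blast
 have cc: "c : carrier A" using c(2) by (simp add: ring_circ_iff)
 have "fmem p e A M L (g [^] (0::nat) \<otimes> c) z" if "e >= e0" for e using c(3)[OF that] cc by simp
 then have "EX e0. ALL e >= e0. EX n::nat. fmem p e A M L (g [^] n \<otimes> c) z" by blast
 then show ?thesis unfolding loc_tight_def using c(1,2) cc unfolding ring_circ_iff by blast
qed

text \<open>The elements \<open>g\<close> that admit a multiplier in \<open>ring_circ A\<close>,
  with powers of \<open>g\<close> depending on \<open>e\<close>, form an ideal. By the local
  hypothesis and prime avoidance it lies in no prime, so it contains \<open>\<one>\<close>, whose
  powers disappear.\<close>

theorem tight_closure_local:
 fixes A (structure)
 assumes A: "cring A" and N: "noetherian_ring A" and M: "module A M" and L: "submodule L A M" and z: "z : carrier M"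
  and loc: "\<And>Q. primeideal Q A ==> EX g:carrier A. g ~: Q & loc_tight p g A M L z"
 shows "z : tight_closure p A M L"
proof -
 interpret A: cring A by (rule A)
 have fi: "ideal {a : carrier A. fmem p e A M L (a \<otimes> d) z} A" if d: "d : carrier A" for e d
 proof (rule idealI2[OF A])
  show "\<zero> : {a : carrier A. fmem p e A M L (a \<otimes> d) z}"
   using fmem_zero_coeff[OF M L z] d by simp
  show "x \<oplus> y : {a : carrier A. fmem p e A M L (a \<otimes> d) z}"
   if "x : {a : carrier A. fmem p e A M L (a \<otimes> d) z}" "y : {a : carrier A. fmem p e A M L (a \<otimes> d) z}" for x y
   using that fmem_add_coeff[OF M L _ _ z, of "x \<otimes> d" "y \<otimes> d"] d by (simp add: A.l_distr)
  show "a \<otimes> x : {a : carrier A. fmem p e A M L (a \<otimes> d) z}"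
   if "a : carrier A" "x : {a : carrier A. fmem p e A M L (a \<otimes> d) z}" for a x
   using that fmem_smult[OF M L that(1) _ z, of "x \<otimes> d"] d by (simp add: A.m_assoc)
 qed auto
 \<comment> \<open>In contrast to \<open>loc_tight\<close>, \<open>d\<close> avoids all minimal
   primes. Otherwise the product of the multipliers for \<open>x\<close> and \<open>y\<close> could
   lie in a minimal prime that contains \<open>y\<close> but not \<open>x\<close>, hence not
   \<open>x \<oplus> y\<close>.\<close>
 define good where "good g d e0 <-> d : ring_circ A & (ALL e >= e0. EX n::nat. fmem p e A M L (g [^] n \<otimes> d) z)"
  for g d and e0 :: nat
 let ?J = "{g : carrier A. EX d e0. good g d e0}"
 have J: "ideal ?J A"
 proof (rule idealI2[OF A])
  \<comment> \<open>The exponent 1 is taken here, since the power of zero with exponent 0 is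
    \<open>\<one>\<close>.\<close>
  have "good \<zero> \<one> 0" unfolding good_def
   using ring_circ_one[OF A] fmem_zero_coeff[OF M L z] by (auto intro!: exI[of _ "1::nat"])
  then show "\<zero> : ?J" by blast
  fix x assume "x : ?J"
  then obtain d e0 where x: "x : carrier A" "good x d e0" by blast
  have dc: "d : carrier A" using x(2) by (simp add: good_def ring_circ_iff)
  {
   fix y assume "y : ?J"
   then obtain d' e1 where y: "y : carrier A" "good y d' e1" by blast
   have dc': "d' : carrier A" using y(2) by (simp add: good_def ring_circ_iff)
   have "EX n::nat. fmem p e A M L ((x \<oplus> y) [^] n \<otimes> (d \<otimes> d')) z" if e: "e >= max e0 e1" for e
   proof -
    let ?I = "{a : carrier A. fmem p e A M L (a \<otimes> (d \<otimes> d')) z}"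
    have e01: "e >= e0" "e >= e1" using e by auto
    obtain n :: nat where n: "fmem p e A M L (x [^] n \<otimes> d) z"
     using x(2) e01(1) unfolding good_def by blast
    obtain m :: nat where m: "fmem p e A M L (y [^] m \<otimes> d') z"
     using y(2) e01(2) unfolding good_def by blast
    have "x [^] n : ?I"
     using fmem_smult[OF M L dc' A.m_closed[OF A.nat_pow_closed[OF x(1)] dc] z n] x(1) dc dc' by (simp add: A.m_ac)
    moreover have "y [^] m : ?I"
     using fmem_smult[OF M L dc A.m_closed[OF A.nat_pow_closed[OF y(1)] dc'] z m] y(1) dc dc' by (simp add: A.m_ac)
    ultimately have xy: "x [^] n : ?I" "y [^] m : ?I" by blast+
    \<comment> \<open>For this \<open>e\<close> the ideal \<open>?I\<close> of multipliers contains
      a power of \<open>x\<close> and a power of \<open>y\<close>, hence a power of their sum; the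
      exponent again depends on \<open>e\<close>.\<close>
    have "EX n::nat. (x \<oplus> y) [^] n : ?I"
    proof (rule ideal_local[OF A fi[OF A.m_closed[OF dc dc']] A.a_closed[OF x(1) y(1)]])
     fix Q assume Q: "primeideal Q A" "x \<oplus> y ~: Q"
     then consider "x ~: Q" | "y ~: Q" using idealD(3)[OF primeD(1)[OF Q(1)]] by blast
     then show "EX j:?I. j ~: Q"
     proof cases
      case 1
      show ?thesis using prime_pow[OF Q(1) x(1) 1, of n] xy(1) by blast
     next
      case 2
      show ?thesis using prime_pow[OF Q(1) y(1) 2, of m] xy(2) by blast
     qed
    qed
    then show ?thesis by blast
   qed
   then have "good (x \<oplus> y) (d \<otimes> d') (max e0 e1)"
    unfolding good_def using x(2) y(2) ring_circ_mult[OF _ _ A] unfolding good_def by blast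
   then show "x \<oplus> y : ?J" using x(1) y(1) by blast
  }
  fix a assume a: "a : carrier A"
  have "EX n::nat. fmem p e A M L ((a \<otimes> x) [^] n \<otimes> d) z" if e: "e >= e0" for e
  proof -
   obtain n :: nat where n: "fmem p e A M L (x [^] n \<otimes> d) z" using x(2) e unfolding good_def by blast
   have "fmem p e A M L (a [^] n \<otimes> (x [^] n \<otimes> d)) z"
    by (rule fmem_smult[OF M L _ _ z n]) (use a x(1) dc in auto)
   then show ?thesis using a x(1) dc by (auto simp: A.nat_pow_distrib A.m_assoc)
  qed
  then have "good (a \<otimes> x) d e0" using x(2) unfolding good_def by blast
  then show "a \<otimes> x : ?J" using a x(1) by blast
 qed blast
 have "\<one> : ?J"
 proof (rule ideal_local_one[OF A J])
  fix Q assume "primeideal Q A"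
  then obtain g where g: "g : carrier A" "g ~: Q" "loc_tight p g A M L z" using loc by blast
  then obtain d e0 where d: "d : carrier A" "\<And>P. minimal_prime A P ==> g ~: P ==> d ~: P"
   "\<And>e. e >= e0 ==> EX n::nat. fmem p e A M L (g [^] n \<otimes> d) z"
   unfolding loc_tight_def by blast
  \<comment> \<open>The multiplier supplied by \<open>loc_tight\<close> is exchanged for one
    avoiding all minimal primes, at the price of \<open>g^k\<close>.\<close>
  obtain c b and k :: nat where c: "c : ring_circ A" "b : carrier A" "g [^] k \<otimes> c = b \<otimes> d"
   using spread_ring_circ[OF A N g(1) d(1,2)] by blast
  have cc: "c : carrier A" using c(1) by (simp add: ring_circ_iff)
  have "EX n::nat. fmem p e A M L (g [^] n \<otimes> c) z" if e: "e >= e0" for e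
  proof -
   obtain n :: nat where n: "fmem p e A M L (g [^] n \<otimes> d) z" using d(3)[OF e] by blast
   have "fmem p e A M L (b \<otimes> (g [^] n \<otimes> d)) z"
    by (rule fmem_smult[OF M L c(2) _ z n]) (use g d in auto)
   moreover have "b \<otimes> (g [^] n \<otimes> d) = g [^] n \<otimes> (b \<otimes> d)" using g d c by (simp add: A.m_ac)
   moreover have "\<dots> = g [^] (n + k) \<otimes> c"
    unfolding c(3)[symmetric] using g cc by (simp add: A.nat_pow_mult[symmetric] A.m_assoc)
   ultimately show ?thesis by metis
  qed
  then have "good g c e0" unfolding good_def using c(1) by blast
  then show "EX j:?J. j ~: Q" using g by blast
 qed
 then obtain d e0 where d: "good \<one> d e0" by blast
 then have "d : carrier A" by (simp add: good_def ring_circ_iff)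
 then have "fmem p e A M L d z" if "e >= e0" for e using d that unfolding good_def by auto
 then show ?thesis unfolding tight_closure_fmem using d z unfolding good_def by blast
qed

section \<open>Sections over open subsets of the spectrum\<close>

definition Dset :: "('a, 'm) ring_scheme => 'a => 'a set set" where
 "Dset R f = {P : Spec R. f ~: P}"

lemma Spec_iff: "P : Spec R <-> primeideal P R"
 by (simp add: Spec_def)

lemma Dset_iff: "P : Dset R f <-> primeideal P R & f ~: P"
 by (simp add: Dset_def Spec_def)

lemma topspace_zariski: "topspace (zariski R) = Spec R"
proof -
 have "zopen R (Spec R)"
  unfolding openin_zariski
 proof (intro exI conjI)
  show "carrier R <= carrier R" ..
  have "~ carrier R <= P" if "P : Spec R" for P
  proof -
   interpret primeideal P R using that by (simp add: Spec_iff)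
   show ?thesis using I_notcarr Icarr by blast
  qed
  then show "Spec R = {P : Spec R. ~ carrier R <= P}" by blast
 qed
 then have "Spec R <= topspace (zariski R)" by (rule openin_subset)
 moreover have "topspace (zariski R) <= Spec R"
  using openin_topspace[of "zariski R"] unfolding openin_zariski by blast
 ultimately show ?thesis by blast
qed

lemma openin_zariski_iff:
 "zopen R U <-> U <= Spec R & (ALL P:U. EX f:carrier R. f ~: P & Dset R f <= U)"
proof
 assume "zopen R U"
 then obtain A where A: "A <= carrier R" "U = {P : Spec R. ~ A <= P}" unfolding openin_zariski by blast
 have "EX f:carrier R. f ~: P & Dset R f <= U" if PU: "P : U" for P
 proof -
  obtain f where "f : A" "f ~: P" using PU A(2) by blast
  moreover have "Dset R f <= U" using \<open>f : A\<close> A(2) by (auto simp: Dset_def)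
  ultimately show ?thesis using A(1) by blast
 qed
 then show "U <= Spec R & (ALL P:U. EX f:carrier R. f ~: P & Dset R f <= U)" using A(2) by blast
next
 assume U: "U <= Spec R & (ALL P:U. EX f:carrier R. f ~: P & Dset R f <= U)"
 let ?A = "{f : carrier R. Dset R f <= U}"
 have "U = {P : Spec R. ~ ?A <= P}"
 proof (intro equalityI subsetI)
  fix P assume "P : U" then show "P : {P : Spec R. ~ ?A <= P}" using U by blast
 next
  fix P assume "P : {P : Spec R. ~ ?A <= P}"
  then obtain f where "P : Spec R" "f : ?A" "f ~: P" by blast
  then have "P : Dset R f" by (simp add: Dset_def)
  then show "P : U" using \<open>f : ?A\<close> by blast
 qed
 moreover have "?A <= carrier R" by blast
 ultimately show "zopen R U" unfolding openin_zariski by (intro exI[of _ ?A] conjI)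
qed

lemma open_nbhd:
 assumes "zopen R U" "P : U"
 obtains f where "f : carrier R" "f ~: P" "Dset R f <= U" "P : Dset R f"
proof -
 obtain f where "f : carrier R" "f ~: P" "Dset R f <= U" using assms unfolding openin_zariski_iff by blast
 moreover have "P : Spec R" using assms unfolding openin_zariski_iff by blast
 ultimately show thesis using that by (simp add: Dset_def)
qed

lemma openin_Dset: "f : carrier R ==> zopen R (Dset R f)"
 unfolding openin_zariski by (intro exI[of _ "{f}"]) (auto simp: Dset_def)

lemma Dset_mult:
 assumes "cring R" "a : carrier R" "b : carrier R"
 shows "Dset R (a \<otimes>\<^sub>R b) = Dset R a Int Dset R b"
proof (rule Set.set_eqI)
 fix P
 show "P : Dset R (a \<otimes>\<^sub>R b) <-> P : Dset R a Int Dset R b"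
  using primeD(4)[of P R, OF _ assms(2,3)] by (auto simp: Dset_iff)
qed

lemma Dset_one: "Dset R \<one>\<^sub>R = Spec R"
proof (rule Set.set_eqI)
 fix P
 show "P : Dset R \<one>\<^sub>R <-> P : Spec R"
  using primeD(3)[of P R] by (auto simp: Dset_iff Spec_iff)
qed

lemma Dset_zero: "Dset R \<zero>\<^sub>R = {}"
proof -
 have "P ~: Dset R \<zero>\<^sub>R" for P using idealD(2)[OF primeD(1), of P R] by (auto simp: Dset_iff)
 then show ?thesis by blast
qed

lemma Dset_pow:
 assumes "cring R" "a : carrier R" shows "Dset R a <= Dset R (a [^]\<^sub>R (n::nat))"
 using prime_pow[OF _ assms(2)] by (auto simp: Dset_iff)

lemma spec_simps [simp]:
 "top_of (spec R) = zariski R"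
 "carrier (\<O> R U) = tilde_sub R (ring_module R) (carrier R) U"
 "s \<otimes>\<^sub>(\<O> R U) t = (\<lambda>P \<in> U. s P \<otimes>\<^sub>(lring R P) t P)"
 "\<one>\<^sub>(\<O> R U) = (\<lambda>P \<in> U. \<one>\<^sub>(lring R P))"
 "\<zero>\<^sub>(\<O> R U) = (\<lambda>P \<in> U. \<zero>\<^sub>(lring R P))"
 "s \<oplus>\<^sub>(\<O> R U) t = (\<lambda>P \<in> U. s P \<oplus>\<^sub>(lring R P) t P)"
 "Ores (spec R) U V s = restrict s V"
 by (simp_all add: spec_def)

lemma tilde_simps [simp]:
 "Sec (tilde R M) U = tilde_sub R M (carrier M) U"
 "\<zero>\<^sub>(sec (tilde R M) U) = (\<lambda>P \<in> U. \<zero>\<^sub>(lmod R P M))"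
 "s \<oplus>\<^sub>(sec (tilde R M) U) t = (\<lambda>P \<in> U. s P \<oplus>\<^sub>(lmod R P M) t P)"
 "a \<odot>\<^sub>(sec (tilde R M) U) s = (\<lambda>P \<in> U. a P \<odot>\<^sub>(lmod R P M) s P)"
 "res (tilde R M) U V s = restrict s V"
 by (simp_all add: tilde_def)

definition msec ::
 "('a, 'm) ring_scheme => ('a, 'b, 'k) module_scheme => 'a set set => 'b => 'a set => ('b \<times> 'a) set" where
 "msec R M U x = (\<lambda>P \<in> U. germ R M P x \<one>\<^sub>R)"

text \<open>A neighbourhood on which a section is one fraction contains a basic one; with basic open
  sets, shrinking turns into multiplication of elements of \<open>R\<close>.\<close>

lemma tilde_sub_iff:
 assumes U: "U <= Spec R"
 shows "s : tilde_sub R M L U <-> s : extensional U & (ALL P:U. EX w:carrier R. w ~: P & Dset R w <= U &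
   (EX x:L. EX f:carrier R. ALL Q:Dset R w. f ~: Q & s Q = germ R M Q x f))"
proof -
 have "(EX V. zopen R V & P : V & V <= U &
   (EX x:L. EX f:carrier R. ALL Q:V. f ~: Q & s Q = germ R M Q x f)) <->
   (EX w:carrier R. w ~: P & Dset R w <= U &
   (EX x:L. EX f:carrier R. ALL Q:Dset R w. f ~: Q & s Q = germ R M Q x f))" (is "?l <-> ?r")
  if PU: "P : U" for P
 proof
  assume ?l
  then obtain V x f where V: "zopen R V" "P : V" "V <= U" "x : L" "f : carrier R"
   "ALL Q:V. f ~: Q & s Q = germ R M Q x f" by blast
  obtain w where w: "w : carrier R" "w ~: P" "Dset R w <= V" "P : Dset R w" by (rule open_nbhd[OF V(1,2)])
  have "ALL Q:Dset R w. f ~: Q & s Q = germ R M Q x f" using V(6) w(3) by blast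
  moreover have "Dset R w <= U" using w(3) V(3) by blast
  ultimately show ?r using w(1,2) V(4,5) by blast
 next
  assume ?r
  then obtain w x f where w: "w : carrier R" "w ~: P" "Dset R w <= U" "x : L" "f : carrier R"
   "ALL Q:Dset R w. f ~: Q & s Q = germ R M Q x f" by blast
  have "P : Dset R w" using PU U w(2) by (auto simp: Dset_def)
  then show ?l using w openin_Dset[OF w(1)] by blast
 qed
 then show ?thesis unfolding tilde_sub_def by (simp add: Ball_def)
qed

context
 fixes R :: "('a, 'm) ring_scheme" (structure)
 assumes R: "cring R"
begin

interpretation R: cring R by (rule R)

private lemmas rm6 = ring_module_module[OF R]

lemma stalk_mult: "P : Spec R ==> mult_set R (carrier R - P)"
 using primeD(5) by (simp add: Spec_iff)

lemma open_Spec: "zopen R U ==> U <= Spec R"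
 unfolding openin_zariski_iff by blast

lemma tilde_subE:
 assumes s: "s : tilde_sub R M L U" and U: "U <= Spec R" and P: "P : U"
 obtains w x f where "w : carrier R" "w ~: P" "Dset R w <= U" "x : L" "f : carrier R"
  "ALL Q:Dset R w. f ~: Q & s Q = germ R M Q x f"
 using s P unfolding tilde_sub_iff[OF U] by blast

lemma tilde_sub_ext: "s : tilde_sub R M L U ==> s : extensional U"
 by (simp add: tilde_sub_def)

lemma tilde_subI:
 assumes U: "U <= Spec R" and "s : extensional U"
  and "\<And>P. P : U ==> EX w:carrier R. w ~: P & Dset R w <= U &
   (EX x:L. EX f:carrier R. ALL Q:Dset R w. f ~: Q & s Q = germ R M Q x f)"
 shows "s : tilde_sub R M L U"
 unfolding tilde_sub_iff[OF U] using assms by blast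

lemma tilde_sub_stalk:
 assumes s: "s : tilde_sub R M L U" and U: "U <= Spec R" and P: "P : U"
 obtains x f where "x : L" "f : carrier R - P" "s P = germ R M P x f"
proof -
 obtain w x f where *: "w : carrier R" "w ~: P" "Dset R w <= U" "x : L" "f : carrier R"
  "ALL Q:Dset R w. f ~: Q & s Q = germ R M Q x f"
  by (rule tilde_subE[OF s U P])
 have "P : Dset R w" using *(2) P U by (auto simp: Dset_def)
 then show thesis using that[of x f] * by blast
qed

lemma tilde_sub_mono: "L <= K ==> U <= Spec R ==> tilde_sub R M L U <= tilde_sub R M K U"
proof
 fix s assume a: "L <= K" "U <= Spec R" "s : tilde_sub R M L U"
 show "s : tilde_sub R M K U"
 proof (rule tilde_subI[OF a(2) tilde_sub_ext[OF a(3)]])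
  fix P assume "P : U"
  then obtain w x f where w: "w : carrier R" "w ~: P" "Dset R w <= U" "x : L" "f : carrier R"
   "ALL Q:Dset R w. f ~: Q & s Q = germ R M Q x f"
   by (rule tilde_subE[OF a(3,2)])
  then have "x : K" using a(1) by blast
  then show "EX w:carrier R. w ~: P & Dset R w <= U &
   (EX x:K. EX f:carrier R. ALL Q:Dset R w. f ~: Q & s Q = germ R M Q x f)"
   using w(1,2,3,5,6) by blast
 qed
qed

lemma tilde_sub_carrier:
 assumes M: "module R M" and L: "L <= carrier M"
  and s: "s : tilde_sub R M L U" and U: "U <= Spec R" and P: "P : U"
 shows "s P : carrier (lmod R P M)"
proof -
 have W: "mult_set R (carrier R - P)" using stalk_mult P U by blast
 obtain x f where "x : L" "f : carrier R - P" "s P = germ R M P x f"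
  by (rule tilde_sub_stalk[OF s U P])
 then show ?thesis unfolding loc_carrier[OF M W] using L by blast
qed

lemma tilde_sub_restrict:
 assumes s: "s : tilde_sub R M L U" and U: "zopen R U" and V: "zopen R V" "V <= U"
 shows "restrict s V : tilde_sub R M L V"
proof (rule tilde_subI[OF open_Spec[OF V(1)] restrict_extensional])
 fix P assume P: "P : V"
 have PU: "P : U" using P V(2) by blast
 obtain w x f where w: "w : carrier R" "w ~: P" "Dset R w <= U" "x : L" "f : carrier R"
  "ALL Q:Dset R w. f ~: Q & s Q = germ R M Q x f"
  by (rule tilde_subE[OF s open_Spec[OF U] PU])
 obtain v where v: "v : carrier R" "v ~: P" "Dset R v <= V" "P : Dset R v" by (rule open_nbhd[OF V(1) P])
 have pP: "primeideal P R" using P open_Spec[OF V(1)] by (auto simp: Spec_iff)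
 have D: "Dset R (v \<otimes> w) = Dset R v Int Dset R w" by (rule Dset_mult[OF R v(1) w(1)])
 have "v \<otimes> w ~: P" using primeD(4)[OF pP v(1) w(1)] v w by blast
 moreover have "ALL Q:Dset R (v \<otimes> w). f ~: Q & restrict s V Q = germ R M Q x f"
  using w(6) v(3) D by auto
 ultimately show "EX w:carrier R. w ~: P & Dset R w <= V &
   (EX x:L. EX f:carrier R. ALL Q:Dset R w. f ~: Q & restrict s V Q = germ R M Q x f)"
  using w(4,5) D v(3) R.m_closed[OF v(1) w(1)] by (intro bexI[of _ "v \<otimes> w"]) blast+
qed

lemma tilde_sub_add:
 assumes M: "module R M" and L: "submodule L R M" and U: "U <= Spec R"
  and s: "s : tilde_sub R M L U" and t: "t : tilde_sub R M L U"
 shows "(\<lambda>P \<in> U. s P \<oplus>\<^sub>(lmod R P M) t P) : tilde_sub R M L U"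
proof (rule tilde_subI[OF U restrict_extensional])
 interpret M: module R M by (rule M)
 note Lc = submoduleD[OF L M]
 fix P assume P: "P : U"
 obtain w x f where w: "w : carrier R" "w ~: P" "Dset R w <= U" "x : L" "f : carrier R"
  "ALL Q:Dset R w. f ~: Q & s Q = germ R M Q x f"
  by (rule tilde_subE[OF s U P])
 obtain v y g where v: "v : carrier R" "v ~: P" "Dset R v <= U" "y : L" "g : carrier R"
  "ALL Q:Dset R v. g ~: Q & t Q = germ R M Q y g"
  by (rule tilde_subE[OF t U P])
 have pP: "primeideal P R" using P U by (auto simp: Spec_iff)
 have D: "Dset R (w \<otimes> v) = Dset R w Int Dset R v" by (rule Dset_mult[OF R w(1) v(1)])
 have wv: "w \<otimes> v ~: P" using primeD(4)[OF pP w(1) v(1)] v w by blast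
 have "f \<otimes> g ~: Q & (\<lambda>P \<in> U. s P \<oplus>\<^sub>(lmod R P M) t P) Q
   = germ R M Q (g \<odot>\<^sub>M x \<oplus>\<^sub>M f \<odot>\<^sub>M y) (f \<otimes> g)" if Q: "Q : Dset R (w \<otimes> v)" for Q
 proof -
  have QS: "Q : Spec R" "Q : U" using Q D w(3) by (auto simp: Dset_def)
  have a: "f ~: Q" "s Q = germ R M Q x f" "g ~: Q" "t Q = germ R M Q y g"
   using w(6)[rule_format, of Q] v(6)[rule_format, of Q] Q D by auto
  have "f \<otimes> g ~: Q" using primeD(4)[of Q R f g] QS(1) a w(5) v(5) by (simp add: Spec_iff)
  then show ?thesis using loc_add[OF M stalk_mult[OF QS(1)], of x f y g] a w(4,5) v(4,5) Lc(7) QS(2) by simp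
 qed
 moreover have "g \<odot>\<^sub>M x \<oplus>\<^sub>M f \<odot>\<^sub>M y : L" using Lc w v by simp
 ultimately show "EX w:carrier R. w ~: P & Dset R w <= U & (EX x:L. EX f:carrier R. ALL Q:Dset R w. f ~: Q &
   (\<lambda>P \<in> U. s P \<oplus>\<^sub>(lmod R P M) t P) Q = germ R M Q x f)"
  using wv D w(1,3,5) v(1,5) R.m_closed by (intro bexI[of _ "w \<otimes> v"]) blast+
qed

lemma tilde_sub_smult:
 assumes M: "module R M" and L: "submodule L R M" and U: "U <= Spec R"
  and s: "s : tilde_sub R (ring_module R) (carrier R) U" and t: "t : tilde_sub R M L U"
 shows "(\<lambda>P \<in> U. s P \<odot>\<^sub>(lmod R P M) t P) : tilde_sub R M L U"
proof (rule tilde_subI[OF U restrict_extensional])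
 interpret M: module R M by (rule M)
 note Lc = submoduleD[OF L M]
 fix P assume P: "P : U"
 obtain w x f where w: "w : carrier R" "w ~: P" "Dset R w <= U" "x : carrier R" "f : carrier R"
  "ALL Q:Dset R w. f ~: Q & s Q = germ R (ring_module R) Q x f"
  by (rule tilde_subE[OF s U P])
 obtain v y g where v: "v : carrier R" "v ~: P" "Dset R v <= U" "y : L" "g : carrier R"
  "ALL Q:Dset R v. g ~: Q & t Q = germ R M Q y g"
  by (rule tilde_subE[OF t U P])
 have pP: "primeideal P R" using P U by (auto simp: Spec_iff)
 have D: "Dset R (w \<otimes> v) = Dset R w Int Dset R v" by (rule Dset_mult[OF R w(1) v(1)])
 have wv: "w \<otimes> v ~: P" using primeD(4)[OF pP w(1) v(1)] v w by blast
 have "f \<otimes> g ~: Q & (\<lambda>P \<in> U. s P \<odot>\<^sub>(lmod R P M) t P) Q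
   = germ R M Q (x \<odot>\<^sub>M y) (f \<otimes> g)" if Q: "Q : Dset R (w \<otimes> v)" for Q
 proof -
  have QS: "Q : Spec R" "Q : U" using Q D w(3) by (auto simp: Dset_def)
  have a: "f ~: Q" "s Q = germ R (ring_module R) Q x f" "g ~: Q" "t Q = germ R M Q y g"
   using w(6)[rule_format, of Q] v(6)[rule_format, of Q] Q D by auto
  have "f \<otimes> g ~: Q" using primeD(4)[of Q R f g] QS(1) a w(5) v(5) by (simp add: Spec_iff)
  then show ?thesis using loc_smult[OF R stalk_mult[OF QS(1)] M, of x f y g] a w(4,5) v(4,5) Lc(7) QS(2) by simp
 qed
 moreover have "x \<odot>\<^sub>M y : L" using Lc w v by simp
 ultimately show "EX w:carrier R. w ~: P & Dset R w <= U & (EX x:L. EX f:carrier R. ALL Q:Dset R w. f ~: Q &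
   (\<lambda>P \<in> U. s P \<odot>\<^sub>(lmod R P M) t P) Q = germ R M Q x f)"
  using wv D w(1,3,5) v(1,5) R.m_closed by (intro bexI[of _ "w \<otimes> v"]) blast+
qed

lemma tilde_sub_const:
 assumes U: "zopen R U" and x: "x : L" and f: "f : carrier R" "U <= Dset R f"
 shows "(\<lambda>P \<in> U. germ R M P x f) : tilde_sub R M L U"
proof (rule tilde_subI[OF open_Spec[OF U] restrict_extensional])
 fix P assume P: "P : U"
 obtain v where v: "v : carrier R" "v ~: P" "Dset R v <= U" "P : Dset R v" by (rule open_nbhd[OF U P])
 have "ALL Q:Dset R v. f ~: Q & (\<lambda>P \<in> U. germ R M P x f) Q = germ R M Q x f"
  using v(3) f(2) by (auto simp: Dset_def)
 then show "EX w:carrier R. w ~: P & Dset R w <= U & (EX y:L. EX g:carrier R. ALL Q:Dset R w. g ~: Q &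
   (\<lambda>P \<in> U. germ R M P x f) Q = germ R M Q y g)"
  using v x f(1) by blast
qed

lemma msec_in:
 assumes U: "zopen R U" and x: "x : L"
 shows "msec R M U x : tilde_sub R M L U"
 unfolding msec_def by (rule tilde_sub_const[OF U x R.one_closed]) (use open_Spec[OF U] Dset_one in auto)

lemma abelian_group_tilde:
 assumes M: "module R M" and U: "zopen R U"
 shows "abelian_group (sec (tilde R M) U)"
proof (rule abelian_groupI)
 interpret M: module R M by (rule M)
 note US = open_Spec[OF U]
 have G: "abelian_group (lmod R P M)" if "P : U" for P
  using abelian_group_loc[OF M stalk_mult] that US by blast
 note G = abelian_group.axioms(1)[OF G] G
 have c: "s P : carrier (lmod R P M)" if "s : tilde_sub R M (carrier M) U" "P : U" for s P
  by (rule tilde_sub_carrier[OF M subset_refl that(1) US that(2)])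
 note ex = extensionalityI[OF restrict_extensional restrict_extensional]
 fix s t u assume "s : Sec (tilde R M) U" "t : Sec (tilde R M) U" "u : Sec (tilde R M) U"
 then have s: "s : tilde_sub R M (carrier M) U" and t: "t : tilde_sub R M (carrier M) U" and u: "u : tilde_sub R M (carrier M) U" by auto
 show "s \<oplus>\<^sub>(sec (tilde R M) U) t : Sec (tilde R M) U"
  using tilde_sub_add[OF M M.carrier_is_submodule US s t] by simp
 show "s \<oplus>\<^sub>(sec (tilde R M) U) t = t \<oplus>\<^sub>(sec (tilde R M) U) s"
  unfolding tilde_simps by (rule ex) (use c[OF s] c[OF t] G in \<open>simp add: abelian_monoid.a_comm\<close>)
 show "s \<oplus>\<^sub>(sec (tilde R M) U) t \<oplus>\<^sub>(sec (tilde R M) U) u = s \<oplus>\<^sub>(sec (tilde R M) U) (t \<oplus>\<^sub>(sec (tilde R M) U) u)"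
  unfolding tilde_simps by (rule ex) (use c[OF s] c[OF t] c[OF u] G in \<open>simp add: abelian_monoid.a_assoc\<close>)
 show "\<zero>\<^sub>(sec (tilde R M) U) \<oplus>\<^sub>(sec (tilde R M) U) s = s"
  unfolding tilde_simps
  by (rule extensionalityI[OF restrict_extensional tilde_sub_ext[OF s]]) (use c[OF s] G in \<open>simp add: abelian_monoid.l_zero\<close>)
 \<comment> \<open>The additive inverse is the product with the section \<open>-1\<close> of the
   structure sheaf, so the closure of sections under products provides it.\<close>
 let ?m = "\<lambda>P \<in> U. msec R (ring_module R) U (\<ominus> \<one>) P \<odot>\<^sub>(lmod R P M) s P"
 have m: "?m : tilde_sub R M (carrier M) U"
  by (rule tilde_sub_smult[OF M M.carrier_is_submodule US msec_in[OF U] s]) simp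
 have "?m \<oplus>\<^sub>(sec (tilde R M) U) s = \<zero>\<^sub>(sec (tilde R M) U)"
  unfolding tilde_simps
 proof (rule ex)
  fix P assume P: "P : U"
  have W: "mult_set R (carrier R - P)" using stalk_mult P US by blast
  obtain x f where x: "x : carrier M" "f : carrier R - P" "s P = germ R M P x f"
   by (rule tilde_sub_stalk[OF s US P])
  have "?m P = germ R M P (\<ominus>\<^sub>M x) f"
   using P x mult_setD(2)[OF W] by (simp add: msec_def loc_smult[OF R W M] M.smult_l_minus)
  then show "(\<lambda>P \<in> U. ?m P \<oplus>\<^sub>(lmod R P M) s P) P = (\<lambda>P \<in> U. \<zero>\<^sub>(lmod R P M)) P"
   using P x by (simp add: loc_add_same[OF M W] M.M.l_neg frac_zero[OF M W])
 qed
 then show "EX y:Sec (tilde R M) U. y \<oplus>\<^sub>(sec (tilde R M) U) s = \<zero>\<^sub>(sec (tilde R M) U)"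
  using m by (intro bexI[of _ ?m]) auto
next
 interpret M: module R M by (rule M)
 have "msec R M U \<zero>\<^sub>M = \<zero>\<^sub>(sec (tilde R M) U)"
  unfolding tilde_simps msec_def
  by (rule restrict_ext) (use open_Spec[OF U] stalk_mult in \<open>auto simp: loc_zero[OF M]\<close>)
 then show "\<zero>\<^sub>(sec (tilde R M) U) : Sec (tilde R M) U"
  using msec_in[OF U M.M.zero_closed, of M] by simp
qed

text \<open>The structure sheaf is the sheaf associated with \<open>ring_module R\<close>; its
  additive structure and its closure under products are taken from there.\<close>

lemma Osec_eqs:
 assumes "zopen R U"
 shows "carrier (\<O> R U) = Sec (tilde R (ring_module R)) U"
  "\<zero>\<^sub>(\<O> R U) = \<zero>\<^sub>(sec (tilde R (ring_module R)) U)"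
  "s \<oplus>\<^sub>(\<O> R U) t = s \<oplus>\<^sub>(sec (tilde R (ring_module R)) U) t"
  "s \<otimes>\<^sub>(\<O> R U) t = s \<odot>\<^sub>(sec (tilde R (ring_module R)) U) t"
proof -
 have W: "P : U ==> mult_set R (carrier R - P)" for P using stalk_mult open_Spec[OF assms] by blast
 show "carrier (\<O> R U) = Sec (tilde R (ring_module R)) U" by simp
 show "\<zero>\<^sub>(\<O> R U) = \<zero>\<^sub>(sec (tilde R (ring_module R)) U)"
  unfolding tilde_simps spec_simps by (rule restrict_ext) (simp add: loc_ring_eqs[OF R W])
 show "s \<oplus>\<^sub>(\<O> R U) t = s \<oplus>\<^sub>(sec (tilde R (ring_module R)) U) t"
  unfolding tilde_simps spec_simps by (rule restrict_ext) (simp add: loc_ring_eqs[OF R W])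
 show "s \<otimes>\<^sub>(\<O> R U) t = s \<odot>\<^sub>(sec (tilde R (ring_module R)) U) t"
  unfolding tilde_simps spec_simps by (rule restrict_ext) (simp add: loc_ring_eqs[OF R W])
qed

lemma cring_Osec:
 assumes U: "zopen R U"
 shows "cring (\<O> R U)"
proof (rule cringI)
 note US = open_Spec[OF U]
 interpret T: abelian_group "sec (tilde R (ring_module R)) U" by (rule abelian_group_tilde[OF rm6 U])
 note eqs = Osec_eqs[OF U]
 show "abelian_group (\<O> R U)"
 proof (rule abelian_groupI, goal_cases)
  case (1 x y) then show ?case unfolding eqs by (rule T.a_closed)
 next
  case 2 then show ?case unfolding eqs by (rule T.zero_closed)
 next
  case (3 x y z) then show ?case unfolding eqs by (rule T.a_assoc)
 next
  case (4 x y) then show ?case unfolding eqs by (rule T.a_comm)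
 next
  case (5 x) then show ?case unfolding eqs by (rule T.l_zero)
 next
  case (6 x) then show ?case unfolding eqs using T.l_neg T.a_inv_closed by blast
 qed
 have C: "cring (lring R P)" if "P : U" for P
  using cring_loc_ring[OF R stalk_mult] that US by blast
 have c: "s P : carrier (lring R P)" if "s : carrier (\<O> R U)" "P : U" for s P
 proof -
  have "mult_set R (carrier R - P)" using stalk_mult US that by blast
  then show ?thesis using tilde_sub_carrier[OF rm6 _ _ US that(2), of "carrier R" s] that by (simp add: loc_ring_eqs[OF R])
 qed
 note ex = extensionalityI[OF restrict_extensional restrict_extensional]
 show "Group.comm_monoid (\<O> R U)"
 proof (rule comm_monoidI)
  fix s t u assume s: "s : carrier (\<O> R U)" and t: "t : carrier (\<O> R U)" and u: "u : carrier (\<O> R U)"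
  show "s \<otimes>\<^sub>(\<O> R U) t : carrier (\<O> R U)"
   unfolding eqs(4) using tilde_sub_smult[OF rm6 module.carrier_is_submodule[OF rm6] US, of s t] s t by simp
  show "s \<otimes>\<^sub>(\<O> R U) t \<otimes>\<^sub>(\<O> R U) u = s \<otimes>\<^sub>(\<O> R U) (t \<otimes>\<^sub>(\<O> R U) u)"
   unfolding spec_simps
  proof (rule ex)
   fix P assume P: "P : U"
   interpret P: cring "lring R P" by (rule C[OF P])
   show "(\<lambda>P \<in> U. (\<lambda>P \<in> U. s P \<otimes>\<^sub>(lring R P) t P) P \<otimes>\<^sub>(lring R P) u P) P
     = (\<lambda>P \<in> U. s P \<otimes>\<^sub>(lring R P) (\<lambda>P \<in> U. t P \<otimes>\<^sub>(lring R P) u P) P) P"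
    using P c[OF s P] c[OF t P] c[OF u P] by (simp add: P.m_assoc)
  qed
  show "s \<otimes>\<^sub>(\<O> R U) t = t \<otimes>\<^sub>(\<O> R U) s"
   unfolding spec_simps
  proof (rule ex)
   fix P assume P: "P : U"
   interpret P: cring "lring R P" by (rule C[OF P])
   show "(\<lambda>P \<in> U. s P \<otimes>\<^sub>(lring R P) t P) P = (\<lambda>P \<in> U. t P \<otimes>\<^sub>(lring R P) s P) P"
    using P c[OF s P] c[OF t P] by (simp add: P.m_comm)
  qed
  have se: "s : extensional U" using s tilde_sub_ext by auto
  show "\<one>\<^sub>(\<O> R U) \<otimes>\<^sub>(\<O> R U) s = s"
   unfolding spec_simps
  proof (rule extensionalityI[OF restrict_extensional se])
   fix P assume P: "P : U"
   interpret P: cring "lring R P" by (rule C[OF P])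
   show "(\<lambda>P \<in> U. (\<lambda>P \<in> U. \<one>\<^sub>(lring R P)) P \<otimes>\<^sub>(lring R P) s P) P = s P"
    using P c[OF s P] by simp
  qed
 next
  have "\<one>\<^sub>(\<O> R U) = msec R (ring_module R) U \<one>"
   unfolding spec_simps msec_def by (rule restrict_ext) (simp add: loc_ring_def)
  then show "\<one>\<^sub>(\<O> R U) : carrier (\<O> R U)"
   using msec_in[OF U R.one_closed, of "ring_module R"] by simp
 qed
 fix s t u assume s: "s : carrier (\<O> R U)" and t: "t : carrier (\<O> R U)" and u: "u : carrier (\<O> R U)"
 show "(s \<oplus>\<^sub>(\<O> R U) t) \<otimes>\<^sub>(\<O> R U) u = s \<otimes>\<^sub>(\<O> R U) u \<oplus>\<^sub>(\<O> R U) t \<otimes>\<^sub>(\<O> R U) u"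
  unfolding spec_simps
 proof (rule ex)
  fix P assume P: "P : U"
  interpret P: cring "lring R P" by (rule C[OF P])
  show "(\<lambda>P \<in> U. (\<lambda>P \<in> U. s P \<oplus>\<^sub>(lring R P) t P) P \<otimes>\<^sub>(lring R P) u P) P
    = (\<lambda>P \<in> U. (\<lambda>P \<in> U. s P \<otimes>\<^sub>(lring R P) u P) P \<oplus>\<^sub>(lring R P) (\<lambda>P \<in> U. t P \<otimes>\<^sub>(lring R P) u P) P) P"
   using P c[OF s P] c[OF t P] c[OF u P] by (simp add: P.l_distr)
 qed
qed

lemma module_tilde_sec:
 assumes M: "module R M" and U: "zopen R U"
 shows "module (\<O> R U) (sec (tilde R M) U)"
proof (rule moduleI[OF cring_Osec[OF U] abelian_group_tilde[OF M U]])
 interpret M: module R M by (rule M)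
 note US = open_Spec[OF U]
 note ex = extensionalityI[OF restrict_extensional restrict_extensional]
 have C: "module (lring R P) (lmod R P M)" if "P : U" for P
  using module_loc[OF R stalk_mult M] that US by blast
 have cr: "s P : carrier (lring R P)" if "s : carrier (\<O> R U)" "P : U" for s P
 proof -
  have "mult_set R (carrier R - P)" using stalk_mult US that by blast
  then show ?thesis using tilde_sub_carrier[OF rm6 _ _ US that(2), of "carrier R" s] that by (simp add: loc_ring_eqs[OF R])
 qed
 have c: "s P : carrier (lmod R P M)" if "s : Sec (tilde R M) U" "P : U" for s P
  by (rule tilde_sub_carrier[OF M subset_refl _ US that(2)]) (use that in auto)
 fix s assume s: "s : Sec (tilde R M) U"
 have se: "s : extensional U" using s tilde_sub_ext by auto
 show "\<one>\<^sub>(\<O> R U) \<odot>\<^sub>(sec (tilde R M) U) s = s"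
  unfolding tilde_simps spec_simps
 proof (rule extensionalityI[OF restrict_extensional se])
  fix P assume P: "P : U"
  interpret P: module "lring R P" "lmod R P M" by (rule C[OF P])
  show "(\<lambda>P \<in> U. (\<lambda>P \<in> U. \<one>\<^sub>(lring R P)) P \<odot>\<^sub>(lmod R P M) s P) P = s P"
   using P c[OF s P] by simp
 qed
 fix a assume a: "a : carrier (\<O> R U)"
 show "a \<odot>\<^sub>(sec (tilde R M) U) s : Sec (tilde R M) U"
  using tilde_sub_smult[OF M M.carrier_is_submodule US, of a s] a s by simp
 {
  fix b assume b: "b : carrier (\<O> R U)"
  show "(a \<oplus>\<^sub>(\<O> R U) b) \<odot>\<^sub>(sec (tilde R M) U) s = a \<odot>\<^sub>(sec (tilde R M) U) s \<oplus>\<^sub>(sec (tilde R M) U) b \<odot>\<^sub>(sec (tilde R M) U) s"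
   unfolding tilde_simps spec_simps
  proof (rule ex)
   fix P assume P: "P : U"
   interpret P: module "lring R P" "lmod R P M" by (rule C[OF P])
   show "(\<lambda>P \<in> U. (\<lambda>P \<in> U. a P \<oplus>\<^sub>(lring R P) b P) P \<odot>\<^sub>(lmod R P M) s P) P =
    (\<lambda>P \<in> U. (\<lambda>P \<in> U. a P \<odot>\<^sub>(lmod R P M) s P) P \<oplus>\<^sub>(lmod R P M) (\<lambda>P \<in> U. b P \<odot>\<^sub>(lmod R P M) s P) P) P"
    using P c[OF s P] cr[OF a P] cr[OF b P] by (simp add: P.smult_l_distr)
  qed
  show "(a \<otimes>\<^sub>(\<O> R U) b) \<odot>\<^sub>(sec (tilde R M) U) s = a \<odot>\<^sub>(sec (tilde R M) U) (b \<odot>\<^sub>(sec (tilde R M) U) s)"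
   unfolding tilde_simps spec_simps
  proof (rule ex)
   fix P assume P: "P : U"
   interpret P: module "lring R P" "lmod R P M" by (rule C[OF P])
   show "(\<lambda>P \<in> U. (\<lambda>P \<in> U. a P \<otimes>\<^sub>(lring R P) b P) P \<odot>\<^sub>(lmod R P M) s P) P =
    (\<lambda>P \<in> U. a P \<odot>\<^sub>(lmod R P M) (\<lambda>P \<in> U. b P \<odot>\<^sub>(lmod R P M) s P) P) P"
    using P c[OF s P] cr[OF a P] cr[OF b P] by (simp add: P.smult_assoc1)
  qed
 }
 fix t assume t: "t : Sec (tilde R M) U"
 show "a \<odot>\<^sub>(sec (tilde R M) U) (s \<oplus>\<^sub>(sec (tilde R M) U) t) = a \<odot>\<^sub>(sec (tilde R M) U) s \<oplus>\<^sub>(sec (tilde R M) U) a \<odot>\<^sub>(sec (tilde R M) U) t"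
  unfolding tilde_simps spec_simps
 proof (rule ex)
  fix P assume P: "P : U"
  interpret P: module "lring R P" "lmod R P M" by (rule C[OF P])
  show "(\<lambda>P \<in> U. a P \<odot>\<^sub>(lmod R P M) (\<lambda>P \<in> U. s P \<oplus>\<^sub>(lmod R P M) t P) P) P =
   (\<lambda>P \<in> U. (\<lambda>P \<in> U. a P \<odot>\<^sub>(lmod R P M) s P) P \<oplus>\<^sub>(lmod R P M) (\<lambda>P \<in> U. a P \<odot>\<^sub>(lmod R P M) t P) P) P"
   using P c[OF s P] c[OF t P] cr[OF a P] by (simp add: P.smult_r_distr)
 qed
qed

text \<open>Being locally a fraction can be tested on a cover. This gives both the existence of
  glued sections and the locality of the subsheaf belonging to a submodule.\<close>

lemma tilde_sub_cover:
 assumes U: "U <= Spec R" and C: "\<Union>C = U" and s: "s : extensional U"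
  and V: "\<And>V. V : C ==> restrict s V : tilde_sub R M L V"
 shows "s : tilde_sub R M L U"
proof (rule tilde_subI[OF U s])
 fix P assume "P : U"
 then obtain V where VC: "V : C" "P : V" using C by blast
 have VS: "V <= Spec R" "V <= U" using U C VC(1) by auto
 obtain w x f where w: "w : carrier R" "w ~: P" "Dset R w <= V" "x : L" "f : carrier R"
  "ALL Q:Dset R w. f ~: Q & restrict s V Q = germ R M Q x f"
  by (rule tilde_subE[OF V[OF VC(1)] VS(1) VC(2)])
 have "ALL Q:Dset R w. f ~: Q & s Q = germ R M Q x f"
 proof
  fix Q assume Q: "Q : Dset R w"
  have "restrict s V Q = s Q" using Q w(3) by auto
  then show "f ~: Q & s Q = germ R M Q x f" using w(6) Q by metis
 qed
 then show "EX w:carrier R. w ~: P & Dset R w <= U &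
   (EX x:L. EX f:carrier R. ALL Q:Dset R w. f ~: Q & s Q = germ R M Q x f)"
  using w(1-5) VS(2) by blast
qed

lemma sheaf_tilde:
 assumes M: "module R M"
 shows "sheaf_of_modules (spec R) (tilde R M)"
 unfolding sheaf_of_modules_def
proof (intro conjI allI impI)
 interpret M: module R M by (rule M)
 fix U assume "openin (top_of (spec R)) U"
 then have U: "zopen R U" by simp
 show "module (\<O> R U) (sec (tilde R M) U)" by (rule module_tilde_sec[OF M U])
 show "ALL s:Sec (tilde R M) U. res (tilde R M) U U s = s"
 proof
  fix s assume "s : Sec (tilde R M) U"
  then have "s : extensional U" using tilde_sub_ext[of s M "carrier M" U] by simp
  then show "res (tilde R M) U U s = s" by (simp add: extensional_restrict)
 qed
next
 fix U V assume "openin (top_of (spec R)) U & openin (top_of (spec R)) V & V <= U"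
 then have U: "zopen R U" "zopen R V" "V <= U" by auto
 show "res (tilde R M) U V : Sec (tilde R M) U \<rightarrow> Sec (tilde R M) V"
  using tilde_sub_restrict[OF _ U] by auto
 show "ALL s:Sec (tilde R M) U. ALL t:Sec (tilde R M) U.
   res (tilde R M) U V (s \<oplus>\<^sub>(sec (tilde R M) U) t) = res (tilde R M) U V s \<oplus>\<^sub>(sec (tilde R M) V) res (tilde R M) U V t"
  using U(3) by (auto simp: Int_absorb1 intro!: restrict_ext)
 show "ALL a:carrier (\<O> R U). ALL s:Sec (tilde R M) U.
   res (tilde R M) U V (a \<odot>\<^sub>(sec (tilde R M) U) s) = Ores (spec R) U V a \<odot>\<^sub>(sec (tilde R M) V) res (tilde R M) U V s"
  using U(3) by (auto simp: Int_absorb1 intro!: restrict_ext)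
next
 fix U V W assume "openin (top_of (spec R)) U & openin (top_of (spec R)) V & openin (top_of (spec R)) W & W <= V & V <= U"
 then show "ALL s:Sec (tilde R M) U. res (tilde R M) V W (res (tilde R M) U V s) = res (tilde R M) U W s"
  by (auto simp: Int_absorb1 intro!: restrict_ext)
next
 fix U C assume "openin (top_of (spec R)) U & open_cover (spec R) U C"
 then have U: "zopen R U" and C: "\<Union>C = U" and CO: "\<And>V. V : C ==> zopen R V"
  by (auto simp: open_cover_def)
 show "ALL s:Sec (tilde R M) U. ALL t:Sec (tilde R M) U.
   (ALL V:C. res (tilde R M) U V s = res (tilde R M) U V t) --> s = t"
 proof (intro ballI impI)
  fix s t assume s: "s : Sec (tilde R M) U" and t: "t : Sec (tilde R M) U"
   and eq: "ALL V:C. res (tilde R M) U V s = res (tilde R M) U V t"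
  show "s = t"
  proof (rule extensionalityI[of _ U])
   show "s : extensional U" "t : extensional U" using s t tilde_sub_ext by auto
   fix P assume "P : U"
   then obtain V where V: "V : C" "P : V" using C by blast
   then have "restrict s V P = restrict t V P" using eq by simp
   then show "s P = t P" using V(2) by simp
  qed
 qed
 fix sigma assume "(ALL V:C. sigma V : Sec (tilde R M) V) &
  (ALL V:C. ALL W:C. res (tilde R M) V (V Int W) (sigma V) = res (tilde R M) W (V Int W) (sigma W))"
 then have sigma: "\<And>V. V : C ==> sigma V : tilde_sub R M (carrier M) V"
  "\<And>V W. V : C ==> W : C ==> restrict (sigma V) (V Int W) = restrict (sigma W) (V Int W)" by auto
 \<comment> \<open>The value at \<open>P\<close> is read off from an arbitrary member of the cover
   containing \<open>P\<close>; compatibility on intersections makes the choice irrelevant.\<close>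
 define s where "s = (\<lambda>P \<in> U. sigma (SOME V. V : C & P : V) P)"
 have sV: "restrict s V = sigma V" if V: "V : C" for V
 proof (rule extensionalityI[OF restrict_extensional tilde_sub_ext[OF sigma(1)[OF V]]])
  fix P assume P: "P : V"
  let ?V = "SOME V. V : C & P : V"
  have V': "?V : C" "P : ?V" using someI[of "%V. V : C & P : V" V] V P by auto
  have "restrict (sigma ?V) (?V Int V) P = restrict (sigma V) (?V Int V) P" using sigma(2)[OF V'(1) V] by simp
  then have "sigma ?V P = sigma V P" using P V'(2) by simp
  moreover have "P : U" using P V C by blast
  ultimately show "restrict s V P = sigma V P" using P by (simp add: s_def)
 qed
 have "s : tilde_sub R M (carrier M) U"
  by (rule tilde_sub_cover[OF open_Spec[OF U] C]) (use sV sigma(1) in \<open>auto simp: s_def\<close>)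
 then show "EX s:Sec (tilde R M) U. ALL V:C. res (tilde R M) U V s = sigma V" using sV by auto
qed

lemma subsheaf_tilde:
 assumes M: "module R M" and L: "submodule L R M"
 shows "subsheaf_of_modules (spec R) (tilde R M) (tilde_sub R M L)"
 unfolding subsheaf_of_modules_def
proof (intro conjI allI impI)
 interpret M: module R M by (rule M)
 fix U assume "openin (top_of (spec R)) U"
 then have U: "zopen R U" by simp
 note US = open_Spec[OF U]
 show "submodule (tilde_sub R M L U) (\<O> R U) (sec (tilde R M) U)"
 proof (rule submoduleI2[OF module_tilde_sec[OF M U]])
  show "tilde_sub R M L U <= Sec (tilde R M) U"
   using tilde_sub_mono[OF submoduleD(1)[OF L M] US] by simp
  have "msec R M U \<zero>\<^sub>M = \<zero>\<^sub>(sec (tilde R M) U)"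
   unfolding tilde_simps msec_def
   by (rule restrict_ext) (use US stalk_mult in \<open>auto simp: loc_zero[OF M]\<close>)
  then show "\<zero>\<^sub>(sec (tilde R M) U) : tilde_sub R M L U"
   using msec_in[OF U submoduleD(2)[OF L M], of M] by simp
  show "x \<oplus>\<^sub>(sec (tilde R M) U) y : tilde_sub R M L U" if "x : tilde_sub R M L U" "y : tilde_sub R M L U" for x y
   using tilde_sub_add[OF M L US that] by simp
  show "a \<odot>\<^sub>(sec (tilde R M) U) x : tilde_sub R M L U" if "a : carrier (\<O> R U)" "x : tilde_sub R M L U" for a x
   using tilde_sub_smult[OF M L US _ that(2), of a] that(1) by simp
 qed
next
 fix U V assume "openin (top_of (spec R)) U & openin (top_of (spec R)) V & V <= U"
 then show "res (tilde R M) U V ` tilde_sub R M L U <= tilde_sub R M L V"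
  using tilde_sub_restrict by auto
next
 fix U C assume "openin (top_of (spec R)) U & open_cover (spec R) U C"
 then have U: "zopen R U" and C: "\<Union>C = U" by (auto simp: open_cover_def)
 show "ALL s:Sec (tilde R M) U. (ALL V:C. res (tilde R M) U V s : tilde_sub R M L V) --> s : tilde_sub R M L U"
 proof (intro ballI impI)
  fix s assume s: "s : Sec (tilde R M) U" "ALL V:C. res (tilde R M) U V s : tilde_sub R M L V"
  have "s : extensional U" using tilde_sub_ext[of s M "carrier M" U] s(1) by simp
  then show "s : tilde_sub R M L U" by (rule tilde_sub_cover[OF open_Spec[OF U] C]) (use s(2) in auto)
 qed
qed

end

section \<open>Sheaves of modules on the spectrum\<close>

definition rsec :: "('a, 'm) ring_scheme => 'a set set => 'a => 'a set => ('a \<times> 'a) set" where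
 "rsec R U r = (\<lambda>P \<in> U. germ R (ring_module R) P r \<one>\<^sub>R)"

lemma rsec_msec: "rsec R U r = msec R (ring_module R) U r"
 by (simp add: rsec_def msec_def)

lemma rsec_restrict: "V <= U ==> restrict (rsec R U r) V = rsec R V r"
 unfolding rsec_def by (auto intro!: restrict_ext simp: Int_absorb1)

text \<open>Sections over different open sets become modules over the one ring \<open>R\<close>, so
  that restriction maps are linear and can be compared with localizations of
  \<open>R\<close>-modules.\<close>

definition rmod ::
 "('a, 'm) ring_scheme => ('a, 'b) spec_mod => 'a set set => ('a, 'b) module" where
 "rmod R F U = restrict_scalars (rsec R U) (sec F U)"

abbreviation (input) ract ("_ \<odot>[_,_,_] _" [70, 0, 0, 0, 71] 70)
 where "a \<odot>[R,F,U] x \<equiv> rsec R U a \<odot>\<^sub>(sec F U) x"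

lemma rmod_simps [simp]:
 "carrier (rmod R F U) = Sec F U" "\<zero>\<^sub>(rmod R F U) = \<zero>\<^sub>(sec F U)"
 "x \<oplus>\<^sub>(rmod R F U) y = x \<oplus>\<^sub>(sec F U) y" "a \<odot>\<^sub>(rmod R F U) x = a \<odot>[R,F,U] x"
 by (simp_all add: rmod_def)

context
 fixes R :: "('a, 'm) ring_scheme" (structure)
 assumes R: "cring R"
begin

interpretation R: cring R by (rule R)

private lemmas rm7 = ring_module_module[OF R]

lemma rsec_closed: "zopen R U ==> r : carrier R ==> rsec R U r : carrier (\<O> R U)"
 using msec_in[OF R, of U r "carrier R" "ring_module R"] by (simp add: rsec_msec)

lemma rsec_hom:
 assumes U: "zopen R U"
 shows "rsec R U : ring_hom R (\<O> R U)"
proof (rule ring_hom_memI)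
 have W: "mult_set R (carrier R - P)" if "P : U" for P
  using stalk_mult[OF R] that open_Spec[OF R U] by blast
 show "rsec R U x : carrier (\<O> R U)" if "x : carrier R" for x by (rule rsec_closed[OF U that])
 show "rsec R U (x \<otimes> y) = rsec R U x \<otimes>\<^sub>(\<O> R U) rsec R U y" if "x : carrier R" "y : carrier R" for x y
  unfolding rsec_def spec_simps
  by (rule restrict_ext) (use that ring_hom_mult[OF loc_ring_hom[OF R W]] in simp)
 show "rsec R U (x \<oplus> y) = rsec R U x \<oplus>\<^sub>(\<O> R U) rsec R U y" if "x : carrier R" "y : carrier R" for x y
  unfolding rsec_def spec_simps
  by (rule restrict_ext) (use that ring_hom_add[OF loc_ring_hom[OF R W]] in simp)
 show "rsec R U \<one> = \<one>\<^sub>(\<O> R U)"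
  unfolding rsec_def spec_simps by (rule restrict_ext) (use ring_hom_one[OF loc_ring_hom[OF R W]] in simp)
qed

lemma rsec_unit:
 assumes U: "zopen R U" and r: "r : carrier R" "U <= Dset R r"
 shows "rsec R U r : Units (\<O> R U)"
proof -
 interpret O: cring "\<O> R U" by (rule cring_Osec[OF R U])
 let ?i = "\<lambda>P \<in> U. germ R (ring_module R) P \<one> r"
 have i: "?i : carrier (\<O> R U)"
  using tilde_sub_const[OF R U R.one_closed r, of "ring_module R"] by simp
 have "rsec R U r \<otimes>\<^sub>(\<O> R U) ?i = \<one>\<^sub>(\<O> R U)"
  unfolding rsec_def spec_simps
 proof (rule restrict_ext)
  fix P assume P: "P : U"
  have W: "mult_set R (carrier R - P)" using stalk_mult[OF R] P open_Spec[OF R U] by blast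
  have rP: "r : carrier R - P" using P r by (auto simp: Dset_def)
  show "restrict (%P. germ R (ring_module R) P r \<one>) U P \<otimes>\<^sub>(lring R P) ?i P = \<one>\<^sub>(lring R P)"
   using loc_ring_inverse[OF R W rP mult_setD(2)[OF W]] P by simp
 qed
 moreover have "?i \<otimes>\<^sub>(\<O> R U) rsec R U r = rsec R U r \<otimes>\<^sub>(\<O> R U) ?i"
  by (rule O.m_comm[OF i rsec_closed[OF U r(1)]])
 ultimately show ?thesis unfolding Units_def using rsec_closed[OF U r(1)] i by (metis (mono_tags, lifting) mem_Collect_eq)
qed

text \<open>At a point \<open>P\<close> of \<open>U\<close> an inverse of \<open>r\<close> gives
  \<open>v r x = v g\<close> with \<open>v\<close> and \<open>g\<close> outside \<open>P\<close>,
  which rules out that \<open>r\<close> is in \<open>P\<close>.\<close>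

lemma rsec_unit_converse:
 assumes U: "zopen R U" and r: "r : carrier R" and u: "rsec R U r : Units (\<O> R U)"
 shows "U <= Dset R r"
proof
 fix P assume P: "P : U"
 have PS: "P : Spec R" using P open_Spec[OF R U] by blast
 then have pP: "primeideal P R" by (simp add: Spec_iff)
 have W: "mult_set R (carrier R - P)" using stalk_mult[OF R PS] .
 obtain b where b: "b : carrier (\<O> R U)" "rsec R U r \<otimes>\<^sub>(\<O> R U) b = \<one>\<^sub>(\<O> R U)"
  using u unfolding Units_def by blast
 obtain x g where x: "x : carrier R" "g : carrier R - P" "b P = germ R (ring_module R) P x g"
  by (rule tilde_sub_stalk[OF R b(1)[unfolded spec_simps] open_Spec[OF R U] P])
 have "(rsec R U r \<otimes>\<^sub>(\<O> R U) b) P = \<one>\<^sub>(\<O> R U) P" using b(2) by simp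
 then have "germ R (ring_module R) P r \<one> \<otimes>\<^sub>(lring R P) germ R (ring_module R) P x g
   = germ R (ring_module R) P \<one> \<one>"
  using P x(3) by (simp add: rsec_def loc_ring_def)
 then have "germ R (ring_module R) P (r \<otimes> x) (\<one> \<otimes> g) = germ R (ring_module R) P \<one> \<one>"
  using loc_ring_mult[OF R W r mult_setD(2)[OF W] x(1,2)] by simp
 then obtain v where v: "v : carrier R - P" "v \<otimes> (r \<otimes> x) = v \<otimes> g"
  using frac_eq_iff[OF rm7 W, of "r \<otimes> x" "\<one> \<otimes> g" "\<one>" "\<one>"] x r mult_setD(2)[OF W] by auto
 have "v \<otimes> g ~: P" using primeD(4)[OF pP, of v g] v(1) x(2) by blast
 moreover have "v \<otimes> (r \<otimes> x) : P" if "r : P"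
  using primeD(4)[OF pP] v(1) x(1) r that by simp
 ultimately show "P : Dset R r" using v(2) PS by (auto simp: Dset_def)
qed

end

text \<open>For \<open>U = Spec R\<close> this is the form in which quasi-coherence is used: restriction to \<open>D(r)\<close> inverts \<open>r\<close>.\<close>

definition qcl ::
 "('a, 'm) ring_scheme => ('a, 'b) spec_mod => 'a set set => bool" where
 "qcl R F U <-> (ALL r:carrier R. loc_at R r id (rmod R F U) (rmod R F (U Int Dset R r)) (res F U (U Int Dset R r)))"

locale spec_sheaf =
 fixes R :: "('a, 'm) ring_scheme" (structure) and F :: "('a, 'b) spec_mod"
 assumes R: "cring R" and F: "sheaf_of_modules (spec R) F"
begin

sublocale R: cring R by (rule R)

abbreviation "op U \<equiv> zopen R U"
abbreviation "D f \<equiv> Dset R f"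
abbreviation "X \<equiv> Spec R"

lemma op_D [simp]: "f : carrier R ==> op (D f)" by (rule openin_Dset)

lemma op_X [simp]: "op X" using op_D[OF R.one_closed] by (simp add: Dset_one)

lemma op_Int [simp]: "op U ==> op V ==> op (U Int V)" by (rule openin_Int)

lemma D_sub [simp]: "D f <= X" by (auto simp: Dset_def)

lemma op_sub: "op U ==> U <= X" by (rule open_Spec[OF R])

lemma smod: "op U ==> module (\<O> R U) (sec F U)"
 using F unfolding sheaf_of_modules_def by simp

lemma rmod_module: "op U ==> module R (rmod R F U)"
 unfolding rmod_def by (rule restrict_scalars_module[OF smod R rsec_hom[OF R]])

lemma res_semilin:
 assumes "op U" "op V" "V <= U"
 shows "semilinear (\<O> R U) (%s. restrict s V) (sec F U) (sec F V) (res F U V)"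
 using F assms unfolding sheaf_of_modules_def semilinear_def by simp

lemma res_lin:
 assumes "op U" "op V" "V <= U"
 shows "semilinear R id (rmod R F U) (rmod R F V) (res F U V)"
 by (rule semilinearI)
   (use semilinearD[OF res_semilin[OF assms]] rsec_closed[OF R assms(1)] rsec_restrict[OF assms(3), of R] in simp_all)

lemma res_closed [simp]: "op U ==> op V ==> V <= U ==> s : Sec F U ==> res F U V s : Sec F V"
 using semilinearD(1)[OF res_semilin] by blast

lemma res_add: "op U ==> op V ==> V <= U ==> s : Sec F U ==> t : Sec F U ==>
  res F U V (s \<oplus>\<^sub>(sec F U) t) = res F U V s \<oplus>\<^sub>(sec F V) res F U V t"
 using semilinearD(2)[OF res_semilin] by blast

lemma res_smult: "op U ==> op V ==> V <= U ==> a : carrier (\<O> R U) ==> s : Sec F U ==>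
  res F U V (a \<odot>\<^sub>(sec F U) s) = restrict a V \<odot>\<^sub>(sec F V) res F U V s"
 using semilinearD(3)[OF res_semilin] by blast

lemma res_rsmult: "op U ==> op V ==> V <= U ==> r : carrier R ==> s : Sec F U ==>
  res F U V (r \<odot>[R,F,U] s) = r \<odot>[R,F,V] res F U V s"
 by (simp add: res_smult rsec_closed[OF R, unfolded spec_simps] rsec_restrict)

lemma res_zero: "op U ==> op V ==> V <= U ==> res F U V \<zero>\<^sub>(sec F U) = \<zero>\<^sub>(sec F V)"
 by (rule semilinear_zero[OF res_semilin]) (auto intro: module_abelian[OF smod])

lemma res_minus: "op U ==> op V ==> V <= U ==> s : Sec F U ==> t : Sec F U ==>
  res F U V (s \<ominus>\<^sub>(sec F U) t) = res F U V s \<ominus>\<^sub>(sec F V) res F U V t"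
 by (rule semilinear_minus[OF res_semilin]) (auto intro: module_abelian[OF smod])

lemma res_id [simp]: "op U ==> s : Sec F U ==> res F U U s = s"
 using F unfolding sheaf_of_modules_def by simp

lemma res_comp: "op U ==> op V ==> op W ==> W <= V ==> V <= U ==> s : Sec F U ==>
  res F V W (res F U V s) = res F U W s"
 using F unfolding sheaf_of_modules_def by simp

lemma smult_closed [simp]: "op U ==> a : carrier (\<O> R U) ==> s : Sec F U ==> a \<odot>\<^sub>(sec F U) s : Sec F U"
 using module.smult_closed[OF smod] .

lemma rsmult_closed [simp]: "op U ==> r : carrier R ==> s : Sec F U ==> r \<odot>[R,F,U] s : Sec F U"
 using module.smult_closed[OF rmod_module, of U r s] by simp

lemma rsmult_mult: "op U ==> a : carrier R ==> b : carrier R ==> s : Sec F U ==>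
  (a \<otimes> b) \<odot>[R,F,U] s = a \<odot>[R,F,U] (b \<odot>[R,F,U] s)"
 using module.smult_assoc1[OF rmod_module, of U a b s] by simp

lemma rsmult_zero: "op U ==> a : carrier R ==> a \<odot>[R,F,U] \<zero>\<^sub>(sec F U) = \<zero>\<^sub>(sec F U)"
 using module.smult_r_null[OF rmod_module, of U a] by simp

lemma rsmult_one: "op U ==> s : Sec F U ==> rsec R U \<one> \<odot>\<^sub>(sec F U) s = s"
 using module.smult_one[OF rmod_module, of U s] by simp

lemma zero_closed [simp]: "op U ==> \<zero>\<^sub>(sec F U) : Sec F U"
 using abelian_monoid.zero_closed[OF abelian_group.axioms(1)[OF module_abelian[OF smod]]] .

lemmas F_cover = F[unfolded sheaf_of_modules_def, THEN conjunct2, THEN conjunct2, THEN conjunct2, THEN conjunct2,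
 THEN HOL.spec, THEN HOL.spec, THEN mp]

lemma sep:
 assumes U: "op U" and C: "\<And>V. V : C ==> op V" "\<Union>C = U" and st: "s : Sec F U" "t : Sec F U"
  and eq: "\<And>V. V : C ==> res F U V s = res F U V t"
 shows "s = t"
proof -
 have "openin (top_of (spec R)) U & open_cover (spec R) U C"
  using U C by (auto simp: open_cover_def)
 from conjunct1[OF F_cover[OF this], rule_format, OF st] eq show ?thesis by simp
qed

lemma sep_local:
 assumes U: "op U" and st: "s : Sec F U" "t : Sec F U"
  and eq: "\<And>P. P : U ==> EX w:carrier R. w ~: P & D w <= U & res F U (D w) s = res F U (D w) t"
 shows "s = t"
proof (rule sep[OF U _ _ st])
 let ?C = "{D w | w. w : carrier R & D w <= U & res F U (D w) s = res F U (D w) t}"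
 show "V : ?C ==> op V" "V : ?C ==> res F U V s = res F U V t" for V by auto
 show "\<Union>?C = U"
 proof (intro equalityI subsetI)
  fix P assume P: "P : U"
  then obtain w where w: "w : carrier R" "w ~: P" "D w <= U" "res F U (D w) s = res F U (D w) t" using eq by blast
  have "P : D w" using w(2) P op_sub[OF U] by (auto simp: Dset_def)
  then show "P : \<Union>?C" using w by blast
 qed blast
qed

text \<open>The sheaf axiom indexes local sections by the open sets themselves. In an indexed
  family, two indices with the same open set carry the same section, by compatibility on their
  intersection.\<close>

lemma glue:
 assumes V: "\<And>i. i : I ==> op (V i)" and U: "\<Union>(V ` I) = U" and s: "\<And>i. i : I ==> s i : Sec F (V i)"
  and eq: "\<And>i j. i : I ==> j : I ==> res F (V i) (V i Int V j) (s i) = res F (V j) (V i Int V j) (s j)"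
 shows "EX u:Sec F U. ALL i:I. res F U (V i) u = s i"
proof -
 define sigma where "sigma Z = s (SOME i. i : I & V i = Z)" for Z
 have sigma: "sigma (V i) = s i" if i: "i : I" for i
 proof -
  let ?j = "SOME j. j : I & V j = V i"
  have j: "?j : I" "V ?j = V i" using someI[of "%j. j : I & V j = V i" i] i by auto
  have "res F (V i) (V i) (s i) = res F (V i) (V i) (s ?j)" using eq[OF i j(1)] j(2) by simp
  then show ?thesis using s[OF i] s[OF j(1)] j(2) V[OF i] by (simp add: sigma_def)
 qed
 have oU: "op U" using U V openin_Union[of "V ` I" "zariski R"] by blast
 have cov: "open_cover (spec R) U (V ` I)" using V U by (auto simp: open_cover_def)
 have cond: "openin (top_of (spec R)) U & open_cover (spec R) U (V ` I)" using oU cov by simp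
 have "(ALL Z:V ` I. sigma Z : Sec F Z) & (ALL Y:V ` I. ALL Z:V ` I. res F Y (Y Int Z) (sigma Y) = res F Z (Y Int Z) (sigma Z))"
  using sigma s eq by auto
 then have "EX u:Sec F U. ALL Z:V ` I. res F U Z u = sigma Z"
  by (rule conjunct2[OF F_cover[OF cond], THEN HOL.spec, THEN mp])
 then show ?thesis using sigma by auto
qed

lemma glue2:
 assumes V: "op V" "op W" and s: "s : Sec F V" "t : Sec F W"
  and eq: "res F V (V Int W) s = res F W (V Int W) t"
 shows "EX u:Sec F (V Un W). res F (V Un W) V u = s & res F (V Un W) W u = t"
proof -
 let ?V = "%b. if b then V else W" and ?s = "%b. if b then s else t"
 have "EX u:Sec F (V Un W). ALL b:UNIV. res F (V Un W) (?V b) u = ?s b"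
 proof (rule glue)
  show "\<Union>(?V ` UNIV) = V Un W" by (auto simp: UNIV_bool)
  show "res F (?V i) (?V i Int ?V j) (?s i) = res F (?V j) (?V i Int ?V j) (?s j)" for i j
   using eq by (auto simp: Int_commute)
 qed (use V s in auto)
 then obtain u where u: "u : Sec F (V Un W)" "ALL b:UNIV. res F (V Un W) (?V b) u = ?s b" by blast
 have "res F (V Un W) V u = s" using u(2)[rule_format, of True] by simp
 moreover have "res F (V Un W) W u = t" using u(2)[rule_format, of False] by simp
 ultimately show ?thesis using u(1) by blast
qed

lemma sec_empty: "s : carrier (sec F {}) ==> t : carrier (sec F {}) ==> s = t"
 by (rule sep[of "{}" "{}"]) auto

lemma unit_cancel:
 assumes V: "op V" "r : carrier R" "V <= D r" and s: "s : Sec F V" "t : Sec F V"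
  and eq: "r \<odot>[R,F,V] s = r \<odot>[R,F,V] t"
 shows "s = t"
 by (rule unit_smult_cancel[OF smod[OF V(1)] rsec_unit[OF R V] s eq])

lemma unit_div:
 assumes V: "op V" "r : carrier R" "V <= D r" and s: "s : Sec F V"
 shows "EX t:Sec F V. r \<odot>[R,F,V] t = s"
proof -
 interpret M: module "\<O> R V" "sec F V" by (rule smod[OF V(1)])
 note u = rsec_unit[OF R V]
 let ?t = "inv\<^bsub>\<O> R V\<^esub> (rsec R V r) \<odot>\<^sub>(sec F V) s"
 have i: "inv\<^bsub>\<O> R V\<^esub> (rsec R V r) : carrier (\<O> R V)" using M.R.Units_inv_closed[OF u] .
 have rc: "rsec R V r : carrier (\<O> R V)" using M.R.Units_closed[OF u] .
 have "r \<odot>[R,F,V] ?t = (rsec R V r \<otimes>\<^sub>(\<O> R V) inv\<^bsub>\<O> R V\<^esub> (rsec R V r)) \<odot>\<^sub>(sec F V) s"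
  by (rule M.smult_assoc1[OF rc i s, symmetric])
 also have "\<dots> = s" unfolding M.R.Units_r_inv[OF u] using s by (rule M.smult_one)
 finally show ?thesis using M.smult_closed[OF i s] by blast
qed

lemma D_mult: "a : carrier R ==> b : carrier R ==> D (a \<otimes> b) = D a Int D b"
 by (rule Dset_mult[OF R])

section \<open>Annihilating and extending sections by powers of an element\<close>

lemma pow_ge:
 assumes "op U" "r : carrier R" "s : Sec F U" "n <= m"
  and "(r [^] (n::nat)) \<odot>[R,F,U] s = \<zero>\<^sub>(sec F U)"
 shows "(r [^] m) \<odot>[R,F,U] s = \<zero>\<^sub>(sec F U)"
proof -
 have "r [^] m = r [^] (m - n) \<otimes> r [^] n" using assms(2,4) by (simp add: R.nat_pow_mult)
 then show ?thesis using assms rsmult_mult[OF assms(1), of "r [^] (m - n)" "r [^] n" s]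
  by (simp add: rsmult_zero)
qed

text \<open>The elements \<open>g\<close> such that some power of \<open>h\<close> kills
  \<open>t\<close> on the intersection of D(f) and D(g) form an ideal, exponents being raised to a
  common maximum. Local vanishing puts a power of \<open>f\<close> into it, and D(f^k) contains
  D(f).\<close>

lemma vanish_local:
 assumes f: "f : carrier R" "h : carrier R" and t: "t : Sec F (D f)"
  and loc: "\<And>P. P : D f ==> EX w:carrier R. w ~: P & D w <= D f &
    (EX n::nat. (h [^] n) \<odot>[R,F,D w] res F (D f) (D w) t = \<zero>\<^sub>(sec F (D w)))"
 shows "EX n::nat. (h [^] n) \<odot>[R,F,D f] t = \<zero>\<^sub>(sec F (D f))"
proof -
 define van where "van g n <-> (let V = D f Int D g in
  (h [^] (n::nat)) \<odot>[R,F,V] res F (D f) V t = \<zero>\<^sub>(sec F V))" for g n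
 have van_mono: "van g m" if "van g n" "n <= m" "g : carrier R" for g n m
  using pow_ge[of "D f Int D g" h "res F (D f) (D f Int D g) t" n m] that f t unfolding van_def Let_def by simp
 have van_sub: "(h [^] (n::nat)) \<odot>[R,F,V] res F (D f) V t = \<zero>\<^sub>(sec F V)"
  if "van g n" "g : carrier R" "op V" "V <= D f Int D g" for g n V
 proof -
  let ?V = "D f Int D g"
  have o: "op ?V" using that f by simp
  have "res F ?V V ((h [^] n) \<odot>[R,F,?V] res F (D f) ?V t) = \<zero>\<^sub>(sec F V)"
   using that(1) res_zero[OF o that(3,4)] unfolding van_def Let_def by simp
  then show ?thesis using o f t that by (simp add: res_rsmult res_comp)
 qed
 let ?J = "{g : carrier R. EX n. van g n}"
 have J: "ideal ?J R"
 proof (rule idealI2[OF R])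
  \<comment> \<open>D(0) is empty, and over the empty set all sections agree, by separation for the
    empty cover.\<close>
  have "van \<zero> 0" unfolding van_def Let_def Dset_zero using t f by (auto intro!: sec_empty simp: Int_empty_right)
  then show "\<zero> : ?J" by blast
  fix x assume "x : ?J"
  then obtain n where x: "x : carrier R" "van x n" by blast
  {
   fix y assume "y : ?J"
   then obtain m where y: "y : carrier R" "van y m" by blast
   let ?k = "max n m"
   have v: "van x ?k" "van y ?k" using van_mono[OF x(2) _ x(1)] van_mono[OF y(2) _ y(1)] by auto
   let ?V = "D f Int D (x \<oplus> y)"
   have oV: "op ?V" using f x(1) y(1) by simp
   have tV: "res F (D f) ?V t : Sec F ?V" using t f oV by simp
   have "van (x \<oplus> y) ?k" unfolding van_def Let_def
   proof (rule sep_local[OF oV])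
    fix P assume P: "P : ?V"
    then have pP: "primeideal P R" "f ~: P" "x \<oplus> y ~: P" by (auto simp: Dset_iff)
    have "EX z:carrier R. z ~: P & van z ?k"
     using idealD(3)[OF primeD(1)[OF pP(1)]] pP(3) v x(1) y(1) by blast
    then obtain z where z: "z : carrier R" "z ~: P" "van z ?k" by blast
    let ?w = "(f \<otimes> (x \<oplus> y)) \<otimes> z"
    have w: "?w : carrier R" "D ?w = D f Int D (x \<oplus> y) Int D z" using f x(1) y(1) z(1) by (auto simp: D_mult)
    have wP: "?w ~: P" using pP z P w(2) by (auto simp: Dset_iff)
    have "res F ?V (D ?w) ((h [^] ?k) \<odot>[R,F,?V] res F (D f) ?V t)
     = (h [^] ?k) \<odot>[R,F,D ?w] res F (D f) (D ?w) t"
    proof -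
     have o: "op (D ?w)" "D ?w <= ?V" "?V <= D f" using op_D[OF w(1)] unfolding w(2) by auto
     show ?thesis
      using res_rsmult[OF oV o(1,2) _ tV, of "h [^] ?k"] res_comp[OF op_D[OF f(1)] oV o(1,2,3) t] f(2) by simp
    qed
    also have "\<dots> = \<zero>\<^sub>(sec F (D ?w))" by (rule van_sub[OF z(3,1)]) (use op_D[OF w(1)] w(2) in auto)
    also have "\<dots> = res F ?V (D ?w) \<zero>\<^sub>(sec F ?V)" by (rule res_zero[OF oV op_D[OF w(1)], symmetric]) (use w(2) in auto)
    finally show "EX w:carrier R. w ~: P & D w <= ?V &
      res F ?V (D w) ((h [^] ?k) \<odot>[R,F,?V] res F (D f) ?V t) = res F ?V (D w) \<zero>\<^sub>(sec F ?V)"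
     using w wP by blast
   qed (use oV tV f in auto)
   then show "x \<oplus> y : ?J" using x(1) y(1) by blast
  }
  fix a assume a: "a : carrier R"
  have "van (a \<otimes> x) n" unfolding van_def Let_def
   by (rule van_sub[OF x(2,1)]) (use a x f in \<open>auto simp: D_mult\<close>)
  then show "a \<otimes> x : ?J" using a x(1) by blast
 qed blast
 have "EX k::nat. f [^] k : ?J"
 proof (rule ideal_local[OF R J f(1)])
  fix Q assume Q: "primeideal Q R" "f ~: Q"
  then have "Q : D f" by (simp add: Dset_iff)
  then obtain w and n :: nat where w: "w : carrier R" "w ~: Q" "D w <= D f"
   "(h [^] n) \<odot>[R,F,D w] res F (D f) (D w) t = \<zero>\<^sub>(sec F (D w))"
   using loc by blast
  have "D f Int D w = D w" using w(3) by blast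
  then have "van w n" using w(4) by (simp add: van_def)
  then show "EX j:?J. j ~: Q" using w(1,2) by blast
 qed
 then obtain k n :: nat where k: "van (f [^] k) n" by blast
 have "D f Int D (f [^] k) = D f" using Dset_pow[OF R f(1), of k] by blast
 then show ?thesis using k t f by (auto simp: van_def Let_def)
qed

lemma qclD:
 assumes "qcl R F U" "r : carrier R"
 shows "t : Sec F U ==> res F U (U Int D r) t = \<zero>\<^sub>(sec F (U Int D r)) ==>
   EX n::nat. (r [^] n) \<odot>[R,F,U] t = \<zero>\<^sub>(sec F U)"
  and "t : Sec F (U Int D r) ==>
   EX n::nat. EX t':Sec F U. (r [^] n) \<odot>[R,F,U Int D r] t = res F U (U Int D r) t'"
 using loc_atD(2,3)[OF assms(1)[unfolded qcl_def, rule_format, OF assms(2)], of t] by auto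

lemma qclI:
 assumes U: "op U"
  and "\<And>r t. r : carrier R ==> t : Sec F U ==> res F U (U Int D r) t = \<zero>\<^sub>(sec F (U Int D r)) ==>
   EX n::nat. (r [^] n) \<odot>[R,F,U] t = \<zero>\<^sub>(sec F U)"
  and "\<And>r t. r : carrier R ==> t : Sec F (U Int D r) ==>
   EX n::nat. EX t':Sec F U. (r [^] n) \<odot>[R,F,U Int D r] t = res F U (U Int D r) t'"
 shows "qcl R F U"
 unfolding qcl_def loc_at_def using assms res_lin[OF U] by simp

text \<open>A section over D(w) extends to \<open>U\<close> after multiplication by a power of
  \<open>w\<close>. There the hypothesis is applied to \<open>w r\<close>, and afterwards the powers
  of \<open>w\<close> are cancelled, as \<open>w\<close> is a unit on D(w).\<close>

lemma qcl_sub: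
 assumes q: "qcl R F U" and U: "op U" and w: "w : carrier R" "D w <= U"
 shows "qcl R F (D w)"
proof (rule qclI[OF op_D[OF w(1)]])
 have UD: "U Int D w = D w" using w(2) by blast
 fix r t assume r: "r : carrier R"
 have D: "D w Int D r = D (w \<otimes> r)" "U Int D (w \<otimes> r) = D (w \<otimes> r)" "D (w \<otimes> r) <= D w"
  using w r by (auto simp: D_mult)
 have wr: "w \<otimes> r : carrier R" using w r by simp
 {
  assume t: "t : Sec F (D w)" and t0: "res F (D w) (D w Int D r) t = \<zero>\<^sub>(sec F (D w Int D r))"
  obtain n :: nat and t' where t': "t' : Sec F U" "(w [^] n) \<odot>[R,F,D w] t = res F U (D w) t'"
   using qclD(2)[OF q w(1), of t] t UD by auto
  have "res F U (D (w \<otimes> r)) t' = res F (D w) (D (w \<otimes> r)) (res F U (D w) t')"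
   using res_comp[of U "D w" "D (w \<otimes> r)" t'] U w wr D(3) t' by simp
  also have "\<dots> = (w [^] n) \<odot>[R,F,D (w \<otimes> r)] res F (D w) (D (w \<otimes> r)) t"
   unfolding t'(2)[symmetric] using res_rsmult[of "D w" "D (w \<otimes> r)" "w [^] n" t] w wr D(3) t by simp
  also have "\<dots> = \<zero>\<^bsub>sec F (D (w \<otimes> r))\<^esub>" using t0 w wr unfolding D(1) by (simp add: rsmult_zero)
  finally obtain m :: nat where m: "((w \<otimes> r) [^] m) \<odot>[R,F,U] t' = \<zero>\<^sub>(sec F U)"
   using qclD(1)[OF q wr t'(1)] unfolding D(2) by blast
  have "((w \<otimes> r) [^] m) \<odot>[R,F,D w] res F U (D w) t' = \<zero>\<^sub>(sec F (D w))"
   using res_rsmult[of U "D w" "(w \<otimes> r) [^] m" t'] U w wr t'(1) m res_zero[of U "D w"] by simp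
  then have "((w \<otimes> r) [^] m \<otimes> w [^] n) \<odot>[R,F,D w] t = \<zero>\<^sub>(sec F (D w))"
   unfolding t'(2)[symmetric] using rsmult_mult[of "D w" "(w \<otimes> r) [^] m" "w [^] n" t] w wr t by simp
  moreover have "(w \<otimes> r) [^] m \<otimes> w [^] n = w [^] (m + n) \<otimes> r [^] m"
   using w r by (simp add: R.nat_pow_distrib R.nat_pow_mult[symmetric] R.m_ac)
  ultimately have "(w [^] (m + n)) \<odot>[R,F,D w] ((r [^] m) \<odot>[R,F,D w] t)
    = (w [^] (m + n)) \<odot>[R,F,D w] \<zero>\<^sub>(sec F (D w))"
   using w r t by (simp add: rsmult_mult rsmult_zero)
  then have "(r [^] m) \<odot>[R,F,D w] t = \<zero>\<^sub>(sec F (D w))"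
   by (rule unit_cancel[rotated -1]) (use w r t Dset_pow[OF R w(1)] in auto)
  then show "EX n::nat. (r [^] n) \<odot>[R,F,D w] t = \<zero>\<^sub>(sec F (D w))" by blast
 }
 assume t: "t : Sec F (D w Int D r)"
 obtain n :: nat and t' where t': "t' : Sec F U"
  "((w \<otimes> r) [^] n) \<odot>[R,F,D (w \<otimes> r)] t = res F U (D (w \<otimes> r)) t'"
  using qclD(2)[OF q wr, of t] t unfolding D by auto
 obtain t'' where t'': "t'' : Sec F (D w)" "(w [^] n) \<odot>[R,F,D w] t'' = res F U (D w) t'"
  using unit_div[of "D w" "w [^] n" "res F U (D w) t'"] w U t'(1) Dset_pow[OF R w(1), of n] by auto
 let ?V = "D (w \<otimes> r)"
 have tV: "t : Sec F ?V" using t D(1) by simp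
 have oV: "op ?V" using wr by simp
 have "(w [^] n) \<odot>[R,F,?V] ((r [^] n) \<odot>[R,F,?V] t) = res F U ?V t'"
  unfolding t'(2)[symmetric] using w r tV oV by (simp add: R.nat_pow_distrib rsmult_mult)
 also have "\<dots> = res F (D w) ?V (res F U (D w) t')"
  using res_comp[of U "D w" ?V t'] U w oV D(3) t'(1) by simp
 also have "\<dots> = (w [^] n) \<odot>[R,F,?V] res F (D w) ?V t''"
  unfolding t''(2)[symmetric] using res_rsmult[of "D w" ?V "w [^] n" t''] w oV D(3) t''(1) by simp
 finally have "(r [^] n) \<odot>[R,F,?V] t = res F (D w) ?V t''"
  by (rule unit_cancel[rotated -1]) (use w r tV oV t'' D(3) Dset_pow[OF R w(1)] in auto)
 then show "EX n::nat. EX t':Sec F (D w). (r [^] n) \<odot>[R,F,D w Int D r] t = res F (D w) (D w Int D r) t'"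
  unfolding D(1) using t''(1) by blast
qed

context
 assumes loc: "\<And>P. P : X ==> EX w:carrier R. w ~: P & qcl R F (D w)"
begin

text \<open>Near each point of D(c) the property of some D(w) passes to D(w c) and gives a power of
  \<open>r\<close> killing \<open>t\<close> there; \<open>vanish_local\<close> finds one exponent
  for all of D(c).\<close>

lemma vanish_on_overlap:
 assumes c: "c : carrier R" and r: "r : carrier R" and t: "t : Sec F (D c)"
  and t0: "res F (D c) (D c Int D r) t = \<zero>\<^sub>(sec F (D c Int D r))"
 shows "EX n::nat. (r [^] n) \<odot>[R,F,D c] t = \<zero>\<^sub>(sec F (D c))"
proof (rule vanish_local[OF c r t])
 fix P assume P: "P : D c"
 then obtain w where w: "w : carrier R" "w ~: P" "qcl R F (D w)" using loc D_sub by blast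
 let ?v = "w \<otimes> c"
 have v: "?v : carrier R" "D ?v = D w Int D c" using w(1) c by (auto simp: D_mult)
 then have o: "op (D ?v)" "op (D ?v Int D r)" "D ?v <= D c" "D ?v Int D r <= D c Int D r" using r w(1) c by auto
 have "res F (D ?v) (D ?v Int D r) (res F (D c) (D ?v) t) = res F (D c Int D r) (D ?v Int D r) (res F (D c) (D c Int D r) t)"
  using res_comp[OF op_D[OF c] o(1,2) Int_lower1 o(3) t] res_comp[OF op_D[OF c] _ o(2,4) Int_lower1 t] c r by simp
 also have "\<dots> = \<zero>\<^sub>(sec F (D ?v Int D r))" unfolding t0 using res_zero[OF _ o(2,4)] c r by simp
 finally obtain n :: nat where "(r [^] n) \<odot>[R,F,D ?v] res F (D c) (D ?v) t = \<zero>\<^sub>(sec F (D ?v))"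
  using qclD(1)[OF qcl_sub[OF w(3) op_D[OF w(1)] v(1)] r, of "res F (D c) (D ?v) t"] res_closed[OF op_D[OF c] o(1,3) t] v(2) by auto
 moreover have "?v ~: P" using v(2) w(2) P by (auto simp: Dset_iff)
 ultimately show "EX w:carrier R. w ~: P & D w <= D c &
   (EX n::nat. (r [^] n) \<odot>[R,F,D w] res F (D c) (D w) t = \<zero>\<^sub>(sec F (D w)))"
  using v(1) o(3) by blast
qed

text \<open>The set of those \<open>c\<close> for which some \<open>r\<^sup>n t\<close> extends to \<open>D(c)\<close> is an ideal: after multiplication
 with a further power of \<open>r\<close>, extensions to \<open>D(x)\<close> and \<open>D(y)\<close> agree on the overlap.\<close>

lemma extend_power:
 assumes r: "r : carrier R" and t: "t : Sec F (D r)"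
 shows "EX n::nat. EX s:Sec F X. (r [^] n) \<odot>[R,F,D r] t = res F X (D r) s"
proof -
 \<comment> \<open>Equality is asked on every open subset of D(c) and D(r), which makes the relation
   stable under restriction; by \<open>extI\<close> it suffices to check it on the
   intersection.\<close>
 define ext where "ext c n s <-> c : carrier R & s : Sec F (D c) & (ALL Z. op Z --> Z <= D c --> Z <= D r -->
  res F (D c) Z s = (r [^] (n::nat)) \<odot>[R,F,Z] res F (D r) Z t)" for c n s
 have rn: "r [^] (n::nat) : carrier R" for n using r by simp
 have tZ: "res F (D r) Z t : Sec F Z" if "op Z" "Z <= D r" for Z by (rule res_closed[OF op_D[OF r] that t])
 have extI: "ext c n s" if c: "c : carrier R" "s : Sec F (D c)"
  and eq: "res F (D c) (D c Int D r) s = (r [^] n) \<odot>[R,F,D c Int D r] res F (D r) (D c Int D r) t" for c n s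
  unfolding ext_def
 proof (intro conjI allI impI c)
  fix Z assume Z: "op Z" "Z <= D c" "Z <= D r"
  have I: "op (D c Int D r)" "Z <= D c Int D r" using c(1) r Z by auto
  show "res F (D c) Z s = (r [^] n) \<odot>[R,F,Z] res F (D r) Z t"
   using arg_cong[OF eq, of "res F (D c Int D r) Z"] res_comp[OF op_D[OF c(1)] I(1) Z(1) I(2) Int_lower1 c(2)]
    res_comp[OF op_D[OF r] I(1) Z(1) I(2) Int_lower2 t] res_rsmult[OF I(1) Z(1) I(2) rn tZ[OF I(1) Int_lower2]] by simp
 qed
 have ext_mono: "ext c (k + n) ((r [^] k) \<odot>[R,F,D c] s)" if e: "ext c n s" for c k n s
 proof -
  have c: "c : carrier R" "s : Sec F (D c)" using e unfolding ext_def by blast+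
  have "res F (D c) Z ((r [^] k) \<odot>[R,F,D c] s) = (r [^] (k + n)) \<odot>[R,F,Z] res F (D r) Z t"
   if Z: "op Z" "Z <= D c" "Z <= D r" for Z
   unfolding res_rsmult[OF op_D[OF c(1)] Z(1,2) rn c(2)] R.nat_pow_mult[OF r, symmetric] rsmult_mult[OF Z(1) rn rn tZ[OF Z(1,3)]]
   using e Z unfolding ext_def by simp
  then show ?thesis unfolding ext_def using c rsmult_closed[OF op_D[OF c(1)] rn c(2)] by blast
 qed
 have ext_sub: "ext c n (res F (D b) (D c) s)" if e: "ext b n s" and c: "c : carrier R" "D c <= D b" for b c n s
 proof -
  have b: "b : carrier R" "s : Sec F (D b)" using e unfolding ext_def by blast+
  have "res F (D c) Z (res F (D b) (D c) s) = (r [^] n) \<odot>[R,F,Z] res F (D r) Z t"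
   if Z: "op Z" "Z <= D c" "Z <= D r" for Z
   unfolding res_comp[OF op_D[OF b(1)] op_D[OF c(1)] Z(1,2) c(2) b(2)] using e Z subset_trans[OF Z(2) c(2)] unfolding ext_def by simp
  then show ?thesis unfolding ext_def using c res_closed[OF op_D[OF b(1)] op_D[OF c(1)] c(2) b(2)] by blast
 qed
 have ext_unique: "EX k::nat. (r [^] k) \<odot>[R,F,D c] s = (r [^] k) \<odot>[R,F,D c] s'"
  if e: "ext c n s" "ext c n s'" for c n s s'
 proof -
  have c: "c : carrier R" "s : Sec F (D c)" "s' : Sec F (D c)" using e unfolding ext_def by blast+
  interpret C: module R "rmod R F (D c)" by (rule rmod_module[OF op_D[OF c(1)]])
  let ?I = "D c Int D r"
  have oI: "op ?I" using c(1) r by simp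
  interpret I: module R "rmod R F ?I" by (rule rmod_module[OF oI])
  note l = res_lin[OF op_D[OF c(1)] oI Int_lower1]
  have sc: "s : carrier (rmod R F (D c))" "s' : carrier (rmod R F (D c))" using c(2,3) by simp_all
  have "res F (D c) ?I s = res F (D c) ?I s'" using e oI unfolding ext_def by simp
  then have "res F (D c) ?I (s \<ominus>\<^sub>(rmod R F (D c)) s') = \<zero>\<^sub>(rmod R F ?I)"
   unfolding semilinear_minus[OF l C.M.abelian_group_axioms I.M.abelian_group_axioms sc]
   using semilinearD(1)[OF l sc(2)] by (simp only: a_minus_def I.M.r_neg)
  then obtain k :: nat where "(r [^] k) \<odot>\<^sub>(rmod R F (D c)) (s \<ominus>\<^sub>(rmod R F (D c)) s') = \<zero>\<^sub>(rmod R F (D c))"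
   using vanish_on_overlap[OF c(1) r C.M.minus_closed[OF sc, unfolded rmod_simps]] unfolding rmod_simps by blast
  moreover have "s = (s \<ominus>\<^sub>(rmod R F (D c)) s') \<oplus>\<^sub>(rmod R F (D c)) s'"
   using sc by (simp only: a_minus_def C.M.a_assoc C.M.a_inv_closed C.M.l_neg C.M.r_zero)
  ultimately have "(r [^] k) \<odot>\<^sub>(rmod R F (D c)) s = (r [^] k) \<odot>\<^sub>(rmod R F (D c)) s'"
   using C.smult_r_distr[OF rn C.M.minus_closed[OF sc] sc(2)] C.M.l_zero[OF C.smult_closed[OF rn sc(2)]] by metis
  then show ?thesis unfolding rmod_simps by blast
 qed
 let ?J = "{c. EX n s. ext c n s}"
 have "ideal ?J R"
 proof (rule idealI2[OF R])
  show "?J <= carrier R" unfolding ext_def by blast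
  have "ext \<zero> 0 \<zero>\<^bsub>sec F (D \<zero>)\<^esub>"
   by (rule extI) (use r t in \<open>auto simp: Dset_zero intro!: sec_empty\<close>)
  then show "\<zero> : ?J" by blast
  fix x assume "x : ?J"
  then obtain n s where s: "ext x n s" by blast
  have x: "x : carrier R" using s unfolding ext_def by blast
  show "a \<otimes> x : ?J" if a: "a : carrier R" for a
   using ext_sub[OF s, of "a \<otimes> x"] a x by (auto simp: D_mult)
  fix y assume "y : ?J"
  then obtain m s' where s': "ext y m s'" by blast
  have y: "y : carrier R" using s' unfolding ext_def by blast
  have xy: "x \<otimes> y : carrier R" "D (x \<otimes> y) = D x Int D y" using x y by (auto simp: D_mult)
  have oxy: "op (D x)" "op (D y)" "op (D x Int D y)" "op (D x Un D y)" using x y by auto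
  \<comment> \<open>Multiplying by the power belonging to the other extension brings both to the
    exponent \<open>m + n\<close>, so that they can be compared by
    \<open>ext_unique\<close>.\<close>
  note e1 = ext_mono[OF s, of m] and e2 = ext_mono[OF s', of n]
  let ?s = "(r [^] m) \<odot>[R,F,D x] s" and ?s' = "(r [^] n) \<odot>[R,F,D y] s'"
  have e2: "ext y (m + n) ?s'" using e2 by (simp only: add.commute)
  have sc: "?s : Sec F (D x)" "?s' : Sec F (D y)" using e1 e2 unfolding ext_def by blast+
  obtain k :: nat where k: "(r [^] k) \<odot>[R,F,D x Int D y] res F (D x) (D x Int D y) ?s
    = (r [^] k) \<odot>[R,F,D x Int D y] res F (D y) (D x Int D y) ?s'"
   using ext_unique[OF ext_sub[OF e1 xy(1)] ext_sub[OF e2 xy(1)]] unfolding xy(2) by blast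
  let ?u = "(r [^] k) \<odot>[R,F,D x] ?s" and ?v = "(r [^] k) \<odot>[R,F,D y] ?s'"
  note eu = ext_mono[OF e1, of k] and ev = ext_mono[OF e2, of k]
  have uv: "?u : Sec F (D x)" "?v : Sec F (D y)" using eu ev unfolding ext_def by blast+
  have "res F (D x) (D x Int D y) ?u = res F (D y) (D x Int D y) ?v"
   unfolding res_rsmult[OF oxy(1,3) Int_lower1 rn sc(1)] res_rsmult[OF oxy(2,3) Int_lower2 rn sc(2)] by (rule k)
  then obtain z where z: "z : Sec F (D x Un D y)" "res F (D x Un D y) (D x) z = ?u" "res F (D x Un D y) (D y) z = ?v"
   using glue2[OF oxy(1,2) uv] by blast
  let ?c = "x \<oplus> y"
  have c: "?c : carrier R" using x y by simp
  have cU: "D ?c <= D x Un D y"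
   using idealD(3)[OF primeD(1), of _ R x y] by (auto simp: Dset_iff)
  have zc: "res F (D x Un D y) (D ?c) z : Sec F (D ?c)" by (rule res_closed[OF oxy(4) op_D[OF c] cU z(1)])
  let ?I = "D ?c Int D r"
  have oI: "op ?I" "?I <= D x Un D y" using c r cU by auto
  have "ext ?c (k + (m + n)) (res F (D x Un D y) (D ?c) z)"
  proof (rule extI[OF c zc])
   show "res F (D ?c) ?I (res F (D x Un D y) (D ?c) z) = (r [^] (k + (m + n))) \<odot>[R,F,?I] res F (D r) ?I t"
    unfolding res_comp[OF oxy(4) op_D[OF c] oI(1) Int_lower1 cU z(1)]
   proof (rule sep[OF oI(1), of "{?I Int D x, ?I Int D y}"])
    show "res F (D x Un D y) ?I z : Sec F ?I" by (rule res_closed[OF oxy(4) oI z(1)])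
    show "(r [^] (k + (m + n))) \<odot>[R,F,?I] res F (D r) ?I t : Sec F ?I"
     by (rule rsmult_closed[OF oI(1) rn tZ[OF oI(1) Int_lower2]])
    have eq: "res F ?I (?I Int D b) (res F (D x Un D y) ?I z)
      = res F ?I (?I Int D b) ((r [^] (k + (m + n))) \<odot>[R,F,?I] res F (D r) ?I t)"
     if b: "ext b (k + (m + n)) (res F (D x Un D y) (D b) z)" "D b <= D x Un D y" for b
    proof -
     let ?K = "?I Int D b"
     have bc: "op (D b)" using b(1) unfolding ext_def by simp
     have K: "op ?K" "?K <= D b" "?K <= D r" using oI(1) bc by auto
     have "res F (D b) ?K (res F (D x Un D y) (D b) z) = (r [^] (k + (m + n))) \<odot>[R,F,?K] res F (D r) ?K t"
      using b(1) K unfolding ext_def by blast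
     then show ?thesis
      unfolding res_comp[OF oxy(4) bc K(1,2) b(2) z(1)] res_comp[OF oxy(4) oI(1) K(1) Int_lower1 oI(2) z(1)]
       res_rsmult[OF oI(1) K(1) Int_lower1 rn tZ[OF oI(1) Int_lower2]] res_comp[OF op_D[OF r] oI(1) K(1) Int_lower1 Int_lower2 t] .
    qed
    show "res F ?I V (res F (D x Un D y) ?I z) = res F ?I V ((r [^] (k + (m + n))) \<odot>[R,F,?I] res F (D r) ?I t)"
     if "V : {?I Int D x, ?I Int D y}" for V
     using that eq[of x] eq[of y] eu ev z(2,3) by auto
   qed (use oI oxy in auto)
  qed
  then show "?c : ?J" by blast
 qed
 moreover have "EX w:?J. w ~: P" if P: "primeideal P R" for P
 proof -
  obtain w where w: "w : carrier R" "w ~: P" "qcl R F (D w)" using loc[of P] P by (auto simp: Spec_iff)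
  have oI: "op (D w Int D r)" using w(1) r by simp
  obtain n :: nat and s where "s : Sec F (D w)"
   "(r [^] n) \<odot>[R,F,D w Int D r] res F (D r) (D w Int D r) t = res F (D w) (D w Int D r) s"
   using qclD(2)[OF w(3) r tZ[OF oI Int_lower2]] by blast
  then have "ext w n s" by (intro extI w(1)) simp_all
  then show ?thesis using w(2) by blast
 qed
 ultimately have "\<one> : ?J" by (rule ideal_local_one[OF R])
 then obtain n s where e: "ext \<one> n s" by blast
 then have "s : Sec F X" "(r [^] n) \<odot>[R,F,D r] t = res F X (D r) s"
  using r t op_D[OF r] D_sub[of r] unfolding ext_def Dset_one by (auto simp del: op_D)
 then show ?thesis by blast
qed

theorem qcl_local: "qcl R F X"
proof (rule qclI[OF op_X])
 have XD: "X Int D r = D r" for r using D_sub by blast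
 fix r t assume r: "r : carrier R"
 show "EX n::nat. (r [^] n) \<odot>[R,F,X] t = \<zero>\<^sub>(sec F X)"
  if "t : Sec F X" "res F X (X Int D r) t = \<zero>\<^sub>(sec F (X Int D r))"
  using vanish_on_overlap[OF R.one_closed r] that unfolding Dset_one by blast
 show "EX n::nat. EX t':Sec F X. (r [^] n) \<odot>[R,F,X Int D r] t = res F X (X Int D r) t'"
  if "t : Sec F (X Int D r)"
  using extend_power[OF r] that unfolding XD by blast
qed

end

lemma res_loc_at:
 assumes "qcl R F X" "f : carrier R"
 shows "loc_at R f id (rmod R F X) (rmod R F (D f)) (res F X (D f))"
proof -
 have "X Int D f = D f" using D_sub by blast
 then show ?thesis using assms unfolding qcl_def by (metis)
qed

end

section \<open>The sheaf associated with a module\<close>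

lemma msec_simp: "P : U ==> msec R M U x P = germ R M P x \<one>\<^sub>R"
 by (simp add: msec_def)

context
 fixes R :: "('a, 'm) ring_scheme" (structure) and M :: "('a, 'b, 'k) module_scheme"
 assumes R: "cring R" and M: "module R M"
begin

interpretation R: cring R by (rule R)
interpretation M: module R M by (rule M)
interpretation S: spec_sheaf R "tilde R M" by (rule spec_sheaf.intro[OF R sheaf_tilde[OF R M]])

lemma rsec_tilde_apply:
 assumes U: "U <= Spec R" "P : U" and r: "r : carrier R" and x: "x : carrier M" "q : carrier R - P"
  and s: "s P = germ R M P x q"
 shows "(r \<odot>[R,tilde R M,U] s) P = germ R M P (r \<odot>\<^sub>M x) q"
proof -
 have W: "mult_set R (carrier R - P)" using stalk_mult[OF R] U by blast
 show ?thesis using U(2) s x r mult_setD(2)[OF W] by (simp add: rsec_def loc_smult[OF R W M])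
qed

lemma msec_add:
 assumes U: "U <= Spec R" and x: "x : carrier M" "y : carrier M"
 shows "msec R M U (x \<oplus>\<^sub>M y) = msec R M U x \<oplus>\<^sub>(sec (tilde R M) U) msec R M U y"
 unfolding tilde_simps msec_def
proof (rule restrict_ext)
 fix P assume P: "P : U"
 have W: "mult_set R (carrier R - P)" using stalk_mult[OF R] U P by blast
 show "germ R M P (x \<oplus>\<^sub>M y) \<one> = restrict (%P. germ R M P x \<one>) U P
   \<oplus>\<^sub>(lmod R P M) restrict (%P. germ R M P y \<one>) U P"
  using P loc_add_same[OF M W x mult_setD(2)[OF W]] by simp
qed

lemma msec_smult:
 assumes U: "U <= Spec R" and x: "x : carrier M" and a: "a : carrier R"
 shows "msec R M U (a \<odot>\<^sub>M x) = a \<odot>[R,tilde R M,U] msec R M U x"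
proof -
 have "a \<odot>[R,tilde R M,U] msec R M U x : extensional U" by simp
 moreover have "msec R M U (a \<odot>\<^sub>M x) : extensional U" by (simp add: msec_def)
 moreover have "msec R M U (a \<odot>\<^sub>M x) P = (a \<odot>[R,tilde R M,U] msec R M U x) P" if P: "P : U" for P
 proof -
  have W: "mult_set R (carrier R - P)" using stalk_mult[OF R] U P by blast
  show ?thesis
   using rsec_tilde_apply[OF U P a x mult_setD(2)[OF W], of "msec R M U x"] P by (simp only: msec_simp)
 qed
 ultimately show ?thesis by (metis extensionalityI)
qed

lemma msec_restrict: "V <= U ==> restrict (msec R M U x) V = msec R M V x"
 unfolding msec_def by (auto intro!: restrict_ext simp: Int_absorb1)

lemma msec_lin: "zopen R U ==> semilinear R id M (rmod R (tilde R M) U) (msec R M U)"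
 by (rule semilinearI)
   (use msec_in[OF R] msec_add[OF S.op_sub] msec_smult[OF S.op_sub] in \<open>simp_all del: tilde_simps(3,4) spec_simps\<close>)

lemma tilde_zero_apply: "P : U ==> \<zero>\<^sub>(sec (tilde R M) U) P = \<zero>\<^sub>(lmod R P M)"
 by simp

text \<open>Vanishing of the germ of \<open>x\<close> at the points of D(f) says that no prime
  without \<open>f\<close> contains the annihilator of \<open>x\<close>, so the annihilator contains
  a power of \<open>f\<close>.\<close>

lemma msec_zero_iff:
 assumes f: "f : carrier R" and x: "x : carrier M" and z: "msec R M (Dset R f) x = \<zero>\<^sub>(sec (tilde R M) (Dset R f))"
 shows "EX n::nat. (f [^] n) \<odot>\<^sub>M x = \<zero>\<^sub>M"
proof -
 let ?J = "{a : carrier R. a \<odot>\<^sub>M x = \<zero>\<^sub>M}"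
 have "ideal ?J R"
  by (rule idealI2[OF R]) (use x in \<open>auto simp: M.smult_l_distr M.smult_assoc1\<close>)
 then have "EX n::nat. f [^] n : ?J"
 proof (rule ideal_local[OF R _ f])
  fix Q assume Q: "primeideal Q R" "f ~: Q"
  have QD: "Q : Dset R f" using Q by (simp add: Dset_iff)
  have W: "mult_set R (carrier R - Q)" using primeD(5)[OF Q(1)] .
  have "germ R M Q x \<one> = \<zero>\<^sub>(lmod R Q M)"
   using fun_cong[OF z, of Q] QD by (simp add: msec_def)
  then show "EX j:?J. j ~: Q" using frac_eq_zero_iff[OF M W x mult_setD(2)[OF W]] by blast
 qed
 then show ?thesis by blast
qed

text \<open>Near a point, \<open>t\<close> is \<open>x/q\<close> on some D(w). Then
  \<open>x/1\<close> vanishes on D(w h), so \<open>(w h)^n x = 0\<close>, and \<open>w\<close> is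
  invertible on D(w); \<open>vanish_local\<close> patches the exponents.\<close>

lemma tilde_vanish:
 assumes f: "f : carrier R" "h : carrier R" and t: "t : Sec (tilde R M) (Dset R f)"
  and z: "\<And>P. P : Dset R f ==> h ~: P ==> t P = \<zero>\<^sub>(lmod R P M)"
 shows "EX n::nat. (h [^] n) \<odot>[R,tilde R M,Dset R f] t = \<zero>\<^sub>(sec (tilde R M) (Dset R f))"
proof (rule S.vanish_local[OF f t])
 fix P assume P: "P : Dset R f"
 obtain w x q where w: "w : carrier R" "w ~: P" "Dset R w <= Dset R f" "x : carrier M" "q : carrier R"
  "ALL Q:Dset R w. q ~: Q & t Q = germ R M Q x q"
  by (rule tilde_subE[OF R t[unfolded tilde_simps] S.D_sub P])
 have wh: "w \<otimes> h : carrier R" using w f by simp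
 have "msec R M (Dset R (w \<otimes> h)) x = \<zero>\<^bsub>sec (tilde R M) (Dset R (w \<otimes> h))\<^esub>"
  unfolding msec_def tilde_simps
 proof (rule restrict_ext)
  fix Q assume "Q : Dset R (w \<otimes> h)"
  then have Q: "Q : Dset R w" "h ~: Q" "Q : Spec R" using S.D_mult[OF w(1) f(2)] by (auto simp: Dset_def)
  have W: "mult_set R (carrier R - Q)" using stalk_mult[OF R Q(3)] .
  have q: "q : carrier R - Q" "t Q = germ R M Q x q" using w(5,6) Q(1) by auto
  have "t Q = \<zero>\<^sub>(lmod R Q M)" using z[of Q] Q w(3) by blast
  then have "EX u:carrier R - Q. u \<odot>\<^sub>M x = \<zero>\<^sub>M"
   using frac_eq_zero_iff[OF M W w(4) q(1)] q(2) by simp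
  then show "germ R M Q x \<one> = \<zero>\<^sub>(lmod R Q M)"
   using frac_eq_zero_iff[OF M W w(4) mult_setD(2)[OF W]] by simp
 qed
 then obtain n :: nat where n: "((w \<otimes> h) [^] n) \<odot>\<^sub>M x = \<zero>\<^sub>M"
  using msec_zero_iff[OF wh w(4)] by blast
 have "(h [^] n) \<odot>[R,tilde R M,Dset R w] restrict t (Dset R w) = \<zero>\<^sub>(sec (tilde R M) (Dset R w))"
 proof (rule extensionalityI[of _ "Dset R w"])
  fix Q assume Q: "Q : Dset R w"
  then have pQ: "primeideal Q R" "w ~: Q" by (auto simp: Dset_iff)
  have W: "mult_set R (carrier R - Q)" using primeD(5)[OF pQ(1)] .
  have q: "q : carrier R - Q" "restrict t (Dset R w) Q = germ R M Q x q" using w(5,6) Q by auto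
  have "(w [^] n) \<odot>\<^sub>M ((h [^] n) \<odot>\<^sub>M x) = \<zero>\<^sub>M"
   using n w f by (simp add: R.nat_pow_distrib M.smult_assoc1)
  moreover have "w [^] n : carrier R - Q" using prime_pow[OF pQ(1) w(1) pQ(2)] w(1) by simp
  ultimately have "germ R M Q ((h [^] n) \<odot>\<^sub>M x) q = \<zero>\<^sub>(lmod R Q M)"
   using frac_eq_zero_iff[OF M W _ q(1), of "(h [^] n) \<odot>\<^sub>M x"] w(4) f(2) by auto
  then show "((h [^] n) \<odot>[R,tilde R M,Dset R w] restrict t (Dset R w)) Q = \<zero>\<^sub>(sec (tilde R M) (Dset R w)) Q"
   unfolding tilde_zero_apply[OF Q]
   using rsec_tilde_apply[OF S.D_sub Q _ w(4) q(1), where s = "restrict t (Dset R w)" and r = "h [^] n", OF _ q(2)] f(2) by (simp del: tilde_simps)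
 qed auto
 then have "(h [^] n) \<odot>[R,tilde R M,Dset R w] res (tilde R M) (Dset R f) (Dset R w) t = \<zero>\<^sub>(sec (tilde R M) (Dset R w))"
  by (simp only: tilde_simps(5))
 then show "EX w:carrier R. w ~: P & Dset R w <= Dset R f &
  (EX n::nat. (h [^] n) \<odot>[R,tilde R M,Dset R w] res (tilde R M) (Dset R f) (Dset R w) t = \<zero>\<^sub>(sec (tilde R M) (Dset R w)))"
  using w(1-3) by blast
qed

text \<open>The elements \<open>g\<close> for which \<open>g t\<close> is \<open>x/1\<close> with
  \<open>x\<close> in \<open>L\<close> form an ideal. Where \<open>t = x/q\<close> on D(w), the
  difference \<open>q t - x/1\<close> vanishes on D(w), so some \<open>w^n\<close> kills it and
  \<open>w^n q\<close> belongs to the ideal.\<close>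

lemma tilde_sections:
 assumes f: "f : carrier R" and L: "submodule L R M" and t: "t : tilde_sub R M L (Dset R f)"
 shows "EX n::nat. EX x:L. (f [^] n) \<odot>[R,tilde R M,Dset R f] t = msec R M (Dset R f) x"
proof -
 note Lc = submoduleD[OF L M]
 let ?U = "Dset R f"
 have oU: "zopen R ?U" using f by simp
 let ?F = "sec (tilde R M) ?U"
 have tc: "t : carrier ?F" using t tilde_sub_mono[OF R Lc(1) S.D_sub] by auto
 interpret T: module R "rmod R (tilde R M) ?U" by (rule S.rmod_module[OF oU])
 note lin = semilinearD[OF msec_lin[OF oU], unfolded rmod_simps id_apply]
 let ?J = "{g : carrier R. EX x:L. rsec R ?U g \<odot>\<^sub>?F t = msec R M ?U x}"
 have J: "ideal ?J R"
 proof (rule idealI2[OF R])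
  have "rsec R ?U \<zero> \<odot>\<^sub>?F t = \<zero>\<^sub>?F" using T.smult_l_null[of t] tc by (simp only: rmod_simps)
  also have "\<dots> = msec R M ?U \<zero>\<^sub>M"
   using semilinear_zero[OF msec_lin[OF oU] M.M.abelian_group_axioms T.M.abelian_group_axioms] by (simp only: rmod_simps)
  finally show "\<zero> : ?J" using Lc(2) by blast
  fix g assume "g : ?J"
  then obtain x where g: "g : carrier R" "x : L" "rsec R ?U g \<odot>\<^sub>?F t = msec R M ?U x" by blast
  {
   fix h assume "h : ?J"
   then obtain y where h: "h : carrier R" "y : L" "rsec R ?U h \<odot>\<^sub>?F t = msec R M ?U y" by blast
   have "rsec R ?U (g \<oplus> h) \<odot>\<^sub>?F t = rsec R ?U g \<odot>\<^sub>?F t \<oplus>\<^sub>?F rsec R ?U h \<odot>\<^sub>?F t"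
    using T.smult_l_distr[OF g(1) h(1), of t] tc by (simp only: rmod_simps)
   also have "\<dots> = msec R M ?U (x \<oplus>\<^sub>M y)" unfolding g(3) h(3) using lin(2)[OF Lc(7)[OF g(2)] Lc(7)[OF h(2)]] by simp
   finally show "g \<oplus> h : ?J" using Lc(3)[OF g(2) h(2)] R.a_closed[OF g(1) h(1)] by blast
  }
  fix a assume a: "a : carrier R"
  have "rsec R ?U (a \<otimes> g) \<odot>\<^sub>?F t = rsec R ?U a \<odot>\<^sub>?F (rsec R ?U g \<odot>\<^sub>?F t)"
   by (rule S.rsmult_mult[OF oU a g(1) tc])
  also have "\<dots> = msec R M ?U (a \<odot>\<^sub>M x)" unfolding g(3) using lin(3)[OF a Lc(7)[OF g(2)]] by simp
  finally show "a \<otimes> g : ?J" using Lc(5)[OF a g(2)] R.m_closed[OF a g(1)] by blast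
 qed blast
 have "EX n::nat. f [^] n : ?J"
 proof (rule ideal_local[OF R J f])
  fix Q assume Q: "primeideal Q R" "f ~: Q"
  have QU: "Q : ?U" using Q by (simp add: Dset_iff)
  obtain w x q where w: "w : carrier R" "w ~: Q" "Dset R w <= ?U" "x : L" "q : carrier R"
   "ALL Q:Dset R w. q ~: Q & t Q = germ R M Q x q"
   by (rule tilde_subE[OF R t S.D_sub QU])
  note xc = Lc(7)[OF w(4)]
  let ?a = "rsec R ?U q \<odot>\<^sub>?F t" and ?b = "msec R M ?U x"
  have ab: "?a : carrier (rmod R (tilde R M) ?U)" "?b : carrier (rmod R (tilde R M) ?U)"
   using S.rsmult_closed[OF oU w(5) tc] lin(1)[OF xc] by (simp_all only: rmod_simps)
  let ?d = "?a \<ominus>\<^sub>(rmod R (tilde R M) ?U) ?b"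
  have dc: "?d : carrier (rmod R (tilde R M) ?U)" by (rule T.M.minus_closed[OF ab])
  have add: "?d \<oplus>\<^sub>?F ?b = ?a"
  proof -
   have "?d \<oplus>\<^sub>(rmod R (tilde R M) ?U) ?b = ?a" using ab by (simp only: a_minus_def T.M.a_assoc T.M.l_neg T.M.r_zero T.M.a_inv_closed)
   then show ?thesis by (simp only: rmod_simps)
  qed
  have "?d P = \<zero>\<^sub>(lmod R P M)" if P: "P : ?U" "w ~: P" for P
  proof -
   have Pw: "P : Dset R w" using P by (simp add: Dset_iff)
   have W: "mult_set R (carrier R - P)" using stalk_mult[OF R] P(1) S.D_sub by blast
   interpret St: abelian_group "lmod R P M" by (rule abelian_group_loc[OF M W])
   have q: "q : carrier R - P" "t P = germ R M P x q" using w(5,6) Pw by auto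
   have "?a P = germ R M P (q \<odot>\<^sub>M x) q" by (rule rsec_tilde_apply[OF S.D_sub P(1) w(5) xc q(1), where s = t, OF q(2)])
   also have "\<dots> = ?b P" unfolding msec_simp[OF P(1)]
    by (rule frac_eqI[OF M W]) (use xc q mult_setD(2)[OF W] in auto)
   finally have ba: "?a P = ?b P" .
   have bc: "?b P : carrier (lmod R P M)"
    unfolding msec_simp[OF P(1)] loc_carrier[OF M W] using xc mult_setD(2)[OF W] by blast
   have dP: "?d P : carrier (lmod R P M)"
    by (rule tilde_sub_carrier[OF R M subset_refl _ S.D_sub P(1)]) (use dc in \<open>simp only: rmod_simps tilde_simps(1)\<close>)
   have "?d P \<oplus>\<^sub>(lmod R P M) ?b P = (?d \<oplus>\<^sub>?F ?b) P" using P(1) by simp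
   also have "\<dots> = ?b P" unfolding add ba ..
   finally show ?thesis using bc dP St.add.r_cancel_one by simp
  qed
  then have "EX n::nat. rsec R ?U (w [^] n) \<odot>\<^sub>?F ?d = \<zero>\<^sub>?F"
   by (intro tilde_vanish[OF f w(1)]) (use dc in \<open>auto simp only: rmod_simps\<close>)
  then obtain n :: nat where n: "rsec R ?U (w [^] n) \<odot>\<^sub>?F ?d = \<zero>\<^sub>?F" by blast
  have wn: "w [^] n : carrier R" using w(1) by simp
  have "rsec R ?U (w [^] n \<otimes> q) \<odot>\<^sub>?F t = rsec R ?U (w [^] n) \<odot>\<^sub>?F (?d \<oplus>\<^sub>?F ?b)"
   unfolding add by (rule S.rsmult_mult[OF oU wn w(5) tc])
  also have "\<dots> = rsec R ?U (w [^] n) \<odot>\<^sub>?F ?d \<oplus>\<^sub>?F rsec R ?U (w [^] n) \<odot>\<^sub>?F ?b"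
   using T.smult_r_distr[OF wn dc ab(2)] by (simp only: rmod_simps)
  also have "\<dots> = rsec R ?U (w [^] n) \<odot>\<^sub>?F ?b"
   unfolding n using T.M.l_zero[OF T.smult_closed[OF wn ab(2)]] by (simp only: rmod_simps)
  also have "\<dots> = msec R M ?U ((w [^] n) \<odot>\<^sub>M x)" using lin(3)[OF wn xc] by simp
  finally have "w [^] n \<otimes> q : ?J" using wn w(5) Lc(5)[OF wn w(4)] by blast
  moreover have "w [^] n \<otimes> q ~: Q"
  proof -
   have "Q : Dset R w" using Q w(2) by (simp add: Dset_iff)
   then have "q ~: Q" using w(6) by blast
   then show ?thesis using primeD(4)[OF Q(1) wn w(5)] prime_pow[OF Q(1) w(1,2)] by blast
  qed
  ultimately show "EX j:?J. j ~: Q" by blast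
 qed
 then show ?thesis by blast
qed

theorem tilde_loc_at:
 assumes f: "f : carrier R"
 shows "loc_at R f id M (rmod R (tilde R M) (Dset R f)) (msec R M (Dset R f))"
 unfolding loc_at_def
proof (intro conjI ballI impI)
 show "semilinear R id M (rmod R (tilde R M) (Dset R f)) (msec R M (Dset R f))" using msec_lin f by simp
 show "EX n::nat. (f [^] n) \<odot>\<^sub>M x = \<zero>\<^sub>M"
  if "x : carrier M" "msec R M (Dset R f) x = \<zero>\<^sub>(rmod R (tilde R M) (Dset R f))" for x
  using msec_zero_iff[OF f that(1)] that(2) by (simp only: rmod_simps)
 show "EX n::nat. EX x:carrier M. id (f [^] n) \<odot>\<^sub>(rmod R (tilde R M) (Dset R f)) y = msec R M (Dset R f) x"
  if "y : carrier (rmod R (tilde R M) (Dset R f))" for y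
  using tilde_sections[OF f M.carrier_is_submodule, of y] that by (simp only: rmod_simps id_apply tilde_simps(1))
qed

text \<open>The case \<open>f = \<one>\<close> of the localization property: powers of
  \<open>\<one>\<close> act as the identity, so nothing is killed and nothing has to be
  cleared.\<close>

lemma msec_bij: "bij_betw (msec R M (Spec R)) (carrier M) (Sec (tilde R M) (Spec R))"
proof -
 have D1: "Dset R \<one> = Spec R" by (rule Dset_one)
 note l = tilde_loc_at[OF R.one_closed, unfolded D1]
 interpret T: module R "rmod R (tilde R M) (Spec R)" by (rule S.rmod_module) simp
 have "x = y" if x: "x : carrier M" "y : carrier M" "msec R M (Spec R) x = msec R M (Spec R) y" for x y
 proof -
  have "msec R M (Spec R) (x \<ominus>\<^sub>M y) = \<zero>\<^sub>(rmod R (tilde R M) (Spec R))"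
   using semilinear_minus[OF loc_atD(1)[OF l] M.M.abelian_group_axioms T.M.abelian_group_axioms x(1,2)] x(3)
    semilinearD(1)[OF loc_atD(1)[OF l] x(2)] by (simp only: a_minus_def T.M.r_neg)
  then have "x \<ominus>\<^sub>M y = \<zero>\<^sub>M" using loc_atD(2)[OF l M.M.minus_closed[OF x(1,2)]] x by auto
  moreover have "x = (x \<ominus>\<^sub>M y) \<oplus>\<^sub>M y" using x by (simp add: a_minus_def M.M.a_assoc M.M.l_neg)
  ultimately show ?thesis using x by simp
 qed
 moreover have "EX x:carrier M. t = msec R M (Spec R) x" if t: "t : Sec (tilde R M) (Spec R)" for t
  using loc_atD(3)[OF l, of t] t S.rsmult_one[OF S.op_X t] by (simp del: tilde_simps)
 moreover have "msec R M (Spec R) x : Sec (tilde R M) (Spec R)" if "x : carrier M" for x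
  using semilinearD(1)[OF loc_atD(1)[OF l] that] by (simp only: rmod_simps)
 ultimately show ?thesis
  by (intro bij_betw_imageI inj_onI equalityI subsetI) blast+
qed

lemma msec_submodule:
 assumes L: "submodule L R M" shows "msec R M (Spec R) ` L = tilde_sub R M L (Spec R)"
proof -
 have D1: "Dset R \<one> = Spec R" by (rule Dset_one)
 have "t : msec R M (Spec R) ` L" if t: "t : tilde_sub R M L (Spec R)" for t
 proof -
  have tc: "t : Sec (tilde R M) (Spec R)"
   using t tilde_sub_mono[OF R submoduleD(1)[OF L M] subset_refl] by auto
  show ?thesis using tilde_sections[OF R.one_closed L, unfolded D1, OF t] S.rsmult_one[OF S.op_X tc]
   by (auto simp del: tilde_simps)
 qed
 then show ?thesis using msec_in[OF R S.op_X, of _ L M] by blast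
qed

end

text \<open>The case \<open>f = \<one>\<close> shows that every global section comes from
  \<open>M\<close>, so the localization property of \<open>M\<close> becomes that of the global
  sections.\<close>

lemma (in spec_sheaf) qclI_loc_at:
 fixes M :: "('a, 'c, 'k) module_scheme"
 assumes M: "module R M" and h: "h : carrier M \<rightarrow> Sec F X"
  and l: "\<And>f. f : carrier R ==> loc_at R f id M (rmod R F (D f)) (%x. res F X (D f) (h x))"
 shows "qcl R F X"
proof (rule qclI[OF op_X])
 note l1 = l[OF R.one_closed, unfolded Dset_one]
 fix r t assume r: "r : carrier R"
 have XD: "X Int D r = D r" using D_sub by blast
 {
  assume t: "t : Sec F X" and t0: "res F X (X Int D r) t = \<zero>\<^sub>(sec F (X Int D r))"
  obtain x where x: "x : carrier M" "t = res F X X (h x)"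
   using loc_atD(3)[OF l1, of t] t rsmult_one[OF op_X t] by auto
  have "h x : Sec F X" using x(1) h by blast
  then have tx: "t = h x" using x(2) by simp
  obtain n :: nat where n: "(r [^] n) \<odot>\<^sub>M x = \<zero>\<^sub>M"
   using loc_atD(2)[OF l[OF r] x(1)] t0 unfolding XD tx by auto
  have "(r [^] n) \<odot>[R,F,X] t = res F X X (h ((r [^] n) \<odot>\<^sub>M x))"
   using semilinearD(3)[OF loc_atD(1)[OF l1], of "r [^] n" x] x r t by simp
  also have "\<dots> = \<zero>\<^sub>(sec F X)"
   unfolding n using semilinear_zero[OF loc_atD(1)[OF l1] module_abelian[OF M] module_abelian[OF rmod_module[OF op_X]]] by simp
  finally show "EX n::nat. (r [^] n) \<odot>[R,F,X] t = \<zero>\<^sub>(sec F X)" by blast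
 }
 assume t: "t : Sec F (X Int D r)"
 obtain n :: nat and x where "x : carrier M" "(r [^] n) \<odot>[R,F,D r] t = res F X (D r) (h x)"
  using loc_atD(3)[OF l[OF r], of t] t unfolding XD by auto
 then show "EX n::nat. EX t':Sec F X. (r [^] n) \<odot>[R,F,X Int D r] t = res F X (X Int D r) t'"
  unfolding XD using h by blast
qed

lemma qcl_tilde:
 assumes R: "cring R" and M: "module R M"
 shows "qcl R (tilde R M) (Spec R)"
proof -
 interpret S: spec_sheaf R "tilde R M" by (rule spec_sheaf.intro[OF R sheaf_tilde[OF R M]])
 show ?thesis
 proof (rule S.qclI_loc_at[OF M])
  show "msec R M (Spec R) : carrier M \<rightarrow> Sec (tilde R M) (Spec R)"
   using msec_in[OF R S.op_X] by auto
  show "loc_at R f id M (rmod R (tilde R M) (Dset R f)) (%x. res (tilde R M) (Spec R) (Dset R f) (msec R M (Spec R) x))"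
   if "f : carrier R" for f
   using tilde_loc_at[OF R M that] by (simp add: msec_restrict[OF R M])
 qed
qed

section \<open>The structure sheaf\<close>

text \<open>The locale \<open>module\<close> reads only these four fields. The structure module and
  the sheaf associated with \<open>ring_module R\<close> agree in them, while their entries for
  \<open>mult\<close> and \<open>one\<close> are defined differently.\<close>

lemma module_cong:
 fixes M N :: "('a, 'b) module"
 assumes "carrier M = carrier N" "\<zero>\<^sub>M = \<zero>\<^sub>N" "ring.add M = ring.add N" "smult M = smult N"
 shows "module S M <-> module S N"
proof -
 have "add_monoid M = add_monoid N" using assms by simp
 then show ?thesis
  unfolding module_def abelian_group_def abelian_group_axioms_def abelian_monoid_def module_axioms_def
  using assms by simp
qed

lemma SM_simps [simp]:
 "sec (structure_module X) U = ring_module (Osec X U)" "res (structure_module X) = Ores X"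
 by (simp_all add: structure_module_def)

lemma structure_tilde_eqs:
 "carrier (ring_module (\<O> R U)) = Sec (tilde R (ring_module R)) U"
 "\<zero>\<^sub>(ring_module (\<O> R U)) = \<zero>\<^sub>(sec (tilde R (ring_module R)) U)"
 "ring.add (ring_module (\<O> R U)) = ring.add (sec (tilde R (ring_module R)) U)"
 "smult (ring_module (\<O> R U)) = smult (sec (tilde R (ring_module R)) U)"
 "Ores (spec R) = res (tilde R (ring_module R))"
 by (simp_all add: ring_module_def spec_def tilde_def loc_ring_def loc_module_def)

lemma sheaf_structure:
 assumes R: "cring R" shows "sheaf_of_modules (spec R) (structure_module (spec R))"
proof -
 have mc: "module S (ring_module (\<O> R U)) <-> module S (sec (tilde R (ring_module R)) U)"
  for S :: "('a set => ('a \<times> 'a) set) ring" and U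
  by (rule module_cong) (rule structure_tilde_eqs)+
 show ?thesis
  using sheaf_tilde[OF R ring_module_module[OF R]]
  unfolding sheaf_of_modules_def SM_simps structure_tilde_eqs by (simp only: mc)
qed


lemma qcl_structure:
 assumes R: "cring R" shows "qcl R (structure_module (spec R)) (Spec R)"
proof -
 have "rmod R (structure_module (spec R)) U = rmod R (tilde R (ring_module R)) U" for U
  unfolding rmod_def restrict_scalars_def SM_simps structure_tilde_eqs by simp
 then show ?thesis
  using qcl_tilde[OF R ring_module_module[OF R]] unfolding qcl_def SM_simps structure_tilde_eqs by simp
qed

lemma ring_loc_at_Osec:
 fixes R (structure)
 assumes R: "cring R" and f: "f : carrier R"
 shows "ring_loc_at R f (\<O> R (Dset R f)) (rsec R (Dset R f))"
proof (rule ring_loc_atI[OF R])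
 have o: "zopen R (Dset R f)" using openin_Dset[OF f] .
 note l = tilde_loc_at[OF R ring_module_module[OF R] f]
 show "cring (\<O> R (Dset R f))" by (rule cring_Osec[OF R o])
 show "rsec R (Dset R f) : ring_hom R (\<O> R (Dset R f))" by (rule rsec_hom[OF R o])
 show "rsec R (Dset R f) f : Units (\<O> R (Dset R f))" by (rule rsec_unit[OF R o f]) simp
 show "EX n::nat. f [^] n \<otimes> a = \<zero>"
  if "a : carrier R" "rsec R (Dset R f) a = \<zero>\<^sub>(\<O> R (Dset R f))" for a
  using loc_atD(2)[OF l, of a] that unfolding rsec_msec Osec_eqs(2)[OF R o] by (simp del: tilde_simps)
 show "EX n::nat. EX a:carrier R. rsec R (Dset R f) (f [^] n) \<otimes>\<^sub>(\<O> R (Dset R f)) b = rsec R (Dset R f) a"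
  if "b : carrier (\<O> R (Dset R f))" for b
  using loc_atD(3)[OF l, of b] that unfolding Osec_eqs[OF R o] by (simp add: rsec_msec del: tilde_simps)
qed

section \<open>Affine charts\<close>

lemma preim_open_subspace:
 assumes "U <= topspace (top_of X)"
 shows "preim (open_subspace X U) psi V = {x : U. psi x : V}"
 using assms by (auto simp: preim_def open_subspace_def)

lemma open_subspace_simps [simp]:
 "Osec (open_subspace X U) = Osec X" "Ores (open_subspace X U) = Ores X"
 by (simp_all add: open_subspace_def)

lemma ring_iso_Units_iff:
 fixes A (structure)
 assumes "cring A" "cring B" and theta: "theta : ring_iso A B" and a: "a : carrier A"
 shows "theta a : Units B <-> a : Units A"
proof -
 interpret A: cring A by fact
 interpret B: cring B by fact
 have h: "theta : ring_hom A B" and b: "bij_betw theta (carrier A) (carrier B)" using theta unfolding ring_iso_def by auto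
 interpret theta: ring_hom_cring A B theta by (rule ring_hom_cring_I[OF assms(1,2) h])
 show ?thesis
 proof
  assume "theta a : Units B"
  then obtain y where y: "y : carrier B" "theta a \<otimes>\<^sub>B y = \<one>\<^sub>B" unfolding Units_def by blast
  then obtain x where x: "x : carrier A" "y = theta x" using bij_betw_imp_surj_on[OF b] by blast
  have "theta (a \<otimes> x) = theta \<one>" using x y a by simp
  then have "a \<otimes> x = \<one>" using inj_onD[OF bij_betw_imp_inj_on[OF b]] a x(1) by blast
  then show "a : Units A" using a x(1) A.m_comm[OF a x(1)] unfolding Units_def by auto
 next
  assume "a : Units A"
  then obtain x where x: "x : carrier A" "a \<otimes> x = \<one>" unfolding Units_def by blast
  have "theta a \<otimes>\<^sub>B theta x = \<one>\<^sub>B" using theta.ring.hom_mult[OF a x(1)] x(2) by simp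
  moreover have "theta x \<otimes>\<^sub>B theta a = \<one>\<^sub>B" using calculation a x by (simp add: B.m_comm)
  ultimately show "theta a : Units B" using a x(1) unfolding Units_def by auto
 qed
qed

context
 fixes R :: "('a, 'm) ring_scheme" (structure) and A :: "('c, 'n) ring_scheme" and U psi theta
 assumes R: "cring R" and A: "cring A" and U: "zopen R U"
  and iso: "ringed_space_iso (open_subspace (spec R) U) (spec A) psi theta"
begin

abbreviation "pre V \<equiv> preim (open_subspace (spec R) U) psi V"

lemma pre_eq: "pre V = {P : U. psi P : V}"
 by (rule preim_open_subspace) (use open_Spec[OF R U] topspace_zariski[of R] in simp)

lemma chart_homeo: "homeomorphic_map (subtopology (zariski R) U) (zariski A) psi"
 using iso unfolding ringed_space_iso_def by (simp add: open_subspace_def)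

lemma topspace_sub: "topspace (subtopology (zariski R) U) = U"
 using open_Spec[OF R U] topspace_zariski[of R] by auto

lemma chart_open: "zopen A V ==> zopen R (pre V)"
 using openin_continuous_map_preimage[OF homeomorphic_imp_continuous_map[OF chart_homeo], of V]
  openin_trans_full[OF _ U] unfolding pre_eq topspace_sub by blast

lemma chart_X: "pre (Spec A) = U"
 using homeomorphic_imp_surjective_map[OF chart_homeo] topspace_sub topspace_zariski[of A] unfolding pre_eq by blast

lemma chart_iso: "zopen A V ==> theta V : ring_iso (\<O> A V) (\<O> R (pre V))"
 using iso unfolding ringed_space_iso_def by simp

lemma chart_iso_units:
 assumes V: "zopen A V" and a: "a : carrier (\<O> A V)"
 shows "theta V a : Units (\<O> R (pre V)) <-> a : Units (\<O> A V)"
 by (rule ring_iso_Units_iff[OF cring_Osec[OF A V] cring_Osec[OF R chart_open[OF V]] chart_iso[OF V] a])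

lemma op_Spec: "zopen A (Spec A)" using openin_topspace[of "zariski A"] by (simp add: topspace_zariski)

text \<open>The global sections of \<open>spec A\<close> are \<open>A\<close> itself, so
  \<open>theta\<close> makes the function \<open>r\<close> on \<open>U\<close> correspond to an
  element of \<open>A\<close>.\<close>

lemma chart_function:
 assumes r: "r : carrier R"
 shows "EX a:carrier A. theta (Spec A) (rsec A (Spec A) a) = rsec R U r"
proof -
 have "rsec R U r : carrier (\<O> R U)" by (rule rsec_closed[OF R U r])
 then have "rsec R U r : theta (Spec A) ` carrier (\<O> A (Spec A))"
  using chart_iso[OF op_Spec] unfolding chart_X ring_iso_def by (auto dest: bij_betw_imp_surj_on)
 moreover have "carrier (\<O> A (Spec A)) = msec A (ring_module A) (Spec A) ` carrier A"
  using bij_betw_imp_surj_on[OF msec_bij[OF A ring_module_module[OF A]]] Osec_eqs(1)[OF A op_Spec] by simp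
 ultimately show ?thesis unfolding rsec_msec by auto
qed

lemma chart_rsec:
 assumes V: "zopen A V" and r: "r : carrier R" and a: "a : carrier A"
  and eq: "theta (Spec A) (rsec A (Spec A) a) = rsec R U r"
 shows "theta V (rsec A V a) = rsec R (pre V) r"
proof -
 have VA: "V <= Spec A" by (rule open_Spec[OF A V])
 have "theta V (Ores (spec A) (Spec A) V (rsec A (Spec A) a)) = Ores (spec R) (pre (Spec A)) (pre V) (theta (Spec A) (rsec A (Spec A) a))"
  using iso V op_Spec VA rsec_closed[OF A op_Spec a] unfolding ringed_space_iso_def open_subspace_simps spec_simps(1) by blast
 moreover have "pre V <= U" unfolding pre_eq by blast
 ultimately show ?thesis unfolding spec_simps eq by (simp add: rsec_restrict[OF VA] rsec_restrict)
qed

text \<open>Inside any open set, the points where \<open>r\<close> does not vanish form the largest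
  open subset on which \<open>r\<close> is a unit. Ring isomorphisms preserve units, so basic open
  sets correspond without reference to stalks.\<close>

lemma chart_Dset:
 assumes r: "r : carrier R" and a: "a : carrier A"
  and eq: "theta (Spec A) (rsec A (Spec A) a) = rsec R U r"
 shows "pre (Dset A a) = U Int Dset R r"
proof
 note oa = openin_Dset[OF a]
 have "theta (Dset A a) (rsec A (Dset A a) a) : Units (\<O> R (pre (Dset A a)))"
  using chart_iso_units[OF oa rsec_closed[OF A oa a]] rsec_unit[OF A oa a] by simp
 then have "pre (Dset A a) <= Dset R r"
  unfolding chart_rsec[OF oa r a eq] by (rule rsec_unit_converse[OF R chart_open[OF oa] r])
 then show "pre (Dset A a) <= U Int Dset R r" using pre_eq by blast
next
 \<comment> \<open>For the reverse inclusion, \<open>psi\<close> carries this intersection to an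
   open set on which \<open>a\<close> is a unit, which hence lies in D(a).\<close>
 let ?V = "U Int Dset R r" let ?W = "psi ` ?V"
 have oV: "zopen R ?V" using U openin_Dset[OF r] by (rule openin_Int)
 then have "openin (subtopology (zariski R) U) ?V" unfolding openin_subtopology by blast
 then have oW: "zopen A ?W"
  using homeomorphic_imp_open_map[OF chart_homeo] unfolding open_map_def by blast
 have pW: "pre ?W = ?V"
  using homeomorphic_imp_injective_map[OF chart_homeo] unfolding pre_eq topspace_sub by (auto dest: inj_onD)
 have "rsec R ?V r : Units (\<O> R ?V)" by (rule rsec_unit[OF R oV r]) simp
 then have "rsec A ?W a : Units (\<O> A ?W)"
  using chart_iso_units[OF oW rsec_closed[OF A oW a]] chart_rsec[OF oW r a eq] pW by simp
 then have "?W <= Dset A a" by (rule rsec_unit_converse[OF A oW a])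
 then show "?V <= pre (Dset A a)" unfolding pre_eq by blast
qed

end

lemma ring_iso_ring_module:
 assumes A: "cring A" and B: "cring B" and theta: "theta : ring_iso A B" and "a : carrier A"
 shows "theta (a [^]\<^sub>A (n::nat)) = theta a [^]\<^sub>B n"
proof -
 interpret theta: ring_hom_cring A B theta by (rule ring_hom_cring_I[OF A B]) (use theta ring_iso_def in blast)
 show ?thesis using theta.ring.hom_nat_pow assms(4) by blast
qed

context spec_sheaf
begin

context
 fixes U A N psi theta eta
 assumes U: "op U" and A: "cring A" and N: "module A N"
  and iso: "ringed_space_iso (open_subspace (spec R) U) (spec A) psi theta"
  and miso: "mod_sheaf_iso (open_subspace (spec R) U) F (spec A) (tilde A N) psi theta eta"
begin

private abbreviation (input) "pr V \<equiv> preim (open_subspace (spec R) U) psi V"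

interpretation T: spec_sheaf A "tilde A N" by (rule spec_sheaf.intro[OF A sheaf_tilde[OF A N]])

private lemma chart_op: "zopen A V ==> op (pr V)" by (rule chart_open[OF R A U iso])
private lemma chart_top: "pr (Spec A) = U" by (rule chart_X[OF R A U iso])

private lemma eta:
 assumes V: "zopen A V"
 shows "bij_betw (eta V) (Sec (tilde A N) V) (Sec F (pr V))"
  and "semilinear (\<O> A V) (theta V) (sec (tilde A N) V) (sec F (pr V)) (eta V)"
  and "eta V \<zero>\<^sub>(sec (tilde A N) V) = \<zero>\<^sub>(sec F (pr V))"
proof -
 have VV: "openin (top_of (spec A)) V" using V by simp
 note m = miso[unfolded mod_sheaf_iso_def, THEN conjunct1, THEN HOL.spec, THEN mp, OF VV]
 show b: "bij_betw (eta V) (Sec (tilde A N) V) (Sec F (pr V))" using m by blast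
 show s: "semilinear (\<O> A V) (theta V) (sec (tilde A N) V) (sec F (pr V)) (eta V)"
 proof (rule semilinearI)
  show "eta V x : Sec F (pr V)" if "x : Sec (tilde A N) V" for x
   using that b by (rule bij_betwE[rule_format, rotated])
 qed (use m in blast)+
 show "eta V \<zero>\<^sub>(sec (tilde A N) V) = \<zero>\<^sub>(sec F (pr V))"
  by (rule semilinear_zero[OF s module_abelian[OF T.smod[OF V]] module_abelian[OF smod[OF chart_op[OF V]]]])
qed

private lemma eta_res:
 assumes "zopen A V" "zopen A W" "W <= V" "s : Sec (tilde A N) V"
 shows "eta W (res (tilde A N) V W s) = res F (pr V) (pr W) (eta V s)"
 using miso[unfolded mod_sheaf_iso_def, THEN conjunct2, THEN HOL.spec, THEN HOL.spec, THEN mp, of V W] assms by simp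

private lemma eta_pow:
 assumes V: "zopen A V" and r: "r : carrier R" and a: "a : carrier A"
  and eq: "theta (Spec A) (rsec A (Spec A) a) = rsec R U r" and s: "s : Sec (tilde A N) V"
 shows "eta V (rsec A V (a [^]\<^sub>A (n::nat)) \<odot>\<^sub>(sec (tilde A N) V) s) = (r [^] n) \<odot>[R,F,pr V] eta V s"
proof -
 interpret rhoR: ring_hom_cring R "\<O> R (pr V)" "rsec R (pr V)"
  by (rule ring_hom_cring_I[OF R cring_Osec[OF R chart_op[OF V]] rsec_hom[OF R chart_op[OF V]]])
 interpret rhoA: ring_hom_cring A "\<O> A V" "rsec A V"
  by (rule ring_hom_cring_I[OF A cring_Osec[OF A V] rsec_hom[OF A V]])
 have ac: "a [^]\<^sub>A n : carrier A" using a by simp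
 have "theta V (rsec A V (a [^]\<^sub>A n)) = theta V (rsec A V a [^]\<^sub>(\<O> A V) n)"
  using rhoA.ring.hom_nat_pow[OF a] by simp
 also have "\<dots> = theta V (rsec A V a) [^]\<^sub>(\<O> R (pr V)) n"
  by (rule ring_iso_ring_module[OF cring_Osec[OF A V] cring_Osec[OF R chart_op[OF V]] chart_iso[OF R A U iso V] rsec_closed[OF A V a]])
 also have "\<dots> = rsec R (pr V) (r [^] n)"
  unfolding chart_rsec[OF R A U iso V r a eq] using rhoR.ring.hom_nat_pow[OF r] by simp
 finally show ?thesis using semilinearD(3)[OF eta(2)[OF V] rsec_closed[OF A V ac] s] by simp
qed

text \<open>An element \<open>r\<close> of \<open>R\<close> and the corresponding \<open>a\<close>
  of \<open>A\<close> have corresponding basic open sets and corresponding actions, so the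
  localization property of the sheaf associated with \<open>N\<close> carries over to
  \<open>F\<close> on \<open>U\<close>.\<close>

lemma chart_qcl: "qcl R F U"
proof (rule qclI[OF U])
 note oY = T.op_X
 fix r t assume r: "r : carrier R"
 obtain a where a: "a : carrier A" "theta (Spec A) (rsec A (Spec A) a) = rsec R U r"
  using chart_function[OF R A U iso r] by blast
 have oa: "zopen A (Dset A a)" using a(1) by simp
 have Da: "pr (Dset A a) = U Int D r" by (rule chart_Dset[OF R A U iso r a])
 have YD: "Spec A Int Dset A a = Dset A a" using T.D_sub by blast
 note q = T.qclD[OF qcl_tilde[OF A N] a(1), unfolded YD]
 {
  assume t: "t : Sec F U" and t0: "res F U (U Int D r) t = \<zero>\<^sub>(sec F (U Int D r))"
  obtain s where s: "s : Sec (tilde A N) (Spec A)" "t = eta (Spec A) s"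
   using bij_betw_imp_surj_on[OF eta(1)[OF oY], unfolded chart_top] t by blast
  have rs: "res (tilde A N) (Spec A) (Dset A a) s : Sec (tilde A N) (Dset A a)"
   by (rule T.res_closed[OF oY oa T.D_sub s(1)])
  have "eta (Dset A a) (res (tilde A N) (Spec A) (Dset A a) s) = eta (Dset A a) \<zero>\<^sub>(sec (tilde A N) (Dset A a))"
   unfolding eta_res[OF oY oa T.D_sub s(1)] eta(3)[OF oa] Da chart_top s(2)[symmetric] by (rule t0)
  then have "res (tilde A N) (Spec A) (Dset A a) s = \<zero>\<^sub>(sec (tilde A N) (Dset A a))"
   by (rule inj_onD[OF bij_betw_imp_inj_on[OF eta(1)[OF oa]] _ rs T.zero_closed[OF oa]])
  then obtain n :: nat where "rsec A (Spec A) (a [^]\<^sub>A n) \<odot>\<^sub>(sec (tilde A N) (Spec A)) s = \<zero>\<^sub>(sec (tilde A N) (Spec A))"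
   using q(1)[OF s(1)] by blast
  then have "(r [^] n) \<odot>[R,F,U] t = \<zero>\<^sub>(sec F U)"
   using eta_pow[OF oY r a s(1), of n] eta(3)[OF oY] unfolding chart_top s(2) by argo
  then show "EX n::nat. (r [^] n) \<odot>[R,F,U] t = \<zero>\<^sub>(sec F U)" by blast
 }
 assume t: "t : Sec F (U Int D r)"
 obtain s where s: "s : Sec (tilde A N) (Dset A a)" "t = eta (Dset A a) s"
  using bij_betw_imp_surj_on[OF eta(1)[OF oa], unfolded Da] t by blast
 obtain n :: nat and s' where s': "s' : Sec (tilde A N) (Spec A)"
  "rsec A (Dset A a) (a [^]\<^sub>A n) \<odot>\<^sub>(sec (tilde A N) (Dset A a)) s = res (tilde A N) (Spec A) (Dset A a) s'"
  using q(2)[OF s(1)] by blast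
 have "(r [^] n) \<odot>[R,F,U Int D r] t = res F U (U Int D r) (eta (Spec A) s')"
  using eta_pow[OF oa r a s(1), of n] eta_res[OF oY oa T.D_sub s'(1)] s'(2) unfolding Da chart_top s(2) by argo
 moreover have "eta (Spec A) s' : Sec F U"
  using bij_betwE[OF eta(1)[OF oY]] s'(1) unfolding chart_top by blast
 ultimately show "EX n::nat. EX t':Sec F U. (r [^] n) \<odot>[R,F,U Int D r] t = res F U (U Int D r) t'"
  by blast
qed

text \<open>The images of generators of \<open>N\<close> generate, because the elements of
  \<open>N\<close> whose image lies in their span form an \<open>A\<close>-submodule,
  \<open>A\<close> acting through \<open>theta\<close>.\<close>

lemma chart_finite_generation:
 assumes fin: "finite_module A N"
 shows "EX G <= Sec F U. finite G & gen_submodule (\<O> R U) (sec F U) G = Sec F U"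
proof -
 note oY = T.op_X
 let ?k = "%n. eta (Spec A) (msec A N (Spec A) n)"
 let ?O = "\<O> R U"
 obtain B where B: "B <= carrier N" "finite B" "gen_submodule A N B = carrier N" using fin unfolding finite_module_def by blast
 have mc: "msec A N (Spec A) n : Sec (tilde A N) (Spec A)" if "n : carrier N" for n
  using bij_betwE[OF msec_bij[OF A N]] that by blast
 have kc: "?k n : Sec F U" if "n : carrier N" for n
  using bij_betwE[OF eta(1)[OF oY]] mc[OF that] unfolding chart_top by blast
 have thetac: "theta (Spec A) (rsec A (Spec A) a) : carrier ?O" if "a : carrier A" for a
 proof -
  have "theta (Spec A) : ring_hom (\<O> A (Spec A)) ?O"
   using chart_iso[OF R A U iso oY] unfolding chart_top ring_iso_def by simp
  then show ?thesis using rsec_closed[OF A oY that] by (rule ring_hom_closed)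
 qed
 note lin = semilinearD[OF eta(2)[OF oY], unfolded chart_top]
 note ml = semilinearD[OF msec_lin[OF A N oY], unfolded rmod_simps]
 have kadd: "?k (n \<oplus>\<^sub>N n') = ?k n \<oplus>\<^sub>(sec F U) ?k n'" if "n : carrier N" "n' : carrier N" for n n'
  unfolding ml(2)[OF that] by (rule lin(2)[OF mc[OF that(1)] mc[OF that(2)]])
 have ksm: "?k (a \<odot>\<^sub>N n) = theta (Spec A) (rsec A (Spec A) a) \<odot>\<^sub>(sec F U) ?k n" if "a : carrier A" "n : carrier N" for a n
  using ml(3)[OF that] lin(3)[OF rsec_closed[OF A oY that(1)] mc[OF that(2)]] by simp
 interpret N: module A N by (rule N)
 interpret FU: module ?O "sec F U" by (rule smod[OF U])
 let ?G = "gen_submodule ?O (sec F U) (?k ` B)"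
 have BG: "?k ` B <= Sec F U" using B(1) kc by (intro image_subsetI) (rule kc, erule subsetD)
 note G = submoduleD[OF gen_submodule_submodule[OF smod[OF U] BG] smod[OF U]]
 have k0: "?k \<zero>\<^sub>N = \<zero>\<^sub>(sec F U)"
  using kadd[OF N.M.zero_closed N.M.zero_closed] kc[OF N.M.zero_closed] FU.M.add.r_cancel_one by simp
 have "submodule {n : carrier N. ?k n : ?G} A N"
 proof (rule submoduleI2[OF N])
  show "x \<oplus>\<^sub>N y : {n : carrier N. ?k n : ?G}" if "x : {n : carrier N. ?k n : ?G}" "y : {n : carrier N. ?k n : ?G}" for x y
   using that G(3) kadd[of x y] by simp
  show "a \<odot>\<^sub>N x : {n : carrier N. ?k n : ?G}" if "a : carrier A" "x : {n : carrier N. ?k n : ?G}" for a x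
   using that G(5)[OF thetac[OF that(1)]] ksm[of a x] by simp
 qed (use k0 G(2) in auto)
 moreover have "B <= {n : carrier N. ?k n : ?G}" using B(1) gen_submodule_incl[of "?k ` B" ?O "sec F U"] by blast
 ultimately have all: "?k n : ?G" if "n : carrier N" for n
  using gen_submodule_least[of B _ A N] that B(3) by blast
 have "Sec F U <= ?G"
 proof
  fix t assume "t : Sec F U"
  then obtain s where s: "s : Sec (tilde A N) (Spec A)" "t = eta (Spec A) s"
   using bij_betw_imp_surj_on[OF eta(1)[OF oY], unfolded chart_top] by blast
  then obtain n where "n : carrier N" "s = msec A N (Spec A) n"
   using bij_betw_imp_surj_on[OF msec_bij[OF A N]] by blast
  then show "t : ?G" using all s(2) by blast
 qed
 then have "?G = Sec F U" using G(1) by blast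
 then show ?thesis using BG B(2) by (intro exI[of _ "?k ` B"]) auto
qed

end

end

section \<open>Quasi-coherent sheaves on the spectrum\<close>

context spec_sheaf
begin

lemma rsmult_add: "op U ==> r : carrier R ==> s : Sec F U ==> t : Sec F U ==>
  r \<odot>[R,F,U] (s \<oplus>\<^sub>(sec F U) t) = r \<odot>[R,F,U] s \<oplus>\<^sub>(sec F U) r \<odot>[R,F,U] t"
 using module.smult_r_distr[OF rmod_module, of U r s t] by simp

lemma rsmult_comm: "op U ==> a : carrier R ==> b : carrier R ==> s : Sec F U ==>
  a \<odot>[R,F,U] (b \<odot>[R,F,U] s) = b \<odot>[R,F,U] (a \<odot>[R,F,U] s)"
 using rsmult_mult[of U a b s] rsmult_mult[of U b a s] by (simp add: R.m_comm)

lemma add_closed: "op U ==> s : Sec F U ==> t : Sec F U ==> s \<oplus>\<^sub>(sec F U) t : Sec F U"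
 using abelian_monoid.a_closed[OF abelian_group.axioms(1)[OF module_abelian[OF smod]]] .

end

text \<open>The primes of \<open>O(D(f))\<close> are identified with the points of \<open>D(f)\<close> by contraction. A section \<open>t\<close> of \<open>F\<close>
 corresponds to the section of the associated sheaf that is \<open>x/w\<close> on \<open>D(w)\<close> whenever \<open>w t = x\<close> there, \<open>x\<close> a section over \<open>D(f)\<close>.\<close>

definition chart_datum where
 "chart_datum R F f W t w x <-> w : carrier R & x : Sec F (Dset R f) & Dset R w <= W &
   w \<odot>[R,F,Dset R w] res F W (Dset R w) t = res F (Dset R f) (Dset R w) x"

definition chart_stalk where
 "chart_stalk R F f Q x w =
   frac (\<O> R (Dset R f)) (sec F (Dset R f)) (carrier (\<O> R (Dset R f)) - Q) x (rsec R (Dset R f) w)"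

definition chart_dom where
 "chart_dom R f W = {Q : Spec (\<O> R (Dset R f)). contraction R (rsec R (Dset R f)) Q : W}"

text \<open>The description has a solution by \<open>chart_datum_ex\<close>, and only one because
  any two data for \<open>t\<close> give the same fraction, by \<open>stk_unique\<close>.\<close>

definition chart_map where
 "chart_map R F f W t = (\<lambda>Q \<in> chart_dom R f W. THE c. EX w x. chart_datum R F f W t w x &
   w ~: contraction R (rsec R (Dset R f)) Q & c = chart_stalk R F f Q x w)"

context
 fixes R :: "('a, 'm) ring_scheme" (structure) and f
 assumes R: "cring R" and f: "f : carrier R"
begin

interpretation R: cring R by (rule R)

private abbreviation (input) "Df \<equiv> Dset R f"
private abbreviation (input) "B \<equiv> \<O> R Df"
private abbreviation (input) "rho \<equiv> rsec R Df"
private abbreviation (input) "ctr \<equiv> contraction R (rsec R Df)"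
private abbreviation (input) "exn \<equiv> extension R f (\<O> R Df) (rsec R Df)"
private abbreviation (input) "E \<equiv> chart_dom R f"

private lemma Bc: "cring B" by (rule cring_Osec[OF R openin_Dset[OF f]])
private lemma loc: "ring_loc_at R f B rho" by (rule ring_loc_at_Osec[OF R f])

interpretation B: cring B by (rule Bc)
interpretation rho: ring_hom_cring R B rho by (rule ring_hom_cring_I[OF R Bc ring_loc_atD(1)[OF loc]])

private lemmas rho_closed = rho.ring.hom_closed

lemma chart_contr: "Q : Spec B ==> ctr Q : Df"
 using contr_prime[OF R Bc f loc, of Q] by (simp add: Spec_iff Dset_iff)

lemma chart_extn: "P : Df ==> exn P : Spec B"
 using extn_prime[OF R Bc f loc, of P] by (simp add: Spec_iff Dset_iff)

lemma chart_contr_extn: "P : Df ==> ctr (exn P) = P"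
 using contr_extn[OF R Bc f loc, of P] by (simp add: Dset_iff)

lemma chart_extn_contr: "Q : Spec B ==> exn (ctr Q) = Q"
 using extn_contr[OF R Bc f loc, of Q] by (simp add: Spec_iff)

lemma rho_mem: "w : carrier R ==> rho w : Q <-> w : ctr Q"
 by (simp add: contraction_def)

text \<open>Multiplying \<open>b\<close> by a power of the unit \<open>f\<close> does not change
  which primes contain it, so every basic open set of the spectrum of \<open>B\<close> comes from an
  element of \<open>R\<close>.\<close>

lemma chart_den:
 assumes b: "b : carrier B"
 shows "EX n::nat. EX r:carrier R. rho (f [^] n) \<otimes>\<^sub>B b = rho r & (ALL Q:Spec B. b : Q <-> r : ctr Q)"
proof -
 obtain n :: nat and r where r: "r : carrier R" "rho (f [^] n) \<otimes>\<^sub>B b = rho r" using ring_loc_atD(5)[OF loc b] by blast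
 have "b : Q <-> r : ctr Q" if Q: "Q : Spec B" for Q
  using extn_iff[OF R Bc f loc _ _ b r, of "ctr Q"] chart_contr[OF Q] chart_extn_contr[OF Q] by (simp add: Dset_iff)
 then show ?thesis using r by blast
qed

lemma chart_dom_sub: "E W <= Spec B" unfolding chart_dom_def by blast

lemma chart_dom_open:
 assumes W: "zopen R W" shows "zopen B (E W)"
 unfolding openin_zariski_iff
proof (intro conjI ballI chart_dom_sub)
 fix Q assume Q: "Q : E W"
 then have Q': "Q : Spec B" "ctr Q : W" unfolding chart_dom_def by auto
 obtain w where w: "w : carrier R" "w ~: ctr Q" "Dset R w <= W" "ctr Q : Dset R w" by (rule open_nbhd[OF W Q'(2)])
 have "Dset B (rho w) <= E W"
 proof
  fix Q' assume "Q' : Dset B (rho w)"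
  then have "Q' : Spec B" "w ~: ctr Q'" using rho_mem[OF w(1)] by (auto simp: Dset_iff Spec_iff)
  then have "ctr Q' : Dset R w" using chart_contr[of Q'] by (simp add: Dset_iff)
  then show "Q' : E W" using w(3) \<open>Q' : Spec B\<close> unfolding chart_dom_def by blast
 qed
 then show "EX b:carrier B. b ~: Q & Dset B b <= E W"
  using rho_closed[OF w(1)] rho_mem[OF w(1)] w(2) by blast
qed

lemma chart_nbhd:
 assumes V: "zopen B V" and Q: "Q : V"
 shows "EX r:carrier R. r ~: ctr Q & (ALL Q':Spec B. r ~: ctr Q' --> Q' : V)"
proof -
 obtain b where b: "b : carrier B" "b ~: Q" "Dset B b <= V" "Q : Dset B b" by (rule open_nbhd[OF V Q])
 obtain n :: nat and r where r: "r : carrier R" "ALL Q:Spec B. b : Q <-> r : ctr Q" using chart_den[OF b(1)] by blast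
 have "Q' : V" if "Q' : Spec B" "r ~: ctr Q'" for Q'
  using b(3) r(2) that by (auto simp: Dset_iff Spec_iff)
 moreover have "Q : Spec B" using open_Spec[OF Bc V] Q by blast
 ultimately show ?thesis using r b(2) by blast
qed

text \<open>Basic open sets on both sides come from elements of \<open>R\<close>; this makes
  contraction continuous by \<open>chart_dom_open\<close> and extension continuous by
  \<open>chart_nbhd\<close>.\<close>

lemma chart_homeomorphic: "homeomorphic_map (subtopology (zariski R) Df) (zariski B) exn"
proof -
 have tR: "topspace (subtopology (zariski R) Df) = Df"
  unfolding topspace_subtopology topspace_zariski by (auto simp: Dset_def)
 have "continuous_map (subtopology (zariski R) Df) (zariski B) exn"
  unfolding continuous_map_def tR topspace_zariski
 proof (intro conjI allI impI funcsetI chart_extn)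
  fix V assume V: "zopen B V"
  show "openin (subtopology (zariski R) Df) {P : Df. exn P : V}"
  proof (subst openin_subopen, intro ballI)
   fix P assume P: "P : {P : Df. exn P : V}"
   then have PD: "P : Df" by blast
   obtain r where r: "r : carrier R" "r ~: ctr (exn P)" "ALL Q':Spec B. r ~: ctr Q' --> Q' : V"
    using chart_nbhd[OF V, of "exn P"] P by blast
   have "P' : {P : Df. exn P : V}" if "P' : Dset R r Int Df" for P'
    using r(3)[rule_format, OF chart_extn, of P'] chart_contr_extn[of P'] that by (simp add: Dset_iff)
   moreover have "P : Dset R r Int Df" using r(2) chart_contr_extn[OF PD] PD by (simp add: Dset_iff)
   moreover have "openin (subtopology (zariski R) Df) (Dset R r Int Df)"
    unfolding openin_subtopology using openin_Dset[OF r(1)] by blast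
   ultimately show "EX T. openin (subtopology (zariski R) Df) T & P : T & T <= {P : Df. exn P : V}"
    by (intro exI[of _ "Dset R r Int Df"] conjI subsetI)
  qed
 qed
 moreover have "continuous_map (zariski B) (zariski R) ctr"
  unfolding continuous_map_def topspace_zariski
 proof (intro conjI allI impI funcsetI)
  show "ctr Q : Spec R" if "Q : Spec B" for Q using chart_contr[OF that] by (simp add: Dset_iff Spec_iff)
  show "zopen B {Q : Spec B. ctr Q : W}" if "zopen R W" for W
   using chart_dom_open[OF that] unfolding chart_dom_def .
 qed
 then have "continuous_map (zariski B) (subtopology (zariski R) Df) ctr"
  unfolding continuous_map_in_subtopology topspace_zariski using chart_contr by blast
 ultimately have "homeomorphic_maps (subtopology (zariski R) Df) (zariski B) exn ctr"
  unfolding homeomorphic_maps_def tR topspace_zariski using chart_contr_extn chart_extn_contr by blast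
 then show ?thesis unfolding homeomorphic_map_maps by blast
qed

lemma chart_preim:
 assumes V: "zopen B V"
 shows "zopen R {P : Df. exn P : V}" "E {P : Df. exn P : V} = V"
proof -
 have tR: "topspace (subtopology (zariski R) Df) = Df"
  unfolding topspace_subtopology topspace_zariski by (auto simp: Dset_def)
 have "openin (subtopology (zariski R) Df) {P : Df. exn P : V}"
  using openin_continuous_map_preimage[OF homeomorphic_imp_continuous_map[OF chart_homeomorphic] V] unfolding tR .
 then show "zopen R {P : Df. exn P : V}" by (rule openin_trans_full) (rule openin_Dset[OF f])
 show "E {P : Df. exn P : V} = V"
  unfolding chart_dom_def using open_Spec[OF Bc V] chart_contr chart_extn_contr by (auto simp del: spec_simps)
qed

section \<open>The chart of a sheaf of modules over D(f)\<close>

context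
 fixes F
 assumes F: "sheaf_of_modules (spec R) F" and q: "qcl R F (Spec R)"
begin

interpretation S: spec_sheaf R F by (rule spec_sheaf.intro[OF R F])

private abbreviation (input) "N \<equiv> sec F Df"
private abbreviation (input) "dat \<equiv> chart_datum R F f"
private abbreviation (input) "stk \<equiv> chart_stalk R F f"

private lemma oD: "zopen R Df" using f by simp
private lemma Nm: "module B N" by (rule S.smod[OF oD])

interpretation N: module B N by (rule Nm)

lemma chart_datumD:
 assumes "dat W t w x"
 shows "w : carrier R" "x : carrier N" "Dset R w <= W"
 using assms unfolding chart_datum_def by auto

lemma chart_datum_on:
 assumes d: "dat W t w x" and W: "zopen R W" "W <= Df" and t: "t : Sec F W"
  and Z: "zopen R Z" "Z <= Dset R w"
 shows "w \<odot>[R,F,Z] res F W Z t = res F Df Z x"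
proof -
 note D = chart_datumD[OF d]
 have "res F (Dset R w) Z (w \<odot>[R,F,Dset R w] res F W (Dset R w) t) = res F (Dset R w) Z (res F Df (Dset R w) x)"
  using d unfolding chart_datum_def by simp
 moreover have "res F (Dset R w) Z (w \<odot>[R,F,Dset R w] res F W (Dset R w) t) = w \<odot>[R,F,Z] res F W Z t"
  using S.res_rsmult[OF S.op_D[OF D(1)] Z D(1) S.res_closed[OF W(1) S.op_D[OF D(1)] D(3) t]]
   S.res_comp[OF W(1) S.op_D[OF D(1)] Z D(3) t] by simp
 moreover have "res F (Dset R w) Z (res F Df (Dset R w) x) = res F Df Z x"
  by (rule S.res_comp[OF oD S.op_D[OF D(1)] Z subset_trans[OF D(3) W(2)] D(2)])
 ultimately show ?thesis by simp
qed

text \<open>On a basic neighbourhood D(v) of \<open>P\<close>, the localization property over D(f)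
  extends some \<open>v^n t\<close> to a section over D(f).\<close>

lemma chart_datum_ex:
 assumes W: "zopen R W" "W <= Df" and t: "t : Sec F W" and P: "P : W"
 shows "EX w x. dat W t w x & w ~: P"
proof -
 obtain v where v: "v : carrier R" "v ~: P" "Dset R v <= W" "P : Dset R v" by (rule open_nbhd[OF W(1) P])
 have Dv: "Df Int Dset R v = Dset R v" using v(3) W(2) by blast
 have rc: "res F W (Dset R v) t : Sec F (Dset R v)" by (rule S.res_closed[OF W(1) S.op_D[OF v(1)] v(3) t])
 obtain n :: nat and x where x: "x : carrier N" "(v [^] n) \<odot>[R,F,Dset R v] res F W (Dset R v) t = res F Df (Dset R v) x"
  using S.qclD(2)[OF S.qcl_sub[OF q S.op_X f S.D_sub] v(1), unfolded Dv, OF rc] by blast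
 \<comment> \<open>The additional factor \<open>v\<close> matters for \<open>n = 0\<close>: it
   ensures that D(w) is D(v) and so lies in \<open>W\<close>.\<close>
 let ?w = "v \<otimes> v [^] n" let ?x = "rho v \<odot>\<^sub>N x"
 have vn: "v [^] n : carrier R" using v(1) by simp
 have Dw: "Dset R ?w = Dset R v" using S.D_mult[OF v(1) vn] Dset_pow[OF R v(1), of n] by blast
 have "?w \<odot>[R,F,Dset R v] res F W (Dset R v) t = res F Df (Dset R v) ?x"
  unfolding S.rsmult_mult[OF S.op_D[OF v(1)] v(1) vn rc] x(2)
  by (rule S.res_rsmult[OF oD S.op_D[OF v(1)] _ v(1) x(1), symmetric]) (use v(3) W(2) in blast)
 then have "dat W t ?w ?x" unfolding chart_datum_def Dw using v vn x(1) rho_closed[OF v(1)] by (auto simp del: spec_simps)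
 moreover have "?w ~: P"
 proof -
  have "P : Dset R ?w" unfolding Dw by (rule v(4))
  then show ?thesis unfolding Dset_iff by (rule conjunct2)
 qed
 ultimately show ?thesis by (intro exI conjI)
qed

private lemma stalk_ms: "Q : Spec B ==> mult_set B (carrier B - Q)" by (rule stalk_mult[OF Bc])

private lemma rho_den: "w : carrier R ==> w ~: ctr Q ==> rho w : carrier B - Q"
 using rho_closed rho_mem by blast

text \<open>If the cross products agree on D(u), a power of \<open>u\<close> kills their difference
  over D(f), and this power is an admissible denominator at \<open>Q\<close>.\<close>

private lemma stk_eqI:
 assumes Q: "Q : Spec B" and x: "x : carrier N" "w : carrier R" "w ~: ctr Q" and y: "y : carrier N" "v : carrier R" "v ~: ctr Q"
  and u: "u : carrier R" "u ~: ctr Q" "Dset R u <= Df"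
  and eq: "res F Df (Dset R u) (rho v \<odot>\<^sub>N x) = res F Df (Dset R u) (rho w \<odot>\<^sub>N y)"
 shows "stk Q x w = stk Q y v"
proof -
 let ?a = "rho v \<odot>\<^sub>N x" and ?b = "rho w \<odot>\<^sub>N y"
 have ab: "?a : carrier N" "?b : carrier N" using S.rsmult_closed[OF oD] x y by auto
 have Du: "Df Int Dset R u = Dset R u" using u(3) by blast
 interpret U: module "\<O> R (Dset R u)" "sec F (Dset R u)" by (rule S.smod[OF S.op_D[OF u(1)]])
 have "res F Df (Dset R u) (?a \<ominus>\<^sub>N ?b) = \<zero>\<^sub>(sec F (Dset R u))"
  unfolding S.res_minus[OF oD S.op_D[OF u(1)] u(3) ab] eq
  using S.res_closed[OF oD S.op_D[OF u(1)] u(3) ab(2)] by (simp add: a_minus_def U.M.r_neg)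
 then obtain n :: nat where n: "rho (u [^] n) \<odot>\<^sub>N (?a \<ominus>\<^sub>N ?b) = \<zero>\<^sub>N"
  using S.qclD(1)[OF S.qcl_sub[OF q S.op_X f S.D_sub] u(1), unfolded Du, OF N.M.minus_closed[OF ab]] by blast
 have un: "u [^] n : carrier R" "u [^] n ~: ctr Q"
  using u(1,2) prime_pow[of "ctr Q" R u n] chart_contr[OF Q] by (auto simp: Dset_iff)
 have c: "rho (u [^] n) : carrier B" "rho v : carrier B" "rho w : carrier B" using rho_closed un(1) x(2) y(2) by blast+
 have "rho (u [^] n) \<odot>\<^sub>N ?a \<ominus>\<^sub>N rho (u [^] n) \<odot>\<^sub>N ?b = \<zero>\<^sub>N"
  using n N.smult_r_distr[OF c(1) ab(1) N.M.a_inv_closed[OF ab(2)]] N.smult_r_minus[OF c(1) ab(2)] by (simp only: a_minus_def)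
 then have "rho (u [^] n) \<odot>\<^sub>N ?a = rho (u [^] n) \<odot>\<^sub>N ?b"
  using N.M.minus_equality[OF _ N.M.a_inv_closed[OF N.smult_closed[OF c(1) ab(2)]] N.smult_closed[OF c(1) ab(1)]]
   N.M.minus_minus[OF N.smult_closed[OF c(1) ab(2)]] by (simp only: a_minus_def)
 then have "(rho (u [^] n) \<otimes>\<^sub>B rho v) \<odot>\<^sub>N x = (rho (u [^] n) \<otimes>\<^sub>B rho w) \<odot>\<^sub>N y"
  unfolding N.smult_assoc1[OF c(1,2) x(1)] N.smult_assoc1[OF c(1,3) y(1)] .
 then show ?thesis unfolding chart_stalk_def frac_eq_iff[OF Nm stalk_ms[OF Q] x(1) rho_den[OF x(2,3)] y(1) rho_den[OF y(2,3)]]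
  using rho_den[OF un] by blast
qed

text \<open>The element of \<open>B\<close> that witnesses equality of the fractions is replaced by
  an \<open>r\<close> in \<open>R\<close> lying in the same primes, and \<open>r\<close> is
  cancelled on open subsets of D(r).\<close>

private lemma stk_eqD:
 assumes Q: "Q : Spec B" and x: "x : carrier N" "w : carrier R" "w ~: ctr Q" and y: "y : carrier N" "v : carrier R" "v ~: ctr Q"
  and eq: "stk Q x w = stk Q y v"
 shows "EX r:carrier R. r ~: ctr Q & (ALL Z. zopen R Z --> Z <= Df --> Z <= Dset R r -->
   v \<odot>[R,F,Z] res F Df Z x = w \<odot>[R,F,Z] res F Df Z y)"
proof -
 obtain u where u: "u : carrier B - Q" "(u \<otimes>\<^sub>B rho v) \<odot>\<^sub>N x = (u \<otimes>\<^sub>B rho w) \<odot>\<^sub>N y"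
  using eq unfolding chart_stalk_def frac_eq_iff[OF Nm stalk_ms[OF Q] x(1) rho_den[OF x(2,3)] y(1) rho_den[OF y(2,3)]] by blast
 have uc: "u : carrier B" "u ~: Q" using u(1) by blast+
 obtain n :: nat and r where r: "r : carrier R" "rho (f [^] n) \<otimes>\<^sub>B u = rho r" "ALL Q:Spec B. u : Q <-> r : ctr Q"
  using chart_den[OF uc(1)] by blast
 have fn: "rho (f [^] n) : carrier B" by (rule rho_closed) (use f in simp)
 have c: "rho v : carrier B" "rho w : carrier B" using rho_closed x(2) y(2) by blast+
 have e: "rho r \<odot>\<^sub>N (rho v \<odot>\<^sub>N x) = rho r \<odot>\<^sub>N (rho w \<odot>\<^sub>N y)"
  unfolding r(2)[symmetric] N.smult_assoc1[OF fn uc(1) N.smult_closed[OF c(1) x(1)]]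
   N.smult_assoc1[OF fn uc(1) N.smult_closed[OF c(2) y(1)]]
  using u(2) unfolding N.smult_assoc1[OF uc(1) c(1) x(1)] N.smult_assoc1[OF uc(1) c(2) y(1)] by simp
 have "v \<odot>[R,F,Z] res F Df Z x = w \<odot>[R,F,Z] res F Df Z y"
  if Z: "zopen R Z" "Z <= Df" "Z <= Dset R r" for Z
 proof (rule S.unit_cancel[OF Z(1) r(1) Z(3)])
  note l = S.res_rsmult[OF oD Z(1,2)]
  have rc: "res F Df Z x : Sec F Z" "res F Df Z y : Sec F Z"
   using S.res_closed[OF oD Z(1,2)] x(1) y(1) by blast+
  show "v \<odot>[R,F,Z] res F Df Z x : Sec F Z" "w \<odot>[R,F,Z] res F Df Z y : Sec F Z"
   using S.rsmult_closed[OF Z(1)] rc x(2) y(2) by blast+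
  show "r \<odot>[R,F,Z] (v \<odot>[R,F,Z] res F Df Z x) = r \<odot>[R,F,Z] (w \<odot>[R,F,Z] res F Df Z y)"
   using arg_cong[OF e, of "res F Df Z"]
   unfolding l[OF r(1) N.smult_closed[OF c(1) x(1)]] l[OF r(1) N.smult_closed[OF c(2) y(1)]] l[OF y(2) x(1)] l[OF x(2) y(1)] .
 qed
 then show ?thesis using r(1,3) uc(2) Q by blast
qed

text \<open>On D(w v) both cross products are \<open>w v t\<close>.\<close>

private lemma stk_unique:
 assumes W: "zopen R W" "W <= Df" and t: "t : Sec F W"
  and d: "dat W t w x" "dat W t v y" and Q: "Q : Spec B" "w ~: ctr Q" "v ~: ctr Q"
 shows "stk Q x w = stk Q y v"
proof -
 note Dw = chart_datumD[OF d(1)] and Dv = chart_datumD[OF d(2)]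
 let ?u = "w \<otimes> v" let ?Z = "Dset R (w \<otimes> v)"
 have uc: "?u : carrier R" using Dw(1) Dv(1) by simp
 have Zi: "?Z = Dset R w Int Dset R v" by (rule S.D_mult[OF Dw(1) Dv(1)])
 then have Z: "zopen R ?Z" "?Z <= Df" "?Z <= Dset R w" "?Z <= Dset R v" "?Z <= W"
  using S.op_D[OF uc] Dw(3) W(2) by blast+
 have tc: "res F W ?Z t : Sec F ?Z" by (rule S.res_closed[OF W(1) Z(1,5) t])
 show ?thesis
 proof (rule stk_eqI[OF Q(1) Dw(2,1) Q(2) Dv(2,1) Q(3) uc _ Z(2)])
  show "?u ~: ctr Q" using Q(2,3) chart_contr[OF Q(1)] Zi by (auto simp: Dset_iff)
  show "res F Df ?Z (rho v \<odot>\<^sub>N x) = res F Df ?Z (rho w \<odot>\<^sub>N y)"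
   unfolding S.res_rsmult[OF oD Z(1,2) Dv(1) Dw(2)] S.res_rsmult[OF oD Z(1,2) Dw(1) Dv(2)]
    chart_datum_on[OF d(1) W t Z(1,3), symmetric] chart_datum_on[OF d(2) W t Z(1,4), symmetric]
   by (rule S.rsmult_comm[OF Z(1) Dv(1) Dw(1) tc])
 qed
qed

lemma chart_map_eq:
 assumes W: "zopen R W" "W <= Df" and t: "t : Sec F W"
  and d: "chart_datum R F f W t w x" and Q: "Q : Spec B" "w ~: ctr Q"
 shows "chart_map R F f W t Q = chart_stalk R F f Q x w"
proof -
 have "ctr Q : Dset R w" using chart_contr[OF Q(1)] Q(2) by (simp add: Dset_iff)
 then have "Q : E W" unfolding chart_dom_def using Q(1) chart_datumD(3)[OF d] by blast
 moreover have "(THE c. EX w x. dat W t w x & w ~: ctr Q & c = stk Q x w) = stk Q x w"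
 proof (rule the_equality)
  show "EX w' x'. dat W t w' x' & w' ~: ctr Q & stk Q x w = stk Q x' w'" using d Q(2) by blast
  fix c assume "EX w' x'. dat W t w' x' & w' ~: ctr Q & c = stk Q x' w'"
  then obtain w' x' where c: "dat W t w' x'" "w' ~: ctr Q" "c = stk Q x' w'" by blast
  show "c = stk Q x w" unfolding c(3) by (rule stk_unique[OF W t c(1) d Q(1) c(2) Q(2)])
 qed
 ultimately show ?thesis unfolding chart_map_def by simp
qed

lemma chart_map_closed:
 assumes W: "zopen R W" "W <= Df" and t: "t : Sec F W"
 shows "chart_map R F f W t : tilde_sub B N (carrier N) (E W)"
proof (rule tilde_subI[OF Bc chart_dom_sub])
 show "chart_map R F f W t : extensional (E W)" unfolding chart_map_def by (rule restrict_extensional)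
 fix Q assume "Q : E W"
 then have Q: "Q : Spec B" "ctr Q : W" unfolding chart_dom_def by auto
 obtain w x where d: "dat W t w x" "w ~: ctr Q" using chart_datum_ex[OF W t Q(2)] by blast
 note D = chart_datumD[OF d(1)]
 have *: "Q' : Spec B & w ~: ctr Q'" if "Q' : Dset B (rho w)" for Q'
  using that rho_mem[OF D(1)] by (simp add: Dset_iff Spec_iff)
 have "Dset B (rho w) <= E W"
 proof
  fix Q' assume "Q' : Dset B (rho w)"
  then have Q': "Q' : Spec B" "w ~: ctr Q'" using * by auto
  then have "ctr Q' : Dset R w" using chart_contr[of Q'] by (simp add: Dset_iff)
  then show "Q' : E W" unfolding chart_dom_def using Q'(1) D(3) by blast
 qed
 moreover have "ALL Q':Dset B (rho w). rho w ~: Q' & chart_map R F f W t Q' = frac B N (carrier B - Q') x (rho w)"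
  using * chart_map_eq[OF W t d(1)] by (simp add: chart_stalk_def Dset_iff)
 ultimately show "EX v:carrier B. v ~: Q & Dset B v <= E W & (EX x:carrier N. EX b:carrier B. ALL Q':Dset B v.
   b ~: Q' & chart_map R F f W t Q' = frac B N (carrier B - Q') x b)"
  using rho_den[OF D(1) d(2)] D(2) by blast
qed

text \<open>Equal fractions at the prime corresponding to \<open>P\<close> make \<open>w v t\<close>
  and \<open>w v t'\<close> agree near \<open>P\<close>, where \<open>w v\<close> is a unit; then
  separation applies.\<close>

lemma chart_map_inj:
 assumes W: "zopen R W" "W <= Df" and t: "t : Sec F W" "t' : Sec F W"
  and eq: "chart_map R F f W t = chart_map R F f W t'"
 shows "t = t'"
proof (rule S.sep_local[OF W(1) t])
 fix P assume P: "P : W"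
 have PD: "P : Df" using P W(2) by blast
 let ?Q = "exn P"
 have Q: "?Q : Spec B" "ctr ?Q = P" using chart_extn[OF PD] chart_contr_extn[OF PD] by auto
 obtain w x where d: "dat W t w x" "w ~: P" using chart_datum_ex[OF W t(1) P] by blast
 obtain v y where e: "dat W t' v y" "v ~: P" using chart_datum_ex[OF W t(2) P] by blast
 note Dw = chart_datumD[OF d(1)] and Dv = chart_datumD[OF e(1)]
 have "stk ?Q x w = stk ?Q y v"
  using chart_map_eq[OF W t(1) d(1) Q(1)] chart_map_eq[OF W t(2) e(1) Q(1)] d(2) e(2) eq Q(2) by simp
 then obtain r where r: "r : carrier R" "r ~: P" "ALL Z. zopen R Z --> Z <= Df --> Z <= Dset R r -->
   v \<odot>[R,F,Z] res F Df Z x = w \<odot>[R,F,Z] res F Df Z y"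
  using stk_eqD[OF Q(1) Dw(2,1) _ Dv(2,1)] d(2) e(2) unfolding Q(2) by blast
 let ?u = "r \<otimes> (w \<otimes> v)" let ?Z = "Dset R ?u"
 have wv: "w \<otimes> v : carrier R" "v \<otimes> w = w \<otimes> v" using Dw(1) Dv(1) by (auto simp: R.m_comm)
 have uc: "?u : carrier R" using r(1) wv(1) by simp
 have Zi: "?Z = Dset R r Int (Dset R w Int Dset R v)" using S.D_mult[OF r(1) wv(1)] S.D_mult[OF Dw(1) Dv(1)] by simp
 then have Z: "zopen R ?Z" "?Z <= Df" "?Z <= Dset R r" "?Z <= Dset R w" "?Z <= Dset R v" "?Z <= W" "?Z <= Dset R (w \<otimes> v)"
  using S.op_D[OF uc] Dw(3) W(2) S.D_mult[OF Dw(1) Dv(1)] by blast+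
 have tc: "res F W ?Z t : Sec F ?Z" "res F W ?Z t' : Sec F ?Z" using S.res_closed[OF W(1) Z(1,6)] t by blast+
 have "(w \<otimes> v) \<odot>[R,F,?Z] res F W ?Z t = (w \<otimes> v) \<odot>[R,F,?Z] res F W ?Z t'"
  using S.rsmult_mult[OF Z(1) Dv(1) Dw(1) tc(1)] S.rsmult_mult[OF Z(1) Dw(1) Dv(1) tc(2)] r(3)[rule_format, OF Z(1-3)]
  unfolding chart_datum_on[OF d(1) W t(1) Z(1,4)] chart_datum_on[OF e(1) W t(2) Z(1,5)] wv(2) by simp
 then have "res F W ?Z t = res F W ?Z t'" by (rule S.unit_cancel[OF Z(1) wv(1) Z(7) tc])
 moreover have "P : ?Z" unfolding Zi using r(2) d(2) e(2) PD by (simp add: Dset_iff)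
 ultimately show "EX w:carrier R. w ~: P & Dset R w <= W & res F W (Dset R w) t = res F W (Dset R w) t'"
  using uc Z(6) by (auto simp: Dset_iff)
qed

private lemma dat_shrink:
 assumes W: "zopen R W" "W <= Df" and t: "t : Sec F W" and d: "dat W t w x"
  and V: "zopen R V" "V <= W" and v: "v : carrier R" "Dset R v <= V"
 shows "dat V (res F W V t) (v \<otimes> w) (rho v \<odot>\<^sub>N x)"
proof -
 note D = chart_datumD[OF d]
 let ?Z = "Dset R (v \<otimes> w)"
 have Zi: "?Z = Dset R v Int Dset R w" by (rule S.D_mult[OF v(1) D(1)])
 then have Z: "zopen R ?Z" "?Z <= V" "?Z <= Dset R w" "?Z <= W" "?Z <= Df"
  using S.op_D[of "v \<otimes> w"] v D(1) V(2) W(2) by auto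
 have "(v \<otimes> w) \<odot>[R,F,?Z] res F V ?Z (res F W V t) = res F Df ?Z (rho v \<odot>\<^sub>N x)"
  unfolding S.res_comp[OF W(1) V(1) Z(1,2) V(2) t] S.rsmult_mult[OF Z(1) v(1) D(1) S.res_closed[OF W(1) Z(1,4) t]]
   chart_datum_on[OF d W t Z(1,3)] S.res_rsmult[OF oD Z(1,5) v(1) D(2)] ..
 then show ?thesis unfolding chart_datum_def using v(1) D Z(2) S.rsmult_closed[OF oD v(1) D(2)] by simp
qed

text \<open>A datum for \<open>t\<close> shrinks to one for its restriction by multiplying both
  parts with some \<open>v\<close>, which does not change the fraction.\<close>

lemma chart_map_restrict:
 assumes W: "zopen R W" "W <= Df" and t: "t : Sec F W"
  and V: "zopen R V" "V <= W"
 shows "chart_map R F f V (res F W V t) = restrict (chart_map R F f W t) (E V)"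
proof (rule extensionalityI)
 show "chart_map R F f V (res F W V t) : extensional (E V)" unfolding chart_map_def by (rule restrict_extensional)
 show "restrict (chart_map R F f W t) (E V) : extensional (E V)" by (rule restrict_extensional)
 fix Q assume QE: "Q : E V"
 then have Q: "Q : Spec B" "ctr Q : V" unfolding chart_dom_def by auto
 have VD: "V <= Df" using V(2) W(2) by blast
 obtain w x where d: "dat W t w x" "w ~: ctr Q" using chart_datum_ex[OF W t, of "ctr Q"] Q(2) V(2) by blast
 obtain v where v: "v : carrier R" "v ~: ctr Q" "Dset R v <= V" "ctr Q : Dset R v" by (rule open_nbhd[OF V(1) Q(2)])
 note D = chart_datumD[OF d(1)]
 have vw: "v \<otimes> w ~: ctr Q" using S.D_mult[OF v(1) D(1)] v(4) d(2) by (auto simp: Dset_iff)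
 have "chart_map R F f V (res F W V t) Q = stk Q (rho v \<odot>\<^sub>N x) (v \<otimes> w)"
  by (rule chart_map_eq[OF V(1) VD S.res_closed[OF W(1) V t] dat_shrink[OF W t d(1) V v(1,3)] Q(1) vw])
 also have "\<dots> = stk Q x w"
  unfolding chart_stalk_def rho.ring.hom_mult[OF v(1) D(1)]
  by (rule frac_cancel[OF Nm stalk_ms[OF Q(1)] D(2) rho_den[OF D(1) d(2)] rho_den[OF v(1,2)]])
 also have "\<dots> = chart_map R F f W t Q" by (rule chart_map_eq[OF W t d(1) Q(1) d(2), symmetric])
 finally show "chart_map R F f V (res F W V t) Q = restrict (chart_map R F f W t) (E V) Q" using QE by simp
qed

text \<open>Data add by the rule for fractions: \<open>w t = x\<close> and \<open>v t' = y\<close>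
  give \<open>w v (t + t') = v x + w y\<close>.\<close>

lemma chart_map_add:
 assumes W: "zopen R W" "W <= Df" and t: "t : Sec F W" "t' : Sec F W"
 shows "chart_map R F f W (t \<oplus>\<^sub>(sec F W) t') = chart_map R F f W t \<oplus>\<^sub>(sec (tilde B N) (E W)) chart_map R F f W t'"
proof (rule extensionalityI)
 show "chart_map R F f W (t \<oplus>\<^sub>(sec F W) t') : extensional (E W)" unfolding chart_map_def by (rule restrict_extensional)
 show "chart_map R F f W t \<oplus>\<^sub>(sec (tilde B N) (E W)) chart_map R F f W t' : extensional (E W)"
  unfolding tilde_simps by (rule restrict_extensional)
 fix Q assume QE: "Q : E W"
 then have Q: "Q : Spec B" "ctr Q : W" unfolding chart_dom_def by auto
 obtain w x where d: "dat W t w x" "w ~: ctr Q" using chart_datum_ex[OF W t(1) Q(2)] by blast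
 obtain v y where e: "dat W t' v y" "v ~: ctr Q" using chart_datum_ex[OF W t(2) Q(2)] by blast
 note Dw = chart_datumD[OF d(1)] and Dv = chart_datumD[OF e(1)]
 let ?u = "w \<otimes> v" let ?Z = "Dset R (w \<otimes> v)" let ?z = "rho v \<odot>\<^sub>N x \<oplus>\<^sub>N rho w \<odot>\<^sub>N y"
 have uc: "?u : carrier R" "v \<otimes> w = ?u" using Dw(1) Dv(1) by (auto simp: R.m_comm)
 have Zi: "?Z = Dset R w Int Dset R v" by (rule S.D_mult[OF Dw(1) Dv(1)])
 then have Z: "zopen R ?Z" "?Z <= Df" "?Z <= Dset R w" "?Z <= Dset R v" "?Z <= W"
  using S.op_D[OF uc(1)] Dw(3) W(2) by blast+
 have uQ: "?u ~: ctr Q" using d(2) e(2) chart_contr[OF Q(1)] Zi by (auto simp: Dset_iff)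
 have xy: "rho v \<odot>\<^sub>N x : carrier N" "rho w \<odot>\<^sub>N y : carrier N" using S.rsmult_closed[OF oD] Dw Dv by blast+
 have tc: "res F W ?Z t : Sec F ?Z" "res F W ?Z t' : Sec F ?Z" using S.res_closed[OF W(1) Z(1,5)] t by blast+
 have "?u \<odot>[R,F,?Z] res F W ?Z (t \<oplus>\<^sub>(sec F W) t') = res F Df ?Z ?z"
  unfolding S.res_add[OF W(1) Z(1,5) t] S.rsmult_add[OF Z(1) uc(1) tc] S.res_add[OF oD Z(1,2) xy]
   S.res_rsmult[OF oD Z(1,2) Dv(1) Dw(2)] S.res_rsmult[OF oD Z(1,2) Dw(1) Dv(2)]
   chart_datum_on[OF d(1) W t(1) Z(1,3), symmetric] chart_datum_on[OF e(1) W t(2) Z(1,4), symmetric]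
   S.rsmult_mult[OF Z(1) Dv(1) Dw(1) tc(1), symmetric] S.rsmult_mult[OF Z(1) Dw(1) Dv(1) tc(2), symmetric] uc(2) ..
 then have dz: "dat W (t \<oplus>\<^sub>(sec F W) t') ?u ?z" unfolding chart_datum_def using uc(1) Z(5) N.M.a_closed[OF xy] by simp
 have "chart_map R F f W (t \<oplus>\<^sub>(sec F W) t') Q = stk Q ?z ?u"
  by (rule chart_map_eq[OF W S.add_closed[OF W(1) t] dz Q(1) uQ])
 also have "\<dots> = stk Q x w \<oplus>\<^sub>(lmod B Q N) stk Q y v"
  unfolding chart_stalk_def loc_add[OF Nm stalk_ms[OF Q(1)] Dw(2) rho_den[OF Dw(1) d(2)] Dv(2) rho_den[OF Dv(1) e(2)]]
   rho.ring.hom_mult[OF Dw(1) Dv(1)] ..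
 finally show "chart_map R F f W (t \<oplus>\<^sub>(sec F W) t') Q = (chart_map R F f W t \<oplus>\<^sub>(sec (tilde B N) (E W)) chart_map R F f W t') Q"
  unfolding tilde_simps using chart_map_eq[OF W t(1) d(1) Q(1) d(2)] chart_map_eq[OF W t(2) e(1) Q(1) e(2)] QE by simp
qed

text \<open>Locally \<open>s\<close> is a fraction over \<open>B\<close>, which is rewritten with a
  denominator \<open>w\<close> from \<open>R\<close>; dividing by \<open>w\<close> on D(w) gives a
  local section of \<open>F\<close>. These sections glue because \<open>chart_map\<close> is already
  known to be injective over intersections.\<close>

lemma chart_map_surj:
 assumes W: "zopen R W" "W <= Df" and s: "s : tilde_sub B N (carrier N) (E W)"
 shows "EX t:Sec F W. chart_map R F f W t = s"
proof -
 have "EX w y. w : carrier R & w ~: P & Dset R w <= W & y : Sec F (Dset R w) &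
   chart_map R F f (Dset R w) y = restrict s (E (Dset R w))" if P: "P : W" for P
 proof -
  have PD: "P : Df" using P W(2) by blast
  have Q: "exn P : Spec B" "ctr (exn P) = P" using chart_extn[OF PD] chart_contr_extn[OF PD] by auto
  then have QE: "exn P : E W" unfolding chart_dom_def using P by simp
  obtain b0 x b where b: "b0 : carrier B" "b0 ~: exn P" "Dset B b0 <= E W" "x : carrier N" "b : carrier B"
   "ALL Q:Dset B b0. b ~: Q & s Q = germ B N Q x b"
   by (rule tilde_subE[OF Bc s chart_dom_sub QE])
  obtain r0 where r0: "r0 : carrier R" "ALL Q:Spec B. b0 : Q <-> r0 : ctr Q" using chart_den[OF b(1)] by blast
  obtain n :: nat and r where r: "r : carrier R" "rho (f [^] n) \<otimes>\<^sub>B b = rho r" "ALL Q:Spec B. b : Q <-> r : ctr Q"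
   using chart_den[OF b(5)] by blast
  have fr: "f \<otimes> r0 : carrier R" "f [^] n : carrier R" using f r0(1) by auto
  \<comment> \<open>The factor \<open>f r0\<close> keeps D(w) inside the region where
    \<open>s\<close> is \<open>x/b\<close>, and \<open>r\<close> stands for \<open>f^n b\<close>.
    With \<open>v\<close> the second element, \<open>w\<close> acts as \<open>v b\<close> in
    \<open>B\<close>, so \<open>x/b\<close> equals \<open>v x / w\<close>.\<close>
  let ?w = "f \<otimes> r0 \<otimes> r" let ?v = "f \<otimes> r0 \<otimes> f [^] n"
  let ?x = "rho ?v \<odot>\<^sub>N x"
  have wv: "?w : carrier R" "?v : carrier R" using fr r(1) by auto
  have xc: "?x : carrier N" by (rule S.rsmult_closed[OF oD wv(2) b(4)])
  have Dw: "Dset R ?w = Df Int Dset R r0 Int Dset R r" using S.D_mult[OF fr(1) r(1)] S.D_mult[OF f r0(1)] by simp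
  have Dv: "Dset R ?v \<supseteq> Df Int Dset R r0"
   using S.D_mult[OF fr(1,2)] S.D_mult[OF f r0(1)] Dset_pow[OF R f, of n] by blast
  have "rho ?w = rho (f \<otimes> r0) \<otimes>\<^sub>B (rho (f [^] n) \<otimes>\<^sub>B b)" unfolding r(2) by (rule rho.ring.hom_mult[OF fr(1) r(1)])
  also have "\<dots> = rho ?v \<otimes>\<^sub>B b"
   using B.m_assoc[OF rho_closed[OF fr(1)] rho_closed[OF fr(2)] b(5)] rho.ring.hom_mult[OF fr] by simp
  finally have rhow: "rho ?w = rho ?v \<otimes>\<^sub>B b" .
  have sQ: "Q' : Dset B b0 & s Q' = stk Q' ?x ?w" if Q': "Q' : Spec B" "?w ~: ctr Q'" for Q'
  proof -
   have "ctr Q' : Df Int Dset R r0 Int Dset R r" using Dw Q'(2) chart_contr[OF Q'(1)] by (auto simp: Dset_iff)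
   then have n: "r0 ~: ctr Q'" "r ~: ctr Q'" "?v ~: ctr Q'" using Dv by (auto simp: Dset_iff)
   have Qb: "Q' : Dset B b0" using r0(2) n(1) Q'(1) by (simp add: Dset_iff Spec_iff)
   have bQ: "b : carrier B - Q'" using r(3) n(2) Q'(1) b(5) by blast
   have "s Q' = frac B N (carrier B - Q') x b" using b(6) Qb by blast
   also have "\<dots> = stk Q' ?x ?w" unfolding chart_stalk_def rhow
    by (rule frac_cancel[OF Nm stalk_ms[OF Q'(1)] b(4) bQ rho_den[OF wv(2) n(3)], symmetric])
   finally show ?thesis using Qb by blast
  qed
  have DwW: "Dset R ?w <= W"
  proof
   fix P' assume P': "P' : Dset R ?w"
   then have PD': "P' : Df" using Dw by blast
   have "exn P' : E W"
    using sQ[OF chart_extn[OF PD']] P' b(3) unfolding chart_contr_extn[OF PD'] by (auto simp: Dset_iff)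
   then show "P' : W" unfolding chart_dom_def chart_contr_extn[OF PD'] by (simp add: chart_contr_extn[OF PD'])
  qed
  have oDw: "zopen R (Dset R ?w)" "Dset R ?w <= Df" using S.op_D[OF wv(1)] Dw by blast+
  obtain y where y: "y : Sec F (Dset R ?w)"
   "?w \<odot>[R,F,Dset R ?w] y = res F Df (Dset R ?w) ?x"
   using S.unit_div[OF oDw(1) wv(1) subset_refl S.res_closed[OF oD oDw xc]] by blast
  have d: "dat (Dset R ?w) y ?w ?x"
   unfolding chart_datum_def using wv(1) xc y S.res_id[OF oDw(1) y(1)] by simp
  have "chart_map R F f (Dset R ?w) y = restrict s (E (Dset R ?w))"
  proof (rule extensionalityI)
   show "chart_map R F f (Dset R ?w) y : extensional (E (Dset R ?w))" unfolding chart_map_def by (rule restrict_extensional)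
   show "restrict s (E (Dset R ?w)) : extensional (E (Dset R ?w))" by (rule restrict_extensional)
   fix Q' assume QE: "Q' : E (Dset R ?w)"
   then have Q': "Q' : Spec B" "?w ~: ctr Q'" unfolding chart_dom_def by (auto simp: Dset_iff)
   show "chart_map R F f (Dset R ?w) y Q' = restrict s (E (Dset R ?w)) Q'"
    using chart_map_eq[OF oDw y(1) d Q'] sQ[OF Q'] QE by simp
  qed
  moreover have "?w ~: P"
  proof -
   have "exn P : Dset B b0" using b(2) Q(1) by (simp add: Dset_iff Spec_iff)
   then have "b ~: exn P" using b(6) by blast
   then have "r ~: P" using r(3)[rule_format, OF Q(1)] Q(2) by simp
   moreover have "r0 ~: P" using r0(2)[rule_format, OF Q(1)] b(2) Q(2) by simp
   ultimately have "P : Dset R ?w" unfolding Dw using PD by (simp add: Dset_iff)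
   then show ?thesis by (simp add: Dset_iff)
  qed
  ultimately show ?thesis using wv(1) DwW y(1) by blast
 qed
 then have "EX w y. ALL P:W. w P : carrier R & w P ~: P & Dset R (w P) <= W & y P : Sec F (Dset R (w P)) &
   chart_map R F f (Dset R (w P)) (y P) = restrict s (E (Dset R (w P)))" by metis
 then obtain w y where wy: "ALL P:W. w P : carrier R & w P ~: P & Dset R (w P) <= W & y P : Sec F (Dset R (w P)) &
   chart_map R F f (Dset R (w P)) (y P) = restrict s (E (Dset R (w P)))" by (elim exE)
 let ?V = "%P. Dset R (w P)"
 have o: "zopen R (?V P)" "?V P <= Df" "P : ?V P" if "P : W" for P
  using wy that W(2) S.op_D[of "w P"] S.op_sub[OF W(1)] by (auto simp: Dset_iff Spec_iff)
 have restr: "restrict (restrict s (E A)) (E A') = restrict s (E A')" if "A' <= A" for A A'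
 proof -
  have "E A Int E A' = E A'" using that unfolding chart_dom_def by blast
  then show ?thesis unfolding restrict_restrict by simp
 qed
 have "EX t:Sec F W. ALL P:W. res F W (?V P) t = y P"
 proof (rule S.glue)
  show "\<Union>(?V ` W) = W"
  proof
   show "\<Union>(?V ` W) <= W" by (rule UN_least) (use wy in simp)
   show "W <= \<Union>(?V ` W)" using o(3) by (intro subsetI UN_I)
  qed
  fix P P' assume P: "P : W" "P' : W"
  let ?I = "?V P Int ?V P'"
  have oI: "zopen R ?I" "?I <= ?V P" "?I <= ?V P'" "?I <= Df" using o[OF P(1)] o[OF P(2)] by auto
  have yc: "y P : Sec F (?V P)" "y P' : Sec F (?V P')" using wy P by auto
  have e: "chart_map R F f (?V P) (y P) = restrict s (E (?V P))" "chart_map R F f (?V P') (y P') = restrict s (E (?V P'))"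
   using wy P by auto
  show "res F (?V P) ?I (y P) = res F (?V P') ?I (y P')"
  proof (rule chart_map_inj[OF oI(1,4)])
   show "res F (?V P) ?I (y P) : Sec F ?I" by (rule S.res_closed[OF o(1)[OF P(1)] oI(1,2) yc(1)])
   show "res F (?V P') ?I (y P') : Sec F ?I" by (rule S.res_closed[OF o(1)[OF P(2)] oI(1,3) yc(2)])
   show "chart_map R F f ?I (res F (?V P) ?I (y P)) = chart_map R F f ?I (res F (?V P') ?I (y P'))"
    unfolding chart_map_restrict[OF o(1,2)[OF P(1)] yc(1) oI(1,2)] chart_map_restrict[OF o(1,2)[OF P(2)] yc(2) oI(1,3)]
     e restr[OF oI(2)] restr[OF oI(3)] ..
  qed
 qed (use wy o in auto)
 then obtain t where t: "t : Sec F W" "ALL P:W. res F W (?V P) t = y P" by blast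
 have "chart_map R F f W t = s"
 proof (rule extensionalityI)
  show "chart_map R F f W t : extensional (E W)" unfolding chart_map_def by (rule restrict_extensional)
  show "s : extensional (E W)" by (rule tilde_sub_ext[OF Bc s])
  fix Q assume "Q : E W"
  then have Q: "Q : Spec B" "ctr Q : W" unfolding chart_dom_def by auto
  let ?P = "ctr Q"
  have VW: "?V ?P <= W" using wy Q(2) by blast
  have "restrict (chart_map R F f W t) (E (?V ?P)) = restrict s (E (?V ?P))"
   unfolding chart_map_restrict[OF W t(1) o(1)[OF Q(2)] VW, symmetric] using t(2) wy Q(2) by simp
  moreover have "Q : E (?V ?P)" using o(3)[OF Q(2)] Q(1) unfolding chart_dom_def by blast
  ultimately show "chart_map R F f W t Q = s Q" by (metis restrict_apply')
 qed
 then show ?thesis using t(1) by blast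
qed

lemma chart_map_bij:
 assumes W: "zopen R W" "W <= Df"
 shows "bij_betw (chart_map R F f W) (Sec F W) (Sec (tilde B N) (E W))"
proof (rule bij_betw_imageI)
 show "inj_on (chart_map R F f W) (Sec F W)" using chart_map_inj[OF W] by (rule inj_onI)
 show "chart_map R F f W ` Sec F W = Sec (tilde B N) (E W)"
  unfolding tilde_simps
 proof (intro equalityI image_subsetI subsetI)
  show "chart_map R F f W t : tilde_sub B N (carrier N) (E W)" if "t : Sec F W" for t
   by (rule chart_map_closed[OF W that])
  show "s : chart_map R F f W ` Sec F W" if "s : tilde_sub B N (carrier N) (E W)" for s
   using chart_map_surj[OF W that] by blast
 qed
qed

end

private abbreviation (input) "SM \<equiv> structure_module (spec R)"

private lemma rho_hom: "rho : ring_hom R B" by (rule ring_loc_atD(1)[OF ring_loc_at_Osec[OF R f]])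

private lemma rho_den2: "w : carrier R ==> w ~: ctr Q ==> rho w : carrier B - Q"
 using ring_hom_closed[OF rho_hom] by (simp add: contraction_def)

private lemmas SMq = sheaf_structure[OF R] qcl_structure[OF R]

definition chart_pre where "chart_pre V = {P : Df. exn P : V}"

lemma chart_pre_sub: "chart_pre V <= Df" unfolding chart_pre_def by blast

lemma chart_preim_open:
 assumes "zopen B V" shows "zopen R (chart_pre V)" "E (chart_pre V) = V"
 using chart_preim[OF assms] unfolding chart_pre_def by blast+

context
 fixes F
 assumes F: "sheaf_of_modules (spec R) F" and q: "qcl R F (Spec R)"
begin

interpretation S: spec_sheaf R F by (rule spec_sheaf.intro[OF R F])

private abbreviation (input) "N2 \<equiv> sec F Df"

private lemma oD2: "zopen R Df" using f by simp
private lemma Nm2: "module B N2" by (rule S.smod[OF oD2])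

text \<open>With \<open>w a = y\<close> for the function and \<open>v t = x\<close> for the section,
  the product has datum \<open>w v\<close> and \<open>y x\<close>, as for fractions. Scalars are
  mapped by the same construction for the structure sheaf, which later supplies the ring
  isomorphisms.\<close>

lemma chart_map_smult:
 assumes W: "zopen R W" "W <= Df" and a: "a : carrier (\<O> R W)" and t: "t : Sec F W"
 shows "chart_map R F f W (a \<odot>\<^sub>(sec F W) t) = chart_map R SM f W a \<odot>\<^sub>(sec (tilde B N2) (E W)) chart_map R F f W t"
proof (rule extensionalityI)
 show "chart_map R F f W (a \<odot>\<^sub>(sec F W) t) : extensional (E W)" unfolding chart_map_def by (rule restrict_extensional)
 show "chart_map R SM f W a \<odot>\<^sub>(sec (tilde B N2) (E W)) chart_map R F f W t : extensional (E W)"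
  unfolding tilde_simps by (rule restrict_extensional)
 fix Q assume QE: "Q : E W"
 then have Q: "Q : Spec B" "ctr Q : W" unfolding chart_dom_def by auto
 have a': "a : Sec SM W" using a by (simp del: spec_simps)
 obtain w y where d: "chart_datum R SM f W a w y" "w ~: ctr Q" using chart_datum_ex[OF SMq W a' Q(2)] by blast
 obtain v x where e: "chart_datum R F f W t v x" "v ~: ctr Q" using chart_datum_ex[OF F q W t Q(2)] by blast
 note Dw = chart_datumD[OF SMq d(1)] and Dv = chart_datumD[OF F q e(1)]
 have yc: "y : carrier B" using Dw(2) by (simp del: spec_simps)
 let ?u = "w \<otimes> v" let ?Z = "Dset R (w \<otimes> v)"
 have uc: "?u : carrier R" using Dw(1) Dv(1) by auto
 have Zi: "?Z = Dset R w Int Dset R v" by (rule S.D_mult[OF Dw(1) Dv(1)])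
 then have Z: "zopen R ?Z" "?Z <= Df" "?Z <= Dset R w" "?Z <= Dset R v" "?Z <= W"
  using S.op_D[OF uc] Dw(3) W(2) by blast+
 have uQ: "?u ~: ctr Q" using d(2) e(2) chart_contr[OF Q(1)] Zi by (auto simp: Dset_iff)
 let ?O = "\<O> R ?Z"
 interpret FZ: module ?O "sec F ?Z" by (rule S.smod[OF Z(1)])
 have tc: "res F W ?Z t : Sec F ?Z" by (rule S.res_closed[OF W(1) Z(1,5) t])
 have rO: "restrict a ?Z : carrier ?O" "restrict y ?Z : carrier ?O"
  using tilde_sub_restrict[OF R _ W(1) Z(1,5)] tilde_sub_restrict[OF R _ oD2 Z(1,2)] a yc by auto
 have wv: "rsec R ?Z w : carrier ?O" "rsec R ?Z v : carrier ?O" using rsec_closed[OF R Z(1)] Dw(1) Dv(1) by blast+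
 have aw: "rsec R ?Z w \<otimes>\<^sub>?O restrict a ?Z = restrict y ?Z"
  using chart_datum_on[OF SMq d(1) W a' Z(1,3)] by simp
 have "?u \<odot>[R,F,?Z] res F W ?Z (a \<odot>\<^sub>(sec F W) t)
   = w \<odot>[R,F,?Z] (v \<odot>[R,F,?Z] (restrict a ?Z \<odot>\<^sub>(sec F ?Z) res F W ?Z t))"
  unfolding S.res_smult[OF W(1) Z(1,5) a t] by (rule S.rsmult_mult[OF Z(1) Dw(1) Dv(1) FZ.smult_closed[OF rO(1) tc]])
 also have "\<dots> = (rsec R ?Z w \<otimes>\<^sub>?O restrict a ?Z) \<odot>\<^sub>(sec F ?Z) (v \<odot>[R,F,?Z] res F W ?Z t)"
  unfolding FZ.smult_assoc1[OF wv(2) rO(1) tc, symmetric] FZ.R.m_comm[OF wv(2) rO(1)]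
   FZ.smult_assoc1[OF rO(1) wv(2) tc] by (rule FZ.smult_assoc1[OF wv(1) rO(1) FZ.smult_closed[OF wv(2) tc], symmetric])
 also have "\<dots> = res F Df ?Z (y \<odot>\<^sub>N2 x)"
  unfolding aw chart_datum_on[OF F q e(1) W t Z(1,4)] by (rule S.res_smult[OF oD2 Z(1,2) yc Dv(2), symmetric])
 finally have dz: "chart_datum R F f W (a \<odot>\<^sub>(sec F W) t) ?u (y \<odot>\<^sub>N2 x)"
  unfolding chart_datum_def using uc Z(5) S.smult_closed[OF oD2 yc Dv(2)] by simp
 have "chart_map R F f W (a \<odot>\<^sub>(sec F W) t) Q = chart_stalk R F f Q (y \<odot>\<^sub>N2 x) ?u"
  by (rule chart_map_eq[OF F q W S.smult_closed[OF W(1) a t] dz Q(1) uQ])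
 also have "\<dots> = chart_stalk R SM f Q y w \<odot>\<^sub>(lmod B Q N2) chart_stalk R F f Q x v"
  unfolding chart_stalk_def SM_simps
   loc_smult[OF Bc stalk_mult[OF Bc Q(1)] Nm2 yc rho_den2[OF Dw(1) d(2)] Dv(2) rho_den2[OF Dv(1) e(2)]]
   ring_hom_mult[OF rho_hom Dw(1) Dv(1)] ..
 finally show "chart_map R F f W (a \<odot>\<^sub>(sec F W) t) Q = (chart_map R SM f W a \<odot>\<^sub>(sec (tilde B N2) (E W)) chart_map R F f W t) Q"
  unfolding tilde_simps
  using chart_map_eq[OF SMq W a' d(1) Q(1) d(2)] chart_map_eq[OF F q W t e(1) Q(1) e(2)] QE by simp
qed

text \<open>Isomorphisms of module sheaves go from sections over the target space back to sections
  of \<open>F\<close>, the direction opposite to \<open>chart_map\<close>.\<close>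

definition chart_inv where "chart_inv V = inv_into (Sec F (chart_pre V)) (chart_map R F f (chart_pre V))"

lemma chart_inv_map:
 assumes "zopen B V" "t : Sec F (chart_pre V)"
 shows "chart_inv V (chart_map R F f (chart_pre V) t) = t"
 unfolding chart_inv_def
 by (rule inv_into_f_f[OF bij_betw_imp_inj_on[OF chart_map_bij[OF F q chart_preim_open(1)[OF assms(1)] chart_pre_sub]] assms(2)])

lemma chart_inv_bij:
 assumes V: "zopen B V"
 shows "bij_betw (chart_inv V) (Sec (tilde B N2) V) (Sec F (chart_pre V))"
 using bij_betw_inv_into[OF chart_map_bij[OF F q chart_preim_open(1)[OF V] chart_pre_sub]]
 unfolding chart_inv_def chart_preim_open(2)[OF V] .

lemma chart_inv_ex:
 assumes V: "zopen B V" and s: "s : Sec (tilde B N2) V"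
 shows "EX t:Sec F (chart_pre V). chart_map R F f (chart_pre V) t = s & chart_inv V s = t"
proof -
 have "s : chart_map R F f (chart_pre V) ` Sec F (chart_pre V)"
  using bij_betw_imp_surj_on[OF chart_map_bij[OF F q chart_preim_open(1)[OF V] chart_pre_sub]] s
  unfolding chart_preim_open(2)[OF V] by argo
 then show ?thesis using chart_inv_map[OF V] by auto
qed

lemma chart_inv_add:
 assumes V: "zopen B V" and s: "s : Sec (tilde B N2) V" "s' : Sec (tilde B N2) V"
 shows "chart_inv V (s \<oplus>\<^sub>(sec (tilde B N2) V) s') = chart_inv V s \<oplus>\<^sub>(sec F (chart_pre V)) chart_inv V s'"
proof -
 note o = chart_preim_open[OF V]
 obtain t where t: "t : Sec F (chart_pre V)" "chart_map R F f (chart_pre V) t = s" "chart_inv V s = t"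
  using chart_inv_ex[OF V s(1)] by blast
 obtain t' where t': "t' : Sec F (chart_pre V)" "chart_map R F f (chart_pre V) t' = s'" "chart_inv V s' = t'"
  using chart_inv_ex[OF V s(2)] by blast
 show ?thesis unfolding t(3) t'(3)
  using chart_inv_map[OF V S.add_closed[OF o(1) t(1) t'(1)]]
  unfolding chart_map_add[OF F q o(1) chart_pre_sub t(1) t'(1)] o(2) t(2) t'(2) .
qed

lemma chart_inv_restrict:
 assumes V: "zopen B V" and V': "zopen B V'" "V' <= V" and s: "s : Sec (tilde B N2) V"
 shows "chart_inv V' (restrict s V') = res F (chart_pre V) (chart_pre V') (chart_inv V s)"
proof -
 note o = chart_preim_open[OF V] and o' = chart_preim_open[OF V'(1)]
 have sub: "chart_pre V' <= chart_pre V" using V'(2) unfolding chart_pre_def by blast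
 obtain t where t: "t : Sec F (chart_pre V)" "chart_map R F f (chart_pre V) t = s" "chart_inv V s = t"
  using chart_inv_ex[OF V s] by blast
 show ?thesis unfolding t(3)
  using chart_inv_map[OF V'(1) S.res_closed[OF o(1) o'(1) sub t(1)]]
  unfolding chart_map_restrict[OF F q o(1) chart_pre_sub t(1) o'(1) sub] o'(2) t(2) .
qed

end

lemma chart_inv_smult:
 assumes F: "sheaf_of_modules (spec R) F" and q: "qcl R F (Spec R)"
  and V: "zopen B V" and a: "a : carrier (\<O> B V)" and s: "s : Sec (tilde B (sec F Df)) V"
 shows "chart_inv F V (a \<odot>\<^sub>(sec (tilde B (sec F Df)) V) s) = chart_inv SM V a \<odot>\<^sub>(sec F (chart_pre V)) chart_inv F V s"
proof -
 interpret S: spec_sheaf R F by (rule spec_sheaf.intro[OF R F])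
 note o = chart_preim_open[OF V]
 have a': "a : Sec (tilde B (sec SM Df)) V" using a by (simp del: spec_simps add: Osec_eqs(1)[OF Bc V])
 obtain b where b: "b : Sec SM (chart_pre V)" "chart_map R SM f (chart_pre V) b = a" "chart_inv SM V a = b"
  using chart_inv_ex[OF SMq V a'] by blast
 have bc: "b : carrier (\<O> R (chart_pre V))" using b(1) by (simp del: spec_simps)
 obtain t where t: "t : Sec F (chart_pre V)" "chart_map R F f (chart_pre V) t = s" "chart_inv F V s = t"
  using chart_inv_ex[OF F q V s] by blast
 show ?thesis unfolding t(3) b(3)
  using chart_inv_map[OF F q V S.smult_closed[OF o(1) bc t(1)]]
  unfolding chart_map_smult[OF F q o(1) chart_pre_sub bc t(1)] o(2) t(2) b(2) .
qed

lemma chart_inv_ring_iso: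
 assumes V: "zopen B V"
 shows "chart_inv SM V : ring_iso (\<O> B V) (\<O> R (chart_pre V))"
proof -
 note o = chart_preim_open[OF V]
 let ?O = "\<O> B V" and ?P = "\<O> R (chart_pre V)" and ?h = "chart_inv SM V"
 interpret O: cring ?O by (rule cring_Osec[OF Bc V])
 interpret P: cring ?P by (rule cring_Osec[OF R o(1)])
 have eqs: "carrier ?O = Sec (tilde B (sec SM Df)) V"
  "s \<oplus>\<^sub>?O t = s \<oplus>\<^sub>(sec (tilde B (sec SM Df)) V) t" "s \<otimes>\<^sub>?O t = s \<odot>\<^sub>(sec (tilde B (sec SM Df)) V) t" for s t
  unfolding SM_simps by (rule Osec_eqs[OF Bc V])+
 have bij: "bij_betw ?h (carrier ?O) (carrier ?P)"
  using chart_inv_bij[OF SMq V] unfolding eqs(1) by (simp only: SM_simps ring_module_simps)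
 have mult: "?h (s \<otimes>\<^sub>?O t) = ?h s \<otimes>\<^sub>?P ?h t" if "s : carrier ?O" "t : carrier ?O" for s t
  using chart_inv_smult[OF SMq V that(1), of t] that(2) unfolding eqs by (simp only: SM_simps ring_module_simps)
 have add: "?h (s \<oplus>\<^sub>?O t) = ?h s \<oplus>\<^sub>?P ?h t" if "s : carrier ?O" "t : carrier ?O" for s t
  using chart_inv_add[OF SMq V, of s t] that unfolding eqs by (simp only: SM_simps ring_module_simps)
 have hc: "?h s : carrier ?P" if "s : carrier ?O" for s using bij_betwE[OF bij] that by blast
 have "\<one>\<^sub>?P : ?h ` carrier ?O" unfolding bij_betw_imp_surj_on[OF bij] by (rule P.one_closed)
 \<comment> \<open>Multiplicativity and surjectivity force the unit to be preserved: with
   \<open>e\<close> a preimage of the unit, the image of the unit equals its product with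
   \<open>?h e\<close>, hence \<open>?h e\<close>.\<close>
 then obtain e where e: "e : carrier ?O" "?h e = \<one>\<^sub>?P" by (elim imageE) simp
 have "?h \<one>\<^sub>?O = ?h \<one>\<^sub>?O \<otimes>\<^sub>?P ?h e" unfolding e(2) using hc[OF O.one_closed] by (rule P.r_one[symmetric])
 also have "\<dots> = ?h e" using mult[OF O.one_closed e(1)] O.l_one[OF e(1)] by argo
 finally have one: "?h \<one>\<^sub>?O = \<one>\<^sub>?P" unfolding e(2) .
 have "?h : ring_hom ?O ?P" by (rule ring_hom_memI) (simp_all only: hc mult add one)
 then show ?thesis using bij unfolding ring_iso_def by blast
qed

text \<open>The ring part of the isomorphism is the chart of the structure sheaf and the module part
  that of \<open>F\<close>; both are instances of \<open>chart_inv\<close>.\<close>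

theorem affine_chart_qcl:
 assumes F: "sheaf_of_modules (spec R) F" and q: "qcl R F (Spec R)"
 shows "affine_chart (spec R) F Df B (sec F Df)"
proof -
 let ?T = "tilde B (sec F Df)"
 interpret S: spec_sheaf R F by (rule spec_sheaf.intro[OF R F])
 have pre: "preim (open_subspace (spec R) Df) exn V = chart_pre V" for V
  unfolding chart_pre_def by (rule preim_open_subspace) (simp add: topspace_zariski)
 have oD: "zopen R Df" using f by simp
 have "ringed_space_iso (open_subspace (spec R) Df) (spec B) exn (chart_inv SM)"
  unfolding ringed_space_iso_def pre open_subspace_simps spec_simps(1)
 proof (intro conjI allI impI ballI)
  show "homeomorphic_map (top_of (open_subspace (spec R) Df)) (zariski B) exn"
   using chart_homeomorphic by (simp add: open_subspace_def)
  show "chart_inv SM V : ring_iso (\<O> B V) (\<O> R (chart_pre V))" if "zopen B V" for V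
   by (rule chart_inv_ring_iso[OF that])
  fix V W s assume VW: "zopen B V & zopen B W & W <= V" and s: "s : carrier (\<O> B V)"
  have oV: "zopen B V" using VW by blast
  have "s : Sec (tilde B (sec SM Df)) V" using s unfolding SM_simps Osec_eqs(1)[OF Bc oV] .
  then show "chart_inv SM W (Ores (spec B) V W s) = Ores (spec R) (chart_pre V) (chart_pre W) (chart_inv SM V s)"
   using chart_inv_restrict[OF SMq, of V W s] VW by simp
 qed
 moreover have "mod_sheaf_iso (open_subspace (spec R) Df) F (spec B) ?T exn (chart_inv SM) (chart_inv F)"
  unfolding mod_sheaf_iso_def pre spec_simps(1)
 proof (intro conjI allI impI ballI)
  fix V assume V: "zopen B V"
  show "bij_betw (chart_inv F V) (Sec ?T V) (Sec F (chart_pre V))"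
   by (rule chart_inv_bij[OF F q V])
  show "chart_inv F V (s \<oplus>\<^sub>(sec ?T V) t) = chart_inv F V s \<oplus>\<^sub>(sec F (chart_pre V)) chart_inv F V t"
   if "s : Sec ?T V" "t : Sec ?T V" for s t
   by (rule chart_inv_add[OF F q V that])
  show "chart_inv F V (a \<odot>\<^sub>(sec ?T V) s) = chart_inv SM V a \<odot>\<^sub>(sec F (chart_pre V)) chart_inv F V s"
   if "a : carrier (\<O> B V)" "s : Sec ?T V" for a s
   by (rule chart_inv_smult[OF F q V that])
 next
  fix V W s assume VW: "zopen B V & zopen B W & W <= V"
   and s: "s : Sec ?T V"
  have "chart_inv F W (restrict s W) = res F (chart_pre V) (chart_pre W) (chart_inv F V s)"
   by (rule chart_inv_restrict[OF F q _ _ _ s]) (use VW in blast)+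
  then show "chart_inv F W (res ?T V W s) = res F (chart_pre V) (chart_pre W) (chart_inv F V s)"
   by simp
 qed
 ultimately show ?thesis
  unfolding affine_chart_def spec_simps(1) using oD Bc S.smod[OF oD] by blast
qed

lemma affine_open_Dset: "affine_open (spec R) Df"
 using affine_chart_qcl[OF SMq] unfolding affine_chart_def affine_open_def by blast

end

text \<open>An isomorphism of ringed spaces is at the same time an isomorphism between the structure
  sheaf on \<open>U\<close> and the sheaf associated with \<open>A\<close> over itself, so the chart
  argument applies with \<open>eta = theta\<close>.\<close>

lemma affine_open_qcl:
 assumes R: "cring R" and U: "affine_open (spec R) U"
 shows "qcl R (structure_module (spec R)) U"
proof -
 obtain A :: "('a set => ('a \<times> 'a) set) ring" and psi theta where A: "zopen R U" "cring A"
  and iso: "ringed_space_iso (open_subspace (spec R) U) (spec A) psi theta"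
  using U unfolding affine_open_def spec_simps(1) by blast
 let ?p = "preim (open_subspace (spec R) U) psi" and ?T = "tilde A (ring_module A)"
 note isoD = iso[unfolded ringed_space_iso_def open_subspace_simps spec_simps(1)]
 have "mod_sheaf_iso (open_subspace (spec R) U) (structure_module (spec R)) (spec A) ?T psi theta theta"
  unfolding mod_sheaf_iso_def spec_simps(1) SM_simps ring_module_simps
 proof (intro conjI allI impI ballI)
  fix V assume V: "zopen A V"
  have i: "theta V : ring_iso (\<O> A V) (\<O> R (?p V))" using isoD V by blast
  then have h: "theta V : ring_hom (\<O> A V) (\<O> R (?p V))"
   unfolding ring_iso_def by blast
  note eqs = Osec_eqs[OF A(2) V, symmetric]
  show "bij_betw (theta V) (Sec ?T V) (carrier (\<O> R (?p V)))"
   using i unfolding ring_iso_def eqs by blast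
  show "theta V (s \<oplus>\<^sub>(sec ?T V) t) = theta V s \<oplus>\<^sub>(\<O> R (?p V)) theta V t"
   if "s : Sec ?T V" "t : Sec ?T V" for s t
   using that unfolding eqs by (rule ring_hom_add[OF h])
  show "theta V (s \<odot>\<^sub>(sec ?T V) t) = theta V s \<otimes>\<^sub>(\<O> R (?p V)) theta V t"
   if "s : carrier (\<O> A V)" "t : Sec ?T V" for s t
   using that unfolding eqs by (rule ring_hom_mult[OF h])
 next
  fix V W s assume VW: "zopen A V & zopen A W & W <= V" and s: "s : Sec ?T V"
  have "s : carrier (\<O> A V)" using s VW Osec_eqs(1)[OF A(2)] by blast
  then have "theta W (Ores (spec A) V W s) = Ores (spec R) (?p V) (?p W) (theta V s)"
   using isoD VW by blast
  then show "theta W (res ?T V W s) = Ores (spec R) (?p V) (?p W) (theta V s)"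
   unfolding structure_tilde_eqs(5) .
 qed
 then show ?thesis
  by (rule spec_sheaf.chart_qcl[OF spec_sheaf.intro[OF R sheaf_structure[OF R]] A ring_module_module[OF A(2)] iso])
qed

text \<open>Charts give the localization property near each point, from where it globalizes;
  conversely it yields one chart on D(1), the whole space.\<close>

lemma quasi_coherent_iff:
 assumes R: "cring R"
 shows "quasi_coherent (spec R) F <-> sheaf_of_modules (spec R) F & qcl R F (Spec R)"
proof
 assume qc: "quasi_coherent (spec R) F"
 then have F: "sheaf_of_modules (spec R) F" unfolding quasi_coherent_def by blast
 interpret S: spec_sheaf R F by (rule spec_sheaf.intro[OF R F])
 have "qcl R F (Spec R)"
 proof (rule S.qcl_local)
  fix P assume P: "P : Spec R"
  then obtain U A N where U: "P : U" "affine_chart (spec R) F U A N"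
   using qc unfolding quasi_coherent_def spec_simps(1) topspace_zariski by blast
  have oU: "zopen R U" and qU: "qcl R F U"
   using U(2) S.chart_qcl[of U A N] unfolding affine_chart_def spec_simps(1) by blast+
  obtain w where w: "w : carrier R" "w ~: P" "Dset R w <= U" "P : Dset R w" by (rule open_nbhd[OF oU U(1)])
  show "EX w:carrier R. w ~: P & qcl R F (Dset R w)" using S.qcl_sub[OF qU oU w(1,3)] w(1,2) by blast
 qed
 then show "sheaf_of_modules (spec R) F & qcl R F (Spec R)" using F by blast
next
 interpret R: cring R by (rule R)
 assume "sheaf_of_modules (spec R) F & qcl R F (Spec R)"
 then show "quasi_coherent (spec R) F"
  using affine_chart_qcl[OF R R.one_closed, unfolded Dset_one] unfolding quasi_coherent_def spec_simps(1) topspace_zariski by blast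
qed

text \<open>Generators over \<open>U\<close>, multiplied by powers of \<open>w\<close>, become
  restrictions of global sections. The sections over \<open>U\<close> that some power of
  \<open>w\<close> moves, on D(w), into the span of these form a submodule \<open>H\<close>
  containing the generators, so \<open>H\<close> is everything.\<close>

lemma finite_rmod_chart:
 fixes R (structure)
 assumes R: "cring R" and F: "sheaf_of_modules (spec R) F" and q: "qcl R F (Spec R)"
  and U: "zopen R U" "P : U"
  and S: "S <= Sec F U" "finite S" "gen_submodule (\<O> R U) (sec F U) S = Sec F U"
 shows "EX G <= Sec F (Spec R). finite G & (EX w:carrier R. w ~: P &
   (ALL m:Sec F (Spec R). EX n::nat. (w [^] n) \<odot>[R,F,Spec R] m : gen_submodule R (rmod R F (Spec R)) G))"
proof -
 interpret S: spec_sheaf R F by (rule spec_sheaf.intro[OF R F])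
 interpret O: spec_sheaf R "structure_module (spec R)" by (rule spec_sheaf.intro[OF R sheaf_structure[OF R]])
 let ?X = "Spec R" let ?SM = "structure_module (spec R)"
 obtain w where w: "w : carrier R" "w ~: P" "Dset R w <= U" "P : Dset R w" by (rule open_nbhd[OF U])
 note oX = S.op_X and oD = S.op_D[OF w(1)]
 let ?D = "Dset R w" let ?M = "rmod R F ?X"
 have XD: "?X Int ?D = ?D" "U Int ?D = ?D" using S.D_sub[of w] w(3) by blast+
 have wn: "w [^] (n::nat) : carrier R" for n using w(1) by simp
 note ext = S.qclD(2)[OF q w(1), unfolded XD]
 have "EX n::nat. EX g:Sec F ?X. (w [^] n) \<odot>[R,F,?D] res F U ?D s = res F ?X ?D g" if "s : S" for s
  by (rule ext) (use S.res_closed[OF U(1) oD w(3)] that S(1) in blast)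
 then obtain g where g: "ALL s:S. g s : Sec F ?X & (EX n::nat. (w [^] n) \<odot>[R,F,?D] res F U ?D s = res F ?X ?D (g s))"
  by metis
 have gX: "g ` S <= carrier ?M" using g unfolding rmod_simps by blast
 let ?G = "gen_submodule R ?M (g ` S)"
 have M: "module R ?M" by (rule S.rmod_module[OF oX])
 note G = submoduleD[OF gen_submodule_submodule[OF M gX] M, unfolded rmod_simps]
 have GI: "g ` S <= ?G" by (rule gen_submodule_incl)
 define H where "H = {s : Sec F U. EX n::nat. EX y:?G. (w [^] n) \<odot>[R,F,?D] res F U ?D s = res F ?X ?D y}"
 have rc: "res F U ?D s : Sec F ?D" if "s : Sec F U" for s by (rule S.res_closed[OF U(1) oD w(3) that])
 have pw: "(w [^] (m + n)) \<odot>[R,F,V] s = (w [^] m) \<odot>[R,F,V] ((w [^] n) \<odot>[R,F,V] s)"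
  if "zopen R V" "s : Sec F V" for V s and m n :: nat
  using S.rsmult_mult[OF that(1) wn[of m] wn[of n] that(2)] w(1) by (simp add: S.R.nat_pow_mult)
 have Gr: "r \<odot>[R,F,?D] res F ?X ?D y = res F ?X ?D (r \<odot>[R,F,?X] y)" if "r : carrier R" "y : ?G" for r y
  by (rule S.res_rsmult[OF oX oD S.D_sub that(1) G(7)[OF that(2)], symmetric])
 have "submodule H (\<O> R U) (sec F U)"
 proof (rule submoduleI2[OF S.smod[OF U(1)]])
  show "H <= Sec F U" unfolding H_def by blast
  show "\<zero>\<^sub>(sec F U) : H" unfolding H_def
   using S.zero_closed[OF U(1)] S.res_zero[OF U(1) oD w(3)] S.rsmult_zero[OF oD wn] S.res_zero[OF oX oD S.D_sub] G(2)
   by (auto intro!: bexI[of _ "\<zero>\<^sub>(sec F (Spec R))"])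
  fix s t assume s: "s : H" and t: "t : H"
  obtain m :: nat and y where y: "s : Sec F U" "y : ?G" "(w [^] m) \<odot>[R,F,?D] res F U ?D s = res F ?X ?D y"
   using s unfolding H_def by blast
  obtain n :: nat and z where z: "t : Sec F U" "z : ?G" "(w [^] n) \<odot>[R,F,?D] res F U ?D t = res F ?X ?D z"
   using t unfolding H_def by blast
  let ?y = "(w [^] n) \<odot>[R,F,?X] y" let ?z = "(w [^] m) \<odot>[R,F,?X] z"
  have yz: "?y : ?G" "?z : ?G" by (rule G(5)[OF wn y(2)]) (rule G(5)[OF wn z(2)])
  have "(w [^] (m + n)) \<odot>[R,F,?D] res F U ?D (s \<oplus>\<^sub>(sec F U) t)
    = (w [^] (n + m)) \<odot>[R,F,?D] res F U ?D s \<oplus>\<^sub>(sec F ?D) (w [^] (m + n)) \<odot>[R,F,?D] res F U ?D t"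
   unfolding S.res_add[OF U(1) oD w(3) y(1) z(1)] S.rsmult_add[OF oD wn rc[OF y(1)] rc[OF z(1)]] by (simp only: add.commute)
  also have "\<dots> = res F ?X ?D (?y \<oplus>\<^sub>(sec F ?X) ?z)"
   unfolding pw[OF oD rc[OF y(1)]] pw[OF oD rc[OF z(1)]] y(3) z(3) Gr[OF wn y(2)] Gr[OF wn z(2)]
   by (rule S.res_add[OF oX oD S.D_sub G(7)[OF yz(1)] G(7)[OF yz(2)], symmetric])
  finally show "s \<oplus>\<^sub>(sec F U) t : H" unfolding H_def using G(3)[OF yz] S.add_closed[OF U(1) y(1) z(1)] by blast
 next
  fix a s assume a: "a : carrier (\<O> R U)" and s: "s : H"
  obtain m :: nat and y where y: "s : Sec F U" "y : ?G" "(w [^] m) \<odot>[R,F,?D] res F U ?D s = res F ?X ?D y"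
   using s unfolding H_def by blast
  let ?O = "\<O> R ?D"
  interpret FD: module ?O "sec F ?D" by (rule S.smod[OF oD])
  have a': "a : Sec ?SM U" using a by (simp del: spec_simps)
  have aD: "restrict a ?D : carrier ?O" using O.res_closed[OF U(1) oD w(3) a'] by (simp only: SM_simps ring_module_simps spec_simps(7))
  \<comment> \<open>On D(w) the function \<open>a\<close> is a fraction \<open>b/w^n\<close> with
    \<open>b\<close> in \<open>R\<close>, so after multiplication by \<open>w^n\<close> it preserves
    the \<open>R\<close>-span.\<close>
  obtain n :: nat and b where b: "b : carrier R" "rsec R ?D (w [^] n) \<otimes>\<^sub>?O restrict a ?D = rsec R ?D b"
   using ring_loc_atD(5)[OF ring_loc_at_Osec[OF R w(1)] aD] by blast
  have wc: "rsec R ?D (w [^] k) : carrier ?O" for k :: nat by (rule rsec_closed[OF R oD wn])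
  let ?x = "res F U ?D s" let ?a = "restrict a ?D"
  note xc = rc[OF y(1)]
  have comm: "(w [^] m) \<odot>[R,F,?D] (?a \<odot>\<^sub>(sec F ?D) ?x) = ?a \<odot>\<^sub>(sec F ?D) ((w [^] m) \<odot>[R,F,?D] ?x)"
   unfolding FD.smult_assoc1[OF wc aD xc, symmetric] FD.smult_assoc1[OF aD wc xc, symmetric]
   by (subst FD.R.m_comm[OF wc aD]) (rule refl)
  have "(w [^] (n + m)) \<odot>[R,F,?D] res F U ?D (a \<odot>\<^sub>(sec F U) s)
    = (rsec R ?D (w [^] n) \<otimes>\<^sub>?O ?a) \<odot>\<^sub>(sec F ?D) ((w [^] m) \<odot>[R,F,?D] ?x)"
   unfolding S.res_smult[OF U(1) oD w(3) a y(1)] pw[OF oD FD.smult_closed[OF aD xc]] comm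
   by (rule FD.smult_assoc1[OF wc aD FD.smult_closed[OF wc xc], symmetric])
  also have "\<dots> = res F ?X ?D (b \<odot>[R,F,?X] y)" unfolding b(2) y(3) by (rule Gr[OF b(1) y(2)])
  finally show "a \<odot>\<^sub>(sec F U) s : H" unfolding H_def using G(5)[OF b(1) y(2)] S.smult_closed[OF U(1) a y(1)] by blast
 qed
 moreover have "S <= H" unfolding H_def using g S(1) GI by blast
 ultimately have H: "Sec F U <= H" using gen_submodule_least[of S H] S(3) by blast
 have "EX n::nat. (w [^] n) \<odot>[R,F,?X] m : ?G" if m: "m : Sec F ?X" for m
 proof -
  have UX: "U <= ?X" by (rule S.op_sub[OF U(1)])
  have "res F ?X U m : H" using H S.res_closed[OF oX U(1) UX m] by blast
  then obtain n :: nat and y where y: "y : ?G" "(w [^] n) \<odot>[R,F,?D] res F U ?D (res F ?X U m) = res F ?X ?D y"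
   unfolding H_def by blast
  interpret FX: module "\<O> R ?X" "sec F ?X" by (rule S.smod[OF oX])
  interpret FD: module "\<O> R ?D" "sec F ?D" by (rule S.smod[OF oD])
  let ?m = "(w [^] n) \<odot>[R,F,?X] m"
  have mc: "?m : Sec F ?X" by (rule S.rsmult_closed[OF oX wn m])
  note yc = G(7)[OF y(1)]
  have "res F ?X ?D ?m = res F ?X ?D y"
   using y(2) unfolding S.res_comp[OF oX U(1) oD w(3) UX m] S.res_rsmult[OF oX oD S.D_sub wn m] .
  then have "res F ?X ?D (?m \<ominus>\<^sub>(sec F ?X) y) = \<zero>\<^sub>(sec F ?D)"
   unfolding S.res_minus[OF oX oD S.D_sub mc yc]
   using S.res_closed[OF oX oD S.D_sub yc] by (simp add: a_minus_def FD.M.r_neg)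
  \<comment> \<open>The equality is known on D(w) only; a further power of \<open>w\<close> lifts it
    to the whole space.\<close>
  then obtain k :: nat where k: "(w [^] k) \<odot>[R,F,?X] (?m \<ominus>\<^sub>(sec F ?X) y) = \<zero>\<^sub>(sec F ?X)"
   using S.qclD(1)[OF q w(1), unfolded XD, OF FX.M.minus_closed[OF mc yc]] by blast
  have "?m = (?m \<ominus>\<^sub>(sec F ?X) y) \<oplus>\<^sub>(sec F ?X) y" using mc yc by (simp add: a_minus_def FX.M.a_assoc FX.M.l_neg)
  then have "(w [^] k) \<odot>[R,F,?X] ?m = (w [^] k) \<odot>[R,F,?X] y"
   using S.rsmult_add[OF oX wn[of k] FX.M.minus_closed[OF mc yc] yc] k FX.M.l_zero[OF S.rsmult_closed[OF oX wn[of k] yc]] by metis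
  then have "(w [^] (k + n)) \<odot>[R,F,?X] m : ?G"
   unfolding pw[OF oX m] using G(5)[OF wn[of k] y(1)] by simp
  then show ?thesis by blast
 qed
 then show ?thesis using gX S(2) w(1,2) unfolding rmod_simps by (intro exI[of _ "g ` S"] conjI bexI[of _ w]) auto
qed

lemma colon_ideal:
 assumes R: "cring R" and M: "module R M" and L: "submodule L R M" and m: "m : carrier M"
 shows "ideal {a : carrier R. a \<odot>\<^sub>M m : L} R"
proof (rule idealI2[OF R])
 interpret M: module R M by (rule M)
 note L = submoduleD[OF L M]
 show "\<zero>\<^sub>R : {a : carrier R. a \<odot>\<^sub>M m : L}" using M.smult_l_null[OF m] L(2) by simp
 show "x \<oplus>\<^sub>R y : {a : carrier R. a \<odot>\<^sub>M m : L}"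
  if "x : {a : carrier R. a \<odot>\<^sub>M m : L}" "y : {a : carrier R. a \<odot>\<^sub>M m : L}" for x y
  using that L(3) by (simp add: M.smult_l_distr[OF _ _ m])
 show "a \<otimes>\<^sub>R x : {a : carrier R. a \<odot>\<^sub>M m : L}" if "a : carrier R" "x : {a : carrier R. a \<odot>\<^sub>M m : L}" for a x
  using that L(5) by (simp add: M.smult_assoc1[OF _ _ m])
qed blast

text \<open>Finite generation near each point becomes global through an ideal in place of a finite
  subcover: the elements \<open>c\<close> for which one finite set generates, up to powers, near
  every point of D(c). For a sum the finite sets are united.\<close>

lemma coherent_iff:
 fixes R (structure)
 assumes R: "cring R"
 shows "coherent (spec R) F <-> sheaf_of_modules (spec R) F & qcl R F (Spec R) & finite_module R (rmod R F (Spec R))"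
proof
 let ?X = "Spec R" let ?M = "rmod R F (Spec R)"
 assume c: "coherent (spec R) F"
 then have "quasi_coherent (spec R) F" unfolding coherent_def quasi_coherent_def by blast
 then have F: "sheaf_of_modules (spec R) F" and q: "qcl R F ?X" unfolding quasi_coherent_iff[OF R] by auto
 interpret S: spec_sheaf R F by (rule spec_sheaf.intro[OF R F])
 have M: "module R ?M" by (rule S.rmod_module[OF S.op_X])
 define gens where "gens G w <-> (ALL m:carrier ?M. EX n::nat. (w [^] n) \<odot>\<^sub>?M m : gen_submodule R ?M G)" for G w
 have gens_mono: "gens G' w" if "gens G w" "G <= G'" "G' <= carrier ?M" for G G' w
 proof -
  have "gen_submodule R ?M G <= gen_submodule R ?M G'"
   by (rule gen_submodule_least[OF subset_trans[OF that(2) gen_submodule_incl] gen_submodule_submodule[OF M that(3)]])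
  then show ?thesis using that(1) unfolding gens_def by blast
 qed
 define J where "J = {c : carrier R. EX G <= carrier ?M. finite G & (ALL P. primeideal P R --> c ~: P --> (EX w:carrier R. w ~: P & gens G w))}"
 have "ideal J R"
 proof (rule idealI2[OF R])
  show "J <= carrier R" unfolding J_def by blast
  show "\<zero> : J" unfolding J_def using idealD(2)[OF primeD(1)] by (intro CollectI conjI exI[of _ "{}"]) auto
  fix x assume x: "x : J"
  then obtain G where G: "x : carrier R" "G <= carrier ?M" "finite G"
   "ALL P. primeideal P R --> x ~: P --> (EX w:carrier R. w ~: P & gens G w)" unfolding J_def by blast
  show "a \<otimes> x : J" if a: "a : carrier R" for a
  proof -
   have "x ~: P" if "primeideal P R" "a \<otimes> x ~: P" for P using idealD(4)[OF primeD(1)[OF that(1)] a] that(2) by blast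
   then show ?thesis unfolding J_def using G a by (intro CollectI conjI exI[of _ G]) (auto simp only: S.R.m_closed)
  qed
  fix y assume y: "y : J"
  then obtain H where H: "y : carrier R" "H <= carrier ?M" "finite H"
   "ALL P. primeideal P R --> y ~: P --> (EX w:carrier R. w ~: P & gens H w)" unfolding J_def by blast
  have GH: "G Un H <= carrier ?M" using G(2) H(2) by blast
  have "EX w:carrier R. w ~: P & gens (G Un H) w" if P: "primeideal P R" "x \<oplus> y ~: P" for P
  proof -
   have "x ~: P \<or> y ~: P" using idealD(3)[OF primeD(1)[OF P(1)]] P(2) by blast
   then show ?thesis
   proof
    assume "x ~: P"
    then obtain w where "w : carrier R" "w ~: P" "gens G w" using G(4) P(1) by blast
    then show ?thesis using gens_mono[OF _ Un_upper1 GH] by blast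
   next
    assume "y ~: P"
    then obtain w where "w : carrier R" "w ~: P" "gens H w" using H(4) P(1) by blast
    then show ?thesis using gens_mono[OF _ Un_upper2 GH] by blast
   qed
  qed
  then show "x \<oplus> y : J" unfolding J_def
   using G(1,3) H(1,3) GH by (intro CollectI conjI exI[of _ "G Un H"] allI impI S.R.a_closed finite_UnI) 
 qed
 moreover have "EX w:J. w ~: P" if P: "primeideal P R" for P
 proof -
  have "P : ?X" using P by (simp add: Spec_iff)
  then obtain U A N where U: "P : U" "affine_chart (spec R) F U A N" "finite_module A N"
   using c unfolding coherent_def spec_simps(1) topspace_zariski by blast
  obtain psi theta eta where ch: "zopen R U" "cring A" "module A N"
   "ringed_space_iso (open_subspace (spec R) U) (spec A) psi theta"
   "mod_sheaf_iso (open_subspace (spec R) U) F (spec A) (tilde A N) psi theta eta"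
   using U(2) unfolding affine_chart_def spec_simps(1) by blast
  obtain S where S: "S <= Sec F U" "finite S" "gen_submodule (\<O> R U) (sec F U) S = Sec F U"
   using S.chart_finite_generation[OF ch U(3)] by blast
  obtain G w where G: "G <= carrier ?M" "finite G" and w: "w : carrier R" "w ~: P" "gens G w"
   unfolding gens_def rmod_simps using finite_rmod_chart[OF R F q ch(1) U(1) S] by blast
  have "EX v:carrier R. v ~: P' & gens G v" if "w ~: P'" for P' using w(1,3) that by blast
  then have "w : J" unfolding J_def using G w(1) by (intro CollectI conjI exI[of _ G] allI impI)
  then show ?thesis using w(2) by blast
 qed
 ultimately have "\<one> : J" by (rule ideal_local_one[OF R])
 then obtain G where G: "G <= carrier ?M" "finite G"
  "ALL P. primeideal P R --> \<one> ~: P --> (EX w:carrier R. w ~: P & gens G w)" unfolding J_def by blast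
 interpret Mm: module R ?M by (rule M)
 note GD = submoduleD[OF gen_submodule_submodule[OF M G(1)] M]
 have "m : gen_submodule R ?M G" if m: "m : carrier ?M" for m
 proof -
  \<comment> \<open>Near each prime a power of some \<open>w\<close> outside it moves
    \<open>m\<close> into the span, so this ideal lies in no prime.\<close>
  let ?K = "{a : carrier R. a \<odot>\<^sub>?M m : gen_submodule R ?M G}"
  note K = colon_ideal[OF R M gen_submodule_submodule[OF M G(1)] m]
  have "\<one> : ?K"
  proof (rule ideal_local_one[OF R K])
   fix P assume P: "primeideal P R"
   then obtain w where w: "w : carrier R" "w ~: P" "gens G w" using G(3) primeD(3)[OF P] by blast
   then obtain n :: nat where "(w [^] n) \<odot>\<^sub>?M m : gen_submodule R ?M G" using m unfolding gens_def by blast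
   moreover have "w [^] n ~: P" by (rule prime_pow[OF P w(1,2)])
   ultimately show "EX j:?K. j ~: P" using S.R.nat_pow_closed[OF w(1)] by blast
  qed
  then show ?thesis using Mm.smult_one[OF m] by (metis (mono_tags, lifting) mem_Collect_eq)
 qed
 then have "gen_submodule R ?M G = carrier ?M" using GD(1) by blast
 then have "finite_module R ?M" unfolding finite_module_def using M G(1,2) by blast
 then show "sheaf_of_modules (spec R) F & qcl R F ?X & finite_module R ?M" using F q by blast
next
 interpret R: cring R by (rule R)
 let ?X = "Spec R" let ?M = "rmod R F (Spec R)"
 assume "sheaf_of_modules (spec R) F & qcl R F ?X & finite_module R ?M"
 then have F: "sheaf_of_modules (spec R) F" and q: "qcl R F ?X" and fin: "finite_module R ?M" by auto
 interpret S: spec_sheaf R F by (rule spec_sheaf.intro[OF R F])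
 obtain G where G: "G <= Sec F ?X" "finite G" "gen_submodule R ?M G = Sec F ?X"
  using fin unfolding finite_module_def rmod_simps by blast
 have M: "module (\<O> R ?X) (sec F ?X)" by (rule S.smod[OF S.op_X])
 note GD = submoduleD[OF gen_submodule_submodule[OF M G(1)] M]
 \<comment> \<open>The span over the ring of global functions is in particular an
   \<open>R\<close>-submodule, so it contains the \<open>R\<close>-span, which is
   everything.\<close>
 have "submodule (gen_submodule (\<O> R ?X) (sec F ?X) G) R ?M"
  by (rule submoduleI2[OF S.rmod_module[OF S.op_X]])
   (use GD(1,2,3) GD(5)[OF rsec_closed[OF R S.op_X]] in \<open>simp_all only: rmod_simps\<close>)
 then have "Sec F ?X <= gen_submodule (\<O> R ?X) (sec F ?X) G"
  unfolding G(3)[symmetric] by (rule gen_submodule_least[OF gen_submodule_incl])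
 then have "gen_submodule (\<O> R ?X) (sec F ?X) G = Sec F ?X" using GD(1) by blast
 then have "finite_module (\<O> R ?X) (sec F ?X)" unfolding finite_module_def using M G(1,2) by blast
 then show "coherent (spec R) F"
  using affine_chart_qcl[OF R R.one_closed F q, unfolded Dset_one] F unfolding coherent_def spec_simps(1) topspace_zariski by blast
qed

section \<open>Subsheaves\<close>

lemma sub_sheaf_simps [simp]:
 "Sec (sub_sheaf F L) U = L U" "res (sub_sheaf F L) = res F"
 "\<zero>\<^sub>(sec (sub_sheaf F L) U) = \<zero>\<^sub>(sec F U)" "x \<oplus>\<^sub>(sec (sub_sheaf F L) U) y = x \<oplus>\<^sub>(sec F U) y"
 "a \<odot>\<^sub>(sec (sub_sheaf F L) U) x = a \<odot>\<^sub>(sec F U) x"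
 by (simp_all add: sub_sheaf_def)

lemma sec_sub_sheaf: "sec (sub_sheaf F L) U = (sec F U)\<lparr>carrier := L U\<rparr>"
 by (simp add: sub_sheaf_def)

locale spec_subsheaf = spec_sheaf R F for R :: "('a, 'm) ring_scheme" (structure) and F :: "('a, 'b) spec_mod" +
 fixes L :: "'a set set => 'b set"
 assumes L: "subsheaf_of_modules (spec R) F L"
begin

lemma sub: "op U ==> submodule (L U) (\<O> R U) (sec F U)"
 using L unfolding subsheaf_of_modules_def by simp

lemmas subD = submoduleD[OF sub smod]

lemma sub_res: "op U ==> op V ==> V <= U ==> s : L U ==> res F U V s : L V"
 using L unfolding subsheaf_of_modules_def spec_simps(1) by blast

lemma sub_cover:
 assumes "op U" "open_cover (spec R) U C" "s : Sec F U" "ALL V:C. res F U V s : L V"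
 shows "s : L U"
proof -
 have "openin (top_of (spec R)) U & open_cover (spec R) U C" using assms by simp
 then show ?thesis
  by (rule L[unfolded subsheaf_of_modules_def, THEN conjunct2, THEN conjunct2, THEN HOL.spec, THEN HOL.spec, THEN mp,
   THEN bspec, OF _ assms(3), THEN mp, OF _ assms(4)])
qed

lemma sub_rsub: "op U ==> submodule (L U) R (rmod R F U)"
 by (rule submoduleI2[OF rmod_module])
  (use subD(1,2,3) subD(5)[OF _ _ rsec_closed[OF R]] in \<open>simp_all only: rmod_simps\<close>)

lemma sheaf_sub_sheaf: "sheaf_of_modules (spec R) (sub_sheaf F L)" (is "sheaf_of_modules _ ?G")
 unfolding sheaf_of_modules_def spec_simps(1)
proof (intro conjI allI impI)
 show "module (\<O> R U) (sec ?G U)" if "op U" for U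
  unfolding sec_sub_sheaf by (rule submodule_module[OF sub[OF that] smod[OF that]])
 fix U V assume "op U & op V & V <= U"
 then have UV: "op U" "op V" "V <= U" by auto
 show "res ?G U V : Sec ?G U \<rightarrow> Sec ?G V"
  using sub_res[OF UV] by auto
 show "ALL s:Sec ?G U. ALL t:Sec ?G U.
   res ?G U V (s \<oplus>\<^sub>(sec ?G U) t) = res ?G U V s \<oplus>\<^sub>(sec ?G V) res ?G U V t"
  using res_add[OF UV] subD(7)[OF UV(1) UV(1)] by simp
 show "ALL a:carrier (\<O> R U). ALL s:Sec ?G U.
   res ?G U V (a \<odot>\<^sub>(sec ?G U) s) = Ores (spec R) U V a \<odot>\<^sub>(sec ?G V) res ?G U V s"
  using res_smult[OF UV] subD(7)[OF UV(1) UV(1)] by simp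
next
 show "ALL s:Sec ?G U. res ?G U U s = s" if "op U" for U
  using res_id[OF that] subD(7)[OF that that] by simp
next
 fix U V W assume "op U & op V & op W & W <= V & V <= U"
 then show "ALL s:Sec ?G U. res ?G V W (res ?G U V s) = res ?G U W s"
  using res_comp subD(7) by simp
next
 fix U C assume UC: "op U & open_cover (spec R) U C"
 then have U: "op U" and C: "open_cover (spec R) U C" by auto
 have CU: "op V" "V <= U" if "V : C" for V using C that by (auto simp: open_cover_def)
 show "(ALL s:Sec ?G U. ALL t:Sec ?G U.
   (ALL V:C. res ?G U V s = res ?G U V t) --> s = t)"
  using sep[OF U, of C] C subD(7)[OF U U] unfolding open_cover_def sub_sheaf_simps spec_simps(1) by simp
 fix s assume "(ALL V:C. s V : Sec ?G V) &
   (ALL V:C. ALL W:C. res ?G V (V Int W) (s V) = res ?G W (V Int W) (s W))"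
 then have s: "(ALL V:C. s V : L V) & (ALL V:C. ALL W:C. res F V (V Int W) (s V) = res F W (V Int W) (s W))"
  unfolding sub_sheaf_simps .
  have "EX u:Sec F U. ALL V:C. res F U V u = s V"
   by (rule glue) (use CU C s subD(7) in \<open>auto simp: open_cover_def\<close>)
  then obtain u where u: "u : Sec F U" "ALL V:C. res F U V u = s V" by blast
  have "ALL V:C. res F U V u : L V" using u(2) s by simp
  then have "u : L U" by (rule sub_cover[OF U C u(1)])
  then show "EX u:Sec ?G U. ALL V:C. res ?G U V u = s V"
   unfolding sub_sheaf_simps using u(2) by blast
qed

text \<open>The vanishing half of the localization property is inherited from \<open>F\<close>; what
  remains is that the extension of \<open>r^n t\<close> can be chosen in the subsheaf.\<close>

lemma qcl_sub_sheaf_iff: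
 assumes q: "qcl R F X"
 shows "qcl R (sub_sheaf F L) X <-> (ALL r:carrier R. ALL t:L (D r). EX n::nat. EX t':L X.
   (r [^] n) \<odot>[R,F,D r] t = res F X (D r) t')"
proof -
 let ?G = "sub_sheaf F L"
 interpret G: spec_sheaf R ?G by (rule spec_sheaf.intro[OF R sheaf_sub_sheaf])
 have XD: "X Int D r = D r" for r using D_sub by blast
 show ?thesis
 proof
  assume h: "qcl R ?G X"
  show "ALL r:carrier R. ALL t:L (D r). EX n::nat. EX t':L X. (r [^] n) \<odot>[R,F,D r] t = res F X (D r) t'"
   using G.qclD(2)[OF h, unfolded XD sub_sheaf_simps] by blast
 next
  assume *: "ALL r:carrier R. ALL t:L (D r). EX n::nat. EX t':L X. (r [^] n) \<odot>[R,F,D r] t = res F X (D r) t'"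
  show "qcl R ?G X"
  proof (rule G.qclI[OF op_X])
   fix r t assume r: "r : carrier R"
   show "EX n::nat. (r [^] n) \<odot>[R,?G,X] t = \<zero>\<^sub>(sec ?G X)"
    if "t : Sec ?G X" "res ?G X (X Int D r) t = \<zero>\<^sub>(sec ?G (X Int D r))"
    using qclD(1)[OF q r, of t] subD(7)[OF op_X op_X] that by simp
   show "EX n::nat. EX t':Sec ?G X. (r [^] n) \<odot>[R,?G,X Int D r] t
     = res ?G X (X Int D r) t'" if "t : Sec ?G (X Int D r)"
    using * r that unfolding XD by simp
  qed
 qed
qed

end

section \<open>The tight closure of a subsheaf\<close>

context spec_subsheaf
begin

context
 fixes p :: nat
begin

definition tc where "tc W = tight_closure p (\<O> R W) (sec F W) (L W)"

text \<open>The affine set \<open>V\<close> is not assumed to be a basic open set. By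
  \<open>affine_open_qcl\<close>, restricting functions from \<open>V\<close> to D(g) is
  localization at the image of \<open>g\<close>, so multipliers stay outside the minimal
  primes.\<close>

lemma tc_push:
 assumes V: "affine_open (spec R) V" and g: "g : carrier R" "D g <= V" and t: "t : tc V"
 shows "res F V (D g) t : tc (D g)"
proof -
 interpret O: spec_sheaf R "structure_module (spec R)" by (rule spec_sheaf.intro[OF R sheaf_structure[OF R]])
 have oV: "op V" using V unfolding affine_open_def by simp
 have oD: "op (D g)" using g by simp
 have VD: "V Int D g = D g" using g(2) by blast
 note q = affine_open_qcl[OF R V]
 let ?A = "\<O> R V" and ?B = "\<O> R (D g)"
 have A: "cring ?A" and B: "cring ?B" by (rule cring_Osec[OF R oV], rule cring_Osec[OF R oD])
 interpret rho: ring_hom_cring R ?A "rsec R V" by (rule ring_hom_cring_I[OF R A rsec_hom[OF R oV]])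
 have gA: "rsec R V g : carrier ?A" by (rule rsec_closed[OF R oV g(1)])
 have pow: "rsec R V (g [^] (n::nat)) = rsec R V g [^]\<^sub>?A n" for n by (rule rho.ring.hom_nat_pow[OF g(1)])
 have gn: "g [^] (n::nat) : carrier R" for n using g by simp
 have hom: "(%s. restrict s (D g)) : ring_hom ?A ?B"
 proof (rule ring_hom_memI)
  note l = semilinearD[OF O.res_semilin[OF oV oD g(2)]]
  show "restrict x (D g) : carrier ?B" if "x : carrier ?A" for x
   using l(1)[of x] that by (simp only: SM_simps ring_module_simps spec_simps(7))
  show "restrict (x \<otimes>\<^sub>?A y) (D g) = restrict x (D g) \<otimes>\<^sub>?B restrict y (D g)" if "x : carrier ?A" "y : carrier ?A" for x y
   using l(3)[OF that(1), of y] that(2) by (simp only: SM_simps ring_module_simps spec_simps(7))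
  show "restrict (x \<oplus>\<^sub>?A y) (D g) = restrict x (D g) \<oplus>\<^sub>?B restrict y (D g)" if "x : carrier ?A" "y : carrier ?A" for x y
   using l(2)[of x y] that by (simp only: SM_simps ring_module_simps spec_simps(7))
  show "restrict \<one>\<^sub>?A (D g) = \<one>\<^sub>?B"
   using rsec_restrict[OF g(2), of R "\<one>"] ring_hom_one[OF rsec_hom[OF R oV]] ring_hom_one[OF rsec_hom[OF R oD]] by argo
 qed
 have "ring_loc_at ?A (rsec R V g) ?B (%s. restrict s (D g))"
 proof (rule ring_loc_atI[OF A B hom])
  show "restrict (rsec R V g) (D g) : Units ?B" unfolding rsec_restrict[OF g(2)] by (rule rsec_unit[OF R oD g(1)]) simp
  show "EX n::nat. rsec R V g [^]\<^sub>?A n \<otimes>\<^sub>?A a = \<zero>\<^sub>?A" if "a : carrier ?A" "restrict a (D g) = \<zero>\<^sub>?B" for a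
   using O.qclD(1)[OF q g(1), of a] that unfolding VD pow by (simp only: SM_simps ring_module_simps spec_simps(7))
  show "EX n::nat. EX a:carrier ?A. restrict (rsec R V g [^]\<^sub>?A n) (D g) \<otimes>\<^sub>?B b = restrict a (D g)" if "b : carrier ?B" for b
   using O.qclD(2)[OF q g(1), of b] that unfolding VD pow[symmetric] rsec_restrict[OF g(2)]
   by (simp only: SM_simps ring_module_simps spec_simps(7))
 qed
 then show ?thesis
  using tight_closure_push[OF A B gA _ smod[OF oV] smod[OF oD] res_semilin[OF oV oD g(2)] sub[OF oV] sub[OF oD]] t
   sub_res[OF oV oD g(2)] unfolding tc_def by blast
qed

lemma tc_submodule: "op W ==> submodule (tc W) (\<O> R W) (sec F W)"
 unfolding tc_def by (rule tight_closure_submodule[OF smod sub])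

private abbreviation (input) "\<T> \<equiv> tight_closure_sheaf p (spec R) F L"

text \<open>An arbitrary affine cover is refined to basic open sets by \<open>tc_push\<close>;
  conversely basic open sets are affine. From here on only basic open sets of \<open>R\<close>
  occur.\<close>

lemma T_iff:
 assumes U: "op U"
 shows "t : \<T> U <-> t : Sec F U & (ALL P:U. EX g:carrier R. g ~: P & D g <= U & res F U (D g) t : tc (D g))"
proof
 assume t: "t : \<T> U"
 then obtain C where C: "t : Sec F U" "open_cover (spec R) U C"
  "ALL V:C. affine_open (spec R) V & res F U V t : tc V"
  unfolding tight_closure_sheaf_def tc_def by blast
 have "EX g:carrier R. g ~: P & D g <= U & res F U (D g) t : tc (D g)" if P: "P : U" for P
 proof -
  obtain V where V: "V : C" "P : V" "op V" "V <= U" using C(2) P unfolding open_cover_def spec_simps(1) by blast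
  obtain g where g: "g : carrier R" "g ~: P" "D g <= V" "P : D g" by (rule open_nbhd[OF V(3,2)])
  have "res F V (D g) (res F U V t) : tc (D g)" by (rule tc_push[OF _ g(1,3)]) (use C(3) V(1) in blast)+
  then show ?thesis using res_comp[OF U V(3) op_D[OF g(1)] g(3) V(4) C(1)] g V(4) by (metis subset_trans)
 qed
 then show "t : Sec F U & (ALL P:U. EX g:carrier R. g ~: P & D g <= U & res F U (D g) t : tc (D g))"
  using C(1) by blast
next
 assume t: "t : Sec F U & (ALL P:U. EX g:carrier R. g ~: P & D g <= U & res F U (D g) t : tc (D g))"
 let ?C = "{V. EX g:carrier R. V = D g & V <= U & res F U V t : tc V}"
 have "\<Union>?C = U"
 proof
  show "U <= \<Union>?C"
  proof
   fix P assume P: "P : U"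
   then obtain g where g: "g : carrier R" "g ~: P" "D g <= U" "res F U (D g) t : tc (D g)" using t by blast
   have "P : D g" using g(2) P op_sub[OF U] by (auto simp: Dset_iff Spec_iff)
   then show "P : \<Union>?C" using g by blast
  qed
 qed blast
 then have "open_cover (spec R) U ?C" unfolding open_cover_def by auto
 moreover have "affine_open (spec R) V & res F U V t : tc V" if "V : ?C" for V using that affine_open_Dset[OF R] by blast
 ultimately show "t : \<T> U" unfolding tight_closure_sheaf_def tc_def using t by blast
qed

lemma tc_shrink:
 assumes U: "op U" and t: "t : Sec F U" and g: "g : carrier R" "D g <= U" "res F U (D g) t : tc (D g)"
  and w: "w : carrier R" "D w <= D g"
 shows "res F U (D w) t : tc (D w)"
 using tc_push[OF affine_open_Dset[OF R g(1)] w g(3)] res_comp[OF U op_D[OF g(1)] op_D[OF w(1)] w(2) g(2) t] by simp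

text \<open>With \<open>T_iff\<close> all conditions are checked near one point, and two witnesses
  D(g) and D(k) are replaced by D(g k) by shrinking.\<close>

lemma T_subsheaf: "subsheaf_of_modules (spec R) F \<T>"
 unfolding subsheaf_of_modules_def spec_simps(1)
proof (intro conjI allI impI)
 fix U assume U: "op U"
 show "submodule (\<T> U) (\<O> R U) (sec F U)"
 proof (rule submoduleI2[OF smod[OF U]])
  interpret FU: module "\<O> R U" "sec F U" by (rule smod[OF U])
  show "\<T> U <= Sec F U" unfolding tight_closure_sheaf_def by blast
  have "EX g:carrier R. g ~: P & D g <= U & res F U (D g) \<zero>\<^sub>(sec F U) : tc (D g)" if P: "P : U" for P
  proof -
   obtain g where g: "g : carrier R" "g ~: P" "D g <= U" "P : D g" by (rule open_nbhd[OF U P])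
   then show ?thesis using res_zero[OF U op_D[OF g(1)] g(3)] submoduleD(2)[OF tc_submodule smod] by (intro bexI[of _ g]) auto
  qed
  then show "\<zero>\<^sub>(sec F U) : \<T> U" unfolding T_iff[OF U] using zero_closed[OF U] by blast
  fix s assume s: "s : \<T> U"
  note sU = s[unfolded T_iff[OF U]]
  have sc: "s : Sec F U" using sU by blast
  show "a \<odot>\<^sub>(sec F U) s : \<T> U" if a: "a : carrier (\<O> R U)" for a
   unfolding T_iff[OF U]
  proof (intro conjI ballI)
   show "a \<odot>\<^sub>(sec F U) s : Sec F U" by (rule smult_closed[OF U a sc])
   fix P assume "P : U"
   then obtain g where g: "g : carrier R" "g ~: P" "D g <= U" "res F U (D g) s : tc (D g)" using sU by blast
   have "restrict a (D g) : carrier (\<O> R (D g))"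
    using tilde_sub_restrict[OF R _ U op_D[OF g(1)] g(3)] a by simp
   then have "restrict a (D g) \<odot>\<^sub>(sec F (D g)) res F U (D g) s : tc (D g)"
    by (rule submoduleD(5)[OF tc_submodule[OF op_D[OF g(1)]] smod[OF op_D[OF g(1)]] _ g(4)])
   then show "EX g:carrier R. g ~: P & D g <= U & res F U (D g) (a \<odot>\<^sub>(sec F U) s) : tc (D g)"
    using g(1-3) res_smult[OF U op_D[OF g(1)] g(3) a sc] by auto
  qed
  fix t assume t: "t : \<T> U"
  note tU = t[unfolded T_iff[OF U]]
  have tcr: "t : Sec F U" using tU by blast
  show "s \<oplus>\<^sub>(sec F U) t : \<T> U"
   unfolding T_iff[OF U]
  proof (intro conjI ballI)
   show "s \<oplus>\<^sub>(sec F U) t : Sec F U" by (rule FU.M.a_closed[OF sc tcr])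
   fix P assume P: "P : U"
   obtain g where g: "g : carrier R" "g ~: P" "D g <= U" "res F U (D g) s : tc (D g)" using sU P by blast
   obtain k where k: "k : carrier R" "k ~: P" "D k <= U" "res F U (D k) t : tc (D k)" using tU P by blast
   let ?w = "g \<otimes> k"
   have w: "?w : carrier R" "D ?w <= D g" "D ?w <= D k" "D ?w <= U" using D_mult[OF g(1) k(1)] g k by auto
   have "P : D g Int D k" using g(2) k(2) P op_sub[OF U] by (auto simp: Dset_iff Spec_iff)
   then have wP: "?w ~: P" unfolding D_mult[OF g(1) k(1), symmetric] by (simp add: Dset_iff)
   have "res F U (D ?w) s : tc (D ?w)" "res F U (D ?w) t : tc (D ?w)"
    by (rule tc_shrink[OF U sc g(1,3,4) w(1,2)], rule tc_shrink[OF U tcr k(1,3,4) w(1,3)])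
   then have "res F U (D ?w) (s \<oplus>\<^sub>(sec F U) t) : tc (D ?w)"
    unfolding res_add[OF U op_D[OF w(1)] w(4) sc tcr]
    by (rule submoduleD(3)[OF tc_submodule[OF op_D[OF w(1)]] smod[OF op_D[OF w(1)]]])
   then show "EX g:carrier R. g ~: P & D g <= U & res F U (D g) (s \<oplus>\<^sub>(sec F U) t) : tc (D g)" using w(1,4) wP by blast
  qed
 qed
next
 fix U V assume "op U & op V & V <= U"
 then have UV: "op U" "op V" "V <= U" by auto
 show "res F U V ` \<T> U <= \<T> V"
 proof (rule image_subsetI)
  fix t assume "t : \<T> U"
  note tU = this[unfolded T_iff[OF UV(1)]]
  have tcr: "t : Sec F U" using tU by blast
  show "res F U V t : \<T> V"
   unfolding T_iff[OF UV(2)]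
  proof (intro conjI ballI res_closed[OF UV tcr])
   fix P assume P: "P : V"
   then obtain g where g: "g : carrier R" "g ~: P" "D g <= U" "res F U (D g) t : tc (D g)" using tU UV(3) by blast
   obtain k where k: "k : carrier R" "k ~: P" "D k <= V" "P : D k" by (rule open_nbhd[OF UV(2) P])
   let ?w = "g \<otimes> k"
   have w: "?w : carrier R" "D ?w <= D g" "D ?w <= V" using D_mult[OF g(1) k(1)] g k by auto
   have "P : D g Int D k" using g(2) k(4) by (auto simp: Dset_iff)
   then have wP: "?w ~: P" unfolding D_mult[OF g(1) k(1), symmetric] by (simp add: Dset_iff)
   have "res F V (D ?w) (res F U V t) : tc (D ?w)"
    unfolding res_comp[OF UV(1,2) op_D[OF w(1)] w(3) UV(3) tcr] by (rule tc_shrink[OF UV(1) tcr g(1,3,4) w(1,2)])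
   then show "EX g:carrier R. g ~: P & D g <= V & res F V (D g) (res F U V t) : tc (D g)" using w(1,3) wP by blast
  qed
 qed
next
 fix U C assume UC: "op U & open_cover (spec R) U C"
 then have U: "op U" and C: "\<And>V. V : C ==> op V" "\<Union>C = U" unfolding open_cover_def spec_simps(1) by blast+
 show "ALL s:Sec F U. (ALL V:C. res F U V s : \<T> V) --> s : \<T> U"
 proof (intro ballI impI)
  fix s assume s: "s : Sec F U" "ALL V:C. res F U V s : \<T> V"
  have "EX g:carrier R. g ~: P & D g <= U & res F U (D g) s : tc (D g)" if P: "P : U" for P
  proof -
   obtain V where V: "V : C" "P : V" using P C(2) by blast
   have VU: "V <= U" using V(1) C(2) by blast
   obtain g where g: "g : carrier R" "g ~: P" "D g <= V" "res F V (D g) (res F U V s) : tc (D g)"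
    using s(2)[rule_format, OF V(1), unfolded T_iff[OF C(1)[OF V(1)]]] V(2) by blast
   then show ?thesis using VU unfolding res_comp[OF U C(1)[OF V(1)] op_D[OF g(1)] g(3) VU s(1)] by blast
  qed
  then show "s : \<T> U" unfolding T_iff[OF U] using s(1) by blast
 qed
qed

end

end

text \<open>A module \<open>M\<close> with submodule \<open>L0\<close>, of their own element type,
  identified by \<open>h\<close> with the global sections of \<open>F\<close> and \<open>L\<close>.
  Instances are the sheaf associated with a module, the global sections of a given quasi-coherent
  sheaf, ideals with the structure sheaf, and re-encoded sheaves.\<close>

locale global_model = spec_subsheaf R F L for R :: "('a, 'm) ring_scheme" (structure) and F :: "('a, 'b) spec_mod" and L +
 fixes p :: nat and M :: "('a, 'c, 'k) module_scheme" and L0 h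
 assumes noeth: "noetherian_ring R" and q: "qcl R F X" and qL: "qcl R (sub_sheaf F L) X"
  and M: "module R M" and L0: "submodule L0 R M"
  and h: "semilinear R id M (rmod R F X) h" and bij: "bij_betw h (carrier M) (Sec F X)" and hL: "h ` L0 = L X"
begin

sublocale M: module R M by (rule M)

abbreviation (input) "TC \<equiv> tight_closure p R M L0"
abbreviation (input) "TS \<equiv> tight_closure_sheaf p (spec R) F L"

lemmas TCD = submoduleD[OF tight_closure_submodule[OF M L0] M]

lemma h_closed: "z : carrier M ==> h z : Sec F X" using semilinearD(1)[OF h] by simp

lemma h_smult: "a : carrier R ==> z : carrier M ==> h (a \<odot>\<^sub>M z) = a \<odot>[R,F,X] h z"
 using semilinearD(3)[OF h] by simp

lemma pow_closed: "f : carrier R ==> f [^] (n::nat) : carrier R" by simp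

lemma h_res_loc_at:
 assumes g: "g : carrier R"
 shows "loc_at R g (rsec R (D g)) M (sec F (D g)) (%z. res F X (D g) (h z))"
proof -
 note l = res_loc_at[OF q g]
 have "semilinear R (id \<circ> id) M (rmod R F (D g)) (res F X (D g) \<circ> h)"
  by (rule semilinear_comp[OF h loc_atD(1)[OF l]]) simp
 then have sl: "semilinear R (rsec R (D g)) M (sec F (D g)) (%z. res F X (D g) (h z))"
  unfolding semilinear_def by (simp add: comp_def)
 have gn: "g [^] (n::nat) : carrier R" for n using g by simp
 have h0: "h \<zero>\<^sub>M = \<zero>\<^sub>(sec F X)"
  using semilinear_zero[OF h module_abelian[OF M] module_abelian[OF rmod_module[OF op_X]]] by simp
 have 2: "EX n::nat. (g [^] n) \<odot>\<^sub>M x = \<zero>\<^sub>M" if x: "x : carrier M" "res F X (D g) (h x) = \<zero>\<^sub>(sec F (D g))" for x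
 proof -
  obtain n :: nat where "(g [^] n) \<odot>[R,F,X] h x = \<zero>\<^sub>(sec F X)"
   using loc_atD(2)[OF l, of "h x"] h_closed[OF x(1)] x(2) unfolding rmod_simps by blast
  then have "h ((g [^] n) \<odot>\<^sub>M x) = h \<zero>\<^sub>M" unfolding h_smult[OF gn x(1)] h0 .
  then have "(g [^] n) \<odot>\<^sub>M x = \<zero>\<^sub>M"
   by (rule inj_onD[OF bij_betw_imp_inj_on[OF bij] _ M.smult_closed[OF gn x(1)] M.M.zero_closed])
  then show ?thesis by blast
 qed
 have 3: "EX n::nat. EX x:carrier M. (g [^] n) \<odot>[R,F,D g] y = res F X (D g) (h x)" if y: "y : Sec F (D g)" for y
 proof -
  obtain n :: nat and t where t: "t : Sec F X" "(g [^] n) \<odot>[R,F,D g] y = res F X (D g) t"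
   using loc_atD(3)[OF l, of y] y unfolding rmod_simps id_apply by blast
  have "t : h ` carrier M" unfolding bij_betw_imp_surj_on[OF bij] by (rule t(1))
  then show ?thesis using t(2) by blast
 qed
 show ?thesis unfolding loc_at_def using sl 2 3 by blast
qed

text \<open>Restriction to D(g) is localization for \<open>M\<close> by \<open>h_res_loc_at\<close>,
  and for \<open>L0\<close> by quasi-coherence of \<open>L\<close>; so tight closure over the ring
  of D(g) is expressed over \<open>R\<close>.\<close>

lemma tc_iff:
 assumes g: "g : carrier R" and z: "z : carrier M"
 shows "res F X (D g) (h z) : tc p (D g) <-> loc_tight p g R M L0 z"
proof -
 have oD: "op (D g)" using g by simp
 have hLK: "(%z. res F X (D g) (h z)) ` L0 <= L (D g)" using hL sub_res[OF op_X oD D_sub] by blast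
 have KL: "EX n::nat. EX x:L0. (g [^] n) \<odot>[R,F,D g] y = res F X (D g) (h x)" if y: "y : L (D g)" for y
  using qL[unfolded qcl_sub_sheaf_iff[OF q]] g y unfolding hL[symmetric] by blast
 show ?thesis unfolding tc_def
  by (rule tight_closure_loc_at[OF R cring_Osec[OF R oD] g ring_loc_at_Osec[OF R g] M smod[OF oD] h_res_loc_at[OF g]
    L0 sub[OF oD] hLK KL z])
qed

lemma T_global: "TS X = h ` TC"
proof (intro equalityI subsetI)
 fix t assume "t : TS X"
 note t = this[unfolded T_iff[OF op_X]]
 then obtain z where z: "z : carrier M" "t = h z" using bij_betw_imp_surj_on[OF bij] by blast
 have "z : TC"
 proof (rule tight_closure_local[OF R noeth M L0 z(1)])
  fix Q assume "primeideal Q R"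
  then have "Q : X" by (simp add: Spec_iff)
  then obtain g where g: "g : carrier R" "g ~: Q" "res F X (D g) t : tc p (D g)" using t by blast
  then show "EX g:carrier R. g ~: Q & loc_tight p g R M L0 z" using tc_iff[OF g(1) z(1)] unfolding z(2) by blast
 qed
 then show "t : h ` TC" using z(2) by blast
next
 fix t assume "t : h ` TC"
 then obtain z where z: "z : TC" "t = h z" by blast
 \<comment> \<open>D(1) serves for every point.\<close>
 have "EX g:carrier R. g ~: P & D g <= X & res F X (D g) t : tc p (D g)" if P: "P : X" for P
  using tc_iff[OF R.one_closed TCD(7)[OF z(1)]] loc_tight_of_tight[OF M L0 R.one_closed z(1)] primeD(3)[of P R] P z(2)
  by (intro bexI[of _ "\<one>"]) (auto simp: Spec_iff)
 then show "t : TS X" unfolding T_iff[OF op_X] using h_closed[OF TCD(7)[OF z(1)]] z(2) by blast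
qed

lemma sub_T: "spec_subsheaf R F TS"
 by (rule spec_subsheaf.intro[OF spec_sheaf_axioms]) (rule spec_subsheaf_axioms.intro[OF T_subsheaf])

text \<open>Both sides of the equivalence are compared with this condition: commutation at a single
  \<open>f\<close> with the condition for that \<open>f\<close>, quasi-coherence with the conditions
  for all \<open>f\<close> together.\<close>

definition clears where
 "clears f <-> (ALL z. loc_tight p f R M L0 z --> (EX n::nat. (f [^] n) \<odot>\<^sub>M z : TC))"

lemma quasi_coherent_clears: "quasi_coherent (spec R) (sub_sheaf F TS) <-> (ALL f:carrier R. clears f)"
proof -
 interpret T: spec_subsheaf R F TS by (rule sub_T)
 have "quasi_coherent (spec R) (sub_sheaf F TS) <-> (ALL r:carrier R. ALL t:TS (D r). EX n::nat. EX t':TS X.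
   (r [^] n) \<odot>[R,F,D r] t = res F X (D r) t')"
  unfolding quasi_coherent_iff[OF R] T.qcl_sub_sheaf_iff[OF q] using T.sheaf_sub_sheaf by blast
 also have "\<dots> <-> (ALL f:carrier R. clears f)"
 proof
  assume *: "ALL r:carrier R. ALL t:TS (D r). EX n::nat. EX t':TS X. (r [^] n) \<odot>[R,F,D r] t = res F X (D r) t'"
  show "ALL f:carrier R. clears f"
   unfolding clears_def
  proof (intro ballI allI impI)
   fix f z assume f: "f : carrier R" and lz: "loc_tight p f R M L0 z"
   have z: "z : carrier M" using lz unfolding loc_tight_def by blast
   note l = h_res_loc_at[OF f]
   have oD: "op (D f)" using f by simp
   let ?t = "res F X (D f) (h z)"
   have tD: "?t : Sec F (D f)" by (rule res_closed[OF op_X oD D_sub h_closed[OF z]])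
   have "?t : tc p (D f)" using tc_iff[OF f z] lz by blast
   then have "?t : TS (D f)" unfolding T_iff[OF oD]
    using tD f by (intro conjI ballI bexI[of _ f]) (auto simp: Dset_iff)
   then obtain n :: nat and z' where z': "z' : TC" "(f [^] n) \<odot>[R,F,D f] ?t = res F X (D f) (h z')"
    using *[rule_format, OF f, of ?t] unfolding T_global by blast
   note zc = TCD(7)[OF z'(1)]
   have fz: "(f [^] n) \<odot>\<^sub>M z : carrier M" by (rule M.smult_closed[OF pow_closed[OF f] z])
   \<comment> \<open>\<open>f^n z\<close> and \<open>z'\<close> are known to agree on D(f) only, so
     their difference is killed by another power of \<open>f\<close>.\<close>
   let ?d = "(f [^] n) \<odot>\<^sub>M z \<ominus>\<^sub>M z'"
   interpret FD: module "\<O> R (D f)" "sec F (D f)" by (rule smod[OF oD])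
   have "res F X (D f) (h ?d) = res F X (D f) (h ((f [^] n) \<odot>\<^sub>M z)) \<ominus>\<^sub>(sec F (D f)) res F X (D f) (h z')"
    by (rule semilinear_minus[OF loc_atD(1)[OF l] module_abelian[OF M] module_abelian[OF smod[OF oD]] fz zc])
   also have "res F X (D f) (h ((f [^] n) \<odot>\<^sub>M z)) = res F X (D f) (h z')"
    using semilinearD(3)[OF loc_atD(1)[OF l] pow_closed[OF f] z] z'(2) by simp
   finally have "res F X (D f) (h ?d) = \<zero>\<^sub>(sec F (D f))"
    using res_closed[OF op_X oD D_sub h_closed[OF zc]] by (simp add: a_minus_def FD.M.r_neg)
   then obtain k :: nat where k: "(f [^] k) \<odot>\<^sub>M ?d = \<zero>\<^sub>M" using loc_atD(2)[OF l M.M.minus_closed[OF fz zc]] by blast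
   have "(f [^] n) \<odot>\<^sub>M z = ?d \<oplus>\<^sub>M z'" using fz zc by (simp add: a_minus_def M.M.a_assoc M.M.l_neg)
   then have "(f [^] k) \<odot>\<^sub>M ((f [^] n) \<odot>\<^sub>M z) = (f [^] k) \<odot>\<^sub>M z'"
    using M.smult_r_distr[OF pow_closed[OF f, of k] M.M.minus_closed[OF fz zc] zc] k M.smult_closed[OF pow_closed[OF f, of k] zc] by simp
   then have "(f [^] (k + n)) \<odot>\<^sub>M z : TC"
    using TCD(5)[OF pow_closed[OF f, of k] z'(1)] M.smult_assoc1[OF pow_closed[OF f, of k] pow_closed[OF f, of n] z]
    by (simp add: R.nat_pow_mult[OF f])
   then show "EX n::nat. (f [^] n) \<odot>\<^sub>M z : TC" by blast
  qed
 next
  assume cl: "ALL f:carrier R. clears f"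
  show "ALL r:carrier R. ALL t:TS (D r). EX n::nat. EX t':TS X. (r [^] n) \<odot>[R,F,D r] t = res F X (D r) t'"
  proof (intro ballI)
   fix f t assume f: "f : carrier R" and t: "t : TS (D f)"
   have oD: "op (D f)" using f by simp
   have tcr: "t : Sec F (D f)" using T.subD(7)[OF oD oD t] .
   obtain n :: nat and z where z: "z : carrier M" "(f [^] n) \<odot>[R,F,D f] t = res F X (D f) (h z)"
    using loc_atD(3)[OF h_res_loc_at[OF f] tcr] by blast
   have ft: "res F X (D f) (h z) : TS (D f)"
    unfolding z(2)[symmetric] by (rule T.subD(5)[OF oD oD rsec_closed[OF R oD pow_closed[OF f]] t])
   \<comment> \<open>A section of the tight closure sheaf over D(f) is known to be in the tight
     closure only on smaller sets D(g). The hypothesis is therefore used for these \<open>g\<close>,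
     and the ideal \<open>?J\<close> then yields a power of \<open>f\<close>.\<close>
   let ?J = "{a : carrier R. a \<odot>\<^sub>M z : TC}"
   have "EX k::nat. f [^] k : ?J"
   proof (rule ideal_local[OF R colon_ideal[OF R M tight_closure_submodule[OF M L0] z(1)] f])
    fix Q assume Q: "primeideal Q R" "f ~: Q"
    then have "Q : D f" by (simp add: Dset_iff)
    then obtain g where g: "g : carrier R" "g ~: Q" "D g <= D f" "res F (D f) (D g) (res F X (D f) (h z)) : tc p (D g)"
     using ft unfolding T_iff[OF oD] by blast
    then have "loc_tight p g R M L0 z"
     unfolding tc_iff[OF g(1) z(1), symmetric] res_comp[OF op_X oD op_D[OF g(1)] g(3) D_sub h_closed[OF z(1)]] by blast
    then obtain m :: nat where "(g [^] m) \<odot>\<^sub>M z : TC" using cl g(1) unfolding clears_def by blast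
    moreover have "g [^] m ~: Q" by (rule prime_pow[OF Q(1) g(1,2)])
    ultimately show "EX j:?J. j ~: Q" using pow_closed[OF g(1)] by blast
   qed
   then obtain k :: nat where k: "(f [^] k) \<odot>\<^sub>M z : TC" by blast
   have "(f [^] (k + n)) \<odot>[R,F,D f] t = (f [^] k) \<odot>[R,F,D f] res F X (D f) (h z)"
    unfolding z(2)[symmetric] R.nat_pow_mult[OF f, symmetric] by (rule rsmult_mult[OF oD pow_closed[OF f] pow_closed[OF f] tcr])
   also have "\<dots> = res F X (D f) (h ((f [^] k) \<odot>\<^sub>M z))"
    by (rule semilinearD(3)[OF loc_atD(1)[OF h_res_loc_at[OF f]] pow_closed[OF f] z(1), symmetric])
   finally show "EX n::nat. EX t':TS X. (f [^] n) \<odot>[R,F,D f] t = res F X (D f) t'"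
    unfolding T_global using k by blast
  qed
 qed
 finally show ?thesis .
qed

text \<open>Denominators are units, so membership of a fraction in a submodule depends only on its
  numerator over \<open>\<one>\<close>, for which \<open>fr1\<close> gives \<open>loc_tight\<close>.
  The power of \<open>f\<close> comes from unfolding equality of fractions.\<close>

lemma clears_iff:
 assumes f: "f : carrier R"
 shows "tight_closure p (loc_ring R (powers R f)) (loc_module R (powers R f) M) (loc_sub R M (powers R f) L0)
  = loc_sub R M (powers R f) TC <-> clears f"
proof -
 let ?W = "powers R f" let ?B = "loc_ring R (powers R f)" let ?N = "loc_module R (powers R f) M"
 let ?K = "loc_sub R M (powers R f) L0"
 let ?T = "tight_closure p ?B ?N ?K"
 note W = R.mult_set_powers[OF f]
 note WD = mult_setD[OF W]
 have Bc: "cring ?B" by (rule cring_loc_ring[OF R W])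
 have N: "module ?B ?N" by (rule module_loc[OF R W M])
 have K: "submodule ?K ?B ?N" by (rule loc_sub_submodule[OF R W M L0])
 note L0D = submoduleD[OF L0 M]
 have fW: "f [^] n : ?W" for n :: nat unfolding powers_def by blast
 have Wf: "EX n::nat. s = f [^] n" if "s : ?W" for s using that unfolding powers_def by blast
 have Wc: "s : carrier R" if "s : ?W" for s using Wf[OF that] pow_closed[OF f] by blast
 have cl: "frac R (ring_module R) ?W s \<one> \<odot>\<^sub>?N frac R M ?W x s = frac R M ?W x \<one>" if "x : carrier M" "s : ?W" for x s
 proof -
  have "frac R (ring_module R) ?W s \<one> \<odot>\<^sub>?N frac R M ?W x s = frac R M ?W (s \<odot>\<^sub>M x) (\<one> \<otimes> s)"
   by (rule loc_smult[OF R W M Wc[OF that(2)] WD(2) that])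
  also have "\<dots> = frac R M ?W x \<one>"
   using frac_cancel[OF M W that(1) WD(2) that(2)] Wc[OF that(2)] by simp
  finally show ?thesis .
 qed
 have fr1: "frac R M ?W z \<one> : ?T <-> loc_tight p f R M L0 z" if z: "z : carrier M" for z
 proof (rule tight_closure_loc_at[OF R Bc f ring_loc_at_loc_ring[OF R f] M N loc_at_loc_ring[OF R f M] L0 K _ _ z])
  show "(%x. frac R M ?W x \<one>) ` L0 <= ?K" unfolding loc_sub_def using WD(2) by blast
  fix y assume "y : ?K"
  then obtain x s where x: "x : L0" "s : ?W" "y = frac R M ?W x s" unfolding loc_sub_def by blast
  obtain n :: nat where n: "s = f [^] n" using Wf[OF x(2)] by blast
  show "EX n::nat. EX x:L0. frac R (ring_module R) ?W (f [^] n) \<one> \<odot>\<^sub>?N y = frac R M ?W x \<one>"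
   using cl[OF L0D(7)[OF x(1)] x(2)] x(1) unfolding x(3) n by blast
 qed
 note TD = submoduleD[OF tight_closure_submodule[OF N K] N]
 show ?thesis
 proof
  assume eq: "?T = loc_sub R M ?W TC"
  show "clears f"
   unfolding clears_def
  proof (intro allI impI)
   fix z assume lz: "loc_tight p f R M L0 z"
   then have z: "z : carrier M" unfolding loc_tight_def by blast
   have "frac R M ?W z \<one> : loc_sub R M ?W TC" using fr1[OF z] lz eq by blast
   then obtain x s where x: "x : TC" "s : ?W" "frac R M ?W z \<one> = frac R M ?W x s" unfolding loc_sub_def by blast
   obtain u where u: "u : ?W" "(u \<otimes> s) \<odot>\<^sub>M z = (u \<otimes> \<one>) \<odot>\<^sub>M x"
    using x(3) unfolding frac_eq_iff[OF M W z WD(2) TCD(7)[OF x(1)] x(2)] by blast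
   have "u \<otimes> s : ?W" using WD(3) u(1) x(2) by blast
   then obtain n :: nat where n: "u \<otimes> s = f [^] n" using Wf by blast
   have "(f [^] n) \<odot>\<^sub>M z : TC" using u(2) TCD(5)[OF _ x(1), of "u \<otimes> \<one>"] Wc[OF u(1)] unfolding n by simp
   then show "EX n::nat. (f [^] n) \<odot>\<^sub>M z : TC" by blast
  qed
 next
  assume c: "clears f"
  show "?T = loc_sub R M ?W TC"
  proof (intro equalityI subsetI)
   fix y assume y: "y : ?T"
   then obtain z s where z: "z : carrier M" "s : ?W" "y = frac R M ?W z s"
    using TD(7)[OF y] unfolding loc_carrier[OF M W] by blast
   have sB: "frac R (ring_module R) ?W s \<one> : carrier ?B" using ring_hom_closed[OF loc_ring_hom[OF R W] Wc[OF z(2)]] .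
   have "frac R M ?W z \<one> : ?T" using TD(5)[OF sB y] unfolding z(3) cl[OF z(1,2)] .
   then obtain n :: nat where n: "(f [^] n) \<odot>\<^sub>M z : TC" using fr1[OF z(1)] c unfolding clears_def by blast
   have "y = frac R M ?W ((f [^] n) \<odot>\<^sub>M z) (f [^] n \<otimes> s)"
    unfolding z(3) by (rule frac_cancel[OF M W z(1,2) fW, symmetric])
   moreover have "f [^] n \<otimes> s : ?W" using WD(3) fW z(2) by blast
   ultimately show "y : loc_sub R M ?W TC" unfolding loc_sub_def using n by blast
  next
   fix y assume "y : loc_sub R M ?W TC"
   then obtain x s where x: "x : TC" "s : ?W" "y = frac R M ?W x s" unfolding loc_sub_def by blast
   have xc: "x : carrier M" by (rule TCD(7)[OF x(1)])
   have x1: "frac R M ?W x \<one> : ?T" using fr1[OF xc] loc_tight_of_tight[OF M L0 f x(1)] by blast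
   have sB: "frac R (ring_module R) ?W \<one> s : carrier ?B" unfolding loc_ring_carrier[OF R W] using x(2) by blast
   have "frac R (ring_module R) ?W \<one> s \<odot>\<^sub>?N frac R M ?W x \<one> = y"
    unfolding x(3) loc_smult[OF R W M R.one_closed x(2) xc WD(2)] using xc Wc[OF x(2)] by simp
   then show "y : ?T" using TD(5)[OF sB x1] by simp
  qed
 qed
qed

theorem localization_iff_quasi_coherent:
 "(ALL f:carrier R. tight_closure p (loc_ring R (powers R f)) (loc_module R (powers R f) M) (loc_sub R M (powers R f) L0)
   = loc_sub R M (powers R f) TC) <-> quasi_coherent (spec R) (sub_sheaf F TS)"
 unfolding quasi_coherent_clears using clears_iff by blast

end

section \<open>Models of a module in a given infinite type\<close>

text \<open>Sections of the sheaf associated with \<open>M\<close> do not have the type of \<open>M\<close>. Since open sets are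
 quasi-compact, they embed into that type when it is infinite; the sheaf is transported along such embeddings.\<close>

definition enc_module :: "('b => 'd) => ('a, 'b, 'k) module_scheme => ('a, 'd) module" where
 "enc_module e N = \<lparr>carrier = e ` carrier N, monoid.mult = undefined, one = undefined, ring.zero = e \<zero>\<^sub>N,
   ring.add = (%x y. e (inv_into (carrier N) e x \<oplus>\<^sub>N inv_into (carrier N) e y)),
   smult = (%a x. e (a \<odot>\<^sub>N inv_into (carrier N) e x))\<rparr>"

lemma enc_module_simps:
 "carrier (enc_module e N) = e ` carrier N" "\<zero>\<^sub>(enc_module e N) = e \<zero>\<^sub>N"
 "inj_on e (carrier N) ==> x : carrier N ==> y : carrier N ==> e x \<oplus>\<^sub>(enc_module e N) e y = e (x \<oplus>\<^sub>N y)"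
 "inj_on e (carrier N) ==> x : carrier N ==> a \<odot>\<^sub>(enc_module e N) e x = e (a \<odot>\<^sub>N x)"
 by (simp_all add: enc_module_def)

lemma module_enc_module:
 assumes N: "module S N" and e: "inj_on e (carrier N)"
 shows "module S (enc_module e N)"
proof -
 interpret N: module S N by (rule N)
 note [simp] = enc_module_simps(1,2) enc_module_simps(3,4)[OF e]
 have "abelian_group (enc_module e N)"
 proof (rule abelian_groupI)
  fix x y z assume "x : carrier (enc_module e N)" "y : carrier (enc_module e N)" "z : carrier (enc_module e N)"
  then obtain a b c where abc: "x = e a" "y = e b" "z = e c" "a : carrier N" "b : carrier N" "c : carrier N" by auto
  then show "x \<oplus>\<^sub>(enc_module e N) y : carrier (enc_module e N)" by simp
  show "x \<oplus>\<^sub>(enc_module e N) y \<oplus>\<^sub>(enc_module e N) z = x \<oplus>\<^sub>(enc_module e N) (y \<oplus>\<^sub>(enc_module e N) z)" using abc by (simp add: N.a_assoc)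
  show "x \<oplus>\<^sub>(enc_module e N) y = y \<oplus>\<^sub>(enc_module e N) x" using abc by (simp add: N.a_comm)
  show "\<zero>\<^sub>(enc_module e N) \<oplus>\<^sub>(enc_module e N) x = x" using abc by simp
  have "e (\<ominus>\<^sub>N a) \<oplus>\<^sub>(enc_module e N) x = \<zero>\<^sub>(enc_module e N)" using abc by (simp add: N.l_neg)
  then show "EX y:carrier (enc_module e N). y \<oplus>\<^sub>(enc_module e N) x = \<zero>\<^sub>(enc_module e N)" using abc by auto
 qed simp
 then show ?thesis
 proof (rule moduleI[OF N.is_cring])
  show "a \<odot>\<^sub>(enc_module e N) x : carrier (enc_module e N)" if "a : carrier S" "x : carrier (enc_module e N)" for a x using that by auto
  show "(a \<oplus>\<^sub>S b) \<odot>\<^sub>(enc_module e N) x = a \<odot>\<^sub>(enc_module e N) x \<oplus>\<^sub>(enc_module e N) b \<odot>\<^sub>(enc_module e N) x"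
   if "a : carrier S" "b : carrier S" "x : carrier (enc_module e N)" for a b x using that by (auto simp: N.smult_l_distr)
  show "a \<odot>\<^sub>(enc_module e N) (x \<oplus>\<^sub>(enc_module e N) y) = a \<odot>\<^sub>(enc_module e N) x \<oplus>\<^sub>(enc_module e N) a \<odot>\<^sub>(enc_module e N) y"
   if "a : carrier S" "x : carrier (enc_module e N)" "y : carrier (enc_module e N)" for a x y using that by (auto simp: N.smult_r_distr)
  show "(a \<otimes>\<^sub>S b) \<odot>\<^sub>(enc_module e N) x = a \<odot>\<^sub>(enc_module e N) (b \<odot>\<^sub>(enc_module e N) x)"
   if "a : carrier S" "b : carrier S" "x : carrier (enc_module e N)" for a b x using that by (auto simp: N.smult_assoc1)
  show "\<one>\<^sub>S \<odot>\<^sub>(enc_module e N) x = x" if "x : carrier (enc_module e N)" for x using that by auto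
 qed
qed

text \<open>Each open set has its own encoding, so restriction decodes over \<open>U\<close> and
  encodes again over \<open>V\<close>.\<close>

definition enc_sheaf :: "('x set => 'b => 'd) => ('x, 's, 'b) mod_sheaf => ('x, 's, 'd) mod_sheaf" where
 "enc_sheaf e F = \<lparr>sec = (%U. enc_module (e U) (sec F U)),
   res = (%U V x. e V (res F U V (inv_into (Sec F U) (e U) x)))\<rparr>"

text \<open>Over D(a) a section \<open>t\<close> is determined by a pair \<open>(n, x)\<close> with
  \<open>a^n t = h a x\<close>, since \<open>a\<close> is a unit there. Over a finite union it is
  determined by its restrictions, and every open set is a finite union of basic ones because ideals
  are finitely generated.\<close>

lemma (in spec_sheaf) sections_embed:
 fixes M :: "('a, 'c, 'k) module_scheme"
 assumes inf: "infinite (UNIV :: 'c set)" and noeth: "noetherian_ring R" and U: "op U"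
  and loc: "\<And>f. f : carrier R ==> loc_at R f id M (rmod R F (D f)) (h f)"
 shows "EX e :: 'b => 'c. inj_on e (Sec F U)"
proof -
 \<comment> \<open>An infinite type contains copies of its square and of the natural numbers; these
   injections pack the data into one element.\<close>
 obtain pr :: "'c \<times> 'c => 'c" where pr: "inj pr"
  using card_of_ordIso[THEN iffD2, OF card_of_Times_same_infinite[OF inf]] unfolding bij_betw_def by auto
 obtain nc :: "nat => 'c" where nc: "inj nc" using infinite_countable_subset[OF inf] by blast
 have base: "EX e :: 'b => 'c. inj_on e (Sec F (D a))" if a: "a : carrier R" for a
 proof -
  have "ALL t:Sec F (D a). EX n::nat. EX x. (a [^] n) \<odot>[R,F,D a] t = h a x"
   using loc_atD(3)[OF loc[OF a]] unfolding rmod_simps id_apply by blast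
  then obtain n :: "'b => nat" and x where nx: "ALL t:Sec F (D a). (a [^] n t) \<odot>[R,F,D a] t = h a (x t)"
   by metis
  have "inj_on (%t. pr (nc (n t), x t)) (Sec F (D a))"
  proof (rule inj_onI)
   fix s t assume s: "s : Sec F (D a)" and t: "t : Sec F (D a)" and eq: "pr (nc (n s), x s) = pr (nc (n t), x t)"
   have e: "n s = n t" "x s = x t" using injD[OF pr eq] injD[OF nc] by auto
   show "s = t"
    by (rule unit_cancel[OF op_D[OF a] R.nat_pow_closed[OF a] Dset_pow[OF R a] s t, of "n t"])
     (use nx[THEN bspec, OF s] nx[THEN bspec, OF t] e in simp)
  qed
  then show ?thesis by blast
 qed
 have fin: "EX e :: 'b => 'c. inj_on e (Sec F (\<Union>a \<in> A. D a))" if "finite A" "A <= carrier R" for A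
  using that
 proof (induction A)
  case empty
  show ?case using sec_empty by (intro exI inj_onI) simp
 next
  case (insert a A)
  let ?V = "\<Union>a \<in> A. D a" let ?W = "\<Union>a \<in> insert a A. D a"
  have oa: "op (D a)" using insert.prems by simp
  have "op (\<Union>a \<in> A'. D a)" if "A' <= carrier R" for A' by (rule openin_Union) (use that in auto)
  then have oV: "op ?V" and oW: "op ?W" using insert.prems by blast+
  have sub: "?V <= ?W" "D a <= ?W" by auto
  obtain e1 :: "'b => 'c" where e1: "inj_on e1 (Sec F (D a))" using base[of a] insert.prems by auto
  obtain e2 :: "'b => 'c" where e2: "inj_on e2 (Sec F ?V)" using insert.IH insert.prems by auto
  have "inj_on (%t. pr (e1 (res F ?W (D a) t), e2 (res F ?W ?V t))) (Sec F ?W)"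
  proof (rule inj_onI)
   fix s t assume s: "s : Sec F ?W" and t: "t : Sec F ?W"
    and eq: "pr (e1 (res F ?W (D a) s), e2 (res F ?W ?V s)) = pr (e1 (res F ?W (D a) t), e2 (res F ?W ?V t))"
   have "e1 (res F ?W (D a) s) = e1 (res F ?W (D a) t)" "e2 (res F ?W ?V s) = e2 (res F ?W ?V t)" using injD[OF pr eq] by auto
   then have r: "res F ?W (D a) s = res F ?W (D a) t" "res F ?W ?V s = res F ?W ?V t"
    using inj_onD[OF e1 _ res_closed[OF oW oa sub(2) s] res_closed[OF oW oa sub(2) t]]
     inj_onD[OF e2 _ res_closed[OF oW oV sub(1) s] res_closed[OF oW oV sub(1) t]] by blast+
   show "s = t" by (rule sep[of ?W "{D a, ?V}"]) (use oW oa oV r s t in auto)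
  qed
  then show ?case by blast
 qed
 obtain B where B: "B <= carrier R" "U = {P : X. ~ B <= P}" using U unfolding openin_zariski by blast
 \<comment> \<open>A prime contains \<open>B\<close> exactly when it contains the ideal generated by
   \<open>B\<close>, so a finite generating set describes the same open set.\<close>
 obtain A where A: "A <= carrier R" "finite A" "genideal R B = genideal R A"
  using noetherian_ring.finetely_gen[OF noeth R.genideal_ideal[OF B(1)]] by blast
 have "B <= P <-> A <= P" if "P : X" for P
 proof -
  have P: "ideal P R" using that primeD(1) by (simp add: Spec_iff)
  show ?thesis using R.Idl_subset_ideal[OF P B(1)] R.Idl_subset_ideal[OF P A(1)] A(3) by simp
 qed
 then have "U = {P : X. ~ A <= P}" unfolding B(2) by blast
 also have "\<dots> = (\<Union>a \<in> A. D a)" by (auto simp: Dset_def)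
 finally have "U = (\<Union>a \<in> A. D a)" .
 then show ?thesis using fin[OF A(2,1)] by simp
qed

context spec_subsheaf
begin

context
 fixes e :: "'a set set => 'b => 'd"
 assumes e: "\<And>U. op U ==> inj_on (e U) (Sec F U)"
begin

private abbreviation (input) "G \<equiv> enc_sheaf e F"

lemma enc_carrier: "Sec G U = e U ` Sec F U"
 by (simp add: enc_sheaf_def enc_module_simps)

lemma enc_ops:
 assumes U: "op U" and s: "s : Sec F U"
 shows "t : Sec F U ==> e U s \<oplus>\<^sub>(sec G U) e U t = e U (s \<oplus>\<^sub>(sec F U) t)"
  "a \<odot>\<^sub>(sec G U) e U s = e U (a \<odot>\<^sub>(sec F U) s)" "res G U V (e U s) = e V (res F U V s)"
 using enc_module_simps(3,4)[OF e[OF U]] s inv_into_f_f[OF e[OF U] s] by (simp_all add: enc_sheaf_def)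

lemma enc_zero: "\<zero>\<^sub>(sec G U) = e U \<zero>\<^sub>(sec F U)"
 by (simp add: enc_sheaf_def enc_module_simps(2))

lemma enc_lin:
 assumes U: "op U" shows "semilinear R id (rmod R F U) (rmod R G U) (e U)"
 by (rule semilinearI) (use enc_ops[OF U] in \<open>simp_all add: enc_carrier\<close>)

lemma enc_eq_iff: "op U ==> s : Sec F U ==> t : Sec F U ==> e U s = e U t <-> s = t"
 using e inj_onD by metis

lemma sheaf_enc_sheaf: "sheaf_of_modules (spec R) G"
 unfolding sheaf_of_modules_def spec_simps(1)
proof (intro conjI allI impI)
 show "module (\<O> R U) (sec G U)" if "op U" for U
  using module_enc_module[OF smod[OF that] e[OF that]] by (simp add: enc_sheaf_def)
 fix U V assume "op U & op V & V <= U"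
 then have UV: "op U" "op V" "V <= U" by auto
 show "res G U V : Sec G U \<rightarrow> Sec G V"
  using res_closed[OF UV] enc_ops(3)[OF UV(1)] by (auto simp: enc_carrier)
 show "ALL s:Sec G U. ALL t:Sec G U. res G U V (s \<oplus>\<^sub>(sec G U) t) = res G U V s \<oplus>\<^sub>(sec G V) res G U V t"
  using res_closed[OF UV] res_add[OF UV] add_closed[OF UV(1)] by (auto simp: enc_carrier enc_ops[OF UV(1)] enc_ops[OF UV(2)])
 show "ALL a:carrier (\<O> R U). ALL s:Sec G U. res G U V (a \<odot>\<^sub>(sec G U) s) = Ores (spec R) U V a \<odot>\<^sub>(sec G V) res G U V s"
  using res_closed[OF UV] res_smult[OF UV] smult_closed[OF UV(1)]
  by (auto simp: enc_carrier enc_ops(2,3)[OF UV(1)] enc_ops(2)[OF UV(2)] simp del: spec_simps(2-6))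
next
 show "ALL s:Sec G U. res G U U s = s" if "op U" for U
  using res_id[OF that] by (auto simp: enc_carrier enc_ops(3)[OF that])
next
 fix U V W assume o: "op U & op V & op W & W <= V & V <= U"
 then show "ALL s:Sec G U. res G V W (res G U V s) = res G U W s"
  using res_comp[of U V W] res_closed[of U V] by (auto simp: enc_carrier enc_ops(3))
next
 fix U C assume UC: "op U & open_cover (spec R) U C"
 then have U: "op U" and C: "\<And>V. V : C ==> op V" "\<Union>C = U" unfolding open_cover_def spec_simps(1) by blast+
 have CU: "V <= U" if "V : C" for V using C(2) that by blast
 have rc: "res F U V s : Sec F V" if "V : C" "s : Sec F U" for V s by (rule res_closed[OF U C(1)[OF that(1)] CU[OF that(1)] that(2)])
 show "ALL s:Sec G U. ALL t:Sec G U. (ALL V:C. res G U V s = res G U V t) --> s = t"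
  unfolding enc_carrier
 proof (intro ballI impI)
  fix s t assume "s : e U ` Sec F U" "t : e U ` Sec F U" and eq: "ALL V:C. res G U V s = res G U V t"
  then obtain a b where ab: "s = e U a" "t = e U b" "a : Sec F U" "b : Sec F U" by blast
  have "a = b"
  proof (rule sep[OF U C ab(3,4)])
   fix V assume V: "V : C"
   have "e V (res F U V a) = e V (res F U V b)" using eq V enc_ops(3)[OF U ab(3)] enc_ops(3)[OF U ab(4)] unfolding ab(1,2) by simp
   then show "res F U V a = res F U V b" unfolding enc_eq_iff[OF C(1)[OF V] rc[OF V ab(3)] rc[OF V ab(4)]] .
  qed
  then show "s = t" unfolding ab(1,2) by simp
 qed
 fix s assume s: "(ALL V:C. s V : Sec G V) & (ALL V:C. ALL W:C. res G V (V Int W) (s V) = res G W (V Int W) (s W))"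
 have "ALL V:C. EX a:Sec F V. s V = e V a" using s unfolding enc_carrier by blast
 then obtain a where a: "ALL V:C. a V : Sec F V & s V = e V (a V)" by metis
 have "EX u:Sec F U. ALL V:C. res F U V u = a V"
 proof (rule glue)
  show "\<Union>((%V. V) ` C) = U" using C(2) by simp
  fix V W assume V: "V : C" and W: "W : C"
  have aV: "a V : Sec F V" and aW: "a W : Sec F W" using a V W by blast+
  have oI: "op (V Int W)" using C(1)[OF V] C(1)[OF W] by simp
  have "e (V Int W) (res F V (V Int W) (a V)) = e (V Int W) (res F W (V Int W) (a W))"
   using s a V W enc_ops(3)[OF C(1)[OF V] aV] enc_ops(3)[OF C(1)[OF W] aW] by metis
  then show "res F V (V Int W) (a V) = res F W (V Int W) (a W)"
   unfolding enc_eq_iff[OF oI res_closed[OF C(1)[OF V] oI Int_lower1 aV] res_closed[OF C(1)[OF W] oI Int_lower2 aW]] .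
 qed (use C a in auto)
 then obtain u where u: "u : Sec F U" "ALL V:C. res F U V u = a V" by blast
 have "e U u : Sec G U" "ALL V:C. res G U V (e U u) = s V"
  using u a enc_ops(3)[OF U u(1)] by (auto simp: enc_carrier)
 then show "EX u:Sec G U. ALL V:C. res G U V u = s V" by blast
qed

lemma subsheaf_enc: "subsheaf_of_modules (spec R) G (%U. e U ` L U)"
 unfolding subsheaf_of_modules_def spec_simps(1)
proof (intro conjI allI impI)
 interpret G: spec_sheaf R G by (rule spec_sheaf.intro[OF R sheaf_enc_sheaf])
 fix U assume U: "op U"
 note LD = subD[OF U U]
 show "submodule (e U ` L U) (\<O> R U) (sec G U)"
 proof (rule submoduleI2[OF G.smod[OF U]])
  show "e U ` L U <= Sec G U" unfolding enc_carrier using LD(1) by blast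
  show "\<zero>\<^sub>(sec G U) : e U ` L U" using LD(2) enc_zero by simp
  fix x assume "x : e U ` L U"
  then obtain s where s: "s : L U" "x = e U s" by blast
  note sc = LD(7)[OF s(1)]
  show "a \<odot>\<^sub>(sec G U) x : e U ` L U" if "a : carrier (\<O> R U)" for a
   unfolding s(2) enc_ops(2)[OF U sc] using LD(5)[OF that s(1)] by blast
  fix y assume "y : e U ` L U"
  then obtain t where t: "t : L U" "y = e U t" by blast
  show "x \<oplus>\<^sub>(sec G U) y : e U ` L U"
   unfolding s(2) t(2) enc_ops(1)[OF U sc LD(7)[OF t(1)]] using LD(3)[OF s(1) t(1)] by blast
 qed
next
 fix U V assume "op U & op V & V <= U"
 then have UV: "op U" "op V" "V <= U" by auto
 show "res G U V ` e U ` L U <= e V ` L V"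
 proof (rule image_subsetI, elim imageE)
  fix x s assume s: "s : L U" "x = e U s"
  note sc = subD(7)[OF UV(1,1) s(1)]
  show "res G U V x : e V ` L V" unfolding s(2) enc_ops(3)[OF UV(1) sc] using sub_res[OF UV s(1)] by blast
 qed
next
 fix U C assume UC: "op U & open_cover (spec R) U C"
 then have U: "op U" and C: "\<And>V. V : C ==> op V" "\<And>V. V : C ==> V <= U" unfolding open_cover_def spec_simps(1) by blast+
 show "ALL s:Sec G U. (ALL V:C. res G U V s : e V ` L V) --> s : e U ` L U"
  unfolding enc_carrier
 proof (intro ballI impI)
  fix x assume "x : e U ` Sec F U" and x: "ALL V:C. res G U V x : e V ` L V"
  then obtain s where s: "s : Sec F U" "x = e U s" by blast
  have "res F U V s : L V" if V: "V : C" for V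
  proof -
   have "e V (res F U V s) : e V ` L V" using x V unfolding s(2) enc_ops(3)[OF U s(1)] by blast
   then obtain t where t: "t : L V" "e V (res F U V s) = e V t" by blast
   then show ?thesis
    using enc_eq_iff[OF C(1)[OF V] res_closed[OF U C(1)[OF V] C(2)[OF V] s(1)] subD(7)[OF C(1)[OF V] C(1)[OF V] t(1)]] by simp
  qed
  then have "s : L U" using sub_cover[OF U _ s(1)] UC by blast
  then show "x : e U ` L U" using s(2) by blast
 qed
qed

lemma qcl_sub_enc:
 assumes q: "qcl R F X" and qG: "qcl R G X" and qL: "qcl R (sub_sheaf F L) X"
 shows "qcl R (sub_sheaf G (%U. e U ` L U)) X"
proof -
 interpret G: spec_subsheaf R G "%U. e U ` L U"
  by (rule spec_subsheaf.intro[OF spec_sheaf.intro[OF R sheaf_enc_sheaf]]) (rule spec_subsheaf_axioms.intro[OF subsheaf_enc])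
 show ?thesis
  unfolding G.qcl_sub_sheaf_iff[OF qG]
 proof (intro ballI)
  fix r y assume r: "r : carrier R" and "y : e (D r) ` L (D r)"
  then obtain t where t: "t : L (D r)" "y = e (D r) t" by blast
  obtain n :: nat and t' where n: "t' : L X" "(r [^] n) \<odot>[R,F,D r] t = res F X (D r) t'"
   using qL[unfolded qcl_sub_sheaf_iff[OF q]] r t(1) by blast
  note tcr = subD(7)[OF op_D[OF r] op_D[OF r] t(1)] and t'c = subD(7)[OF op_X op_X n(1)]
  have "(r [^] n) \<odot>[R,G,D r] y = res G X (D r) (e X t')"
   unfolding t(2) enc_ops(2)[OF op_D[OF r] tcr] enc_ops(3)[OF op_X t'c] n(2) ..
  then show "EX n::nat. EX t':e X ` L X. (r [^] n) \<odot>[R,G,D r] y = res G X (D r) t'"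
   using n(1) by blast
 qed
qed

text \<open>The encodings are compatible with restriction and with the operations, so
  \<open>M\<close> remains a model, with \<open>h\<close> followed by the encoding of global
  sections. Quasi-coherence is transferred through the localization property, without touching
  charts.\<close>

lemma enc_model:
 fixes M :: "('a, 'c, 'k) module_scheme"
 assumes m: "global_model R F L M L0 h"
 shows "global_model R G (%U. e U ` L U) M L0 (%x. e X (h x))"
proof -
 interpret m: global_model R F L p M L0 h for p by (rule m)
 interpret G: spec_sheaf R G by (rule spec_sheaf.intro[OF R sheaf_enc_sheaf])
 have lin: "semilinear R id M (rmod R G X) (%x. e X (h x))"
  using semilinear_comp[OF m.h enc_lin[OF op_X], unfolded comp_id] by (simp add: comp_def)
 have hc: "h x : Sec F X" if "x : carrier M" for x by (rule m.h_closed[OF that])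
 have qG: "qcl R G X"
 proof (rule G.qclI_loc_at[OF m.M])
  show "(%x. e X (h x)) : carrier M \<rightarrow> Sec G X" unfolding enc_carrier using hc by blast
  fix f assume f: "f : carrier R"
  note l = m.h_res_loc_at[OF f] and oD = op_D[OF f]
  have rc: "res F X (D f) (h x) : Sec F (D f)" if "x : carrier M" for x by (rule res_closed[OF op_X oD D_sub hc[OF that]])
  have eq: "res G X (D f) (e X (h x)) = e (D f) (res F X (D f) (h x))" if "x : carrier M" for x by (rule enc_ops(3)[OF op_X hc[OF that]])
  show "loc_at R f id M (rmod R G (D f)) (%x. res G X (D f) (e X (h x)))"
   unfolding loc_at_def
  proof (intro conjI ballI impI)
   have "semilinear R (id \<circ> id) M (rmod R G (D f)) (res G X (D f) \<circ> (%x. e X (h x)))"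
    by (rule semilinear_comp[OF lin G.res_lin[OF op_X oD D_sub]]) simp
   then show "semilinear R id M (rmod R G (D f)) (%x. res G X (D f) (e X (h x)))" unfolding comp_id by (simp add: comp_def)
   show "EX n::nat. (f [^] n) \<odot>\<^sub>M x = \<zero>\<^sub>M" if x: "x : carrier M" "res G X (D f) (e X (h x)) = \<zero>\<^sub>(rmod R G (D f))" for x
    using loc_atD(2)[OF l x(1)] x(2) enc_eq_iff[OF oD rc[OF x(1)] zero_closed[OF oD]]
    unfolding eq[OF x(1)] rmod_simps enc_zero by blast
   fix y assume "y : carrier (rmod R G (D f))"
   then obtain t where t: "t : Sec F (D f)" "y = e (D f) t" unfolding rmod_simps enc_carrier by blast
   obtain n :: nat and x where x: "x : carrier M" "(f [^] n) \<odot>[R,F,D f] t = res F X (D f) (h x)"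
    using loc_atD(3)[OF l t(1)] by blast
   have "id (f [^] n) \<odot>\<^sub>(rmod R G (D f)) y = res G X (D f) (e X (h x))"
    unfolding id_apply rmod_simps t(2) enc_ops(2)[OF oD t(1)] x(2) eq[OF x(1)] ..
   then show "EX n::nat. EX x:carrier M. id (f [^] n) \<odot>\<^sub>(rmod R G (D f)) y = res G X (D f) (e X (h x))" using x(1) by blast
  qed
 qed
 have bij: "bij_betw (%x. e X (h x)) (carrier M) (Sec G X)"
  using bij_betw_trans[OF m.bij inj_on_imp_bij_betw[OF e[OF op_X]]] by (simp add: comp_def enc_carrier)
 show ?thesis
  by (rule global_model.intro[OF spec_subsheaf.intro[OF spec_sheaf.intro[OF R sheaf_enc_sheaf]] global_model_axioms.intro])
   (use spec_subsheaf_axioms.intro[OF subsheaf_enc] m.noeth qG qcl_sub_enc[OF m.q qG m.qL] m.M m.L0 lin bij m.hL[symmetric] in \<open>auto simp: image_image\<close>)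
qed

end

end

section \<open>Assembling the equivalences\<close>

lemma finite_module_image:
 assumes fin: "finite_module R M" and N: "module R N" and h: "semilinear R id M N h" and surj: "h ` carrier M = carrier N"
 shows "finite_module R N"
proof -
 obtain G where M: "module R M" and G: "G <= carrier M" "finite G" "gen_submodule R M G = carrier M"
  using fin unfolding finite_module_def by blast
 have hG: "h ` G <= carrier N" using G(1) surj by blast
 note D = submoduleD[OF gen_submodule_submodule[OF N hG] N]
 interpret M: module R M by (rule M)
 have "submodule {m : carrier M. h m : gen_submodule R N (h ` G)} R M"
  by (rule submoduleI2[OF M])
   (use D(2,3,5) semilinearD[OF h] semilinear_zero[OF h module_abelian[OF M] module_abelian[OF N]] in auto)
 moreover have "G <= {m : carrier M. h m : gen_submodule R N (h ` G)}"
  using G(1) gen_submodule_incl[of "h ` G" R N] by blast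
 ultimately have "carrier M <= {m : carrier M. h m : gen_submodule R N (h ` G)}"
  using gen_submodule_least[of G _ R M] G(3) by blast
 then have "carrier N <= gen_submodule R N (h ` G)" unfolding surj[symmetric] by blast
 then show ?thesis unfolding finite_module_def using N hG G(2) D(1) by (intro conjI exI[of _ "h ` G"]) auto
qed

text \<open>The base change reads only the carrier, addition and scalar multiplication. This serves
  to identify the localized ring, as a module over itself, with the localization of
  \<open>ring_module R\<close>.\<close>

lemma tight_closure_cong:
 fixes M N :: "('a, 'b, 'k) module_scheme"
 assumes "carrier M = carrier N" "ring.add M = ring.add N" "smult M = smult N"
 shows "tight_closure p S M L = tight_closure p S N L"
proof -
 have "carrier (M\<lparr>carrier := L\<rparr>) = L" for M :: "('a, 'b, 'k) module_scheme" by simp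
 then show ?thesis
  unfolding tight_closure_def frob_elem_def frob_submodule_def frob_module_def one_tensor_def base_change_incl_def base_change_def
   base_change_rels_def
  by (simp add: assms)
qed

lemma ideal_tight_closure_loc_ring:
 assumes R: "cring R"
 shows "ideal_tight_closure p (loc_ring R W) K = tight_closure p (loc_ring R W) (loc_module R W (ring_module R)) K"
 unfolding ideal_tight_closure_def
 by (rule tight_closure_cong) (simp_all add: ring_module_def loc_ring_def loc_module_def)

text \<open>The passage from sheaves to modules: the global sections are the module, so the element
  type is unchanged and the identification is \<open>id\<close>.\<close>

lemma (in spec_sheaf) model_self:
 assumes noeth: "noetherian_ring R" and q: "qcl R F X" and L: "subsheaf_of_modules (spec R) F L" and qL: "qcl R (sub_sheaf F L) X"
 shows "global_model R F L (rmod R F X) (L X) id"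
proof -
 have s: "spec_subsheaf R F L"
  by (rule spec_subsheaf.intro[OF spec_sheaf.intro[OF R F]]) (rule spec_subsheaf_axioms.intro[OF L])
 interpret s: spec_subsheaf R F L by (rule s)
 show ?thesis
  by (rule global_model.intro[OF s global_model_axioms.intro])
   (use noeth q qL rmod_module[OF op_X] s.sub_rsub[OF op_X] in \<open>auto simp: semilinear_def\<close>)
qed

context
 fixes R :: "('a, 'm) ring_scheme" (structure) and p :: nat
 assumes R: "cring R" and noeth: "noetherian_ring R"
begin

interpretation R: cring R by (rule R)

lemma tilde_model:
 assumes M: "module R M" and L: "submodule L R M"
 shows "global_model R (tilde R M) (tilde_sub R M L) M L (msec R M (Spec R))"
proof -
 have s: "spec_subsheaf R (tilde R M) (tilde_sub R M L)"
  by (rule spec_subsheaf.intro[OF spec_sheaf.intro[OF R sheaf_tilde[OF R M]]])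
   (rule spec_subsheaf_axioms.intro[OF subsheaf_tilde[OF R M L]])
 interpret s: spec_subsheaf R "tilde R M" "tilde_sub R M L" by (rule s)
 note q = qcl_tilde[OF R M]
 have "qcl R (sub_sheaf (tilde R M) (tilde_sub R M L)) (Spec R)"
  unfolding s.qcl_sub_sheaf_iff[OF q]
 proof (intro ballI)
  fix f t assume f: "f : carrier R" and t: "t : tilde_sub R M L (Dset R f)"
  obtain n :: nat and x where x: "x : L" "(f [^] n) \<odot>[R,tilde R M,Dset R f] t = msec R M (Dset R f) x"
   using tilde_sections[OF R M f L t] by blast
  have "(f [^] n) \<odot>[R,tilde R M,Dset R f] t = res (tilde R M) (Spec R) (Dset R f) (msec R M (Spec R) x)"
   unfolding x(2) using msec_restrict[OF R M s.D_sub[of f], of x] by simp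
  then show "EX n::nat. EX t':tilde_sub R M L (Spec R). (f [^] n) \<odot>[R,tilde R M,Dset R f] t
    = res (tilde R M) (Spec R) (Dset R f) t'"
   using x(1) msec_submodule[OF R M L] by blast
 qed
 then show ?thesis
  by (intro global_model.intro[OF s global_model_axioms.intro] noeth q M L msec_lin[OF R M s.op_X] msec_bij[OF R M] msec_submodule[OF R M L])
qed

text \<open>The passage from modules to sheaves with sections of the prescribed type: the sheaf
  associated with \<open>M\<close> is re-encoded, one encoding being chosen for each open
  set.\<close>

lemma module_model:
 fixes M :: "('a, 'c) module"
 assumes inf: "infinite (UNIV :: 'c set)" and M: "module R M" and L: "submodule L R M"
 shows "EX (F :: ('a, 'c) spec_mod) K h. global_model R F K M L h"
proof -
 interpret m: global_model R "tilde R M" "tilde_sub R M L" p M L "msec R M (Spec R)" by (rule tilde_model[OF M L])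
 have "ALL U. EX e :: ('a set => ('c \<times> 'a) set) => 'c. zopen R U --> inj_on e (Sec (tilde R M) U)"
  using m.sections_embed[OF inf noeth _ tilde_loc_at[OF R M]] by blast
 then have "EX e :: 'a set set => ('a set => ('c \<times> 'a) set) => 'c. ALL U. zopen R U --> inj_on (e U) (Sec (tilde R M) U)"
  by (rule choice)
 then obtain e :: "'a set set => ('a set => ('c \<times> 'a) set) => 'c" where
  e: "\<And>U. zopen R U ==> inj_on (e U) (Sec (tilde R M) U)" by blast
 show ?thesis using m.enc_model[OF e m.global_model_axioms] by blast
qed

text \<open>The identification is linear and onto in both directions, so generators move either
  way.\<close>

lemma model_finite_iff:
 fixes M :: "('a, 'c) module"
 assumes m: "global_model R F K M L h"
 shows "finite_module R M <-> finite_module R (rmod R F (Spec R))"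
proof -
 interpret m: global_model R F K p M L h by (rule m)
 have rm: "module R (rmod R F (Spec R))" by (rule m.rmod_module[OF m.op_X])
 let ?k = "inv_into (carrier M) h"
 have kh: "?k (h x) = x" if "x : carrier M" for x using inv_into_f_f[OF bij_betw_imp_inj_on[OF m.bij] that] .
 have ex: "EX y:carrier M. x = h y" if "x : Sec F (Spec R)" for x
  using bij_betw_imp_surj_on[OF m.bij] that by blast
 have "semilinear R id (rmod R F (Spec R)) M ?k"
 proof (rule semilinearI)
  fix x assume x: "x : carrier (rmod R F (Spec R))"
  then obtain a where a: "a : carrier M" "x = h a" using ex unfolding rmod_simps by blast
  show "?k x : carrier M" using a kh by simp
  show "?k (r \<odot>\<^sub>(rmod R F (Spec R)) x) = id r \<odot>\<^sub>M ?k x" if "r : carrier R" for r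
   using semilinearD(3)[OF m.h that a(1)] kh[OF a(1)] kh[OF m.M.smult_closed[OF that a(1)]] a(2) by simp
  fix y assume "y : carrier (rmod R F (Spec R))"
  then obtain b where b: "b : carrier M" "y = h b" using ex unfolding rmod_simps by blast
  show "?k (x \<oplus>\<^sub>(rmod R F (Spec R)) y) = ?k x \<oplus>\<^sub>M ?k y"
   using semilinearD(2)[OF m.h a(1) b(1)] kh[OF a(1)] kh[OF b(1)] kh[OF m.M.a_closed[OF a(1) b(1)]] a(2) b(2) by simp
 qed
 moreover have "?k ` carrier (rmod R F (Spec R)) = carrier M"
  using bij_betw_imp_surj_on[OF bij_betw_inv_into[OF m.bij]] by simp
 ultimately show ?thesis
  using finite_module_image[OF _ m.M] finite_module_image[OF _ rm m.h] bij_betw_imp_surj_on[OF m.bij] by (metis rmod_simps(1))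
qed

abbreviation (input) "commutes f M L \<equiv>
 tight_closure p (loc_ring R (powers R f)) (loc_module R (powers R f) M) (loc_sub R M (powers R f) L)
  = loc_sub R M (powers R f) (tight_closure p R M L)"

text \<open>Each quasi-coherent pair has a module model and each module pair a sheaf model, with one
  element type on both sides, so the two universal statements run over corresponding objects.
  Finiteness passes across by \<open>coherent_iff\<close>.\<close>

lemma modules_iff:
 assumes inf: "infinite (UNIV :: 'c set)"
 shows "(ALL (M :: ('a, 'c) module) L f. module R M & submodule L R M & f : carrier R --> commutes f M L)
   <-> (ALL (M :: ('a, 'c) spec_mod) L.
       quasi_coherent (spec R) M & subsheaf_of_modules (spec R) M L & quasi_coherent (spec R) (sub_sheaf M L) -->
       quasi_coherent (spec R) (sub_sheaf M (tight_closure_sheaf p (spec R) M L)))" (is "?A <-> ?B")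
  and "(ALL (M :: ('a, 'c) module) L f. finite_module R M & submodule L R M & f : carrier R --> commutes f M L)
   <-> (ALL (M :: ('a, 'c) spec_mod) L.
       coherent (spec R) M & subsheaf_of_modules (spec R) M L & quasi_coherent (spec R) (sub_sheaf M L) -->
       quasi_coherent (spec R) (sub_sheaf M (tight_closure_sheaf p (spec R) M L)))" (is "?C <-> ?D")
proof -
 have sheaf: "global_model R F K (rmod R F (Spec R)) (K (Spec R)) id"
  if "quasi_coherent (spec R) F" "subsheaf_of_modules (spec R) F K" "quasi_coherent (spec R) (sub_sheaf F K)"
  for F :: "('a, 'c) spec_mod" and K
 proof -
  interpret S: spec_sheaf R F using that(1) quasi_coherent_iff[OF R] by (intro spec_sheaf.intro[OF R]) blast
  show ?thesis using that quasi_coherent_iff[OF R] by (intro S.model_self noeth) blast+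
 qed
 have qc: "quasi_coherent (spec R) F" "subsheaf_of_modules (spec R) F K" "quasi_coherent (spec R) (sub_sheaf F K)"
  "(ALL f:carrier R. commutes f M L) <-> quasi_coherent (spec R) (sub_sheaf F (tight_closure_sheaf p (spec R) F K))"
  "module R M" "submodule L R M" "finite_module R M <-> coherent (spec R) F"
  if m: "global_model R F K M L h"
  for F :: "('a, 'c) spec_mod" and K and M :: "('a, 'c) module" and L h
 proof -
  interpret m: global_model R F K p M L h by (rule m)
  show "quasi_coherent (spec R) F" using quasi_coherent_iff[OF R] m.F m.q by blast
  show "subsheaf_of_modules (spec R) F K" by (rule m.L)
  show "quasi_coherent (spec R) (sub_sheaf F K)" using quasi_coherent_iff[OF R] m.sheaf_sub_sheaf m.qL by blast
  show "(ALL f:carrier R. commutes f M L) <-> quasi_coherent (spec R) (sub_sheaf F (tight_closure_sheaf p (spec R) F K))"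
   by (rule m.localization_iff_quasi_coherent)
  show "module R M" "submodule L R M" by (rule m.M, rule m.L0)
  show "finite_module R M <-> coherent (spec R) F" unfolding coherent_iff[OF R] model_finite_iff[OF m] using m.F m.q by blast
 qed
 \<comment> \<open>Stated for predicates \<open>PM\<close> and \<open>PS\<close> that match on
   models, to be used once for all modules and once for the finite ones.\<close>
 have main: "(ALL M L f. PM M & submodule L R M & f : carrier R --> commutes f M L)
   <-> (ALL F K. PS F & subsheaf_of_modules (spec R) F K & quasi_coherent (spec R) (sub_sheaf F K) -->
       quasi_coherent (spec R) (sub_sheaf F (tight_closure_sheaf p (spec R) F K)))" (is "?M <-> ?F")
  if PM: "\<And>M. PM M ==> module R M" and PS: "\<And>F. PS F ==> quasi_coherent (spec R) F"
   and eq: "\<And>F K M L h. global_model R F K M L h ==> PM M <-> PS F"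
  for PM :: "('a, 'c) module => bool" and PS :: "('a, 'c) spec_mod => bool"
 proof
  assume A: ?M
  show ?F
  proof (intro allI impI, elim conjE)
   fix F K assume F: "PS F" and K: "subsheaf_of_modules (spec R) F K" "quasi_coherent (spec R) (sub_sheaf F K)"
   note m = sheaf[OF PS[OF F] K]
   show "quasi_coherent (spec R) (sub_sheaf F (tight_closure_sheaf p (spec R) F K))"
    unfolding qc(4)[OF m, symmetric] using A eq[OF m] F qc(6)[OF m] by simp
  qed
 next
  assume B: ?F
  show ?M
  proof (intro allI impI, elim conjE)
   fix M L f assume M: "PM M" "submodule L R M" and f: "f : carrier R"
   obtain F :: "('a, 'c) spec_mod" and K h where m: "global_model R F K M L h"
    using module_model[OF inf PM[OF M(1)] M(2)] by blast
   have "ALL f:carrier R. commutes f M L" unfolding qc(4)[OF m] using B eq[OF m] M(1) qc(2,3)[OF m] by simp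
   then show "commutes f M L" using f by (rule bspec)
  qed
 qed
 show "?A <-> ?B" by (rule main) (simp_all add: qc(1,5))
 show "?C <-> ?D"
 proof (rule main)
  show "module R M" if "finite_module R M" for M :: "('a, 'c) module" using that unfolding finite_module_def by blast
  show "quasi_coherent (spec R) F" if "coherent (spec R) F" for F :: "('a, 'c) spec_mod"
   using that unfolding coherent_iff[OF R] quasi_coherent_iff[OF R] by blast
 qed (rule qc(7))
qed

section \<open>Ideals and ideal sheaves\<close>

abbreviation (input) "OX \<equiv> structure_module (spec R)"

text \<open>Global functions are the elements of \<open>R\<close>, so an ideal sheaf is modelled by
  the ideal of those \<open>r\<close> whose function is a global section of
  \<open>J\<close>.\<close>

lemma structure_model:
 assumes J: "subsheaf_of_modules (spec R) OX J" and qJ: "qcl R (sub_sheaf OX J) (Spec R)"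
 shows "global_model R OX J (ring_module R) {r : carrier R. rsec R (Spec R) r : J (Spec R)} (rsec R (Spec R))"
proof -
 have s: "spec_subsheaf R OX J"
  by (rule spec_subsheaf.intro[OF spec_sheaf.intro[OF R sheaf_structure[OF R]]]) (rule spec_subsheaf_axioms.intro[OF J])
 interpret s: spec_subsheaf R OX J by (rule s)
 let ?X = "Spec R" let ?I = "{r : carrier R. rsec R (Spec R) r : J (Spec R)}"
 have hom: "rsec R ?X : ring_hom R (\<O> R ?X)" by (rule rsec_hom[OF R s.op_X])
 have lin: "semilinear R id (ring_module R) (rmod R OX ?X) (rsec R ?X)"
  by (rule semilinearI) (use ring_hom_closed[OF hom] ring_hom_add[OF hom] ring_hom_mult[OF hom] in
   \<open>simp_all only: rmod_simps SM_simps ring_module_simps id_apply\<close>)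
 have "rsec R ?X = msec R (ring_module R) ?X" by (rule ext) (rule rsec_msec)
 then have bij: "bij_betw (rsec R ?X) (carrier (ring_module R)) (Sec OX ?X)"
  using msec_bij[OF R ring_module_module[OF R]] unfolding SM_simps structure_tilde_eqs(1) by argo
 note D = submoduleD[OF s.sub_rsub[OF s.op_X] s.rmod_module[OF s.op_X]]
 have rm: "module R (ring_module R)" by (rule ring_module_module[OF R])
 have "rsec R ?X \<zero> = \<zero>\<^sub>(rmod R OX ?X)"
  using semilinear_zero[OF lin module_abelian[OF rm] module_abelian[OF s.rmod_module[OF s.op_X]]] by (simp only: ring_module_simps)
 then have r0: "rsec R ?X \<zero> : J ?X" using D(2) by simp
 have sub: "submodule ?I R (ring_module R)"
 proof (rule submoduleI2[OF rm], unfold ring_module_simps)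
  fix x assume x: "x : ?I"
  then have xc: "x : carrier R" "rsec R ?X x : J ?X" by blast+
  show "a \<otimes> x : ?I" if a: "a : carrier R" for a
   using D(5)[OF a xc(2)] semilinearD(3)[OF lin a, of x] R.m_closed[OF a xc(1)] xc(1)
   by (simp only: ring_module_simps mem_Collect_eq id_apply simp_thms)
  show "x \<oplus> y : ?I" if y: "y : ?I" for y
  proof -
   have yc: "y : carrier R" "rsec R ?X y : J ?X" using y by blast+
   show ?thesis using D(3)[OF xc(2) yc(2)] semilinearD(2)[OF lin, of x y] R.a_closed[OF xc(1) yc(1)] xc(1) yc(1)
    by (simp only: ring_module_simps mem_Collect_eq simp_thms)
  qed
 qed (use r0 in auto)
 have "rsec R ?X ` ?I = J ?X"
 proof (intro equalityI subsetI)
  fix t assume t: "t : J ?X"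
  have "t : rsec R ?X ` carrier (ring_module R)"
   unfolding bij_betw_imp_surj_on[OF bij] by (rule s.subD(7)[OF s.op_X s.op_X t])
  then show "t : rsec R ?X ` ?I" using t unfolding ring_module_simps by blast
 qed blast
 then show ?thesis
  by (intro global_model.intro[OF s global_model_axioms.intro] noeth qcl_structure[OF R] qJ rm sub lin bij)
qed

text \<open>The global sections of a quasi-coherent ideal sheaf form an ideal of the Noetherian ring
  \<open>R\<close>, hence are finitely generated, which is all that coherence adds by
  \<open>coherent_iff\<close>.\<close>

lemma coherent_structure_iff:
 assumes J: "subsheaf_of_modules (spec R) OX J"
 shows "coherent (spec R) (sub_sheaf OX J) <-> quasi_coherent (spec R) (sub_sheaf OX J)"
proof -
 have "finite_module R (rmod R (sub_sheaf OX J) (Spec R))" if q: "qcl R (sub_sheaf OX J) (Spec R)"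
 proof -
  interpret m: global_model R OX J p "ring_module R" "{r : carrier R. rsec R (Spec R) r : J (Spec R)}" "rsec R (Spec R)"
   by (rule structure_model[OF J q])
  interpret G: spec_sheaf R "sub_sheaf OX J" by (rule spec_sheaf.intro[OF R m.sheaf_sub_sheaf])
  let ?I = "{r : carrier R. rsec R (Spec R) r : J (Spec R)}"
  let ?N = "(ring_module R)\<lparr>carrier := ?I\<rparr>"
  have I: "ideal ?I R" unfolding ideal_iff_submodule[OF R] by (rule m.L0)
  obtain A where A: "A <= carrier R" "finite A" "?I = genideal R A"
   using noetherian_ring.finetely_gen[OF noeth I] by blast
  have N: "module R ?N" by (rule submodule_module[OF m.L0 m.M])
  have AI: "A <= carrier ?N" using R.genideal_self[OF A(1)] A(3) by simp
  note D = submoduleD[OF gen_submodule_submodule[OF N AI] N]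
  have "submodule (gen_submodule R ?N A) R (ring_module R)"
   by (rule submoduleI2[OF m.M]) (use D(1,2,3,5) in auto)
  then have "ideal (gen_submodule R ?N A) R" unfolding ideal_iff_submodule[OF R] .
  then have "genideal R A <= gen_submodule R ?N A" by (rule R.genideal_minimal[OF _ gen_submodule_incl])
  then have "gen_submodule R ?N A = carrier ?N" using D(1) A(3) by auto
  then have fin: "finite_module R ?N" unfolding finite_module_def using N AI A(2) by blast
  have lin: "semilinear R id ?N (rmod R (sub_sheaf OX J) (Spec R)) (rsec R (Spec R))"
   by (rule semilinearI) (use semilinearD(2,3)[OF m.h] in \<open>simp_all del: spec_simps SM_simps\<close>)
  show ?thesis
   by (rule finite_module_image[OF fin G.rmod_module[OF G.op_X] lin]) (use m.hL in simp)
 qed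
 then show ?thesis unfolding coherent_iff[OF R] quasi_coherent_iff[OF R] by blast
qed

lemma rmod_sub_sheaf: "rmod R (sub_sheaf F L) U = (rmod R F U)\<lparr>carrier := L U\<rparr>"
 unfolding rmod_def restrict_scalars_def sec_sub_sheaf by simp

lemma submodule_cong:
 fixes N N' :: "('s, 'b) module"
 assumes "submodule H S N" "module S N" "module S N'"
  and "carrier N = carrier N'" "\<zero>\<^sub>N = \<zero>\<^sub>N'" "ring.add N = ring.add N'" "smult N = smult N'"
 shows "submodule H S N'"
 by (rule submoduleI2[OF assms(3)]) (use submoduleD[OF assms(1,2)] assms(4-7) in auto)

text \<open>The subsheaf is moved from the sheaf associated with \<open>ring_module R\<close> to the
  structure sheaf, whose sections, restrictions and module operations are the same. The ideal is
  recovered because distinct elements of \<open>R\<close> are distinct global functions.\<close>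

lemma ideal_subsheaf:
 assumes I: "ideal I R"
 shows "subsheaf_of_modules (spec R) OX (tilde_sub R (ring_module R) I)" (is "subsheaf_of_modules _ _ ?J")
  and "qcl R (sub_sheaf OX (tilde_sub R (ring_module R) I)) (Spec R)"
  and "{r : carrier R. rsec R (Spec R) r : tilde_sub R (ring_module R) I (Spec R)} = I"
proof -
 note rm = ring_module_module[OF R]
 have sI: "submodule I R (ring_module R)" using I unfolding ideal_iff_submodule[OF R] .
 interpret m: global_model R "tilde R (ring_module R)" ?J p "ring_module R" I "msec R (ring_module R) (Spec R)"
  by (rule tilde_model[OF rm sI])
 interpret S: spec_sheaf R OX by (rule spec_sheaf.intro[OF R sheaf_structure[OF R]])
 have sub: "submodule (?J U) (\<O> R U) (sec OX U)" if U: "zopen R U" for U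
  by (rule submodule_cong[OF m.sub[OF U] m.smod[OF U] S.smod[OF U]]) (simp_all only: SM_simps structure_tilde_eqs)
 note mL = m.L[unfolded subsheaf_of_modules_def spec_simps(1)]
 show "subsheaf_of_modules (spec R) OX ?J"
  unfolding subsheaf_of_modules_def spec_simps(1)
 proof (intro conjI)
  show "ALL U. zopen R U --> submodule (?J U) (\<O> R U) (sec OX U)" using sub by blast
  show "ALL U V. zopen R U & zopen R V & V <= U --> res OX U V ` ?J U <= ?J V"
   using mL[THEN conjunct2, THEN conjunct1] unfolding SM_simps structure_tilde_eqs(5) .
  show "ALL U C. zopen R U & open_cover (spec R) U C -->
    (ALL s:Sec OX U. (ALL V:C. res OX U V s : ?J V) --> s : ?J U)"
   using mL[THEN conjunct2, THEN conjunct2] unfolding SM_simps structure_tilde_eqs .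
 qed
 have "rmod R OX U = rmod R (tilde R (ring_module R)) U" for U
  unfolding rmod_def restrict_scalars_def SM_simps structure_tilde_eqs by simp
 then have "rmod R (sub_sheaf OX ?J) U = rmod R (sub_sheaf (tilde R (ring_module R)) ?J) U" for U
  unfolding rmod_sub_sheaf by simp
 then show "qcl R (sub_sheaf OX ?J) (Spec R)"
  using m.qL unfolding qcl_def sub_sheaf_simps SM_simps structure_tilde_eqs by simp
 have "msec R (ring_module R) (Spec R) r : ?J (Spec R) <-> r : I" if r: "r : carrier R" for r
 proof -
  have "inj_on (msec R (ring_module R) (Spec R)) (carrier R)" using bij_betw_imp_inj_on[OF m.bij] by simp
  then show ?thesis unfolding m.hL[symmetric] using inj_on_image_mem_iff[OF _ r] idealD(1)[OF I] by blast
 qed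
 then show "{r : carrier R. rsec R (Spec R) r : ?J (Spec R)} = I" unfolding rsec_msec using idealD(1)[OF I] by blast
qed

abbreviation (input) "ideal_commutes f I \<equiv>
 ideal_tight_closure p (loc_ring R (powers R f)) (loc_sub R (ring_module R) (powers R f) I)
  = loc_sub R (ring_module R) (powers R f) (ideal_tight_closure p R I)"

text \<open>The tight closure sheaf is again an ideal sheaf, so its coherence reduces to
  quasi-coherence, which the model treats.\<close>

lemma ideal_sheaf_iff:
 assumes J: "subsheaf_of_modules (spec R) OX J" and qJ: "qcl R (sub_sheaf OX J) (Spec R)"
 shows "(ALL f:carrier R. ideal_commutes f {r : carrier R. rsec R (Spec R) r : J (Spec R)})
  <-> coherent (spec R) (sub_sheaf OX (ideal_tight_closure_sheaf p (spec R) J))"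
proof -
 interpret m: global_model R OX J p "ring_module R" "{r : carrier R. rsec R (Spec R) r : J (Spec R)}" "rsec R (Spec R)"
  by (rule structure_model[OF J qJ])
 show ?thesis
  unfolding ideal_tight_closure_sheaf_def coherent_structure_iff[OF m.T_subsheaf] ideal_tight_closure_loc_ring[OF R]
  unfolding ideal_tight_closure_def by (rule m.localization_iff_quasi_coherent)
qed

text \<open>Ideal sheaves lead to ideals by global sections, and ideals to ideal sheaves by
  \<open>tilde_sub\<close>; taking global sections of the latter returns the ideal.\<close>

lemma ideals_iff:
 "(ALL I f. ideal I R & f : carrier R --> ideal_commutes f I)
  <-> (ALL J. subsheaf_of_modules (spec R) OX J & coherent (spec R) (sub_sheaf OX J) -->
     coherent (spec R) (sub_sheaf OX (ideal_tight_closure_sheaf p (spec R) J)))"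
proof
 assume a: "ALL I f. ideal I R & f : carrier R --> ideal_commutes f I"
 show "ALL J. subsheaf_of_modules (spec R) OX J & coherent (spec R) (sub_sheaf OX J) -->
   coherent (spec R) (sub_sheaf OX (ideal_tight_closure_sheaf p (spec R) J))"
 proof (intro allI impI, elim conjE)
  fix J assume J: "subsheaf_of_modules (spec R) OX J" and c: "coherent (spec R) (sub_sheaf OX J)"
  have q: "qcl R (sub_sheaf OX J) (Spec R)" using c unfolding coherent_iff[OF R] by blast
  interpret m: global_model R OX J p "ring_module R" "{r : carrier R. rsec R (Spec R) r : J (Spec R)}" "rsec R (Spec R)"
   by (rule structure_model[OF J q])
  have "ideal {r : carrier R. rsec R (Spec R) r : J (Spec R)} R" unfolding ideal_iff_submodule[OF R] by (rule m.L0)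
  then show "coherent (spec R) (sub_sheaf OX (ideal_tight_closure_sheaf p (spec R) J))"
   unfolding ideal_sheaf_iff[OF J q, symmetric] using a by simp
 qed
next
 assume b: "ALL J. subsheaf_of_modules (spec R) OX J & coherent (spec R) (sub_sheaf OX J) -->
   coherent (spec R) (sub_sheaf OX (ideal_tight_closure_sheaf p (spec R) J))"
 show "ALL I f. ideal I R & f : carrier R --> ideal_commutes f I"
 proof (intro allI impI, elim conjE)
  fix I f assume I: "ideal I R" and f: "f : carrier R"
  note J = ideal_subsheaf[OF I]
  interpret s: spec_subsheaf R OX "tilde_sub R (ring_module R) I"
   by (rule spec_subsheaf.intro[OF spec_sheaf.intro[OF R sheaf_structure[OF R]]]) (rule spec_subsheaf_axioms.intro[OF J(1)])
  have "coherent (spec R) (sub_sheaf OX (tilde_sub R (ring_module R) I))"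
   unfolding coherent_structure_iff[OF J(1)] quasi_coherent_iff[OF R] using s.sheaf_sub_sheaf J(2) by blast
  then show "ideal_commutes f I"
   using b J(1) f ideal_sheaf_iff[OF J(1,2)] unfolding J(3) by blast
 qed
qed

end

theorem theorem4p14:
  fixes p :: nat and R :: "('a, 'm) ring_scheme"
  assumes "Factorial_Ring.prime p"
    and "cring R" and "noetherian_ring R"
    and "\<exists>h \<in> ring_hom (ZFact (int p)) R. inj_on h (carrier (ZFact (int p)))"
  shows
    "(\<forall>I. ideal I R \<longrightarrow>
       ((\<forall>f \<in> carrier R.
           ideal_tight_closure p (loc_ring R (powers R f)) (loc_sub R (ring_module R) (powers R f) I)
           = loc_sub R (ring_module R) (powers R f) (ideal_tight_closure p R I))
        \<longleftrightarrow> coherent (spec R) (sub_sheaf (structure_module (spec R))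
              (ideal_tight_closure_sheaf p (spec R) (tilde_sub R (ring_module R) I)))))
     \<and>
     ((\<forall>I f. ideal I R \<and> f \<in> carrier R \<longrightarrow>
         ideal_tight_closure p (loc_ring R (powers R f)) (loc_sub R (ring_module R) (powers R f) I)
         = loc_sub R (ring_module R) (powers R f) (ideal_tight_closure p R I))
      \<longleftrightarrow> (\<forall>J. subsheaf_of_modules (spec R) (structure_module (spec R)) J \<and>
               coherent (spec R) (sub_sheaf (structure_module (spec R)) J) \<longrightarrow>
               coherent (spec R) (sub_sheaf (structure_module (spec R))
                 (ideal_tight_closure_sheaf p (spec R) J))))
     \<and>
     (\<forall>(M :: ('a, 'b) module) L. module R M \<and> submodule L R M \<longrightarrow>
       ((\<forall>f \<in> carrier R.
           tight_closure p (loc_ring R (powers R f)) (loc_module R (powers R f) M)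
             (loc_sub R M (powers R f) L)
           = loc_sub R M (powers R f) (tight_closure p R M L))
        \<longleftrightarrow> quasi_coherent (spec R) (sub_sheaf (tilde R M)
              (tight_closure_sheaf p (spec R) (tilde R M) (tilde_sub R M L)))))
     \<and>
     (infinite (UNIV :: 'c set) \<longrightarrow>
     ((\<forall>(M :: ('a, 'c) module) L f. module R M \<and> submodule L R M \<and> f \<in> carrier R \<longrightarrow>
         tight_closure p (loc_ring R (powers R f)) (loc_module R (powers R f) M)
           (loc_sub R M (powers R f) L)
         = loc_sub R M (powers R f) (tight_closure p R M L))
      \<longleftrightarrow> (\<forall>(M :: ('a set, 'a set \<Rightarrow> ('a \<times> 'a) set, 'c) mod_sheaf) L.
             quasi_coherent (spec R) M \<and> subsheaf_of_modules (spec R) M L \<and>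
             quasi_coherent (spec R) (sub_sheaf M L) \<longrightarrow>
             quasi_coherent (spec R) (sub_sheaf M (tight_closure_sheaf p (spec R) M L))))
     \<and>
     ((\<forall>(M :: ('a, 'c) module) L f. finite_module R M \<and> submodule L R M \<and> f \<in> carrier R \<longrightarrow>
         tight_closure p (loc_ring R (powers R f)) (loc_module R (powers R f) M)
           (loc_sub R M (powers R f) L)
         = loc_sub R M (powers R f) (tight_closure p R M L))
      \<longleftrightarrow> (\<forall>(M :: ('a set, 'a set \<Rightarrow> ('a \<times> 'a) set, 'c) mod_sheaf) L.
             coherent (spec R) M \<and> subsheaf_of_modules (spec R) M L \<and>
             quasi_coherent (spec R) (sub_sheaf M L) \<longrightarrow>
             quasi_coherent (spec R) (sub_sheaf M (tight_closure_sheaf p (spec R) M L)))))"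
proof (intro conjI allI impI, goal_cases)
  note R = assms(2) and noeth = assms(3)
  case (1 I)
  show ?case using ideal_sheaf_iff[OF R noeth ideal_subsheaf(1,2)[OF R noeth 1], of p] unfolding ideal_subsheaf(3)[OF R noeth 1] .
next
  case (3 M L)
  then show ?case using global_model.localization_iff_quasi_coherent[OF tilde_model[OF assms(2,3)]] by blast
\<comment> \<open>The remaining goals are the three equivalences quantified over all ideals, all
  modules and all finite modules.\<close>
qed (rule ideals_iff[OF assms(2,3)] modules_iff[OF assms(2,3)], assumption?)+

end
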